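(* Let $n,r\ge1$. The universal trace $\widehat{\mathrm{Tr}}=\int_{BV}\circ\langle-\rangle_{int}$ lies in the relative Lie algebra cochain complex $$\widehat{\mathrm{Tr}}\in C^\bullet\big(\mathfrak g,\mathfrak h;\mathrm{Hom}_{\mathbb K}(CC^{per}_{-\bullet}(\mathfrak{gl}_r(\mathcal W_{2n})),\mathbb K)\big)$$ (i.e. it vanishes whenever one of its Lie algebra arguments lies in $\mathfrak h$, and it is $\mathfrak h$-equivariant), and it satisfies $$(\partial_{\mathrm{Lie}}+b+uB)\,\widehat{\mathrm{Tr}}=0 .$$
   Context: **Weyl algebra.** Fix $n,r\ge1$ and variables $(y^1,\dots,y^{2n})=(p^1,\dots,p^n,q^1,\dots,q^n)$, $\partial_i=\partial/\partial y^i$. Let $\hat\omega^{i,n+i}=1=-\hat\omega^{n+i,i}$ for $1\le i\le n$, all other $\hat\omega^{ij}=0$ (repeated indices are summed). $\mathcal W_{2n}=\mathbb C[[y]]((\hbar))$, $\mathcal W_{2n}^+=\mathbb C[[y]][[\hbar]]$, with Moyal product $f\star g=\sum_k\frac{1}{k!}(\hbar/2)^k\hat\omega^{i_1j_1}\cdots\hat\omega^{i_kj_k}(\partial_{i_1}\cdots\partial_{i_k}f)(\partial_{j_1}\cdots\partial_{j_k}g)$. $\mathfrak{gl}_r(\mathcal W_{2n})$ is the matrix algebra with product $\star$. $\mathfrak g=\mathcal W^+_{2n}\cdot\mathrm{Id}+\hbar\,\mathfrak{gl}_r(\mathcal W^+_{2n})$ is a Lie algebra (over $\mathbb C$) with bracket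 $[x,y]=\frac1\hbar[x,y]_\star=\frac1\hbar(x\star y-y\star x)$; $\mathfrak h=\mathfrak{sp}_{2n}\cdot \mathrm{Id}+\hbar\,\mathfrak{gl}_r(\mathbb C)+\mathbb C[[\hbar]]\cdot\mathrm{Id}\subset\mathfrak g$, where $\mathfrak{sp}_{2n}$ is the space of homogeneous quadratic polynomials in $y$. $\mathbb K=\mathbb C((\hbar))[u,u^{-1}]$, $\deg u=2$. **Forms.** $\hat\Omega^{-\bullet}_{2n}$ is the graded commutative algebra of forms $\sum f_I dy^I$, $f_I\in\mathbb C[[y]]((\hbar))$, with $p$-forms in degree $-p$; $d_{2n}$ is the de Rham differential; $\iota_\Pi=\frac12\hat\omega^{ij}\iota_{\partial_i}\iota_{\partial_j}$. **Cyclic chains.** For $A=\mathfrak{gl}_r(\mathcal W_{2n})$ with base ring $\mathbb C((\hbar))$: $C_{-m}(A)=A\otimes\bar A^{\otimes m}$, $\bar A=A/\mathbb C((\hbar))\cdot1$; $b(a_0\otimes\cdots\otimes a_p)=(-1)^pa_pa_0\otimes a_1\otimes\cdots\otimes a_{p-1}+\sum_{i=0}^{p-1}(-1)^ia_0\otimes\cdots\otimes a_ia_{i+1}\otimes\cdots\otimes a_p$ (and $b=0$ on $C_0$), $B(a_0\otimes\cdots\otimes a_p)=\sum_{i=0}^p(-1)^{pi}1\otimes a_i\otimes\cdots\otimes a_p\otimes a_0\otimes\cdots\otimes a_{i-1}$. $CC^{per}_{-\bullet}(A)=(C_{-\bullet}(A)[u,u^{-1}],b+uB)$. $\mathfrak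 g$ acts on chains by the derivation extension of $x\mapsto\frac1\hbar[\xi,x]_\star$, trivially on $\mathbb K$, and on $\mathrm{Hom}$ by $(\xi\cdot\varphi)(O)=-\varphi(\xi\cdot O)$. **Free expectation.** $S^1=\mathbb R/\mathbb Z$. For anticlockwise cyclically ordered distinct points $(\theta_0,\dots,\theta_m)$ let $u_{\alpha\beta}\in(0,1)$ be the anticlockwise distance from $\theta_\alpha$ to $\theta_\beta$ and $P_{\alpha\beta}=\frac12-u_{\alpha\beta}$ ($\alpha\neq\beta$). On tensors set $\partial_P=\frac12\sum_{\alpha\ne\beta}P_{\alpha\beta}\,\hat\omega^{ij}(\mathcal L_{\partial_i})_\alpha(\mathcal L_{\partial_j})_\beta$, subscripts indicating the tensor slot acted on. Then $$\langle O_0\otimes\cdots\otimes O_m\rangle_{free}=\mathrm{tr}\int d\theta_0\cdots d\theta_m\;e^{\hbar\partial_P}(O_0\otimes d_{2n}O_1\otimes\cdots\otimes d_{2n}O_m)\in\hat\Omega^{-m}_{2n},$$ integrating (Lebesgue measure) over all cyclically ordered $(m+1)$-tuples (a copy of $S^1\times\Delta_m$), where $\mathrm{tr}$ multiplies the form-valued matrices in order and takes the matrix trace. **Interacting expectation.** For $\xi_1,\dots,\xi_k\in\mathfrak g$, $$\langle O_0\otimes\cdots\otimes O_m\rangle_{int}[\xi_1,\dots,\xi_k]=\hbar^{-k}\sum_\tau \mathrm{sgn}(\tau)\,\langle O_0\otimes v_{\tau^{-1}(1)}\otimes\cdots\otimes v_{\tau^{-1}(k+m)}\rangle_{free},$$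 $(v_1,\dots,v_{k+m})=(\xi_1,\dots,\xi_k,O_1,\dots,O_m)$, $\tau$ over permutations of $\{1,\dots,k+m\}$ with $\tau(k+1)<\cdots<\tau(k+m)$. Extend $u$-linearly. **Berezin integral.** $\int_{BV}a=\sigma(u^ne^{\hbar\iota_\Pi/u}a)\in\mathbb K$ for $a\in\hat\Omega^{-\bullet}_{2n}[u,u^{-1}]$, where $\sigma$ sets all $y^i,dy^i$ to $0$. **Cochains.** $C^k(\mathfrak g;V)=\mathrm{Hom}_{\mathbb C}(\wedge^k\mathfrak g,V)$ with Chevalley–Eilenberg differential $(\partial_{\mathrm{Lie}}\alpha)(a_1,\dots,a_{k+1})=\sum_i(-1)^{i-1}a_i\cdot\alpha(\dots\hat a_i\dots)+\sum_{i<j}(-1)^{i+j}\alpha([a_i,a_j],\dots\hat a_i\dots\hat a_j\dots)$; $C^k(\mathfrak g,\mathfrak h;V)=\mathrm{Hom}_{\mathfrak h}(\wedge^k(\mathfrak g/\mathfrak h),V)\subset C^k(\mathfrak g;V)$. For a $k$-cochain $\varphi$ with values in $\mathrm{Hom}_{\mathbb K}(CC^{per},\mathbb K)$, $(b+uB)\varphi$ is the $k$-cochain $(\xi_1,\dots,\xi_k)\mapsto(-1)^k\varphi(\xi_1,\dots,\xi_k)\circ(b+uB)$. *)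

theory Defs
  imports
    "HOL-Analysis.Analysis"
    "HOL-Computational_Algebra.Formal_Laurent_Series"
    "HOL-Combinatorics.Permutations"
    "HOL-Library.Poly_Mapping"
begin

no_notation fps_nth (infixl "$" 75)

section \<open>Power series in \<open>2n\<close> variables\<close>

text \<open>\<open>n\<close> is \<open>CARD('n)\<close>.  The linear order on \<open>'n\<close> only serves to write exterior monomials
  \<open>dy\<^sup>I\<close> in increasing order \<open>p\<^sup>1 < \<dots> < p\<^sup>n < q\<^sup>1 < \<dots> < q\<^sup>n\<close>.\<close>

datatype 'n coord = PP 'n | QQ 'n

lemma UNIV_coord: "(UNIV :: 'n coord set) = range PP \<union> range QQ"
proof -
  have "x \<in> range PP \<union> range QQ" for x :: "'n coord"
    by (cases x) auto
  then show ?thesis by blast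
qed

instance coord :: (finite) finite
  by standard (simp add: UNIV_coord)

instantiation coord :: (linorder) linorder
begin

fun less_coord :: "'a coord \<Rightarrow> 'a coord \<Rightarrow> bool" where
  "less_coord (PP i) (PP j) \<longleftrightarrow> i < j"
| "less_coord (PP i) (QQ j) \<longleftrightarrow> True"
| "less_coord (QQ i) (PP j) \<longleftrightarrow> False"
| "less_coord (QQ i) (QQ j) \<longleftrightarrow> i < j"

definition less_eq_coord :: "'a coord \<Rightarrow> 'a coord \<Rightarrow> bool" where
  "less_eq_coord x y \<longleftrightarrow> x = y \<or> x < y"

instance
proof
  fix x y z :: "'a coord"
  show "(x < y) = (x \<le> y \<and> \<not> y \<le> x)"
    by (cases x; cases y) (auto simp: less_eq_coord_def)
  show "x \<le> x" by (simp add: less_eq_coord_def)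
  show "x \<le> z" if "x \<le> y" "y \<le> z"
    using that by (cases x; cases y; cases z) (auto simp: less_eq_coord_def)
  show "x = y" if "x \<le> y" "y \<le> x"
    using that by (cases x; cases y) (auto simp: less_eq_coord_def)
  show "x \<le> y \<or> y \<le> x"
    by (cases x; cases y) (auto simp: less_eq_coord_def)
qed

end

fun omega :: "'n coord \<Rightarrow> 'n coord \<Rightarrow> complex" where
  "omega (PP i) (QQ j) = (if i = j then 1 else 0)"
| "omega (QQ i) (PP j) = (if i = j then -1 else 0)"
| "omega _ _ = 0"

text \<open>\<open>'v mps\<close> is \<open>\<complex>[[y]]\<close> with one variable for each element of \<open>'v\<close>; \<open>mcoeff f a\<close> is the
  coefficient of the monomial with exponents \<open>a\<close>.\<close>

typedef 'v mps = "UNIV :: (('v \<Rightarrow> nat) \<Rightarrow> complex) set"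
  morphisms mcoeff Abs_mps ..

setup_lifting type_definition_mps

lemma mps_eqI: "(\<And>a. mcoeff f a = mcoeff g a) \<Longrightarrow> f = g"
  by transfer auto

definition msplit :: "('v \<Rightarrow> nat) \<Rightarrow> (('v \<Rightarrow> nat) \<times> ('v \<Rightarrow> nat)) set" where
  "msplit a = {(b, c). \<forall>i. b i + c i = a i}"

lemma finite_msplit [simp]: "finite (msplit (a :: 'v::finite \<Rightarrow> nat))"
proof -
  have "finite {b :: 'v \<Rightarrow> nat. \<forall>i. b i \<in> {..a i}}"
    using finite_PiE[of UNIV "\<lambda>i. {..a i}"] by (simp add: PiE_def Pi_def)
  then have fin: "finite ({b :: 'v \<Rightarrow> nat. \<forall>i. b i \<le> a i} \<times> {b :: 'v \<Rightarrow> nat. \<forall>i. b i \<le> a i})"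
    by simp
  show ?thesis
    by (rule finite_subset[OF _ fin]) (auto simp: msplit_def, (metis le_add1 le_add2)+)
qed

lemma msplit_zero: "(\<lambda>_. 0, c) \<in> msplit a \<longleftrightarrow> c = a"
  by (auto simp: msplit_def)

instantiation mps :: (finite) comm_ring_1
begin

lift_definition zero_mps :: "'a mps" is "\<lambda>_. 0" .
lift_definition one_mps :: "'a mps" is "\<lambda>a. if a = (\<lambda>_. 0) then 1 else 0" .
lift_definition plus_mps :: "'a mps \<Rightarrow> 'a mps \<Rightarrow> 'a mps" is "\<lambda>f g a. f a + g a" .
lift_definition minus_mps :: "'a mps \<Rightarrow> 'a mps \<Rightarrow> 'a mps" is "\<lambda>f g a. f a - g a" .
lift_definition uminus_mps :: "'a mps \<Rightarrow> 'a mps" is "\<lambda>f a. - f a" .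
lift_definition times_mps :: "'a mps \<Rightarrow> 'a mps \<Rightarrow> 'a mps"
  is "\<lambda>f g a. \<Sum>(b, c)\<in>msplit a. f b * g c" .

instance
proof
  fix x y z :: "'a mps"
  show "x * y * z = x * (y * z)"
  proof (rule mps_eqI)
    fix a
    have "mcoeff (x * y * z) a =
        (\<Sum>(u, e)\<in>msplit a. \<Sum>(b, c)\<in>msplit u. mcoeff x b * mcoeff y c * mcoeff z e)"
      by (simp add: times_mps.rep_eq sum_distrib_right case_prod_unfold)
    also have "\<dots> = (\<Sum>((u, e), (b, c))\<in>(SIGMA ue:msplit a. msplit (fst ue)).
        mcoeff x b * mcoeff y c * mcoeff z e)"
      by (subst sum.Sigma[symmetric]) (auto simp: case_prod_unfold)
    also have "\<dots> = (\<Sum>((b, w), (c, e))\<in>(SIGMA bw:msplit a. msplit (snd bw)).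
        mcoeff x b * mcoeff y c * mcoeff z e)"
      by (rule sum.reindex_bij_witness[where
            i = "\<lambda>((b, w), (c, e)). ((\<lambda>i. b i + c i, e), (b, c))" and
            j = "\<lambda>((u, e), (b, c)). ((b, \<lambda>i. c i + e i), (c, e))"])
         (auto simp: msplit_def fun_eq_iff, (metis add.assoc)+)
    also have "\<dots> = (\<Sum>(b, w)\<in>msplit a. \<Sum>(c, e)\<in>msplit w. mcoeff x b * mcoeff y c * mcoeff z e)"
      by (subst sum.Sigma[symmetric]) (auto simp: case_prod_unfold)
    also have "\<dots> = mcoeff (x * (y * z)) a"
      by (simp add: times_mps.rep_eq sum_distrib_left case_prod_unfold mult.assoc)
    finally show "mcoeff (x * y * z) a = mcoeff (x * (y * z)) a" .
  qed
  show "x * y = y * x"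
  proof (rule mps_eqI)
    fix a
    show "mcoeff (x * y) a = mcoeff (y * x) a"
      unfolding times_mps.rep_eq
      by (rule sum.reindex_bij_witness[where i = prod.swap and j = prod.swap])
         (auto simp: msplit_def add.commute mult.commute)
  qed
  show "1 * x = x"
  proof (rule mps_eqI)
    fix a
    have "mcoeff (1 * x) a = (\<Sum>(b, c)\<in>{(\<lambda>_. 0, a)}. mcoeff 1 b * mcoeff x c)"
      unfolding times_mps.rep_eq
      by (rule sum.mono_neutral_right)
         (auto simp: msplit_zero one_mps.rep_eq split: if_splits)
    then show "mcoeff (1 * x) a = mcoeff x a"
      by (simp add: one_mps.rep_eq)
  qed
  show "(x + y) * z = x * z + y * z"
    by (rule mps_eqI)
       (simp add: times_mps.rep_eq plus_mps.rep_eq distrib_right sum.distrib case_prod_unfold)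
  show "(0 :: 'a mps) \<noteq> 1"
  proof
    assume "(0 :: 'a mps) = 1"
    then have "mcoeff (0 :: 'a mps) (\<lambda>_. 0) = mcoeff 1 (\<lambda>_. 0)" by simp
    then show False by (simp add: one_mps.rep_eq zero_mps.rep_eq)
  qed
qed (rule mps_eqI, simp add: plus_mps.rep_eq minus_mps.rep_eq uminus_mps.rep_eq zero_mps.rep_eq)+

end

lift_definition mconst :: "complex \<Rightarrow> 'v mps" is "\<lambda>c a. if a = (\<lambda>_. 0) then c else 0" .

lift_definition mderiv :: "'v \<Rightarrow> 'v mps \<Rightarrow> 'v mps"
  is "\<lambda>i f a. of_nat (a i + 1) * f (a(i := a i + 1))" .


section \<open>The Weyl algebra and its matrix algebra\<close>

text \<open>Formal Laurent series are in \<open>\<hbar>\<close>, so \<open>fls_X\<close> plays the role of \<open>\<hbar>\<close>, and the series below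
  converge in the \<open>\<hbar>\<close>-adic metric of \<^typ>\<open>'a fls\<close>.\<close>

type_synonym 'n weyl = "'n coord mps fls"

abbreviation hbar :: "complex fls" where "hbar \<equiv> fls_X"

definition fls_map :: "('a::zero \<Rightarrow> 'b::zero) \<Rightarrow> 'a fls \<Rightarrow> 'b fls" where
  "fls_map f F = Abs_fls (\<lambda>N. f (fls_nth F N))"

definition emb :: "complex fls \<Rightarrow> 'n::finite weyl" where
  "emb = fls_map mconst"

definition wderiv :: "'n::finite coord \<Rightarrow> 'n weyl \<Rightarrow> 'n weyl" where
  "wderiv i = fls_map (mderiv i)"

definition moyal :: "'n::finite weyl \<Rightarrow> 'n weyl \<Rightarrow> 'n weyl" (infixl "\<star>\<^sub>M" 70) where
  "f \<star>\<^sub>M g = suminf (\<lambda>k. emb (1 / fact k * (hbar / 2) ^ k) *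
     (\<Sum>is | length is = k. \<Sum>js | length js = k.
        emb (fls_const (\<Prod>l<k. omega (is ! l) (js ! l))) * foldr wderiv is f * foldr wderiv js g))"

type_synonym ('n, 'r) gl = "'n weyl ^ 'r ^ 'r"

definition gmult :: "('n::finite, 'r::finite) gl \<Rightarrow> ('n, 'r) gl \<Rightarrow> ('n, 'r) gl" (infixl "\<star>\<^sub>G" 70) where
  "x \<star>\<^sub>G y = (\<chi> i j. \<Sum>k\<in>UNIV. (x $ i $ k) \<star>\<^sub>M (y $ k $ j))"

definition gscale :: "complex fls \<Rightarrow> ('n::finite, 'r::finite) gl \<Rightarrow> ('n, 'r) gl" where
  "gscale c x = (\<chi> i j. emb c * x $ i $ j)"

definition bracket :: "('n::finite, 'r::finite) gl \<Rightarrow> ('n, 'r) gl \<Rightarrow> ('n, 'r) gl" where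
  "bracket x y = gscale (1 / hbar) (x \<star>\<^sub>G y - y \<star>\<^sub>G x)"

definition weyl_plus :: "'n::finite weyl set" where
  "weyl_plus = range fps_to_fls"

definition lie_g :: "('n::finite, 'r::finite) gl set" where
  "lie_g = {mat f + gscale hbar x | f x. f \<in> weyl_plus \<and> (\<forall>i j. x $ i $ j \<in> weyl_plus)}"

definition sp_quad :: "'n::finite coord mps set" where
  "sp_quad = {q. \<forall>a. mcoeff q a \<noteq> 0 \<longrightarrow> (\<Sum>i\<in>UNIV. a i) = 2}"

definition lie_h :: "('n::finite, 'r::finite) gl set" where
  "lie_h = {mat (fls_const q) + gscale hbar (\<chi> i j. fls_const (mconst (M $ i $ j)))
              + mat (emb (fps_to_fls s))
            | q (M :: complex ^ 'r ^ 'r) s. q \<in> sp_quad}"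


section \<open>Periodic cyclic chains\<close>

text \<open>\<open>chain\<close> is the direct sum over \<open>m\<close> of the tensor products \<open>A \<otimes> (A/k)\<^sup>\<otimes>\<^sup>m\<close> over \<open>k = \<complex>((\<hbar>))\<close>
  with \<open>A\<close> the matrix algebra: the free \<open>k\<close>-module on the words \<open>(a\<^sub>0, [a\<^sub>1, \<dots>, a\<^sub>m])\<close> modulo
  multilinearity in all slots and the vanishing of words with a scalar in a slot other than \<open>0\<close>.\<close>

type_synonym ('n, 'r) words = "(('n, 'r) gl \<times> ('n, 'r) gl list) \<Rightarrow>\<^sub>0 complex fls"

definition wscale :: "complex fls \<Rightarrow> ('a \<Rightarrow>\<^sub>0 complex fls) \<Rightarrow> ('a \<Rightarrow>\<^sub>0 complex fls)" where
  "wscale c = Poly_Mapping.map ((*) c)"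

definition word :: "('n::finite, 'r::finite) gl list \<Rightarrow> ('n, 'r) words" where
  "word l = Poly_Mapping.single (hd l, tl l) 1"

inductive_set null_words :: "('n::finite, 'r::finite) words set" where
  zero: "0 \<in> null_words"
| plus: "x \<in> null_words \<Longrightarrow> y \<in> null_words \<Longrightarrow> x + y \<in> null_words"
| scale: "x \<in> null_words \<Longrightarrow> wscale c x \<in> null_words"
| slot_plus: "word (l @ (a + a') # l') - word (l @ a # l') - word (l @ a' # l') \<in> null_words"
| slot_scale: "word (l @ gscale c a # l') - wscale c (word (l @ a # l')) \<in> null_words"
| slot_scalar: "l \<noteq> [] \<Longrightarrow> word (l @ mat (emb c) # l') \<in> null_words"

lemma lookup_wscale [simp]: "Poly_Mapping.lookup (wscale c x) k = c * Poly_Mapping.lookup x k"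
  unfolding wscale_def by (simp add: Poly_Mapping.map.rep_eq when_def)

lemma wscale_plus: "wscale c (x + y) = wscale c x + wscale c y"
  by (rule poly_mapping_eqI) (simp add: lookup_add algebra_simps)

lemma wscale_minus: "wscale c (x - y) = wscale c x - wscale c y"
  by (rule poly_mapping_eqI) (simp add: lookup_minus algebra_simps)

lemma wscale_neg_one: "wscale (-1) x = - x"
  by (rule poly_mapping_eqI) (simp add: lookup_uminus)

lemma null_words_uminus: "x \<in> null_words \<Longrightarrow> - x \<in> null_words"
  using null_words.scale[of x "-1"] by (simp add: wscale_neg_one)

lemma null_words_minus: "x \<in> null_words \<Longrightarrow> y \<in> null_words \<Longrightarrow> x - y \<in> null_words"
  using null_words.plus[of x "- y"] null_words_uminus[of y] by simp

quotient_type ('n, 'r) chain = "('n::finite, 'r::finite) words" / "\<lambda>x y. x - y \<in> null_words"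
  morphisms rep_chain abs_chain
proof (rule equivpI)
  show "reflp (\<lambda>x y. x - y \<in> null_words)"
    by (rule reflpI) (simp add: null_words.zero)
  show "symp (\<lambda>x y. x - y \<in> null_words)"
    by (rule sympI) (metis minus_diff_eq null_words_uminus)
  show "transp (\<lambda>x y. x - y \<in> null_words)"
    by (rule transpI, drule (1) null_words.plus) simp
qed

instantiation chain :: (finite, finite) ab_group_add
begin

lift_definition zero_chain :: "('a, 'b) chain" is 0 .
lift_definition plus_chain :: "('a, 'b) chain \<Rightarrow> ('a, 'b) chain \<Rightarrow> ('a, 'b) chain" is "(+)"
  by (simp add: add_diff_add null_words.plus)
lift_definition minus_chain :: "('a, 'b) chain \<Rightarrow> ('a, 'b) chain \<Rightarrow> ('a, 'b) chain" is "(-)"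
proof -
  fix x x' y y' :: "('a, 'b) words"
  assume "x - x' \<in> null_words" "y - y' \<in> null_words"
  then have "(x - x') - (y - y') \<in> null_words" by (rule null_words_minus)
  then show "(x - y) - (x' - y') \<in> null_words" by (simp add: algebra_simps)
qed
lift_definition uminus_chain :: "('a, 'b) chain \<Rightarrow> ('a, 'b) chain" is uminus
  by (drule null_words_uminus) simp

instance
  by standard (transfer, simp add: algebra_simps null_words.zero)+

end

lift_definition cscale :: "complex fls \<Rightarrow> ('n::finite, 'r::finite) chain \<Rightarrow> ('n, 'r) chain" is wscale
  by (metis wscale_minus null_words.scale)

lift_definition tens :: "('n::finite, 'r::finite) gl list \<Rightarrow> ('n, 'r) chain" is word .

definition normalized_multilinear ::
  "(complex fls \<Rightarrow> 'v \<Rightarrow> 'v) \<Rightarrow> (('n::finite, 'r::finite) gl list \<Rightarrow> 'v::ab_group_add) \<Rightarrow> bool"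
  where
  "normalized_multilinear sc f \<longleftrightarrow>
     (\<forall>l l' a a'. f (l @ (a + a') # l') = f (l @ a # l') + f (l @ a' # l'))
   \<and> (\<forall>l l' a c. f (l @ gscale c a # l') = sc c (f (l @ a # l')))
   \<and> (\<forall>l l' c. l \<noteq> [] \<longrightarrow> f (l @ mat (emb c) # l') = 0)"

text \<open>If \<open>sc\<close> is a scalar multiplication and \<open>f\<close> is \<open>normalized_multilinear\<close>, then \<open>chain_lin sc f\<close>
  is the \<open>k\<close>-linear map with \<open>a\<^sub>0 \<otimes> \<dots> \<otimes> a\<^sub>m \<mapsto> f [a\<^sub>0, \<dots>, a\<^sub>m]\<close>; see \<open>chain_lin\<close> below.\<close>

definition chain_lin ::
  "(complex fls \<Rightarrow> 'v \<Rightarrow> 'v) \<Rightarrow> (('n::finite, 'r::finite) gl list \<Rightarrow> 'v) \<Rightarrow> ('n, 'r) chain \<Rightarrow> 'v::ab_group_add"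
  where "chain_lin sc f x =
    (\<Sum>w\<in>Poly_Mapping.keys (rep_chain x). sc (Poly_Mapping.lookup (rep_chain x) w) (f (fst w # snd w)))"

definition hoch_b :: "('n::finite, 'r::finite) chain \<Rightarrow> ('n, 'r) chain" where
  "hoch_b = chain_lin cscale (\<lambda>a. let p = length a - 1 in
     if p = 0 then 0
     else cscale ((-1) ^ p) (tens ((a ! p \<star>\<^sub>G a ! 0) # take (p - 1) (drop 1 a)))
        + (\<Sum>i<p. cscale ((-1) ^ i) (tens (take i a @ (a ! i \<star>\<^sub>G a ! (i + 1)) # drop (i + 2) a))))"

definition connes_B :: "('n::finite, 'r::finite) chain \<Rightarrow> ('n, 'r) chain" where
  "connes_B = chain_lin cscale (\<lambda>a. let p = length a - 1 in
     \<Sum>i\<le>p. cscale ((-1) ^ (p * i)) (tens (mat 1 # drop i a @ take i a)))"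

definition chain_act :: "('n::finite, 'r::finite) gl \<Rightarrow> ('n, 'r) chain \<Rightarrow> ('n, 'r) chain" where
  "chain_act \<xi> = chain_lin cscale (\<lambda>a. \<Sum>i<length a. tens (a[i := bracket \<xi> (a ! i)]))"

text \<open>Laurent polynomials in \<open>u\<close> are finitely supported functions on the integers.\<close>

type_synonym KK = "int \<Rightarrow>\<^sub>0 complex fls"
type_synonym ('n, 'r) cc_per = "int \<Rightarrow>\<^sub>0 ('n, 'r) chain"

definition kscale :: "KK \<Rightarrow> ('n::finite, 'r::finite) cc_per \<Rightarrow> ('n, 'r) cc_per" where
  "kscale \<kappa> x = (\<Sum>i\<in>Poly_Mapping.keys \<kappa>. \<Sum>j\<in>Poly_Mapping.keys x.
     Poly_Mapping.single (i + j) (cscale (Poly_Mapping.lookup \<kappa> i) (Poly_Mapping.lookup x j)))"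

definition cc_diff :: "('n::finite, 'r::finite) cc_per \<Rightarrow> ('n, 'r) cc_per" where
  "cc_diff x = Poly_Mapping.map hoch_b x
     + kscale (Poly_Mapping.single 1 1) (Poly_Mapping.map connes_B x)"

definition cc_act :: "('n::finite, 'r::finite) gl \<Rightarrow> ('n, 'r) cc_per \<Rightarrow> ('n, 'r) cc_per" where
  "cc_act \<xi> = Poly_Mapping.map (chain_act \<xi>)"


section \<open>Differential forms\<close>

text \<open>For a form \<open>w\<close>, \<open>w $ I\<close> is the coefficient of \<open>dy\<^sup>I = dy\<^sup>i\<^sup>1 \<and> \<dots> \<and> dy\<^sup>i\<^sup>p\<close>, where \<open>i1 < \<dots> < ip\<close> are the elements
  of \<open>I\<close>.\<close>

type_synonym 'n form = "'n weyl ^ 'n coord set"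

definition fscale :: "complex fls \<Rightarrow> 'n::finite form \<Rightarrow> 'n form" where
  "fscale c w = (\<chi> I. emb c * w $ I)"

definition form0 :: "'n::finite weyl \<Rightarrow> 'n form" where
  "form0 f = (\<chi> I. if I = {} then f else 0)"

definition wedge :: "'n::{finite,linorder} form \<Rightarrow> 'n form \<Rightarrow> 'n form" where
  "wedge v w = (\<chi> I. \<Sum>J\<in>Pow I.
     (-1) ^ card {(j, k). j \<in> J \<and> k \<in> I - J \<and> k < j} * v $ J * w $ (I - J))"

definition de_rham :: "'n::{finite,linorder} form \<Rightarrow> 'n form" where
  "de_rham w = (\<chi> I. \<Sum>i\<in>I. (-1) ^ card {j \<in> I. j < i} * wderiv i (w $ (I - {i})))"

text \<open>Lie derivative along the constant vector field \<open>\<partial>\<^sub>i\<close>, which annihilates every \<open>dy\<^sup>j\<close>.\<close>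

definition lie_deriv :: "'n::finite coord \<Rightarrow> 'n form \<Rightarrow> 'n form" where
  "lie_deriv i w = (\<chi> I. wderiv i (w $ I))"

definition contract :: "'n::{finite,linorder} coord \<Rightarrow> 'n form \<Rightarrow> 'n form" where
  "contract i w = (\<chi> I. if i \<in> I then 0 else (-1) ^ card {j \<in> I. j < i} * w $ insert i I)"

definition iota_Pi :: "'n::{finite,linorder} form \<Rightarrow> 'n form" where
  "iota_Pi w = fscale (1 / 2) (\<Sum>i\<in>UNIV. \<Sum>j\<in>UNIV.
     fscale (fls_const (omega i j)) (contract i (contract j w)))"

definition form_sigma :: "'n::finite form \<Rightarrow> complex fls" where
  "form_sigma w = fls_map (\<lambda>f. mcoeff f (\<lambda>_. 0)) (w $ {})"

text \<open>The exponential series of \<open>\<hbar> \<iota>\<^sub>\<Pi> / u\<close> stops at order \<open>n\<close> because \<open>\<iota>\<^sub>\<Pi>\<close> lowers the form degree, which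
  is at most \<open>2n\<close>, by two.\<close>

definition berezin :: "(int \<Rightarrow>\<^sub>0 'n::{finite,linorder} form) \<Rightarrow> KK" where
  "berezin a = (\<Sum>j\<in>Poly_Mapping.keys a. \<Sum>l\<le>CARD('n).
     Poly_Mapping.single (int CARD('n) - int l + j)
       (form_sigma (fscale (hbar ^ l / fact l) ((iota_Pi ^^ l) (Poly_Mapping.lookup a j)))))"

type_synonym ('n, 'r) mform = "'n form ^ 'r ^ 'r"

definition mf_mult :: "('n::{finite,linorder}, 'r::finite) mform \<Rightarrow> ('n, 'r) mform \<Rightarrow> ('n, 'r) mform" where
  "mf_mult x y = (\<chi> i j. \<Sum>k\<in>UNIV. wedge (x $ i $ k) (y $ k $ j))"

definition mf_trace_prod :: "('n::{finite,linorder}, 'r::finite) mform list \<Rightarrow> 'n form" where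
  "mf_trace_prod T = (\<Sum>i\<in>UNIV. foldr mf_mult T (mat (form0 1)) $ i $ i)"

definition mf_map :: "('n form \<Rightarrow> 'n form) \<Rightarrow> ('n::finite, 'r::finite) mform \<Rightarrow> ('n, 'r) mform" where
  "mf_map h x = (\<chi> i j. h (x $ i $ j))"

definition to_mform :: "('n::finite, 'r::finite) gl \<Rightarrow> ('n, 'r) mform" where
  "to_mform x = (\<chi> i j. form0 (x $ i $ j))"


section \<open>Expectation values\<close>

text \<open>The circle is \<open>[0,1)\<close>, and \<open>circ_dist x y\<close> is the anticlockwise distance from \<open>x\<close> to \<open>y\<close>.\<close>

definition circ_dist :: "real \<Rightarrow> real \<Rightarrow> real" where
  "circ_dist x y = frac (y - x)"

text \<open>Going anticlockwise from \<open>\<theta> 0\<close> one meets \<open>\<theta> 1, \<dots>, \<theta> m\<close> in this order; for \<open>a = 0\<close> the condition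
  says that \<open>\<theta> 0\<close> differs from the other points.\<close>

definition cyc_config :: "nat \<Rightarrow> (nat \<Rightarrow> real) set" where
  "cyc_config m = {\<theta> \<in> {..m} \<rightarrow>\<^sub>E {0..<1}.
     \<forall>a b. a < b \<and> b \<le> m \<longrightarrow> circ_dist (\<theta> 0) (\<theta> a) < circ_dist (\<theta> 0) (\<theta> b)}"

definition propagator :: "(nat \<Rightarrow> real) \<Rightarrow> nat \<Rightarrow> nat \<Rightarrow> complex" where
  "propagator \<theta> a b = of_real (1 / 2 - circ_dist (\<theta> a) (\<theta> b))"

text \<open>\<open>tr_dP \<theta> k T\<close> is the trace of the ordered product of \<open>(\<partial>\<^sub>P)\<^sup>k (T\<^sub>0 \<otimes> \<dots> \<otimes> T\<^sub>m)\<close>.\<close>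

primrec tr_dP :: "(nat \<Rightarrow> real) \<Rightarrow> nat \<Rightarrow> ('n::{finite,linorder}, 'r::finite) mform list \<Rightarrow> 'n form" where
  "tr_dP \<theta> 0 T = mf_trace_prod T"
| "tr_dP \<theta> (Suc k) T =
     fscale (1 / 2) (\<Sum>(a, b) | a < length T \<and> b < length T \<and> a \<noteq> b. \<Sum>i\<in>UNIV. \<Sum>j\<in>UNIV.
       fscale (fls_const (propagator \<theta> a b * omega i j))
         (tr_dP \<theta> k (T[a := mf_map (lie_deriv i) (T ! a), b := mf_map (lie_deriv j) (T ! b)])))"

definition form_integral :: "nat \<Rightarrow> ((nat \<Rightarrow> real) \<Rightarrow> 'n::finite form) \<Rightarrow> 'n form" where
  "form_integral m F = (\<chi> I. Abs_fls (\<lambda>N. Abs_mps (\<lambda>y.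
     LINT \<theta>:cyc_config m|(\<Pi>\<^sub>M a\<in>{..m}. lborel). mcoeff (fls_nth (F \<theta> $ I) N) y)))"

definition free_exp :: "('n::{finite,linorder}, 'r::finite) gl list \<Rightarrow> 'n form" where
  "free_exp a = form_integral (length a - 1) (\<lambda>\<theta>. suminf (\<lambda>k. fscale (hbar ^ k / fact k)
     (tr_dP \<theta> k (to_mform (hd a) # map (mf_map de_rham \<circ> to_mform) (tl a)))))"

text \<open>Permutations are of \<open>{0, \<dots>, k + m - 1}\<close> rather than \<open>{1, \<dots>, k + m}\<close>.\<close>

definition int_tensor ::
  "('n::{finite,linorder}, 'r::finite) gl list \<Rightarrow> ('n, 'r) gl list \<Rightarrow> 'n form" where
  "int_tensor \<xi> a = (let k = length \<xi>; v = \<xi> @ tl a; N = length v in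
     fscale ((1 / hbar) ^ k)
       (\<Sum>\<tau> | \<tau> permutes {..<N} \<and> strict_mono_on {k..<N} \<tau>.
          fscale (of_int (sign \<tau>)) (free_exp (hd a # map (\<lambda>s. v ! inv \<tau> s) [0..<N]))))"

definition int_exp ::
  "('n::{finite,linorder}, 'r::finite) gl list \<Rightarrow> ('n, 'r) chain \<Rightarrow> 'n form" where
  "int_exp \<xi> = chain_lin fscale (int_tensor \<xi>)"

definition universal_trace ::
  "('n::{finite,linorder}, 'r::finite) gl list \<Rightarrow> ('n, 'r) cc_per \<Rightarrow> KK" where
  "universal_trace \<xi> x = berezin (Poly_Mapping.map (int_exp \<xi>) x)"


section \<open>Lie algebra cochains\<close>

text \<open>A family of \<open>k\<close>-cochains, one for each \<open>k\<close>, is a function on lists: its \<open>k\<close>-cochain is the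
  restriction to lists of length \<open>k\<close> with entries in \<open>lie_g\<close>; other values are irrelevant.\<close>

type_synonym ('n, 'r) hom_cc = "('n, 'r) cc_per \<Rightarrow> KK"
type_synonym ('n, 'r) cochain = "('n, 'r) gl list \<Rightarrow> ('n, 'r) hom_cc"

definition hom_K :: "('n::finite, 'r::finite) hom_cc set" where
  "hom_K = {\<phi>. (\<forall>x y. \<phi> (x + y) = \<phi> x + \<phi> y) \<and> (\<forall>\<kappa> x. \<phi> (kscale \<kappa> x) = \<kappa> * \<phi> x)}"

definition hom_act :: "('n::finite, 'r::finite) gl \<Rightarrow> ('n, 'r) hom_cc \<Rightarrow> ('n, 'r) hom_cc" where
  "hom_act \<xi> \<phi> x = - \<phi> (cc_act \<xi> x)"

definition cochains :: "nat \<Rightarrow> ('n::finite, 'r::finite) cochain set" where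
  "cochains k = {\<alpha>. \<forall>\<xi>\<in>lists lie_g. length \<xi> = k \<longrightarrow>
       \<alpha> \<xi> \<in> hom_K
     \<and> (\<forall>i<k. \<forall>x\<in>lie_g. \<forall>y\<in>lie_g. \<forall>z. \<alpha> (\<xi>[i := x + y]) z = \<alpha> (\<xi>[i := x]) z + \<alpha> (\<xi>[i := y]) z)
     \<and> (\<forall>i<k. \<forall>x\<in>lie_g. \<forall>c :: complex. \<forall>z.
          \<alpha> (\<xi>[i := gscale (fls_const c) x]) z
            = Poly_Mapping.single 0 (fls_const c) * \<alpha> (\<xi>[i := x]) z)
     \<and> (\<forall>i<k. \<forall>j<k. i \<noteq> j \<and> \<xi> ! i = \<xi> ! j \<longrightarrow> (\<forall>z. \<alpha> \<xi> z = 0))}"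

text \<open>Alternating maps on \<open>lie_g/lie_h\<close> are identified with the alternating maps on \<open>lie_g\<close> that vanish
  if some argument lies in \<open>lie_h\<close>.\<close>

definition rel_cochains :: "nat \<Rightarrow> ('n::finite, 'r::finite) cochain set" where
  "rel_cochains k = {\<alpha> \<in> cochains k. \<forall>\<xi>\<in>lists lie_g. length \<xi> = k \<longrightarrow>
       (set \<xi> \<inter> lie_h \<noteq> {} \<longrightarrow> (\<forall>z. \<alpha> \<xi> z = 0))
     \<and> (\<forall>\<eta>\<in>lie_h. \<forall>z. hom_act \<eta> (\<alpha> \<xi>) z = (\<Sum>i<k. \<alpha> (\<xi>[i := bracket \<eta> (\<xi> ! i)]) z))}"

text \<open>The direct sum over all \<open>k\<close>.\<close>

definition rel_complex :: "('n::finite, 'r::finite) cochain set" where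
  "rel_complex = {\<alpha>. (\<forall>k. \<alpha> \<in> rel_cochains k) \<and>
     (\<exists>K. \<forall>\<xi>\<in>lists lie_g. K < length \<xi> \<longrightarrow> (\<forall>z. \<alpha> \<xi> z = 0))}"

text \<open>Indices start at \<open>0\<close>, which does not change the parity of \<open>i + j\<close> and turns \<open>i - 1\<close> into \<open>i\<close>.\<close>

definition lie_diff :: "('n::finite, 'r::finite) cochain \<Rightarrow> ('n, 'r) cochain" where
  "lie_diff \<alpha> \<xi> z =
     (\<Sum>i<length \<xi>. (-1) ^ i * hom_act (\<xi> ! i) (\<alpha> (nths \<xi> (- {i}))) z)
   + (\<Sum>(i, j) | i < j \<and> j < length \<xi>.
        (-1) ^ (i + j) * \<alpha> (bracket (\<xi> ! i) (\<xi> ! j) # nths \<xi> (- {i, j})) z)"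

definition cyc_diff :: "('n::finite, 'r::finite) cochain \<Rightarrow> ('n, 'r) cochain" where
  "cyc_diff \<alpha> \<xi> z = (-1) ^ length \<xi> * \<alpha> \<xi> (cc_diff z)"


section \<open>The linear maps on chains are well defined\<close>

definition vb :: "int \<Rightarrow> 'a::zero fls \<Rightarrow> bool" where "vb d F \<longleftrightarrow> (\<forall>N<d. fls_nth F N = 0)"

lemma vb_ex: "\<exists>d. vb d F"
  by (rule exI[of _ "fls_subdegree F"]) (simp add: vb_def)

lemma vb_mono: "vb d F \<Longrightarrow> e \<le> d \<Longrightarrow> vb e F"
  by (auto simp: vb_def)

lemma vb_0 [simp]: "vb d 0" by (simp add: vb_def)

lemma vb_sum: "(\<And>x. x \<in> S \<Longrightarrow> vb d (f x)) \<Longrightarrow> vb d (sum f S)"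
  by (auto simp: vb_def fls_nth_sum)

lemma fls_times_nth_vb:
  fixes F G :: "'a::semiring_0 fls"
  assumes "vb d F" "vb e G"
  shows "fls_nth (F * G) N = (\<Sum>i=d..N - e. fls_nth F i * fls_nth G (N - i))"
proof (cases "F = 0 \<or> G = 0")
  case False
  then have d: "d \<le> fls_subdegree F" and e: "e \<le> fls_subdegree G"
    using assms by (auto intro!: fls_subdegree_geI simp: vb_def)
  show ?thesis
    unfolding fls_times_nth(2)
    by (rule sum.mono_neutral_left) (use d e in auto)
qed auto

lemma vb_mult:
  fixes F G :: "'a::semiring_0 fls"
  shows "vb d F \<Longrightarrow> vb e G \<Longrightarrow> vb (d + e) (F * G)"
  unfolding vb_def[of "d + e"] by (auto simp: fls_times_nth_vb)

lemma Abs_fls_nth: "(\<And>N. N < d \<Longrightarrow> f N = 0) \<Longrightarrow> fls_nth (Abs_fls f) N = f N"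
  by (rule nth_Abs_fls_lower_bound[of d]) auto

lemma fls_map_nth [simp]: "f 0 = 0 \<Longrightarrow> fls_nth (fls_map f F) N = f (fls_nth F N)"
  unfolding fls_map_def by (rule Abs_fls_nth[of "fls_subdegree F"]) simp

lemma vb_map: "f 0 = 0 \<Longrightarrow> vb d F \<Longrightarrow> vb d (fls_map f F)"
  by (simp add: vb_def)

lemma dist_fls_small:
  fixes x y :: "'a::group_add fls"
  assumes "\<And>N. N < int m \<Longrightarrow> fls_nth x N = fls_nth y N"
  shows "dist x y \<le> inverse (2 ^ m)"
proof (cases "x = y")
  case False
  have "int m \<le> fls_subdegree (x - y)"
    by (rule fls_subdegree_geI) (use assms False in auto)
  then show ?thesis using False
    by (auto simp: dist_fls_def intro!: le_imp_inverse_le power_increasing)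
qed simp

definition hs :: "int \<Rightarrow> (nat \<Rightarrow> 'a::zero fls) \<Rightarrow> bool" where
  "hs d F \<longleftrightarrow> (\<forall>k. vb (d + int k) (F k))"

lemma hs_sums:
  fixes F :: "nat \<Rightarrow> 'a::ab_group_add fls"
  assumes "hs d F"
  shows "F sums Abs_fls (\<lambda>N. \<Sum>k<nat (N - d + 1). fls_nth (F k) N)" (is "F sums ?S")
    and "N < d + int K \<Longrightarrow> fls_nth (suminf F) N = (\<Sum>k<K. fls_nth (F k) N)"
proof -
  have z: "fls_nth (F k) N = 0" if "N < d + int k" for k N
    using assms that by (auto simp: hs_def vb_def)
  have nth: "fls_nth ?S N = (\<Sum>k<K. fls_nth (F k) N)" if "N < d + int K" for N K
  proof -
    have "fls_nth ?S N = (\<Sum>k<nat (N - d + 1). fls_nth (F k) N)"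
      by (rule Abs_fls_nth[of d]) simp
    also have "\<dots> = (\<Sum>k<K. fls_nth (F k) N)"
      by (rule sum.mono_neutral_left) (use that z in auto)
    finally show ?thesis .
  qed
  have "(\<lambda>n. sum F {..<n}) \<longlonglongrightarrow> ?S"
  proof (rule metric_LIMSEQ_I)
    fix r :: real assume "r > 0"
    then obtain m where m: "inverse (2 ^ m) < r"
      using reals_power_lt_ex[of r 2] by (auto simp: power_one_over inverse_eq_divide)
    show "\<exists>no. \<forall>n\<ge>no. dist (sum F {..<n}) ?S < r"
    proof (intro exI allI impI)
      fix n assume n: "n \<ge> nat (int m - d)"
      have "dist (sum F {..<n}) ?S \<le> inverse (2 ^ m)"
        by (rule dist_fls_small) (subst nth[of _ n], use n in \<open>auto simp: fls_nth_sum\<close>)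
      with m show "dist (sum F {..<n}) ?S < r" by simp
    qed
  qed
  then show s: "F sums ?S" by (simp add: sums_def)
  show "fls_nth (suminf F) N = (\<Sum>k<K. fls_nth (F k) N)" if "N < d + int K"
    using nth[OF that] sums_unique[OF s] by simp
qed

lemma hs_suminf_add:
  fixes F G :: "nat \<Rightarrow> 'a::ab_group_add fls"
  assumes "hs d F" "hs d G"
  shows "suminf (\<lambda>k. F k + G k) = suminf F + suminf G"
proof (rule fls_eqI)
  fix N
  define K where "K = nat (N - d + 1)"
  have K: "N < d + int K" by (simp add: K_def)
  have "hs d (\<lambda>k. F k + G k)" using assms by (auto simp: hs_def vb_def)
  then show "fls_nth (suminf (\<lambda>k. F k + G k)) N = fls_nth (suminf F + suminf G) N"
    using assms by (simp add: hs_sums(2)[OF _ K] sum.distrib)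
qed

lemma hs_suminf_mult:
  fixes F :: "nat \<Rightarrow> 'a::comm_ring_1 fls"
  assumes "hs d F"
  shows "suminf (\<lambda>k. a * F k) = a * suminf F"
proof (rule fls_eqI)
  fix N
  obtain e where e: "vb e a" using vb_ex by blast
  define K where "K = nat (N + 1 + \<bar>d\<bar> + \<bar>e\<bar>)"
  have "hs (e + d) (\<lambda>k. a * F k)"
    using vb_mult[OF e] assms by (auto simp: hs_def add.assoc)
  then have "fls_nth (suminf (\<lambda>k. a * F k)) N = (\<Sum>k<K. fls_nth (a * F k) N)"
    by (rule hs_sums(2)) (auto simp: K_def)
  also have "\<dots> = fls_nth (a * (\<Sum>k<K. F k)) N"
    by (simp add: fls_nth_sum sum_distrib_left)
  also have "\<dots> = fls_nth (a * suminf F) N"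
  proof -
    have vF: "vb d (\<Sum>k<K. F k)"
      using assms by (intro vb_sum) (auto simp: hs_def intro: vb_mono)
    have vS: "vb d (suminf F)"
      using hs_sums(2)[OF assms, of _ 0] by (auto simp: vb_def)
    show ?thesis
      unfolding fls_times_nth_vb[OF e vF] fls_times_nth_vb[OF e vS]
      by (intro sum.cong refl arg_cong2[where f = "(*)"])
         (subst hs_sums(2)[OF assms, of _ K], auto simp: K_def fls_nth_sum)
  qed
  finally show "fls_nth (suminf (\<lambda>k. a * F k)) N = fls_nth (a * suminf F) N" .
qed

lemma mconst_0 [simp]: "mconst 0 = 0" by (rule mps_eqI) (simp add: mconst.rep_eq zero_mps.rep_eq)
lemma mconst_1 [simp]: "mconst 1 = 1" by (rule mps_eqI) (simp add: mconst.rep_eq one_mps.rep_eq)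
lemma mconst_add: "mconst (a + b) = mconst a + mconst b"
  by (rule mps_eqI) (simp add: mconst.rep_eq plus_mps.rep_eq)
lemma mcoeff_mconst_mult: "mcoeff (mconst c * f) a = c * mcoeff (f :: 'a::finite mps) a"
proof -
  have "mcoeff (mconst c * f) a = (\<Sum>(b, e)\<in>{(\<lambda>_. 0, a)}. mcoeff (mconst c :: 'a mps) b * mcoeff f e)"
    unfolding times_mps.rep_eq
    by (rule sum.mono_neutral_right) (auto simp: msplit_zero mconst.rep_eq split: if_splits)
  then show ?thesis by (simp add: mconst.rep_eq)
qed
lemma mconst_mult: "mconst (a * b) = mconst a * mconst b"
  by (rule mps_eqI, simp add: mcoeff_mconst_mult, simp add: mconst.rep_eq)
lemma mconst_sum: "mconst (sum f S) = (\<Sum>x\<in>S. mconst (f x))"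
  by (induction S rule: infinite_finite_induct) (auto simp: mconst_add)

lemma emb_nth [simp]: "fls_nth (emb c) N = mconst (fls_nth c N)" by (simp add: emb_def)
lemma vb_emb: "vb d c \<Longrightarrow> vb d (emb c)" by (simp add: vb_def)
lemma emb_0 [simp]: "emb 0 = 0" by (rule fls_eqI) simp
lemma emb_1 [simp]: "emb 1 = 1" by (rule fls_eqI) simp
lemma emb_add: "emb (a + b) = emb a + emb b" by (rule fls_eqI) (simp add: mconst_add)
lemma emb_mult: "emb (a * b) = emb a * emb b"
proof (rule fls_eqI)
  fix N
  obtain d where "vb d a" using vb_ex by blast
  moreover obtain e where "vb e b" using vb_ex by blast
  ultimately show "fls_nth (emb (a * b)) N = fls_nth (emb a * emb b) N"
    by (simp add: fls_times_nth_vb[of d _ e] vb_emb mconst_sum mconst_mult)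
qed

lemma mderiv_0 [simp]: "mderiv i 0 = 0" by (rule mps_eqI) (simp add: mderiv.rep_eq zero_mps.rep_eq)
lemma mderiv_add: "mderiv i (f + g) = mderiv i f + mderiv i g"
  by (rule mps_eqI) (simp add: mderiv.rep_eq plus_mps.rep_eq algebra_simps)
lemma mderiv_sum: "mderiv i (sum f S) = (\<Sum>x\<in>S. mderiv i (f x))"
  by (induction S rule: infinite_finite_induct) (auto simp: mderiv_add)
lemma mderiv_mconst [simp]: "mderiv i (mconst c) = 0"
  by (rule mps_eqI) (auto simp: mderiv.rep_eq zero_mps.rep_eq mconst.rep_eq fun_eq_iff)
lemma mderiv_mconst_mult: "mderiv i (mconst c * f) = mconst c * mderiv i f"
  by (rule mps_eqI) (simp add: mderiv.rep_eq mcoeff_mconst_mult mult.left_commute)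

lemma wderiv_nth [simp]: "fls_nth (wderiv i f) N = mderiv i (fls_nth f N)" by (simp add: wderiv_def)
lemma vb_wderiv: "vb d c \<Longrightarrow> vb d (wderiv i c)" by (simp add: vb_def)
lemma wderiv_0 [simp]: "wderiv i 0 = 0" by (rule fls_eqI) simp
lemma wderiv_add: "wderiv i (f + g) = wderiv i f + wderiv i g" by (rule fls_eqI) (simp add: mderiv_add)
lemma wderiv_emb [simp]: "wderiv i (emb c) = 0" by (rule fls_eqI) simp
lemma wderiv_emb_mult: "wderiv i (emb c * f) = emb c * wderiv i f"
proof (rule fls_eqI)
  fix N
  obtain d where v1: "vb d c" using vb_ex by blast
  obtain e where v2: "vb e f" using vb_ex by blast
  note v = v1 v2
  show "fls_nth (wderiv i (emb c * f)) N = fls_nth (emb c * wderiv i f) N"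
    using v by (simp add: fls_times_nth_vb[of d _ e] vb_emb vb_wderiv mderiv_sum mderiv_mconst_mult)
qed

lemma foldr_wderiv_0 [simp]: "foldr wderiv is 0 = 0" by (induction "is") auto
lemma foldr_wderiv_add: "foldr wderiv is (f + g) = foldr wderiv is f + foldr wderiv is g"
  by (induction "is") (auto simp: wderiv_add)
lemma foldr_wderiv_emb_mult: "foldr wderiv is (emb c * f) = emb c * foldr wderiv is f"
  by (induction "is") (auto simp: wderiv_emb_mult)
lemma foldr_wderiv_emb: "foldr wderiv is (emb c) = (if is = [] then emb c else 0)"
  by (induction "is") auto
lemma vb_foldr: "vb d f \<Longrightarrow> vb d (foldr wderiv is f)"
  by (induction "is") (auto simp: vb_wderiv)

definition mt :: "nat \<Rightarrow> 'n::finite weyl \<Rightarrow> 'n weyl \<Rightarrow> 'n weyl" where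
  "mt k f g = emb (1 / fact k * (hbar / 2) ^ k) *
     (\<Sum>is | length is = k. \<Sum>js | length js = k.
        emb (fls_const (\<Prod>l<k. omega (is ! l) (js ! l))) * foldr wderiv is f * foldr wderiv js g)"

lemma moyal_mt: "f \<star>\<^sub>M g = suminf (\<lambda>k. mt k f g)"
  by (simp add: moyal_def mt_def)

lemma vb_const: "vb 0 (fls_const c)" by (simp add: vb_def)

lemma two_fls: "(2 :: complex fls) = fls_const 2"
  by (rule fls_const_numeral[symmetric])
lemma fact_fls: "(fact k :: complex fls) = fls_const (fact k)"
proof -
  have "(fact k :: complex fls) = of_nat (fact k)" by simp
  also have "\<dots> = fls_const (of_nat (fact k))" by (rule fls_of_nat)
  finally show ?thesis by simp
qed

lemma fls_const_divide: "c \<noteq> 0 \<Longrightarrow> x / fls_const c = fls_const (1 / c) * (x :: complex fls)"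
  by (subst divide_eq_eq) (simp add: mult.commute mult.left_commute)

lemma hk: "hbar ^ k / fact k = fls_const (1 / fact k) * hbar ^ k"
  unfolding fact_fls by (rule fls_const_divide) simp

lemma vb_X: "vb (int k) (hbar ^ k)" by (simp add: vb_def)

lemma vb_hk: "vb (int k) (hbar ^ k / fact k)"
  unfolding hk using vb_mult[OF vb_const vb_X[of k]] by simp

lemma vb_mk: "vb (int k) (1 / fact k * (hbar / 2) ^ k)"
proof -
  have "1 / fact k * (hbar / 2) ^ k = fls_const (1 / 2 ^ k) * (hbar ^ k / fact k)"
    unfolding two_fls power_divide fls_const_power[symmetric]
    by (subst fls_const_divide) simp_all
  then show ?thesis using vb_mult[OF vb_const vb_hk[of k], of "1 / 2 ^ k"] by simp
qed

lemma hs_mt: "vb d f \<Longrightarrow> vb e g \<Longrightarrow> hs (d + e) (\<lambda>k. mt k f g)"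
  unfolding hs_def mt_def
proof
  fix k assume "vb d f" "vb e g"
  then have "vb (0 + d + e) (emb (fls_const (\<Prod>l<k. omega (is ! l) (js ! l))) * foldr wderiv is f * foldr wderiv js g)"
    for "is" js by (intro vb_mult vb_emb vb_const vb_foldr)
  then have "vb (d + e) (\<Sum>is | length is = k. \<Sum>js | length js = k.
        emb (fls_const (\<Prod>l<k. omega (is ! l) (js ! l))) * foldr wderiv is f * foldr wderiv js g)"
    by (intro vb_sum) auto
  from vb_mult[OF vb_emb[OF vb_mk] this]
  show "vb (d + e + int k) (emb (1 / fact k * (hbar / 2) ^ k) *
     (\<Sum>is | length is = k. \<Sum>js | length js = k.
        emb (fls_const (\<Prod>l<k. omega (is ! l) (js ! l))) * foldr wderiv is f * foldr wderiv js g))"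
    by (simp add: add.commute)
qed

lemma hs_mono: "hs d F \<Longrightarrow> e \<le> d \<Longrightarrow> hs e F" by (auto simp: hs_def intro: vb_mono)

lemma moyal_add_left: "(f + f') \<star>\<^sub>M g = f \<star>\<^sub>M g + f' \<star>\<^sub>M g"
proof -
  obtain d d' e where v: "vb d f" "vb d' f'" "vb e g" using vb_ex by blast
  have 1: "hs (min d d' + e) (\<lambda>k. mt k f g)" "hs (min d d' + e) (\<lambda>k. mt k f' g)"
    using v by (auto intro!: hs_mt intro: vb_mono)
  have "mt k (f + f') g = mt k f g + mt k f' g" for k
    by (simp add: mt_def foldr_wderiv_add algebra_simps sum.distrib)
  then show ?thesis unfolding moyal_mt using hs_suminf_add[OF 1] by simp
qed

lemma moyal_add_right: "g \<star>\<^sub>M (f + f') = g \<star>\<^sub>M f + g \<star>\<^sub>M f'"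
proof -
  obtain d d' e where v: "vb d f" "vb d' f'" "vb e g" using vb_ex by blast
  have 1: "hs (e + min d d') (\<lambda>k. mt k g f)" "hs (e + min d d') (\<lambda>k. mt k g f')"
    using v by (auto intro!: hs_mt intro: vb_mono)
  have "mt k g (f + f') = mt k g f + mt k g f'" for k
    by (simp add: mt_def foldr_wderiv_add algebra_simps sum.distrib)
  then show ?thesis unfolding moyal_mt using hs_suminf_add[OF 1] by simp
qed

lemma moyal_scale_left: "(emb c * f) \<star>\<^sub>M g = emb c * (f \<star>\<^sub>M g)"
proof -
  obtain d where v1: "vb d f" using vb_ex by blast
  obtain e where v2: "vb e g" using vb_ex by blast
  note v = v1 v2
  have "mt k (emb c * f) g = emb c * mt k f g" for k
    unfolding mt_def foldr_wderiv_emb_mult by (simp add: sum_distrib_left mult_ac)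
  then show ?thesis unfolding moyal_mt using hs_suminf_mult[OF hs_mt[OF v]] by simp
qed

lemma moyal_scale_right: "f \<star>\<^sub>M (emb c * g) = emb c * (f \<star>\<^sub>M g)"
proof -
  obtain d where v1: "vb d f" using vb_ex by blast
  obtain e where v2: "vb e g" using vb_ex by blast
  note v = v1 v2
  have "mt k f (emb c * g) = emb c * mt k f g" for k
    unfolding mt_def foldr_wderiv_emb_mult by (simp add: sum_distrib_left mult_ac)
  then show ?thesis unfolding moyal_mt using hs_suminf_mult[OF hs_mt[OF v]] by simp
qed

lemma moyal_emb_left: "emb c \<star>\<^sub>M g = emb c * g"
proof -
  have "mt k (emb c) g = (if k = 0 then emb c * g else 0)" for k
  proof (cases "k = 0")
    case False
    then have "(\<Sum>is | length is = k. \<Sum>js | length js = k.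
        emb (fls_const (\<Prod>l<k. omega (is ! l) (js ! l))) * foldr wderiv is (emb c) * foldr wderiv js g) = 0"
      by (intro sum.neutral ballI) (auto simp: foldr_wderiv_emb)
    with False show ?thesis by (simp add: mt_def)
  qed (simp add: mt_def mult.commute)
  then have "(\<lambda>k. mt k (emb c) g) sums (emb c * g)"
    using sums_If_finite_set[of "{0}" "\<lambda>_. emb c * g"] by simp
  then show ?thesis unfolding moyal_mt by (simp add: sums_iff)
qed

lemma moyal_emb_right: "g \<star>\<^sub>M emb c = emb c * g"
proof -
  have "mt k g (emb c) = (if k = 0 then emb c * g else 0)" for k
  proof (cases "k = 0")
    case False
    then have "(\<Sum>is | length is = k. \<Sum>js | length js = k.
        emb (fls_const (\<Prod>l<k. omega (is ! l) (js ! l))) * foldr wderiv is g * foldr wderiv js (emb c)) = 0"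
      by (intro sum.neutral ballI) (auto simp: foldr_wderiv_emb)
    with False show ?thesis by (simp add: mt_def)
  qed (simp add: mt_def mult.commute)
  then have "(\<lambda>k. mt k g (emb c)) sums (emb c * g)"
    using sums_If_finite_set[of "{0}" "\<lambda>_. emb c * g"] by simp
  then show ?thesis unfolding moyal_mt by (simp add: sums_iff)
qed

lemma moyal_0 [simp]: "0 \<star>\<^sub>M g = 0" "g \<star>\<^sub>M 0 = 0"
  using moyal_emb_left[of 0 g] moyal_emb_right[of g 0] by simp_all

lemma gmult_add_left: "(x + x') \<star>\<^sub>G y = x \<star>\<^sub>G y + x' \<star>\<^sub>G y"
  by (simp add: gmult_def vec_eq_iff moyal_add_left sum.distrib)
lemma gmult_add_right: "y \<star>\<^sub>G (x + x') = y \<star>\<^sub>G x + y \<star>\<^sub>G x'"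
  by (simp add: gmult_def vec_eq_iff moyal_add_right sum.distrib)
lemma gmult_scale_left: "gscale c x \<star>\<^sub>G y = gscale c (x \<star>\<^sub>G y)"
  by (simp add: gmult_def gscale_def vec_eq_iff moyal_scale_left sum_distrib_left)
lemma gmult_scale_right: "y \<star>\<^sub>G gscale c x = gscale c (y \<star>\<^sub>G x)"
  by (simp add: gmult_def gscale_def vec_eq_iff moyal_scale_right sum_distrib_left)
lemma gmult_scalar_left: "mat (emb c) \<star>\<^sub>G y = gscale c y"
proof -
  have "(if i = k then emb c else 0) \<star>\<^sub>M f = (if i = k then emb c * f else 0)" for i k :: 'b and f :: "'a weyl"
    by (simp add: moyal_emb_left)
  then show ?thesis
    by (simp add: gmult_def gscale_def mat_def vec_eq_iff)
qed
lemma gmult_scalar_right: "y \<star>\<^sub>G mat (emb c) = gscale c y"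
proof -
  have "f \<star>\<^sub>M (if k = i then emb c else 0) = (if k = i then emb c * f else 0)" for i k :: 'b and f :: "'a weyl"
    by (simp add: moyal_emb_right)
  then show ?thesis
    by (simp add: gmult_def gscale_def mat_def vec_eq_iff)
qed


lemma mat_1_emb: "(mat 1 :: ('n::finite, 'r::finite) gl) = mat (emb 1)" by simp

definition wlin where
  "wlin sc f x = (\<Sum>w\<in>Poly_Mapping.keys x. sc (Poly_Mapping.lookup x w) (f (fst w # snd w)))"

context
  fixes sc :: "complex fls \<Rightarrow> 'v \<Rightarrow> 'v::ab_group_add"
  assumes m: "module sc"
begin

lemma wlin_superset:
  assumes "finite S" "Poly_Mapping.keys x \<subseteq> S"
  shows "wlin sc f x = (\<Sum>w\<in>S. sc (Poly_Mapping.lookup x w) (f (fst w # snd w)))"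
  unfolding wlin_def
  by (rule sum.mono_neutral_left) (use assms module.scale_zero_left[OF m] in \<open>auto simp: in_keys_iff\<close>)

lemma wlin_add: "wlin sc f (x + y) = wlin sc f x + wlin sc f y"
proof -
  let ?S = "Poly_Mapping.keys x \<union> Poly_Mapping.keys y"
  show ?thesis
    by (simp add: wlin_superset[of ?S] keys_add lookup_add module.scale_left_distrib[OF m] sum.distrib)
qed

lemma wlin_scale: "wlin sc f (wscale c x) = sc c (wlin sc f x)"
proof -
  have "Poly_Mapping.keys (wscale c x) \<subseteq> Poly_Mapping.keys x" by (auto simp: in_keys_iff)
  then show ?thesis
    by (simp add: wlin_superset[of "Poly_Mapping.keys x"] module.scale_sum_right[OF m]
      module.scale_scale[OF m, symmetric] del: module.scale_scale[OF m])
qed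

lemma wlin_minus: "wlin sc f (x - y) = wlin sc f x - wlin sc f y"
  using wlin_add[of f "x - y" y] by simp

lemma wlin_0 [simp]: "wlin sc f 0 = 0" by (simp add: wlin_def)

lemma wlin_word: "l \<noteq> [] \<Longrightarrow> wlin sc f (word l) = f l"
  by (simp add: wlin_def word_def module.scale_one[OF m])

lemma wlin_null: "x \<in> null_words \<Longrightarrow> normalized_multilinear sc f \<Longrightarrow> wlin sc f x = 0"
proof (induction x rule: null_words.induct)
  case (scale x c) then show ?case by (simp add: wlin_scale module.scale_zero_right[OF m])
qed (auto simp: wlin_add wlin_minus wlin_scale wlin_word normalized_multilinear_def)

lemma chain_lin_abs: "normalized_multilinear sc f \<Longrightarrow> chain_lin sc f (abs_chain x) = wlin sc f x"
proof -
  assume n: "normalized_multilinear sc f"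
  have "rep_chain (abs_chain x) - x \<in> null_words"
    using Quotient3_rep_abs[OF Quotient3_chain, of x] by (simp add: null_words.zero)
  from wlin_null[OF this n] show ?thesis
    by (simp add: chain_lin_def wlin_minus flip: wlin_def)
qed

lemma chain_lin:
  assumes "normalized_multilinear sc f"
  shows "chain_lin sc f (x + y) = chain_lin sc f x + chain_lin sc f y"
    and "chain_lin sc f (cscale c x) = sc c (chain_lin sc f x)"
    and "l \<noteq> [] \<Longrightarrow> chain_lin sc f (tens l) = f l"
proof -
  have *: "\<exists>x'. x = abs_chain x'" for x
    by (rule exI[of _ "rep_chain x"]) (simp add: Quotient3_abs_rep[OF Quotient3_chain])
  obtain x' y' where x: "x = abs_chain x'" "y = abs_chain y'"
    using *[of x] *[of y] by blast
  show "chain_lin sc f (x + y) = chain_lin sc f x + chain_lin sc f y"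
    unfolding x plus_chain.abs_eq by (simp add: chain_lin_abs assms wlin_add)
  show "chain_lin sc f (cscale c x) = sc c (chain_lin sc f x)"
    unfolding x cscale.abs_eq by (simp add: chain_lin_abs assms wlin_scale)
  show "l \<noteq> [] \<Longrightarrow> chain_lin sc f (tens l) = f l"
    unfolding tens.abs_eq by (simp add: chain_lin_abs assms wlin_word)
qed

end

lemma module_cscale: "module (cscale :: _ \<Rightarrow> ('n::finite, 'r::finite) chain \<Rightarrow> _)"
proof
  fix a b :: "complex fls" and x y :: "('n, 'r) chain"
  have *: "u = v \<Longrightarrow> u - v \<in> null_words" for u v :: "('n, 'r) words" by (simp add: null_words.zero)
  show "cscale a (x + y) = cscale a x + cscale a y" by transfer (rule *, rule wscale_plus)
  show "cscale (a + b) x = cscale a x + cscale b x"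
    by transfer (rule *, rule poly_mapping_eqI, simp add: lookup_add algebra_simps)
  show "cscale a (cscale b x) = cscale (a * b) x"
    by transfer (rule *, rule poly_mapping_eqI, simp add: algebra_simps)
  show "cscale 1 x = x"
    by transfer (rule *, rule poly_mapping_eqI, simp)
qed

interpretation cs: module cscale by (rule module_cscale)

lemma tens_add: "tens (l @ (a + a') # l') = tens (l @ a # l') + tens (l @ a' # l')"
proof -
  have "tens (l @ (a + a') # l') - (tens (l @ a # l') + tens (l @ a' # l')) = 0"
    by transfer (use null_words.slot_plus in \<open>simp add: algebra_simps\<close>)
  then show ?thesis by simp
qed
lemma tens_scale: "tens (l @ gscale c a # l') = cscale c (tens (l @ a # l'))"
  by transfer (rule null_words.slot_scale)
lemma tens_scalar: "l \<noteq> [] \<Longrightarrow> tens (l @ mat (emb c) # l') = 0"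
  by transfer (use null_words.slot_scalar in simp)

definition glin :: "(('n::finite, 'r::finite) gl \<Rightarrow> ('n, 'r) gl) \<Rightarrow> bool" where
  "glin h \<longleftrightarrow> (\<forall>x y. h (x + y) = h x + h y) \<and> (\<forall>c x. h (gscale c x) = gscale c (h x))"

definition slot :: "(('n::finite, 'r::finite) gl \<Rightarrow> ('n, 'r) gl list) \<Rightarrow> bool" where
  "slot g \<longleftrightarrow> (\<exists>L L' h. glin h \<and> (\<forall>a. g a = L @ h a # L'))"

lemma slotI: "glin h \<Longrightarrow> (\<And>a. g a = L @ h a # L') \<Longrightarrow> slot g"
  unfolding slot_def by blast

lemma slot_tens:
  assumes "slot g"
  shows "tens (g (a + a')) = tens (g a) + tens (g a')" "tens (g (gscale c a)) = cscale c (tens (g a))"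
  using assms by (auto simp: slot_def glin_def tens_add tens_scale)

lemma glin_id [simp]: "glin (\<lambda>a. a)" by (simp add: glin_def)
lemma glin_mult [simp]: "glin (\<lambda>a. a \<star>\<^sub>G b)" "glin (\<lambda>a. b \<star>\<^sub>G a)"
  by (simp_all add: glin_def gmult_add_left gmult_add_right gmult_scale_left gmult_scale_right)

lemma gscale_add: "gscale c (x + y) = gscale c x + gscale c y"
  by (simp add: gscale_def vec_eq_iff algebra_simps)
lemma gscale_minus: "gscale c (x - y) = gscale c x - gscale c y"
  by (simp add: gscale_def vec_eq_iff algebra_simps)
lemma gscale_comm: "gscale c (gscale d x) = gscale d (gscale c x)"
  by (simp add: gscale_def vec_eq_iff algebra_simps)

lemma glin_bracket [simp]: "glin (bracket \<xi>)"
proof -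
  have "bracket \<xi> (gscale c x) = gscale c (bracket \<xi> x)" for c x
    unfolding bracket_def gmult_scale_left gmult_scale_right gscale_minus
    by (simp only: gscale_comm[of c])
  then show ?thesis
    by (simp add: glin_def bracket_def gmult_add_left gmult_add_right gscale_add gscale_minus)
qed

lemma bracket_scalar [simp]: "bracket \<xi> (mat (emb c)) = 0"
  by (simp add: bracket_def gmult_scalar_left gmult_scalar_right) (simp add: gscale_def vec_eq_iff)

lemma tens_0: "tens (l @ 0 # l') = (0 :: ('n::finite, 'r::finite) chain)"
proof -
  have "gscale 0 0 = (0 :: ('n, 'r) gl)" by (simp add: gscale_def vec_eq_iff)
  then show ?thesis using tens_scale[of l 0 0 l'] by simp
qed

lemma normalized_multilinear_act: "normalized_multilinear cscale (\<lambda>a. \<Sum>i<length a. tens (a[i := bracket \<xi> (a ! i)]))"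
proof -
  have sl: "slot (\<lambda>a. (l @ a # l')[i := bracket \<xi> ((l @ a # l') ! i)])" for l l' :: "('a, 'b) gl list" and i
  proof -
    consider "i < length l" | "i = length l" | k where "i = Suc (length l + k)"
      by (metis less_imp_Suc_add linorder_neqE_nat)
    then show ?thesis
    proof cases
      case 1 then show ?thesis
        by (intro slotI[of "\<lambda>a. a" _ "l[i := bracket \<xi> (l ! i)]" l']) (auto simp: list_update_append nth_append)
    next
      case 2 then show ?thesis
        by (intro slotI[of "bracket \<xi>" _ l l']) auto
    next
      case 3 then show ?thesis
        by (intro slotI[of "\<lambda>a. a" _ l "l'[k := bracket \<xi> (l' ! k)]"]) (auto simp: list_update_append nth_append)
    qed
  qed
  have z: "tens ((l @ mat (emb c) # l')[i := bracket \<xi> ((l @ mat (emb c) # l') ! i)]) = 0"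
    if "l \<noteq> []" for l l' :: "('a, 'b) gl list" and i c
  proof -
    consider "i < length l" | "i = length l" | k where "i = Suc (length l + k)"
      by (metis less_imp_Suc_add linorder_neqE_nat)
    then show ?thesis
    proof cases
      case 1 with that show ?thesis
        by (simp add: list_update_append nth_append tens_scalar)
    next
      case 2 then show ?thesis by (simp add: tens_0)
    next
      case 3 with that show ?thesis by (simp add: list_update_append nth_append tens_scalar)
    qed
  qed
  show ?thesis
    unfolding normalized_multilinear_def length_append list.size
    by (intro conjI allI impI)
       (simp_all only: slot_tens[OF sl] z sum.distrib cs.scale_sum_right sum.neutral_const not_False_eq_True)
qed

lemma rot_split:
  fixes l l' :: "'a list"
  shows "\<exists>L L'. \<forall>a. drop i (l @ a # l') @ take i (l @ a # l') = L @ a # L'"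
proof (cases "i \<le> length l")
  case True
  then show ?thesis
    by (intro exI[of _ "drop i l"] exI[of _ "l' @ take i l"]) auto
next
  case False
  then obtain k where k: "i = Suc (length l + k)"
    by (metis less_imp_Suc_add not_le)
  show ?thesis unfolding k
    by (intro exI[of _ "drop k l' @ l"] exI[of _ "take k l'"]) auto
qed

lemma normalized_multilinear_B: "normalized_multilinear cscale (\<lambda>a. let p = length a - 1 in
     \<Sum>i\<le>p. cscale ((-1) ^ (p * i)) (tens (mat 1 # drop i a @ take i a)))"
proof -
  have sl: "slot (\<lambda>a. mat 1 # drop i (l @ a # l') @ take i (l @ a # l'))" for i and l l' :: "('a, 'b) gl list"
  proof -
    obtain L L' where "\<And>a. drop i (l @ a # l') @ take i (l @ a # l') = L @ a # L'"
      using rot_split by blast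
    then show ?thesis by (intro slotI[of "\<lambda>a. a" _ "mat 1 # L" L']) auto
  qed
  have z: "tens (mat 1 # drop i (l @ mat (emb c) # l') @ take i (l @ mat (emb c) # l')) = 0" for i c and l l' :: "('a, 'b) gl list"
  proof -
    obtain L L' where *: "\<And>a. drop i (l @ a # l') @ take i (l @ a # l') = L @ a # L'"
      using rot_split by blast
    show ?thesis unfolding * using tens_scalar[of "mat 1 # L" c L'] by simp
  qed
  show ?thesis
    unfolding normalized_multilinear_def Let_def length_append list.size
    by (intro conjI allI impI)
       (simp_all only: slot_tens[OF sl] z cs.scale_zero_right cs.scale_right_distrib sum.distrib
         cs.scale_sum_right cs.scale_left_commute sum.neutral_const)
qed

definition mrg :: "nat \<Rightarrow> ('n::finite, 'r::finite) gl list \<Rightarrow> ('n, 'r) gl list" where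
  "mrg i a = take i a @ (a ! i \<star>\<^sub>G a ! (i + 1)) # drop (i + 2) a"
definition cyc :: "('n::finite, 'r::finite) gl list \<Rightarrow> ('n, 'r) gl list" where
  "cyc a = (a ! (length a - 1) \<star>\<^sub>G a ! 0) # take (length a - 2) (drop 1 a)"

lemma mrg_lt: "Suc i < length l \<Longrightarrow> mrg i (l @ a # l') = mrg i l @ a # l'"
  by (simp add: mrg_def nth_append)
lemma mrg_eq1: "mrg (length l) (l @ b # a # l') = l @ (b \<star>\<^sub>G a) # l'"
  by (simp add: mrg_def nth_append)
lemma mrg_gt: "mrg (Suc (length l + k)) (l @ a # l') = l @ a # mrg k l'"
  by (simp add: mrg_def nth_append eval_nat_numeral)

lemma cyc_1: "cyc (b # l @ [a]) = (a \<star>\<^sub>G b) # l"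
  by (simp add: cyc_def nth_append)

lemma normalized_multilinear_b: "normalized_multilinear cscale (\<lambda>a. let p = length a - 1 in
     if p = 0 then 0
     else cscale ((-1) ^ p) (tens ((a ! p \<star>\<^sub>G a ! 0) # take (p - 1) (drop 1 a)))
        + (\<Sum>i<p. cscale ((-1) ^ i) (tens (take i a @ (a ! i \<star>\<^sub>G a ! (i + 1)) # drop (i + 2) a))))"
    (is "normalized_multilinear cscale ?f")
proof -
  have f: "?f a = (if length a - 1 = 0 then 0 else cscale ((-1) ^ (length a - 1)) (tens (cyc a))
      + (\<Sum>i<length a - 1. cscale ((-1) ^ i) (tens (mrg i a))))" for a :: "('a, 'b) gl list"
    by (simp add: Let_def mrg_def cyc_def numeral_2_eq_2)
  have cases: "(i + 1 < length l) \<or> (\<exists>k b. l = k @ [b] \<and> i = length k) \<or>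
       (\<exists>b k. l' = b # k \<and> i = length l) \<or> (\<exists>k. i = Suc (length l + k) \<and> k + 1 < length l')"
    if "i < length l + length l'" for i and l l' :: "('a, 'b) gl list"
  proof -
    consider "i + 1 < length l" | "i + 1 = length l" | "i = length l" | k where "i = Suc (length l + k)"
      by (metis Suc_eq_plus1 less_imp_Suc_add linorder_neqE_nat not_less_eq)
    then show ?thesis
    proof cases
      case 2
      then have "l \<noteq> []" "i = length (butlast l)" by auto
      then have "l = butlast l @ [last l]" "i = length (butlast l)" by simp_all
      then show ?thesis by blast
    next
      case 3 with that show ?thesis by (cases l') auto
    qed (use that in auto)
  qed
  have sl: "slot (\<lambda>a. mrg i (l @ a # l'))" if "i < length l + length l'" for i and l l' :: "('a, 'b) gl list"
    using cases[OF that]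
  proof (elim disjE exE conjE)
    assume "i + 1 < length l" then show ?thesis
      by (intro slotI[of "\<lambda>a. a" _ "mrg i l" l']) (auto simp: mrg_lt)
  next
    fix k b assume "l = k @ [b]" "i = length k" then show ?thesis
      by (intro slotI[of "\<lambda>a. b \<star>\<^sub>G a" _ k l']) (auto simp: mrg_eq1)
  next
    fix k b assume "l' = b # k" "i = length l" then show ?thesis
      by (intro slotI[of "\<lambda>a. a \<star>\<^sub>G b" _ l k]) (auto simp: mrg_eq1)
  next
    fix k assume "i = Suc (length l + k)" "k + 1 < length l'" then show ?thesis
      by (intro slotI[of "\<lambda>a. a" _ l "mrg k l'"]) (auto simp: mrg_gt)
  qed
  have slc: "slot (\<lambda>a. cyc (l @ a # l'))" if "length l + length l' \<noteq> 0" for l l' :: "('a, 'b) gl list"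
  proof (cases l)
    case Nil
    with that obtain k b where "l' = k @ [b]" by (cases l' rule: rev_cases) auto
    with Nil show ?thesis
      by (intro slotI[of "\<lambda>a. b \<star>\<^sub>G a" _ "[]" k]) (auto simp: cyc_1)
  next
    case (Cons b k)
    show ?thesis
    proof (cases l' rule: rev_cases)
      case Nil with Cons show ?thesis
        by (intro slotI[of "\<lambda>a. a \<star>\<^sub>G b" _ "[]" k]) (auto simp: cyc_1)
    next
      case (snoc k' b')
      have "cyc (l @ a # l') = (b' \<star>\<^sub>G b) # k @ a # k'" for a
        using cyc_1[of b "k @ a # k'" b'] Cons snoc by simp
      then show ?thesis
        by (intro slotI[of "\<lambda>a. a" _ "(b' \<star>\<^sub>G b) # k" k']) auto
    qed
  qed
  have z: "tens (mrg i (l @ mat (emb c) # l')) =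
      (if i + 1 = length l \<or> i = length l then cscale c (tens (l @ l')) else 0)"
    if "i < length l + length l'" "l \<noteq> []" for i c and l l' :: "('a, 'b) gl list"
    using cases[OF that(1)]
  proof (elim disjE exE conjE)
    assume "i + 1 < length l"
    moreover from this have "mrg i l \<noteq> []" by (simp add: mrg_def)
    ultimately show ?thesis by (simp add: mrg_lt tens_scalar)
  next
    fix k b assume "l = k @ [b]" "i = length k" then show ?thesis
      by (simp add: mrg_eq1 gmult_scalar_right tens_scale)
  next
    fix k b assume "l' = b # k" "i = length l" then show ?thesis
      by (simp add: mrg_eq1 gmult_scalar_left tens_scale)
  next
    fix k assume "i = Suc (length l + k)" "k + 1 < length l'" then show ?thesis
      using that(2) by (simp add: mrg_gt tens_scalar)
  qed
  have zc: "tens (cyc (l @ mat (emb c) # l')) = (if l' = [] then cscale c (tens l) else 0)"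
    if "l \<noteq> []" for c and l l' :: "('a, 'b) gl list"
  proof -
    from that obtain b k where l: "l = b # k" by (cases l) auto
    show ?thesis
    proof (cases l' rule: rev_cases)
      case Nil with l show ?thesis
        using tens_scale[of "[]" c b k] by (simp add: cyc_1 gmult_scalar_left)
    next
      case (snoc k' b')
      have "cyc (l @ mat (emb c) # l') = (b' \<star>\<^sub>G b) # k @ mat (emb c) # k'"
        using cyc_1[of b "k @ mat (emb c) # k'" b'] l snoc by simp
      then show ?thesis using snoc tens_scalar[of "(b' \<star>\<^sub>G b) # k" c k'] by simp
    qed
  qed
  show ?thesis
    unfolding normalized_multilinear_def
  proof (intro conjI allI impI)
    fix l l' :: "('a, 'b) gl list" and a a' c
    show "?f (l @ (a + a') # l') = ?f (l @ a # l') + ?f (l @ a' # l')"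
      unfolding f using slot_tens(1)[OF slc[of l l'], of a a'] slot_tens(1)[OF sl[of _ l l'], of _ a a']
      by (simp add: cs.scale_right_distrib sum.distrib algebra_simps)
    show "?f (l @ gscale c a # l') = cscale c (?f (l @ a # l'))"
      unfolding f using slot_tens(2)[OF slc[of l l'], of c a] slot_tens(2)[OF sl[of _ l l'], of _ c a]
      by (simp add: cs.scale_right_distrib cs.scale_sum_right mult.commute)
    assume l: "l \<noteq> []"
    define j where "j = length l - 1"
    have j: "length l = Suc j" using l by (simp add: j_def)
    have "(\<Sum>i<length l + length l'. cscale ((-1) ^ i) (tens (mrg i (l @ mat (emb c) # l')))) =
      (\<Sum>i<length l + length l'. if i = j \<or> i = Suc j then cscale ((-1) ^ i * c) (tens (l @ l')) else 0)"
      by (intro sum.cong) (auto simp: z l j)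
    also have "\<dots> = (if l' = [] then cscale ((-1) ^ j * c) (tens l) else 0)"
    proof -
      have "{..<length l + length l'} \<inter> {i. i = j \<or> i = Suc j} = (if l' = [] then {j} else {j, Suc j})"
        using j by (cases l') auto
      then show ?thesis
        by (simp add: sum.If_cases flip: cs.scale_left_distrib)
    qed
    finally show "?f (l @ mat (emb c) # l') = 0"
      unfolding f using l by (auto simp: zc j simp flip: cs.scale_left_distrib)
  qed
qed


lemma module_fscale: "module (fscale :: _ \<Rightarrow> 'n::finite form \<Rightarrow> _)"
  by standard (auto simp: fscale_def vec_eq_iff algebra_simps emb_add emb_mult)

interpretation fs: module fscale by (rule module_fscale)

lemma fscale_nth [simp]: "fscale c w $ I = emb c * w $ I" by (simp add: fscale_def)

lemma wedge_add: "wedge (v + v') w = wedge v w + wedge v' w" "wedge v (w + w') = wedge v w + wedge v w'"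
  by (simp_all add: wedge_def vec_eq_iff algebra_simps sum.distrib)
lemma wedge_scale: "wedge (fscale c v) w = fscale c (wedge v w)" "wedge v (fscale c w) = fscale c (wedge v w)"
  by (simp_all add: wedge_def vec_eq_iff sum_distrib_left mult_ac)

definition mscale :: "complex fls \<Rightarrow> ('n::finite, 'r::finite) mform \<Rightarrow> ('n, 'r) mform" where
  "mscale c x = (\<chi> i j. fscale c (x $ i $ j))"

definition mlin :: "(('n::finite, 'r::finite) mform \<Rightarrow> ('n, 'r) mform) \<Rightarrow> bool" where
  "mlin h \<longleftrightarrow> (\<forall>x y. h (x + y) = h x + h y) \<and> (\<forall>c x. h (mscale c x) = mscale c (h x))"

lemma mlin_id [simp]: "mlin (\<lambda>x. x)" by (simp add: mlin_def)
lemma mlin_comp: "mlin g \<Longrightarrow> mlin h \<Longrightarrow> mlin (\<lambda>x. g (h x))" by (simp add: mlin_def)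

lemma mlin_map: "(\<And>x y. h (x + y) = h x + h y) \<Longrightarrow> (\<And>c x. h (fscale c x) = fscale c (h x)) \<Longrightarrow> mlin (mf_map h)"
  by (simp add: mlin_def mf_map_def mscale_def vec_eq_iff)

lemma mlin_lie [simp]: "mlin (mf_map (lie_deriv i))"
  by (rule mlin_map) (simp_all add: lie_deriv_def vec_eq_iff wderiv_add wderiv_emb_mult)

lemma mlin_mult [simp]: "mlin (mf_mult y)" "mlin (\<lambda>x. mf_mult x y)"
  by (simp_all add: mlin_def mf_mult_def mscale_def vec_eq_iff wedge_add wedge_scale sum.distrib
      fs.scale_sum_right sum_distrib_left)

lemma mlin_foldr: "mlin (\<lambda>x. foldr mf_mult l (mf_mult x z))"
  by (induction l) (auto intro: mlin_comp[OF mlin_mult(1)])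

lemma tp_lin:
  "mf_trace_prod (l @ (x + y) # l') = mf_trace_prod (l @ x # l') + mf_trace_prod (l @ y # l')"
  "mf_trace_prod (l @ mscale c x # l') = fscale c (mf_trace_prod (l @ x # l'))"
  using mlin_foldr[of l "foldr mf_mult l' (mat (form0 1))"]
  by (simp_all add: mlin_def mf_trace_prod_def sum.distrib mscale_def fs.scale_sum_right)

definition mslot where
  "mslot g \<longleftrightarrow> (\<exists>L L' h. mlin h \<and> (\<forall>a. g a = L @ h a # L'))"

lemma mslotI: "mlin h \<Longrightarrow> (\<And>a. g a = L @ h a # L') \<Longrightarrow> mslot g"
  unfolding mslot_def by blast

lemma mslot_len: "mslot g \<Longrightarrow> length (g x) = length (g y)"
  by (auto simp: mslot_def)

lemma mslot_upd:
  assumes "mslot g" "mlin h1"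
  shows "mslot (\<lambda>x. (g x)[i := h1 (g x ! i)])"
proof -
  from assms(1) obtain l l' h where h: "mlin h" "\<And>a. g a = l @ h a # l'" by (auto simp: mslot_def)
  consider "i < length l" | "i = length l" | k where "i = Suc (length l + k)"
    by (metis less_imp_Suc_add linorder_neqE_nat)
  then show ?thesis
  proof cases
    case 1 then show ?thesis
      by (intro mslotI[OF h(1), of _ "l[i := h1 (l ! i)]" l']) (auto simp: h list_update_append nth_append)
  next
    case 2 then show ?thesis
      by (intro mslotI[OF mlin_comp[OF assms(2) h(1)], of _ l l']) (auto simp: h)
  next
    case 3 then show ?thesis
      by (intro mslotI[OF h(1), of _ l "l'[k := h1 (l' ! k)]"]) (auto simp: h list_update_append nth_append)
  qed
qed

lemma mslot_upd2:
  assumes "mslot g" "mlin h1" "mlin h2" "a \<noteq> b"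
  shows "mslot (\<lambda>x. (g x)[a := h1 (g x ! a), b := h2 (g x ! b)])"
  using mslot_upd[OF mslot_upd[OF assms(1,2), of a] assms(3), of b] assms(4) by simp

lemma tr_dP_lin:
  "mslot g \<Longrightarrow> tr_dP \<theta> k (g (x + y)) = tr_dP \<theta> k (g x) + tr_dP \<theta> k (g y)
     \<and> tr_dP \<theta> k (g (mscale c x)) = fscale c (tr_dP \<theta> k (g x))"
proof (induction k arbitrary: g)
  case 0
  then show ?case by (auto simp: mslot_def mlin_def tp_lin)
next
  case (Suc k)
  have *: "tr_dP \<theta> k ((g (x + y))[a := mf_map (lie_deriv i) (g (x + y) ! a), b := mf_map (lie_deriv j) (g (x + y) ! b)]) =
     tr_dP \<theta> k ((g x)[a := mf_map (lie_deriv i) (g x ! a), b := mf_map (lie_deriv j) (g x ! b)])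
     + tr_dP \<theta> k ((g y)[a := mf_map (lie_deriv i) (g y ! a), b := mf_map (lie_deriv j) (g y ! b)])"
   "tr_dP \<theta> k ((g (mscale c x))[a := mf_map (lie_deriv i) (g (mscale c x) ! a), b := mf_map (lie_deriv j) (g (mscale c x) ! b)]) =
     fscale c (tr_dP \<theta> k ((g x)[a := mf_map (lie_deriv i) (g x ! a), b := mf_map (lie_deriv j) (g x ! b)]))"
    if "a \<noteq> b" for a b i j
    using Suc.IH[OF mslot_upd2[OF Suc.prems mlin_lie mlin_lie that]] by blast+
  have l: "length (g z) = length (g x)" for z by (rule mslot_len[OF Suc.prems])
  show ?case
  proof
    show "tr_dP \<theta> (Suc k) (g (x + y)) = tr_dP \<theta> (Suc k) (g x) + tr_dP \<theta> (Suc k) (g y)"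
      unfolding tr_dP.simps l[of "x + y"] l[of y] fs.scale_right_distrib[symmetric] sum.distrib[symmetric]
      by (intro arg_cong2[where f = fscale] sum.cong refl)
         (clarsimp simp: * fs.scale_right_distrib sum.distrib)
    show "tr_dP \<theta> (Suc k) (g (mscale c x)) = fscale c (tr_dP \<theta> (Suc k) (g x))"
      unfolding tr_dP.simps l[of "mscale c x"] fs.scale_left_commute[of c] fs.scale_sum_right[of c]
      by (intro arg_cong2[where f = fscale] sum.cong refl)
         (clarsimp simp: * fs.scale_sum_right mult.commute[of c])
  qed
qed

lemma half_fls: "(1 / 2 :: complex fls) = fls_const (1 / 2)"
proof -
  have "1 / fls_const 2 = fls_const (1 / 2) * (1 :: complex fls)"
    by (rule fls_const_divide) simp
  then show ?thesis unfolding fls_const_numeral mult_1_right .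
qed

definition fvb :: "int \<Rightarrow> 'n::finite form \<Rightarrow> bool" where "fvb d w \<longleftrightarrow> (\<forall>I. vb d (w $ I))"
definition mvb :: "int \<Rightarrow> ('n::finite, 'r::finite) mform \<Rightarrow> bool" where
  "mvb d x \<longleftrightarrow> (\<forall>i j. fvb d (x $ i $ j))"

lemma fvb_sum: "(\<And>x. x \<in> S \<Longrightarrow> fvb d (f x)) \<Longrightarrow> fvb d (sum f S)"
  by (auto simp: fvb_def intro!: vb_sum)

lemma fvb_scale: "vb e c \<Longrightarrow> fvb d w \<Longrightarrow> fvb (e + d) (fscale c w)"
  by (auto simp: fvb_def intro!: vb_mult vb_emb)

lemma vb_uminus: "vb d x \<Longrightarrow> vb d (- x :: 'a::ring_1 fls)" by (simp add: vb_def)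
lemma vb_sign: "vb d x \<Longrightarrow> vb d ((-1) ^ k * x :: 'a::ring_1 fls)"
  by (cases "even k") (auto intro: vb_uminus)

lemma fvb_wedge: "fvb d v \<Longrightarrow> fvb e w \<Longrightarrow> fvb (d + e) (wedge v w)"
  by (auto simp: fvb_def wedge_def intro!: vb_sum vb_mult vb_sign)

lemma mvb_mult: "mvb d v \<Longrightarrow> mvb e w \<Longrightarrow> mvb (d + e) (mf_mult v w)"
  by (auto simp: mvb_def mf_mult_def intro!: fvb_sum fvb_wedge)

lemma mvb_one: "mvb 0 (mat (form0 1))"
  by (auto simp: mvb_def fvb_def mat_def form0_def vb_def)

lemma mvb_foldr: "(\<And>x. x \<in> set l \<Longrightarrow> mvb d x) \<Longrightarrow> mvb (int (length l) * d) (foldr mf_mult l (mat (form0 1)))"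
proof (induction l)
  case Nil then show ?case by (simp add: mvb_one)
next
  case (Cons a l)
  then show ?case using mvb_mult[of d a "int (length l) * d"] by (simp add: algebra_simps)
qed

lemma fvb_tr: "(\<And>x. x \<in> set T \<Longrightarrow> mvb d x) \<Longrightarrow> fvb (int (length T) * d) (tr_dP \<theta> k T)"
proof (induction k arbitrary: T)
  case 0
  then show ?case using mvb_foldr[of T d] by (auto simp: mf_trace_prod_def mvb_def intro!: fvb_sum)
next
  case (Suc k)
  have "vb 0 (1 / 2 :: complex fls)"
    unfolding half_fls by (rule vb_const)
  moreover have "fvb (int (length T) * d) (tr_dP \<theta> k (T[a := mf_map (lie_deriv i) (T ! a), b := mf_map (lie_deriv j) (T ! b)]))"
    if "a < length T" "b < length T" for a b i j
  proof -
    have mv: "mvb d x" if "x \<in> set (T[a := mf_map (lie_deriv i) (T ! a), b := mf_map (lie_deriv j) (T ! b)])" for x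
    proof -
      have "x \<in> set T \<or> x = mf_map (lie_deriv i) (T ! a) \<or> x = mf_map (lie_deriv j) (T ! b)"
        using that set_update_subset_insert by (metis insertE subset_iff)
      moreover have "mvb d (mf_map (lie_deriv i) x)" if "mvb d x" for x i
        using that by (auto simp: mvb_def fvb_def mf_map_def lie_deriv_def vb_wderiv)
      ultimately show ?thesis using Suc.prems \<open>a < length T\<close> \<open>b < length T\<close> by auto
    qed
    have "fvb (int (length (T[a := mf_map (lie_deriv i) (T ! a), b := mf_map (lie_deriv j) (T ! b)])) * d)
        (tr_dP \<theta> k (T[a := mf_map (lie_deriv i) (T ! a), b := mf_map (lie_deriv j) (T ! b)]))"
      by (rule Suc.IH) (rule mv)
    then show ?thesis by simp
  qed
  ultimately show ?case
    unfolding tr_dP.simps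
    by (intro fvb_scale[of 0 _ "int (length T) * d", simplified] fvb_sum)
       (auto intro!: fvb_sum fvb_scale[of 0 _ "int (length T) * d", simplified] vb_const)
qed

definition nice :: "nat \<Rightarrow> ((nat \<Rightarrow> real) \<Rightarrow> complex) \<Rightarrow> bool" where
  "nice m \<phi> \<longleftrightarrow> \<phi> \<in> borel_measurable (\<Pi>\<^sub>M a\<in>{..m}. lborel) \<and> (\<exists>B. \<forall>\<theta>. norm (\<phi> \<theta>) \<le> B)"

lemma nice_const [simp]: "nice m (\<lambda>_. c)" by (auto simp: nice_def)
lemma nice_add: "nice m f \<Longrightarrow> nice m g \<Longrightarrow> nice m (\<lambda>x. f x + g x)"
  by (auto simp: nice_def) (meson add_mono norm_triangle_le order_trans norm_triangle_ineq)
lemma nice_mult: "nice m f \<Longrightarrow> nice m g \<Longrightarrow> nice m (\<lambda>x. f x * g x)"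
proof -
  assume "nice m f" "nice m g"
  then obtain B C where "\<And>x. norm (f x) \<le> B" "\<And>x. norm (g x) \<le> C" by (auto simp: nice_def)
  then have "\<forall>x. norm (f x * g x) \<le> B * C"
    unfolding norm_mult by (meson mult_mono norm_ge_zero order_trans)
  with \<open>nice m f\<close> \<open>nice m g\<close> show ?thesis by (auto simp: nice_def)
qed
lemma nice_sum: "(\<And>s. s \<in> S \<Longrightarrow> nice m (f s)) \<Longrightarrow> nice m (\<lambda>x. \<Sum>s\<in>S. f s x)"
  by (induction S rule: infinite_finite_induct) (auto intro: nice_add)

definition cfg :: "nat \<Rightarrow> (nat \<Rightarrow> real) measure" where "cfg m = (\<Pi>\<^sub>M a\<in>{..m}. lborel)"

lemma meas_circ:
  assumes "a \<le> m" "b \<le> m"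
  shows "(\<lambda>\<theta>. circ_dist (\<theta> a) (\<theta> b)) \<in> borel_measurable (cfg m)"
proof -
  have c: "(\<lambda>\<theta>. \<theta> a) \<in> borel_measurable (cfg m)" if "a \<le> m" for a
    using measurable_component_singleton[of a "{..m}" "\<lambda>_. lborel :: real measure"] that
    by (auto simp: cfg_def)
  have "(\<lambda>\<theta>. \<theta> b - \<theta> a) \<in> borel_measurable (cfg m)"
    by (rule borel_measurable_diff[OF c c]) (use assms in auto)
  moreover have "(frac :: real \<Rightarrow> real) \<in> borel_measurable borel"
    unfolding frac_def by measurable
  ultimately show ?thesis
    unfolding circ_dist_def by (rule measurable_compose)
qed

lemma nice_prop: "a \<le> m \<Longrightarrow> b \<le> m \<Longrightarrow> nice m (\<lambda>\<theta>. propagator \<theta> a b)"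
proof -
  assume ab: "a \<le> m" "b \<le> m"
  have "norm (propagator \<theta> a b) \<le> 1" for \<theta>
  proof -
    have "0 \<le> circ_dist (\<theta> a) (\<theta> b)" "circ_dist (\<theta> a) (\<theta> b) < 1"
      by (auto simp: circ_dist_def frac_lt_1)
    then show ?thesis
      unfolding propagator_def norm_of_real by linarith
  qed
  moreover have "(\<lambda>\<theta>. propagator \<theta> a b) \<in> borel_measurable (cfg m)"
    unfolding propagator_def using meas_circ[OF ab] by measurable
  ultimately show ?thesis
    unfolding nice_def cfg_def by blast
qed

lemma emb_const: "emb (fls_const c) = fls_const (mconst c)" by (rule fls_eqI) auto

lemma coeff_fscale_const: "mcoeff (fls_nth (fscale (fls_const c) w $ I) N) y = c * mcoeff (fls_nth (w $ I) N) y"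
  by (simp add: emb_const mcoeff_mconst_mult)

lemma mcoeff_sum: "mcoeff (sum f S) y = (\<Sum>x\<in>S. mcoeff (f x) y)"
  by (induction S rule: infinite_finite_induct) (auto simp: zero_mps.rep_eq plus_mps.rep_eq)

lemma nice_tr: "length T = Suc m \<Longrightarrow> nice m (\<lambda>\<theta>. mcoeff (fls_nth (tr_dP \<theta> k T $ I) N) y)"
proof (induction k arbitrary: T)
  case (Suc k)
  show ?case
    unfolding tr_dP.simps half_fls coeff_fscale_const sum_component fls_nth_sum mcoeff_sum case_prod_unfold
    by (intro nice_mult nice_const nice_sum nice_prop Suc.IH) (use Suc.prems in auto)
qed simp

lemma cyc_config_sets: "cyc_config m \<in> sets (cfg m)"
proof -
  have "cyc_config m = ({..m} \<rightarrow>\<^sub>E {0..<1}) \<inter>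
      {\<theta> \<in> space (cfg m). \<forall>b\<in>{..m}. \<forall>a\<in>{..<b}. circ_dist (\<theta> 0) (\<theta> a) < circ_dist (\<theta> 0) (\<theta> b)}"
    by (auto simp: cyc_config_def cfg_def space_PiM PiE_def)
  moreover have "({..m} \<rightarrow>\<^sub>E {0..<1}) \<in> sets (cfg m)"
    unfolding cfg_def by (rule sets_PiM_I_finite) auto
  moreover have "{\<theta> \<in> space (cfg m). circ_dist (\<theta> 0) (\<theta> a) < circ_dist (\<theta> 0) (\<theta> b)} \<in> sets (cfg m)"
    if "a < b" "b \<le> m" for a b
  proof -
    have [measurable]: "(\<lambda>\<theta>. circ_dist (\<theta> 0) (\<theta> a)) \<in> borel_measurable (cfg m)"
       "(\<lambda>\<theta>. circ_dist (\<theta> 0) (\<theta> b)) \<in> borel_measurable (cfg m)"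
      using that by (auto intro!: meas_circ)
    show ?thesis by measurable
  qed
  then have "{\<theta> \<in> space (cfg m). \<forall>b\<in>{..m}. \<forall>a\<in>{..<b}. circ_dist (\<theta> 0) (\<theta> a) < circ_dist (\<theta> 0) (\<theta> b)}
      \<in> sets (cfg m)"
    by (intro sets.sets_Collect_finite_All) auto
  ultimately show ?thesis by simp
qed

lemma nice_integrable:
  assumes "nice m \<phi>" shows "set_integrable (cfg m) (cyc_config m) \<phi>"
proof -
  interpret product_sigma_finite "\<lambda>_ :: nat. lborel :: real measure"
    by standard
  from assms obtain B where B: "\<And>\<theta>. norm (\<phi> \<theta>) \<le> B" and [measurable]: "\<phi> \<in> borel_measurable (cfg m)"
    by (auto simp: nice_def cfg_def)
  have "emeasure (cfg m) (cyc_config m) \<le> emeasure (cfg m) ({..m} \<rightarrow>\<^sub>E {0..1})"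
  proof (rule emeasure_mono)
    show "{..m} \<rightarrow>\<^sub>E {0..1} \<in> sets (cfg m)"
      unfolding cfg_def by (rule sets_PiM_I_finite) auto
  qed (auto simp: cyc_config_def PiE_def Pi_def less_imp_le)
  also have "\<dots> = (\<Prod>i\<in>{..m}. emeasure lborel {0..1::real})"
    unfolding cfg_def by (rule emeasure_PiM) auto
  also have "\<dots> < \<infinity>" by simp
  finally have "emeasure (cfg m) (cyc_config m) < \<infinity>" .
  then show ?thesis
    unfolding set_integrable_def using cyc_config_sets[of m] B
    by (intro integrableI_bounded_set[where A = "cyc_config m" and B = B])
       (auto simp: indicator_def top.not_eq_extremum intro: order_trans[OF norm_ge_zero])
qed


definition good :: "nat \<Rightarrow> ((nat \<Rightarrow> real) \<Rightarrow> 'n::finite form) \<Rightarrow> bool" where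
  "good m F \<longleftrightarrow> (\<exists>d. \<forall>\<theta>. fvb d (F \<theta>)) \<and>
     (\<forall>I N y. nice m (\<lambda>\<theta>. mcoeff (fls_nth (F \<theta> $ I) N) y))"

lemma form_integral_coeff:
  assumes "good m F"
  shows "mcoeff (fls_nth (form_integral m F $ I) N) y =
     (LINT \<theta>:cyc_config m|cfg m. mcoeff (fls_nth (F \<theta> $ I) N) y)"
proof -
  from assms obtain d where d: "\<And>\<theta>. fvb d (F \<theta>)" by (auto simp: good_def)
  show ?thesis
    unfolding form_integral_def cfg_def vec_lambda_beta
    by (subst Abs_fls_nth[of d])
       (use d in \<open>auto simp: fvb_def vb_def zero_mps.rep_eq Abs_mps_inverse intro!: mps_eqI\<close>)
qed

lemma form_integral_vb: "\<forall>\<theta>. fvb d (F \<theta>) \<Longrightarrow> good m F \<Longrightarrow> fvb d (form_integral m F)"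
  unfolding fvb_def vb_def
  by (auto intro!: mps_eqI simp: form_integral_coeff zero_mps.rep_eq)

lemma form_eqI:
  assumes "\<And>I N y. mcoeff (fls_nth (v $ I) N) y = mcoeff (fls_nth (w $ I) N) y"
  shows "v = (w :: 'n::finite form)"
  unfolding vec_eq_iff by (intro allI fls_eqI mps_eqI assms)

lemma good_add: "good m F \<Longrightarrow> good m G \<Longrightarrow> good m (\<lambda>\<theta>. F \<theta> + G \<theta>)"
proof -
  assume F: "good m F" and G: "good m G"
  from F obtain d where d: "\<And>\<theta>. fvb d (F \<theta>)" by (auto simp: good_def)
  from G obtain e where e: "\<And>\<theta>. fvb e (G \<theta>)" by (auto simp: good_def)
  have "\<forall>\<theta>. fvb (min d e) (F \<theta> + G \<theta>)" using d e by (auto simp: fvb_def vb_def)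
  with F G show ?thesis by (auto simp: good_def plus_mps.rep_eq intro!: nice_add)
qed

lemma form_integral_add:
  assumes "good m F" "good m G"
  shows "form_integral m (\<lambda>\<theta>. F \<theta> + G \<theta>) = form_integral m F + form_integral m G"
proof (rule form_eqI)
  fix I N y
  have n: "set_integrable (cfg m) (cyc_config m) (\<lambda>\<theta>. mcoeff (fls_nth (F \<theta> $ I) N) y)"
    "set_integrable (cfg m) (cyc_config m) (\<lambda>\<theta>. mcoeff (fls_nth (G \<theta> $ I) N) y)"
    using assms by (auto simp: good_def intro!: nice_integrable)
  show "mcoeff (fls_nth (form_integral m (\<lambda>\<theta>. F \<theta> + G \<theta>) $ I) N) y =
      mcoeff (fls_nth ((form_integral m F + form_integral m G) $ I) N) y"
    by (simp add: form_integral_coeff[OF good_add[OF assms]] form_integral_coeff[OF assms(1)]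
        form_integral_coeff[OF assms(2)] plus_mps.rep_eq set_integral_add[OF n])
qed

lemma fscale_coeff:
  assumes "vb e c" "fvb d w"
  shows "mcoeff (fls_nth (fscale c w $ I) N) y =
     (\<Sum>i=e..N - d. fls_nth c i * mcoeff (fls_nth (w $ I) (N - i)) y)"
proof -
  have w: "vb d (w $ I)" using assms(2) by (simp add: fvb_def)
  show ?thesis
    by (simp add: fls_times_nth_vb[OF vb_emb[OF assms(1)] w] mcoeff_sum mcoeff_mconst_mult)
qed

lemma good_scale: "good m F \<Longrightarrow> good m (\<lambda>\<theta>. fscale c (F \<theta>))"
proof -
  assume F: "good m F"
  then obtain d where d: "\<And>\<theta>. fvb d (F \<theta>)" by (auto simp: good_def)
  obtain e where e: "vb e c" using vb_ex by blast
  from F show ?thesis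
    unfolding good_def fscale_coeff[OF e d]
    by (auto intro!: nice_sum nice_mult exI[of _ "e + d"] fvb_scale e d)
qed

lemma form_integral_scale:
  assumes "good m F"
  shows "form_integral m (\<lambda>\<theta>. fscale c (F \<theta>)) = fscale c (form_integral m F)"
proof (rule form_eqI)
  fix I N y
  obtain d where d: "\<And>\<theta>. fvb d (F \<theta>)" using assms by (auto simp: good_def)
  obtain e where e: "vb e c" using vb_ex by blast
  have d': "fvb d (form_integral m F)" using form_integral_vb d assms by blast
  have "(LINT \<theta>:cyc_config m|cfg m. (\<Sum>i=e..N - d. fls_nth c i * mcoeff (fls_nth (F \<theta> $ I) (N - i)) y))
    = (\<Sum>i=e..N - d. fls_nth c i * (LINT \<theta>:cyc_config m|cfg m. mcoeff (fls_nth (F \<theta> $ I) (N - i)) y))"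
  proof -
    have n: "set_integrable (cfg m) (cyc_config m) (\<lambda>\<theta>. fls_nth c i * mcoeff (fls_nth (F \<theta> $ I) (N - i)) y)" for i
      using assms by (auto simp: good_def intro!: nice_integrable nice_mult)
    show ?thesis
      unfolding set_integral_mult_right[symmetric]
      using n unfolding set_integrable_def set_lebesgue_integral_def scaleR_sum_right
      by (intro Bochner_Integration.integral_sum) auto
  qed
  then show "mcoeff (fls_nth (form_integral m (\<lambda>\<theta>. fscale c (F \<theta>)) $ I) N) y =
      mcoeff (fls_nth (fscale c (form_integral m F) $ I) N) y"
    by (simp only: form_integral_coeff[OF good_scale[OF assms]] fscale_coeff[OF e d] fscale_coeff[OF e d']
        form_integral_coeff[OF assms])
qed

lemma suminf_vec:
  fixes F :: "nat \<Rightarrow> 'n::finite form"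
  assumes "\<And>I. hs d (\<lambda>k. F k $ I)"
  shows "suminf F $ I = suminf (\<lambda>k. F k $ I)"
proof -
  have "F sums (\<chi> I. suminf (\<lambda>k. F k $ I))"
    unfolding sums_def
    by (rule vec_tendstoI) (use hs_sums(1)[OF assms] in \<open>simp add: sums_iff flip: sums_def\<close>)
  then show ?thesis by (simp add: sums_iff)
qed

definition fser :: "(nat \<Rightarrow> 'n::finite form) \<Rightarrow> 'n form" where
  "fser w = suminf (\<lambda>k. fscale (hbar ^ k / fact k) (w k))"

lemma hs_ser: "(\<And>k. fvb d (w k)) \<Longrightarrow> hs d (\<lambda>k. fscale (hbar ^ k / fact k) (w k) $ I)"
  unfolding hs_def
proof
  fix k assume "\<And>k. fvb d (w k)"
  then have "fvb (int k + d) (fscale (hbar ^ k / fact k) (w k))" by (intro fvb_scale vb_hk)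
  then show "vb (d + int k) (fscale (hbar ^ k / fact k) (w k) $ I)"
    by (simp only: fvb_def add.commute)
qed

lemma fser_nth: "(\<And>k. fvb d (w k)) \<Longrightarrow> fser w $ I = suminf (\<lambda>k. emb (hbar ^ k / fact k) * w k $ I)"
  unfolding fser_def by (subst suminf_vec[OF hs_ser]) auto

lemma fser_add: "(\<And>k. fvb d (w k)) \<Longrightarrow> (\<And>k. fvb d (v k)) \<Longrightarrow> fser (\<lambda>k. w k + v k) = fser w + fser v"
proof -
  assume w: "\<And>k. fvb d (w k)" and v: "\<And>k. fvb d (v k)"
  then have wv: "fvb d (w k + v k)" for k by (auto simp: fvb_def vb_def)
  show ?thesis
    using hs_suminf_add[OF hs_ser[OF w] hs_ser[OF v]]
    by (simp add: vec_eq_iff fser_nth[OF w] fser_nth[OF v] fser_nth[OF wv] distrib_left)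
qed

lemma fser_scale: "(\<And>k. fvb d (w k)) \<Longrightarrow> fser (\<lambda>k. fscale c (w k)) = fscale c (fser w)"
proof -
  assume w: "\<And>k. fvb d (w k)"
  obtain e where e: "vb e c" using vb_ex by blast
  have cw: "fvb (e + d) (fscale c (w k))" for k by (rule fvb_scale[OF e w])
  show ?thesis
    using hs_suminf_mult[OF hs_ser[OF w], of "emb c"]
    by (simp add: vec_eq_iff fser_nth[OF w] fser_nth[OF cw] mult.left_commute)
qed

lemma good_fser:
  assumes v: "\<And>\<theta> k. fvb d (w \<theta> k)" and n: "\<And>k I N y. nice m (\<lambda>\<theta>. mcoeff (fls_nth (w \<theta> k $ I) N) y)"
  shows "good m (\<lambda>\<theta>. fser (w \<theta>))"
proof -
  have "fls_nth (fser (w \<theta>) $ I) N = (\<Sum>k<K. fls_nth (fscale (hbar ^ k / fact k) (w \<theta> k) $ I) N)"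
    if "N < d + int K" for \<theta> I N K
  proof -
    have "hs d (\<lambda>k. fscale (hbar ^ k / fact k) (w \<theta> k) $ I)" by (rule hs_ser[OF v])
    from hs_sums(2)[OF this that] show ?thesis by (simp add: fser_nth[OF v])
  qed
  note c = this
  have "fvb d (fser (w \<theta>))" for \<theta>
    unfolding fvb_def vb_def using c[where K = 0] by auto
  moreover have "nice m (\<lambda>\<theta>. mcoeff (fls_nth (fser (w \<theta>) $ I) N) y)" for I N y
  proof -
    have N: "N < d + int (nat (N - d + 1))" by simp
    show ?thesis
      unfolding c[OF N] mcoeff_sum fscale_coeff[OF vb_hk v]
      by (intro nice_sum nice_mult nice_const n)
  qed
  ultimately show ?thesis by (auto simp: good_def)
qed

definition fint :: "nat \<Rightarrow> ('n::{finite,linorder}, 'r::finite) mform list \<Rightarrow> 'n form" where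
  "fint m T = form_integral m (\<lambda>\<theta>. fser (\<lambda>k. tr_dP \<theta> k T))"

lemma mvb_list: "\<exists>d. \<forall>x\<in>set l. mvb d x"
proof (induction l)
  case (Cons x l)
  then obtain d where d: "\<forall>x\<in>set l. mvb d x" by blast
  define e where "e = Min (range (\<lambda>(i, j, I). fls_subdegree (x $ i $ j $ I)))"
  have "e \<le> fls_subdegree (x $ i $ j $ I)" for i j I
    unfolding e_def by (rule Min_le) (auto intro: rev_image_eqI[of "(i, j, I)"])
  then have "mvb e x"
    unfolding mvb_def fvb_def vb_def by (meson fls_eq0_below_subdegree order_less_le_trans)
  with d have "\<forall>y\<in>set (x # l). mvb (min d e) y"
    by (auto simp: mvb_def fvb_def vb_def)
  then show ?case by blast
qed simp

lemma good_tr: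
  assumes "length T = Suc m"
  shows "good m (\<lambda>\<theta>. fser (\<lambda>k. tr_dP \<theta> k T))"
proof -
  obtain d where "\<forall>x\<in>set T. mvb d x" using mvb_list by blast
  then have "fvb (int (length T) * d) (tr_dP \<theta> k T)" for \<theta> k by (intro fvb_tr) auto
  then show ?thesis by (rule good_fser) (rule nice_tr[OF assms])
qed

lemma fint_lin:
  assumes g: "mslot g" and m: "\<And>x. length (g x) = Suc m"
  shows "fint m (g (x + y)) = fint m (g x) + fint m (g y)"
    and "fint m (g (mscale c x)) = fscale c (fint m (g x))"
proof -
  obtain d where d: "\<forall>z\<in>set (g x @ g y). mvb d z" using mvb_list by blast
  have vx: "fvb (int (length (g x)) * d) (tr_dP \<theta> k (g x))" for \<theta> k by (rule fvb_tr) (use d in auto)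
  have vy: "fvb (int (length (g x)) * d) (tr_dP \<theta> k (g y))" for \<theta> k
    unfolding mslot_len[OF g, of x y] by (rule fvb_tr) (use d in auto)
  show "fint m (g (x + y)) = fint m (g x) + fint m (g y)"
    unfolding fint_def tr_dP_lin[OF g, THEN conjunct1] fser_add[OF vx vy]
    by (rule form_integral_add[OF good_tr[OF m] good_tr[OF m]])
  show "fint m (g (mscale c x)) = fscale c (fint m (g x))"
    unfolding fint_def tr_dP_lin[OF g, THEN conjunct2] fser_scale[OF vx]
    by (rule form_integral_scale[OF good_tr[OF m]])
qed

lemma free_exp_fint: "free_exp a = fint (length a - 1) (to_mform (hd a) # map (mf_map de_rham \<circ> to_mform) (tl a))"
  by (simp add: free_exp_def fint_def fser_def)

lemma to_mform_lin: "to_mform (x + y) = to_mform x + to_mform y" "to_mform (gscale c x) = mscale c (to_mform x)"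
  by (auto simp: to_mform_def form0_def mscale_def gscale_def vec_eq_iff)

lemma mlin_d [simp]: "mlin (mf_map de_rham)"
  by (rule mlin_map) (simp_all add: de_rham_def vec_eq_iff wderiv_add wderiv_emb_mult algebra_simps
      sum.distrib sum_distrib_left)

lemma d_scalar: "mf_map de_rham (to_mform (mat (emb c))) = 0"
  by (auto simp: mf_map_def de_rham_def to_mform_def form0_def mat_def vec_eq_iff intro!: sum.neutral)

lemma free_exp_lin:
  "free_exp (l @ (x + y) # l') = free_exp (l @ x # l') + free_exp (l @ y # l')"
  "free_exp (l @ gscale c x # l') = fscale c (free_exp (l @ x # l'))"
  "l \<noteq> [] \<Longrightarrow> free_exp (l @ mat (emb c) # l') = 0"
proof -
  obtain g where g: "mslot g" "\<And>x. length (g x) = Suc (length l + length l')"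
     "\<And>z. free_exp (l @ z # l') = fint (length l + length l') (g (to_mform z))"
  proof (cases l)
    case Nil
    show ?thesis
      by (rule that[of "\<lambda>z. z # map (mf_map de_rham \<circ> to_mform) l'"])
         (auto simp: Nil free_exp_fint intro!: mslotI[of "\<lambda>x. x" _ "[]"])
  next
    case (Cons a k)
    show ?thesis
      by (rule that[of "\<lambda>z. (to_mform a # map (mf_map de_rham \<circ> to_mform) k) @ mf_map de_rham z # map (mf_map de_rham \<circ> to_mform) l'"])
         (auto simp: Cons free_exp_fint intro!: mslotI[of "mf_map de_rham" _ "to_mform a # map (mf_map de_rham \<circ> to_mform) k"])
  qed
  show "free_exp (l @ (x + y) # l') = free_exp (l @ x # l') + free_exp (l @ y # l')"
    "free_exp (l @ gscale c x # l') = fscale c (free_exp (l @ x # l'))"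
    unfolding g(3) to_mform_lin by (rule fint_lin[OF g(1,2)])+
  assume "l \<noteq> []"
  then obtain a k where l: "l = a # k" by (cases l) auto
  define h where "h z = to_mform a # map (mf_map de_rham \<circ> to_mform) k @ z # map (mf_map de_rham \<circ> to_mform) l'" for z
  have h: "mslot h" unfolding h_def
    by (rule mslotI[of "\<lambda>x. x" _ "to_mform a # map (mf_map de_rham \<circ> to_mform) k"]) auto
  have "free_exp (l @ mat (emb c) # l') = fint (length l + length l') (h 0)"
    by (simp add: l free_exp_fint h_def d_scalar)
  also have "h 0 = h (mscale 0 0)" by (simp add: mscale_def vec_eq_iff h_def)
  also have "fint (length l + length l') (h (mscale 0 0)) = 0"
    by (subst fint_lin(2)[OF h]) (auto simp: h_def l)
  finally show "free_exp (l @ mat (emb c) # l') = 0" .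
qed

theorem normalized_multilinear_int: "normalized_multilinear fscale (int_tensor \<xi>)"
proof -
  define F where "F \<tau> l = fscale (of_int (sign \<tau>)) (free_exp (hd l # map (\<lambda>s. (\<xi> @ tl l) ! inv \<tau> s)
      [0..<length (\<xi> @ tl l)]))" for \<tau> l
  define S where "S N = {\<tau>. \<tau> permutes {..<N} \<and> strict_mono_on {length \<xi>..<N} \<tau>}" for N
  have I: "int_tensor \<xi> l = fscale ((1 / hbar) ^ length \<xi>) (\<Sum>\<tau>\<in>S (length \<xi> + length (tl l)). F \<tau> l)" for l
    by (simp add: int_tensor_def Let_def F_def S_def)
  have F: "F \<tau> (l @ (x + y) # l') = F \<tau> (l @ x # l') + F \<tau> (l @ y # l')"
    "F \<tau> (l @ gscale c x # l') = fscale c (F \<tau> (l @ x # l'))"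
    "l \<noteq> [] \<Longrightarrow> F \<tau> (l @ mat (emb c) # l') = 0"
    if t: "\<tau> permutes {..<length \<xi> + length (tl (l @ x # l'))}" for \<tau> l l' x y c
  proof -
    have "\<exists>L L'. (l \<noteq> [] \<longrightarrow> L \<noteq> []) \<and> (\<forall>x. F \<tau> (l @ x # l') = fscale (of_int (sign \<tau>)) (free_exp (L @ x # L')))"
    proof (cases l)
      case Nil
      show ?thesis
        by (rule exI[of _ "[]"]) (auto simp: F_def Nil)
    next
      case (Cons a k)
      define N where "N = length \<xi> + length (tl (l @ x # l'))"
      define j where "j = length (\<xi> @ k)"
      define p where "p = \<tau> j"
      have j: "j < N" by (simp add: N_def j_def Cons)
      have p: "p < N" using permutes_in_image[OF t] j by (simp add: p_def N_def)
      define M where "M = map (\<lambda>s. (\<xi> @ k @ a # l') ! inv \<tau> s) [0..<N]"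
      have "map (\<lambda>s. (\<xi> @ k @ z # l') ! inv \<tau> s) [0..<N] = take p M @ z # drop (Suc p) M" for z
      proof -
        have "map (\<lambda>s. (\<xi> @ k @ z # l') ! inv \<tau> s) [0..<N] = M[p := z]"
        proof (rule nth_equalityI)
          fix s assume "s < length (map (\<lambda>s. (\<xi> @ k @ z # l') ! inv \<tau> s) [0..<N])"
          then have s: "s < N" by simp
          have "inv \<tau> s = j \<longleftrightarrow> s = p"
            using permutes_inverses[OF t] by (metis p_def)
          moreover have "(\<xi> @ k @ z # l') ! q = (if q = j then z else (\<xi> @ k @ a # l') ! q)" for q
            by (auto simp: j_def nth_append nth_Cons')
          ultimately show "map (\<lambda>s. (\<xi> @ k @ z # l') ! inv \<tau> s) [0..<N] ! s = M[p := z] ! s"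
            using s by (auto simp: M_def nth_list_update)
        qed (simp add: M_def)
        then show ?thesis using p by (simp add: upd_conv_take_nth_drop M_def)
      qed
      then show ?thesis
        by (intro exI[of _ "a # take p M"] exI[of _ "drop (Suc p) M"]) (auto simp: F_def Cons N_def)
    qed
    then obtain L L' where L: "l \<noteq> [] \<Longrightarrow> L \<noteq> []"
      "\<And>x. F \<tau> (l @ x # l') = fscale (of_int (sign \<tau>)) (free_exp (L @ x # L'))" by blast
    show "F \<tau> (l @ (x + y) # l') = F \<tau> (l @ x # l') + F \<tau> (l @ y # l')"
      "F \<tau> (l @ gscale c x # l') = fscale c (F \<tau> (l @ x # l'))"
      "l \<noteq> [] \<Longrightarrow> F \<tau> (l @ mat (emb c) # l') = 0"
      unfolding L(2) by (simp_all add: free_exp_lin fs.scale_right_distrib L(1) mult.commute)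
  qed
  have len: "length (tl (l @ x # l')) = length l + length l'" for l l' and x :: "('a, 'b) gl"
    by (cases l) auto
  have perm: "\<tau> \<in> S N \<Longrightarrow> \<tau> permutes {..<N}" for \<tau> N by (simp add: S_def)
  show ?thesis
    unfolding normalized_multilinear_def
  proof (intro conjI allI impI)
    fix l l' :: "('a, 'b) gl list" and a a' c
    let ?S = "S (length \<xi> + (length l + length l'))"
    have p: "\<tau> permutes {..<length \<xi> + length (tl (l @ x # l'))}" if "\<tau> \<in> ?S" for \<tau> x
      using perm[OF that] unfolding len .
    show "int_tensor \<xi> (l @ (a + a') # l') = int_tensor \<xi> (l @ a # l') + int_tensor \<xi> (l @ a' # l')"
      unfolding I len fs.scale_right_distrib[symmetric] sum.distrib[symmetric]
      by (intro arg_cong2[where f = fscale] sum.cong refl F(1)[OF p])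
    show "int_tensor \<xi> (l @ gscale c a # l') = fscale c (int_tensor \<xi> (l @ a # l'))"
      unfolding I len fs.scale_left_commute[of c] fs.scale_sum_right[of c]
      by (intro arg_cong2[where f = fscale] sum.cong refl F(2)[OF p])
    show "int_tensor \<xi> (l @ mat (emb c) # l') = 0" if "l \<noteq> []"
      unfolding I len using F(3)[OF p that] by (simp add: sum.neutral)
  qed
qed

lemmas hoch_b_lin = chain_lin[OF module_cscale normalized_multilinear_b, folded hoch_b_def]
lemmas connes_B_lin = chain_lin[OF module_cscale normalized_multilinear_B, folded connes_B_def]
lemmas chain_act_lin = chain_lin[OF module_cscale normalized_multilinear_act, folded chain_act_def]
lemmas int_exp_lin = chain_lin[OF module_fscale normalized_multilinear_int, folded int_exp_def]

end

theory Submission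
  imports Defs
begin

text \<open>The free expectation of a tensor obeys two identities. By Stokes' theorem on the space of cyclic
  configurations, \<open>\<hbar>\<close> times its BV differential \<open>[d, \<iota>\<^sub>\<Pi>]\<close> is its Hochschild boundary: the propagator is
  affine in each position, and when two neighbouring points collide its jump there turns their two
  tensor factors into one Moyal product. On the other hand, consider the sum over all insertions of a
  scalar factor \<open>w\<close> with constant first derivatives. Moving the position of \<open>w\<close> once around the circle kills the contractions
  with \<open>w\<close>, because the propagator has mean zero, so \<open>w\<close> comes out as a factor. For \<open>w = 1\<close> this
  expresses the de Rham differential of the expectation by Connes' operator; for \<open>w = dq\<close> with \<open>q\<close> a
  quadratic polynomial it gives a form that vanishes at \<open>y = 0\<close>.

  The interacting expectation is obtained by iterating signed insertions of the Lie algebra arguments.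
  Insertions anticommute with each other and with Connes' operator, while their anticommutator with the
  Hochschild boundary is the action of the Lie algebra; summing up gives the Chevalley--Eilenberg
  differential. Since the Berezin integral annihilates the image of \<open>\<hbar>[d, \<iota>\<^sub>\<Pi>] + u d\<close>, the universal
  trace is closed. It vanishes on \<open>lie_h\<close> by the case \<open>w = dq\<close>.\<close>

section \<open>The exterior algebra\<close>

text \<open>The boundary terms come from one computation. Contracting the 1-form in a slot with Pi
  and differentiating the whole product pairs that slot with every other one through
  \<open>omega\<close>, and this pairing (\<open>edge_poly\<close>) is minus the derivative of the
  exponent in the position of the slot. So \<open>BV\<close> of the integrand is a sum of total
  derivatives, one for each point other than point 0, and only the ends of the arcs remain. An
  interior collision is reached by moving either of its two points, and the two contributions are
  the two halves of d(a b). The obstacle is that the propagator jumps exactly at collisions.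
  Positions are therefore measured from point 0, and \<open>lifted_prop\<close> chooses the branch
  by the order of the indices, which keeps it affine on closed arcs. Exponentials are treated one
  power at a time, in a polynomial ring; at a fixed power of \<open>hbar\<close> only finitely many
  terms count, so sums, integrals and derivatives may be exchanged. The powers of
  \<open>hbar\<close> match because each anticommutator of an insertion with the boundary carries a
  factor \<open>hbar\<close>, which makes up for the argument that disappears.\<close>

abbreviation flin :: "('n::finite form \<Rightarrow> 'm::finite form) \<Rightarrow> bool" where
  "flin \<equiv> module_hom fscale fscale"

lemma flinI: "(\<And>x y. f (x + y) = f x + f y) \<Longrightarrow> (\<And>c x. f (fscale c x) = fscale c (f x)) \<Longrightarrow> flin f"
  by (intro module_hom.intro module_hom_axioms.intro module_fscale)

text \<open>The factor \<open>a i + 1\<close> of the derivative splits as \<open>b i + c i\<close>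
  over every pair of exponents with sum \<open>?a\<close>; the two shares give the two terms of the
  product rule.\<close>

lemma mderiv_mult: "mderiv i (f * g) = mderiv i f * g + f * mderiv i (g :: 'v::finite mps)"
proof (rule mps_eqI)
  fix a :: "'v \<Rightarrow> nat"
  let ?a = "a(i := Suc (a i))"
  have 1: "(\<Sum>(b, c)\<in>msplit ?a. of_nat (b i) * (mcoeff f b * mcoeff g c)) = mcoeff (mderiv i f * g) a"
    for f g :: "'v mps"
  proof -
    \<comment> \<open>Pairs with \<open>b i = 0\<close> contribute nothing, so lowering
      \<open>b i\<close> by one is a bijection onto \<open>msplit a\<close>.\<close>
    have "(\<Sum>(b, c)\<in>msplit ?a. of_nat (b i) * (mcoeff f b * mcoeff g c)) =
        (\<Sum>(b, c)\<in>msplit ?a - {(b, c). b i = 0}. of_nat (b i) * (mcoeff f b * mcoeff g c))"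
      by (rule sum.mono_neutral_right) auto
    also have "\<dots> = (\<Sum>(b, c)\<in>msplit a. of_nat (Suc (b i)) * (mcoeff f (b(i := Suc (b i))) * mcoeff g c))"
      by (rule sum.reindex_bij_witness[where j = "\<lambda>(b, c). (b(i := b i - 1), c)"
            and i = "\<lambda>(b, c). (b(i := Suc (b i)), c)"])
         (auto simp: msplit_def split: if_splits)
    finally show ?thesis
      by (simp add: times_mps.rep_eq mderiv.rep_eq mult.assoc)
  qed
  have 2: "(\<Sum>(b, c)\<in>msplit ?a. of_nat (c i) * (mcoeff f b * mcoeff g c)) = mcoeff (f * mderiv i g) a"
    using 1[of g f] unfolding mult.commute[of f]
    by (subst (asm) sum.reindex_bij_witness[where i = prod.swap and j = prod.swap])
       (auto simp: msplit_def add.commute mult.commute mult.left_commute case_prod_unfold)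
  have "mcoeff (mderiv i (f * g)) a = (\<Sum>(b, c)\<in>msplit ?a. of_nat (?a i) * (mcoeff f b * mcoeff g c))"
    by (simp add: mderiv.rep_eq times_mps.rep_eq sum_distrib_left case_prod_unfold)
  also have "\<dots> = (\<Sum>(b, c)\<in>msplit ?a. of_nat (b i) * (mcoeff f b * mcoeff g c)
      + of_nat (c i) * (mcoeff f b * mcoeff g c))"
  proof (intro sum.cong refl)
    fix x assume "x \<in> msplit ?a"
    then have "?a i = fst x i + snd x i" by (auto simp: msplit_def)
    then show "(case x of (b, c) \<Rightarrow> of_nat (?a i) * (mcoeff f b * mcoeff g c)) = (case x of (b, c) \<Rightarrow>
       of_nat (b i) * (mcoeff f b * mcoeff g c) + of_nat (c i) * (mcoeff f b * mcoeff g c))"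
      by (simp only: case_prod_unfold of_nat_add distrib_right)
  qed
  also have "\<dots> = mcoeff (mderiv i f * g + f * mderiv i g) a"
    unfolding plus_mps.rep_eq 1[symmetric] 2[symmetric] by (simp add: sum.distrib case_prod_unfold)
  finally show "mcoeff (mderiv i (f * g)) a = mcoeff (mderiv i f * g + f * mderiv i g) a" .
qed

lemma mderiv_commute: "mderiv i (mderiv j f) = mderiv j (mderiv i f)"
  by (rule mps_eqI) (auto simp: mderiv.rep_eq fun_upd_twist mult.left_commute)

lemma mderiv_uminus: "mderiv i (- f) = - mderiv i f"
  by (rule mps_eqI) (simp add: mderiv.rep_eq uminus_mps.rep_eq)

lemma wderiv_commute: "wderiv i (wderiv j f) = wderiv j (wderiv i f)"
  by (rule fls_eqI) (simp add: mderiv_commute)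

lemma wderiv_mult: "wderiv i (f * g) = wderiv i f * g + f * wderiv i g"
proof (rule fls_eqI)
  fix N
  obtain d where d: "vb d f" using vb_ex by blast
  obtain e where e: "vb e g" using vb_ex by blast
  show "fls_nth (wderiv i (f * g)) N = fls_nth (wderiv i f * g + f * wderiv i g) N"
    by (simp add: fls_times_nth_vb[OF d e] fls_times_nth_vb[OF vb_wderiv[OF d] e]
        fls_times_nth_vb[OF d vb_wderiv[OF e]] mderiv_sum mderiv_mult sum.distrib)
qed

lemma wderiv_uminus: "wderiv i (- f) = - wderiv i f"
  by (rule fls_eqI) (simp add: mderiv_uminus)

lemma wderiv_sum: "wderiv i (sum f S) = (\<Sum>x\<in>S. wderiv i (f x))"
  by (induction S rule: infinite_finite_induct) (auto simp: wderiv_add)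

lemma wderiv_sign: "wderiv i ((-1) ^ k * f) = (-1) ^ k * wderiv i f"
  by (cases "even k") (auto simp: wderiv_uminus)

section \<open>Signs and parity in the exterior algebra\<close>

definition inversions :: "'a::linorder set \<Rightarrow> 'a set \<Rightarrow> nat" where
  "inversions J K = card {(j, k). j \<in> J \<and> k \<in> K \<and> k < j}"

lemma inversions_Un:
  fixes J K L :: "'a::{finite,linorder} set"
  shows "J \<inter> K = {} \<Longrightarrow> inversions (J \<union> K) L = inversions J L + inversions K L"
    and "J \<inter> K = {} \<Longrightarrow> inversions L (J \<union> K) = inversions L J + inversions L K"
  unfolding inversions_def
  by (subst card_Un_disjoint[symmetric], auto intro!: arg_cong[where f = card])+

text \<open>Each pair in \<open>J \<times> K\<close> is an inversion for exactly one of the two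
  orders. This is the source of the sign of graded commutativity.\<close>

lemma inversions_swap:
  fixes J K :: "'a::{finite,linorder} set"
  assumes "J \<inter> K = {}"
  shows "inversions J K + inversions K J = card J * card K"
proof -
  have "inversions K J = card {(j, k). j \<in> J \<and> k \<in> K \<and> j < k}"
    unfolding inversions_def
    by (rule bij_betw_same_card[of prod.swap]) (auto simp: bij_betw_def inj_on_def image_iff)
  moreover have "inversions J K + card {(j, k). j \<in> J \<and> k \<in> K \<and> j < k} = card (J \<times> K)"
  proof -
    have "J \<times> K = {(j, k). j \<in> J \<and> k \<in> K \<and> k < j} \<union> {(j, k). j \<in> J \<and> k \<in> K \<and> j < k}"
      using assms by (auto simp: set_eq_iff) (metis linorder_neqE)
    moreover have "card ({(j, k). j \<in> J \<and> k \<in> K \<and> k < j} \<union> {(j, k). j \<in> J \<and> k \<in> K \<and> j < k}) =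
        card {(j, k). j \<in> J \<and> k \<in> K \<and> k < j} + card {(j, k). j \<in> J \<and> k \<in> K \<and> j < k}"
      by (rule card_Un_disjoint) auto
    ultimately show ?thesis
      unfolding inversions_def by presburger
  qed
  ultimately show ?thesis by simp
qed

lemma wedge_nth: "wedge v w $ I = (\<Sum>J\<in>Pow I. (-1) ^ inversions J (I - J) * v $ J * w $ (I - J))"
  by (simp add: wedge_def inversions_def)

text \<open>Both sides are sums over splittings of \<open>I\<close> into three parts, and by
  additivity of \<open>inversions\<close> both signs count the inverted pairs between different
  parts.\<close>

lemma wedge_assoc: "wedge (wedge u v) w = wedge u (wedge v w)"
  for u v w :: "'n::{finite,linorder} form"
  unfolding vec_eq_iff
proof
  fix I :: "'n coord set"
  let ?f = "\<lambda>(J, K). (-1) ^ (inversions J (I - J) + inversions K (J - K)) * u $ K * v $ (J - K) * w $ (I - J)"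
  let ?g = "\<lambda>(K, L). (-1) ^ (inversions K (I - K) + inversions L (I - K - L)) * u $ K * v $ L * w $ (I - K - L)"
  have "wedge (wedge u v) w $ I = (\<Sum>x\<in>Sigma (Pow I) Pow. ?f x)"
    by (subst sum.Sigma[symmetric])
       (auto simp: wedge_nth sum_distrib_left sum_distrib_right power_add mult_ac intro!: sum.cong)
  also have "\<dots> = (\<Sum>x\<in>Sigma (Pow I) (\<lambda>K. Pow (I - K)). ?g x)"
  \<comment> \<open>\<open>J\<close> is the union of the first two parts on the left-hand side,
    hence the second part is \<open>J - K\<close>.\<close>
  proof (rule sum.reindex_bij_witness[where j = "\<lambda>(J, K). (K, J - K)" and i = "\<lambda>(K, L). (K \<union> L, K)"])
    fix x assume x: "x \<in> Sigma (Pow I) Pow"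
    obtain J K where JK: "x = (J, K)" by (cases x)
    have sub: "K \<subseteq> J" "J \<subseteq> I" using x JK by auto
    have e: "I - K - (J - K) = I - J" using sub by auto
    have "inversions J (I - J) = inversions K (I - J) + inversions (J - K) (I - J)"
      using inversions_Un(1)[of K "J - K" "I - J"] sub by (simp add: Un_absorb1)
    moreover have "inversions K (I - K) = inversions K (J - K) + inversions K (I - J)"
    proof -
      have "I - K = (J - K) \<union> (I - J)" using sub by auto
      then show ?thesis using inversions_Un(2)[of "J - K" "I - J" K] by (auto simp: Diff_Int_distrib)
    qed
    ultimately show "?g (case x of (J, K) \<Rightarrow> (K, J - K)) = ?f x"
      by (simp add: JK e add_ac)
  qed (auto simp: Un_absorb1)
  also have "\<dots> = wedge u (wedge v w) $ I"
    by (subst sum.Sigma[symmetric])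
       (auto simp: wedge_nth sum_distrib_left sum_distrib_right power_add mult_ac intro!: sum.cong)
  finally show "wedge (wedge u v) w $ I = wedge u (wedge v w) $ I" .
qed

text \<open>The parity automorphism. It absorbs the Koszul signs, so that Leibniz rules can be
  stated for forms of mixed degree.\<close>

definition grade :: "'n::finite form \<Rightarrow> 'n form" where
  "grade w = (\<chi> I. (-1) ^ card I * w $ I)"

definition odd_form :: "'n::finite form \<Rightarrow> bool" where
  "odd_form w \<longleftrightarrow> (\<forall>I. even (card I) \<longrightarrow> w $ I = 0)"

definition even_form :: "'n::finite form \<Rightarrow> bool" where
  "even_form w \<longleftrightarrow> (\<forall>I. odd (card I) \<longrightarrow> w $ I = 0)"

lemma grade_odd:
  assumes "odd_form w" shows "grade w = - w"
  unfolding vec_eq_iff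
proof
  fix I show "grade w $ I = (- w) $ I"
    using assms by (cases "even (card I)") (simp_all add: grade_def odd_form_def)
qed

lemma grade_even:
  assumes "even_form w" shows "grade w = w"
  unfolding vec_eq_iff
proof
  fix I show "grade w $ I = w $ I"
    using assms by (cases "even (card I)") (simp_all add: grade_def even_form_def)
qed

text \<open>Passing to complements exchanges the factors; \<open>wedge_even\<close> and
  \<open>wedge_odd\<close> then only evaluate the remaining sign.\<close>

lemma wedge_swap:
  "wedge v w $ I = (\<Sum>J\<in>Pow I. (-1) ^ (card J * card (I - J)) * ((-1) ^ inversions J (I - J) * w $ J * v $ (I - J)))"
proof -
  have "wedge v w $ I = (\<Sum>J\<in>Pow I. (-1) ^ inversions (I - J) J * v $ (I - J) * w $ J)"
    unfolding wedge_nth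
    by (rule sum.reindex_bij_witness[where i = "\<lambda>J. I - J" and j = "\<lambda>J. I - J"])
       (auto simp: double_diff)
  also have "\<dots> = (\<Sum>J\<in>Pow I. (-1) ^ (card J * card (I - J)) * ((-1) ^ inversions J (I - J) * w $ J * v $ (I - J)))"
  proof (intro sum.cong refl)
    fix J assume "J \<in> Pow I"
    have "card J * card (I - J) = inversions J (I - J) + inversions (I - J) J"
      by (rule inversions_swap[symmetric]) auto
    then have "(-1 :: 'a weyl) ^ inversions (I - J) J = (-1) ^ (card J * card (I - J)) * (-1) ^ inversions J (I - J)"
      by (cases "even (inversions J (I - J))") (simp_all add: power_add)
    then show "(-1) ^ inversions (I - J) J * v $ (I - J) * w $ J =
       (-1) ^ (card J * card (I - J)) * ((-1) ^ inversions J (I - J) * w $ J * v $ (I - J))"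
      by (simp add: mult_ac)
  qed
  finally show ?thesis .
qed

lemma wedge_even: "even_form v \<Longrightarrow> wedge v w = wedge w v"
  unfolding vec_eq_iff wedge_swap[of v w] wedge_nth[of w v]
proof (intro allI sum.cong refl)
  fix I J assume "even_form v"
  then show "(- 1) ^ (card J * card (I - J)) * ((- 1) ^ inversions J (I - J) * w $ J * v $ (I - J)) =
    (- 1) ^ inversions J (I - J) * w $ J * v $ (I - J)"
    by (cases "even (card (I - J))") (auto simp: even_form_def)
qed

lemma wedge_odd: "odd_form v \<Longrightarrow> wedge v w = wedge (grade w) v"
  unfolding vec_eq_iff wedge_swap[of v w] wedge_nth[of "grade w" v]
proof (intro allI sum.cong refl)
  fix I J assume v: "odd_form v"
  show "(- 1) ^ (card J * card (I - J)) * ((- 1) ^ inversions J (I - J) * w $ J * v $ (I - J)) =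
    (- 1) ^ inversions J (I - J) * grade w $ J * v $ (I - J)"
  proof (cases "even (card (I - J))")
    case False
    then have "(-1 :: 'a weyl) ^ (card J * card (I - J)) = (-1) ^ card J"
      by (cases "even (card J)") auto
    then show ?thesis by (simp add: grade_def mult_ac)
  qed (use v in \<open>auto simp: odd_form_def\<close>)
qed

lemma grade_wedge: "grade (wedge v w) = wedge (grade v) (grade w)"
proof -
  have "(-1 :: 'a weyl) ^ card I = (-1) ^ card J * (-1) ^ card (I - J)" if "J \<subseteq> I" for I J :: "'a coord set"
    using that by (metis card_Diff_subset card_mono finite le_add_diff_inverse power_add)
  then show ?thesis
    unfolding vec_eq_iff
    by (auto simp: grade_def wedge_nth sum_distrib_left mult_ac intro!: sum.cong)
qed

lemma grade_grade [simp]: "grade (grade w) = w"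
  by (simp add: grade_def vec_eq_iff flip: mult.assoc power_add mult_2)

lemma flin_grade: "flin grade"
  by (rule flinI) (simp_all add: grade_def vec_eq_iff algebra_simps)
lemma flin_lie: "flin (lie_deriv i)"
  by (rule flinI) (simp_all add: lie_deriv_def vec_eq_iff wderiv_add wderiv_emb_mult)
lemma flin_contract: "flin (contract i)"
  by (rule flinI) (simp_all add: contract_def vec_eq_iff algebra_simps)
lemma flin_de_rham: "flin de_rham"
  by (rule flinI) (simp_all add: de_rham_def vec_eq_iff wderiv_add wderiv_emb_mult sum.distrib algebra_simps sum_distrib_left)
lemma flin_wedge: "flin (wedge v)" "flin (\<lambda>v. wedge v w)"
  by (rule flinI; simp add: wedge_add wedge_scale)+

lemmas grade_lin = module_hom.add[OF flin_grade] module_hom.scale[OF flin_grade] module_hom.zero[OF flin_grade]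
  module_hom.neg[OF flin_grade] module_hom.diff[OF flin_grade] module_hom.sum[OF flin_grade]
lemmas lie_lin = module_hom.add[OF flin_lie] module_hom.scale[OF flin_lie] module_hom.zero[OF flin_lie]
  module_hom.neg[OF flin_lie] module_hom.diff[OF flin_lie] module_hom.sum[OF flin_lie]
lemmas contract_lin = module_hom.add[OF flin_contract] module_hom.scale[OF flin_contract] module_hom.zero[OF flin_contract]
  module_hom.neg[OF flin_contract] module_hom.diff[OF flin_contract] module_hom.sum[OF flin_contract]
lemmas de_rham_lin = module_hom.add[OF flin_de_rham] module_hom.scale[OF flin_de_rham] module_hom.zero[OF flin_de_rham]
  module_hom.neg[OF flin_de_rham] module_hom.diff[OF flin_de_rham] module_hom.sum[OF flin_de_rham]
lemmas wedge_lin = module_hom.zero[OF flin_wedge(1)] module_hom.neg[OF flin_wedge(1)] module_hom.diff[OF flin_wedge(1)]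
  module_hom.sum[OF flin_wedge(1)] module_hom.zero[OF flin_wedge(2)] module_hom.neg[OF flin_wedge(2)]
  module_hom.diff[OF flin_wedge(2)] module_hom.sum[OF flin_wedge(2)] wedge_add wedge_scale

lemma wedge_form0: "wedge (form0 f) w = (\<chi> I. f * w $ I)"
  unfolding vec_eq_iff
proof
  fix I
  have "wedge (form0 f) w $ I = (\<Sum>J\<in>{{}}. (-1) ^ inversions J (I - J) * form0 f $ J * w $ (I - J))"
    unfolding wedge_nth by (rule sum.mono_neutral_right) (auto simp: form0_def)
  then show "wedge (form0 f) w $ I = (\<chi> I. f * w $ I) $ I"
    by (simp add: form0_def inversions_def)
qed

lemma even_form0: "even_form (form0 f)" by (auto simp: even_form_def form0_def)

lemma wedge_one [simp]: "wedge (form0 1) w = w" "wedge w (form0 1) = w"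
  by (simp_all add: wedge_form0 flip: wedge_even[OF even_form0])

section \<open>Basic 1-forms, Leibniz rules and Cartan's formula\<close>

definition dy :: "'n::finite coord \<Rightarrow> 'n form" where
  "dy i = (\<chi> J. if J = {i} then 1 else 0)"

lemma odd_dy: "odd_form (dy i)" by (auto simp: odd_form_def dy_def)

lemma wedge_dy_nth:
  "wedge (dy i) w $ I = (if i \<in> I then (-1) ^ card {j \<in> I. j < i} * w $ (I - {i}) else 0)"
proof -
  have "wedge (dy i) w $ I = (\<Sum>J\<in>{{i}} \<inter> Pow I. (-1) ^ inversions J (I - J) * dy i $ J * w $ (I - J))"
    unfolding wedge_nth by (rule sum.mono_neutral_right) (auto simp: dy_def)
  moreover have "inversions {i} (I - {i}) = card {j \<in> I. j < i}"
    unfolding inversions_def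
    by (rule bij_betw_same_card[of snd]) (auto simp: bij_betw_def inj_on_def image_iff)
  ultimately show ?thesis by (auto simp: dy_def)
qed

text \<open>In this form the Leibniz rule, Cartan's formula and the vanishing of the square follow
  from the behaviour of \<open>dy i\<close> and \<open>lie_deriv i\<close>.\<close>

lemma de_rham_dy: "de_rham w = (\<Sum>i\<in>UNIV. wedge (dy i) (lie_deriv i w))"
  by (simp add: vec_eq_iff de_rham_def wedge_dy_nth lie_deriv_def sum.If_cases)

lemma lie_deriv_wedge: "lie_deriv i (wedge v w) = wedge (lie_deriv i v) w + wedge v (lie_deriv i w)"
proof -
  have "wderiv i ((-1) ^ k * a * b) = (-1) ^ k * wderiv i a * b + (-1) ^ k * a * wderiv i b" for k a b
    unfolding mult.assoc wderiv_sign by (simp add: wderiv_mult distrib_left)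
  then show ?thesis
    by (simp add: vec_eq_iff lie_deriv_def wedge_nth wderiv_sum sum.distrib)
qed

lemma lie_deriv_commute: "lie_deriv i (lie_deriv j w) = lie_deriv j (lie_deriv i w)"
  by (simp add: lie_deriv_def wderiv_commute)

lemma lie_deriv_dy [simp]: "lie_deriv i (dy j) = 0"
proof -
  have "wderiv i (if b then 1 else 0) = 0" for b using wderiv_emb[of i 1] by simp
  then show ?thesis by (simp add: lie_deriv_def dy_def vec_eq_iff)
qed

lemma de_rham_wedge: "de_rham (wedge v w) = wedge (de_rham v) w + wedge (grade v) (de_rham w)"
proof -
  have "wedge (dy i) (wedge v x) = wedge (grade v) (wedge (dy i) x)" for i x
    by (metis wedge_assoc wedge_odd[OF odd_dy])
  then show ?thesis
    by (simp add: de_rham_dy lie_deriv_wedge wedge_lin sum.distrib wedge_assoc)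
qed

lemma contract_nth: "contract i w $ I = (if i \<in> I then 0 else (-1) ^ card {j \<in> I. j < i} * w $ insert i I)"
  by (simp add: contract_def)

lemma below_insert [simp]: "{j \<in> insert i I. j < i} = {j \<in> I. j < (i :: 'a::linorder)}"
  "{j. (j = i \<or> j \<in> I) \<and> j < i} = {j \<in> I. j < (i :: 'a::linorder)}"
  "{j \<in> I - {i}. j < i} = {j \<in> I. j < i}" "{j \<in> I. j \<noteq> i \<and> j < i} = {j \<in> I. j < i}"
  by auto

lemma contract_dy_wedge: "contract i (wedge (dy i) w) = w - wedge (dy i) (contract i w)"
  by (auto simp: vec_eq_iff contract_nth wedge_dy_nth insert_absorb insert_Diff_if simp flip: mult.assoc power_add mult_2)

lemma contract_contract [simp]: "contract i (contract i w) = 0"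
  by (simp add: vec_eq_iff contract_nth)

lemma contract_anticommute: "contract i (contract j w) = - contract j (contract i w)"
proof (cases "i = j")
  case False
  have "card {k \<in> insert i I. k < j} = (if i < j then 1 else 0) + card {k \<in> I. k < j}" if "i \<notin> I" for i j :: "'a coord" and I
  proof -
    have "{k \<in> insert i I. k < j} = (if i < j then insert i {k \<in> I. k < j} else {k \<in> I. k < j})" by auto
    then show ?thesis using that by auto
  qed
  with False show ?thesis
    by (auto simp: vec_eq_iff contract_nth insert_commute mult_ac)
qed simp

text \<open>Expresses the absence of \<open>dy i\<close> in terms of coefficients, the shape in
  which it passes to products in \<open>contract_wedge_free\<close>.\<close>

lemma contract_free: "contract i w = 0 \<longleftrightarrow> (\<forall>I. i \<in> I \<longrightarrow> w $ I = 0)"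
proof
  assume *: "contract i w = 0"
  show "\<forall>I. i \<in> I \<longrightarrow> w $ I = 0"
  proof safe
    fix I assume "i \<in> I"
    then have "contract i w $ (I - {i}) = (-1) ^ card {j \<in> I. j < i} * w $ I"
      by (simp add: contract_nth insert_absorb)
    with * have "(-1) ^ card {j \<in> I. j < i} * ((-1) ^ card {j \<in> I. j < i} * w $ I) = 0" by simp
    then show "w $ I = 0" by (simp flip: mult.assoc power_add mult_2)
  qed
qed (simp add: vec_eq_iff contract_nth)

lemma contract_wedge_free: "contract i v = 0 \<Longrightarrow> contract i w = 0 \<Longrightarrow> contract i (wedge v w) = 0"
  unfolding contract_free wedge_nth
proof (intro allI impI sum.neutral ballI)
  fix I J assume "\<forall>I. i \<in> I \<longrightarrow> v $ I = 0" "\<forall>I. i \<in> I \<longrightarrow> w $ I = 0" "i \<in> I"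
  then have "v $ J = 0 \<or> w $ (I - J) = 0" by (cases "i \<in> J") auto
  then show "(-1) ^ inversions J (I - J) * v $ J * w $ (I - J) = 0" by auto
qed

lemma contract_grade: "contract i (grade w) = - grade (contract i w)"
  by (simp add: vec_eq_iff contract_nth grade_def mult_ac)

lemma dy_dy_wedge: "wedge (dy i) (wedge (dy i) w) = 0"
  by (auto simp: vec_eq_iff wedge_dy_nth)

text \<open>Every form splits as a part without \<open>dy i\<close> plus \<open>dy i\<close> times
  another such part. On these pieces no signs have to be counted: contraction removes the leading
  \<open>dy i\<close>, and products of free parts stay free.\<close>

lemma contract_wedge: "contract i (wedge v w) = wedge (contract i v) w + wedge (grade v) (contract i w)"
proof -
  let ?e = "wedge (dy i)"
  \<comment> \<open>The contraction is the coefficient of \<open>dy i\<close>, and subtracting that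
    term leaves the free part.\<close>
  define v'' w'' where d1: "v'' = contract i v" "w'' = contract i w"
  define v' w' where d2: "v' = v - ?e v''" "w' = w - ?e w''"
  note d = d1 d2
  have free: "contract i v' = 0" "contract i v'' = 0" "contract i w' = 0" "contract i w'' = 0"
    by (simp_all add: d contract_lin contract_dy_wedge wedge_lin)
  have v: "v = v' + ?e v''" and w: "w = w' + ?e w''" by (simp_all add: d)
  have sw: "wedge x (?e y) = ?e (wedge (grade x) y)" for x y
    using wedge_odd[OF odd_dy[of i], of "grade x"] by (simp flip: wedge_assoc)
  define x where "x = wedge v'' w' + wedge (grade v') w''"
  have "wedge v w = wedge v' w' + ?e x"
    unfolding v w x_def
    by (simp add: wedge_lin wedge_assoc sw[of v'] sw[of v''] dy_dy_wedge grade_lin grade_wedge grade_odd odd_dy)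
  moreover have "contract i (wedge v' w') = 0" "contract i x = 0"
    by (simp_all add: x_def contract_lin contract_wedge_free free contract_grade grade_lin)
  ultimately have "contract i (wedge v w) = x"
    by (simp only: contract_lin contract_dy_wedge wedge_lin) simp
  moreover have g: "grade v = grade v' - ?e (grade v'')"
    by (simp add: v grade_lin grade_wedge grade_odd odd_dy wedge_lin)
  ultimately have "contract i (wedge v w) = wedge v'' w' + wedge (grade v') w''"
    by (simp add: x_def)
  then show ?thesis
    unfolding d1[symmetric] g by (simp add: w wedge_lin wedge_assoc sw[of v''])
qed

lemma contract_dy: "contract j (dy i) = (if i = j then form0 1 else 0)"
  by (auto simp: vec_eq_iff contract_nth dy_def form0_def)

lemma lie_contract: "lie_deriv i (contract j w) = contract j (lie_deriv i w)"
  by (simp add: vec_eq_iff lie_deriv_def contract_nth wderiv_sign)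

text \<open>Contraction along \<open>j\<close> anticommutes with wedging by \<open>dy i\<close>
  except for \<open>i = j\<close>, where \<open>lie_deriv j w\<close> is left over.\<close>

lemma cartan: "contract j (de_rham w) = lie_deriv j w - de_rham (contract j w)"
proof -
  have "contract j (wedge (dy i) x) = (if i = j then x else 0) - wedge (dy i) (contract j x)" for i x
    by (simp add: contract_wedge contract_dy grade_odd odd_dy wedge_lin)
  then show ?thesis
    by (simp add: de_rham_dy contract_lin sum_subtractf lie_contract)
qed

lemma lie_de_rham: "lie_deriv i (de_rham x) = de_rham (lie_deriv i x)"
  by (simp add: de_rham_dy lie_lin lie_deriv_wedge lie_deriv_commute[of i] wedge_lin)

text \<open>Pulling the outer differential past each \<open>dy i\<close> shows that the form equals
  its own negative, which forces it to vanish over the complex numbers.\<close>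

lemma de_rham_de_rham [simp]: "de_rham (de_rham w) = 0"
proof -
  have 2: "w = 0" if "w + w = 0" for w :: "'a form"
  proof (rule form_eqI)
    fix I N y
    have "mcoeff (fls_nth ((w + w) $ I) N) y = 0" using that by (simp add: zero_mps.rep_eq)
    then have "2 * mcoeff (fls_nth (w $ I) N) y = 0" by (simp only: vector_add_component fls_plus_nth plus_mps.rep_eq mult_2)
    then show "mcoeff (fls_nth (w $ I) N) y = mcoeff (fls_nth ((0 :: 'a form) $ I) N) y"
      by (simp add: zero_mps.rep_eq)
  qed
  have c: "de_rham (wedge (dy i) x) = - wedge (dy i) (de_rham x)" for i x
  proof -
    have "de_rham (dy i) = 0" by (simp add: de_rham_dy wedge_lin)
    then show ?thesis by (simp add: de_rham_wedge grade_odd odd_dy wedge_lin)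
  qed
  have "de_rham (de_rham w) = (\<Sum>i\<in>UNIV. - wedge (dy i) (lie_deriv i (de_rham w)))"
    by (subst (2) de_rham_dy) (simp add: de_rham_lin c lie_de_rham)
  also have "\<dots> = - de_rham (de_rham w)"
    by (simp add: de_rham_dy[of "de_rham w"] sum_negf)
  finally have "de_rham (de_rham w) + de_rham (de_rham w) = 0"
    by (metis add.right_inverse)
  then show ?thesis by (rule 2)
qed

section \<open>The Berezin integral\<close>

text \<open>Up to sign the Koszul-Brylinski differential of the constant Poisson structure.\<close>

definition BV :: "'n::{finite,linorder} form \<Rightarrow> 'n form" where
  "BV w = de_rham (iota_Pi w) - iota_Pi (de_rham w)"

definition omega_sum :: "('n::finite coord \<Rightarrow> 'n coord \<Rightarrow> 'm::finite form) \<Rightarrow> 'm form" where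
  "omega_sum f = (\<Sum>i\<in>UNIV. \<Sum>j\<in>UNIV. fscale (fls_const (omega i j)) (f i j))"

lemma omega_antisym: "omega j i = - omega i j"
  by (cases i; cases j) auto

lemma fscale_uminus: "fscale (- c) w = - fscale c w" "fscale c (- w) = - fscale c w"
  by simp_all

lemma omega_sum_swap: "omega_sum (\<lambda>i j. f j i) = - omega_sum f"
proof -
  have "omega_sum (\<lambda>i j. f j i) = (\<Sum>i\<in>UNIV. \<Sum>j\<in>UNIV. fscale (fls_const (omega j i)) (f i j))"
    unfolding omega_sum_def by (rule sum.swap)
  also have "\<dots> = (\<Sum>i\<in>UNIV. \<Sum>j\<in>UNIV. - fscale (fls_const (omega i j)) (f i j))"
  proof (intro sum.cong refl)
    fix i j
    show "fscale (fls_const (omega j i)) (f i j) = - fscale (fls_const (omega i j)) (f i j)"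
      unfolding omega_antisym[of j i] by (simp only: fls_const_uminus fscale_uminus)
  qed
  finally show ?thesis by (simp add: omega_sum_def sum_negf)
qed

lemma omega_sum_add: "omega_sum (\<lambda>i j. f i j + g i j) = omega_sum f + omega_sum g"
  by (simp add: omega_sum_def fs.scale_right_distrib sum.distrib)
lemma omega_sum_diff: "omega_sum (\<lambda>i j. f i j - g i j) = omega_sum f - omega_sum g"
  by (simp add: omega_sum_def fs.scale_right_diff_distrib sum_subtractf)
lemma omega_sum_lin: "flin h \<Longrightarrow> h (omega_sum f) = omega_sum (\<lambda>i j. h (f i j))"
  by (simp add: omega_sum_def module_hom.sum module_hom.scale)

lemma iota_Pi_omega: "iota_Pi w = fscale (1 / 2) (omega_sum (\<lambda>i j. contract i (contract j w)))"
  by (simp add: iota_Pi_def omega_sum_def)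

lemma half_twice: "fscale (1 / 2) (w + w) = w"
  unfolding fs.scale_right_distrib fs.scale_left_distrib[symmetric] by simp

text \<open>Two applications of Cartan's formula leave a difference of two terms that are exchanged
  by swapping \<open>i\<close> and \<open>j\<close>; antisymmetry of \<open>omega\<close> adds them
  up and cancels the factor 1/2 of \<open>iota_Pi\<close>.\<close>

lemma BV_omega: "BV w = omega_sum (\<lambda>i j. lie_deriv i (contract j w))"
proof -
  have "de_rham (contract i (contract j w)) - contract i (contract j (de_rham w)) =
      lie_deriv i (contract j w) - lie_deriv j (contract i w)" for i j
    using cartan[of i "contract j w"] by (simp add: cartan contract_lin lie_contract)
  then have "BV w = fscale (1 / 2) (omega_sum (\<lambda>i j. lie_deriv i (contract j w))
      - omega_sum (\<lambda>i j. lie_deriv j (contract i w)))"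
    unfolding BV_def iota_Pi_omega de_rham_lin fs.scale_right_diff_distrib[symmetric]
    by (simp add: omega_sum_lin[OF flin_de_rham] flip: omega_sum_diff)
  then show ?thesis
    unfolding omega_sum_swap[of "\<lambda>i j. lie_deriv i (contract j w)"] diff_minus_eq_add half_twice .
qed

lemma flin_iota: "flin iota_Pi"
  by (rule flinI)
     (simp_all add: iota_Pi_def contract_lin fs.scale_right_distrib sum.distrib fs.scale_sum_right mult.commute)

lemmas iota_lin = module_hom.add[OF flin_iota] module_hom.scale[OF flin_iota] module_hom.zero[OF flin_iota]
  module_hom.neg[OF flin_iota] module_hom.diff[OF flin_iota] module_hom.sum[OF flin_iota]

lemma flin_BV: "flin BV"
  by (rule flinI) (simp_all add: BV_def iota_lin de_rham_lin fs.scale_right_diff_distrib)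

lemma iota_contract: "iota_Pi (contract j w) = contract j (iota_Pi w)"
proof -
  have "contract a (contract b (contract j w)) = contract j (contract a (contract b w))" for a b
    by (metis contract_anticommute contract_lin(4) minus_minus)
  then show ?thesis by (simp add: iota_Pi_def contract_lin)
qed

lemma iota_lie: "iota_Pi (lie_deriv j w) = lie_deriv j (iota_Pi w)"
  by (simp add: iota_Pi_def lie_lin lie_contract)

text \<open>The Poisson structure has constant coefficients, so \<open>iota_Pi\<close> commutes with
  Lie derivatives and contractions.\<close>

lemma BV_iota: "BV (iota_Pi w) = iota_Pi (BV w)"
  by (simp add: BV_omega omega_sum_lin[OF flin_iota] iota_lie iota_contract)

lemma flin_iota_pow: "flin (iota_Pi ^^ k)"
  by (induction k) (auto intro!: flinI simp: module_hom.add module_hom.scale iota_lin)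

text \<open>Commuting \<open>de_rham\<close> past \<open>l\<close> factors \<open>iota_Pi\<close>
  produces \<open>l\<close> copies of the commutator \<open>BV\<close>, all equal by
  \<open>BV_iota\<close>. For \<open>l = 0\<close> the term with the truncated exponent has
  coefficient 0.\<close>

lemma iota_pow_BV:
  "(iota_Pi ^^ l) (de_rham w) + fscale (of_nat l) ((iota_Pi ^^ (l - 1)) (BV w)) = de_rham ((iota_Pi ^^ l) w)"
proof (induction l arbitrary: w)
  case (Suc l)
  have sw: "(iota_Pi ^^ k) (iota_Pi x) = iota_Pi ((iota_Pi ^^ k) x)" for k and x :: "'a form" by (simp add: funpow_swap1)
  show ?case
  proof (cases l)
    case 0 then show ?thesis by (simp add: BV_def)
  next
    case (Suc k)
    have "(iota_Pi ^^ Suc l) (de_rham w) = (iota_Pi ^^ l) (de_rham (iota_Pi w)) - (iota_Pi ^^ l) (BV w)"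
      by (simp add: BV_def funpow_Suc_right module_hom.diff[OF flin_iota_pow] del: funpow.simps)
    also have "(iota_Pi ^^ l) (de_rham (iota_Pi w)) = de_rham ((iota_Pi ^^ l) (iota_Pi w))
        - fscale (of_nat l) ((iota_Pi ^^ (l - 1)) (BV (iota_Pi w)))"
      using Suc.IH[of "iota_Pi w"] by (simp add: algebra_simps)
    also have "(iota_Pi ^^ (l - 1)) (BV (iota_Pi w)) = (iota_Pi ^^ l) (BV w)"
      by (simp add: BV_iota Suc sw)
    finally show ?thesis
      by (simp add: sw fs.scale_left_distrib)
  qed
qed simp

lemma card_coord: "CARD('n::finite coord) = 2 * CARD('n)"
proof -
  have "card (range PP \<union> range QQ :: 'n coord set) = CARD('n) + CARD('n)"
    by (subst card_Un_disjoint) (auto simp: card_image inj_on_def)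
  then show ?thesis by (simp add: UNIV_coord)
qed

text \<open>Every \<open>iota_Pi\<close> reads coefficients two degrees higher, and no index set has
  more than 2n elements.\<close>

lemma iota_pow_zero:
  "2 * CARD('n) < card I + 2 * l \<Longrightarrow> (iota_Pi ^^ l) w $ I = 0" for w :: "'n::{finite,linorder} form"
proof (induction l arbitrary: I)
  case 0
  have "card I \<le> CARD('n coord)" by (rule card_mono) auto
  with 0 show ?case by (simp add: card_coord)
next
  case (Suc l)
  have "contract i (contract j ((iota_Pi ^^ l) w)) $ I = 0" for i j
  proof (cases "i \<in> I \<or> j \<in> insert i I")
    case False
    then have "(iota_Pi ^^ l) w $ insert j (insert i I) = 0"
      using Suc.prems by (intro Suc.IH) simp
    then show ?thesis by (simp add: contract_nth)
  qed (auto simp: contract_nth)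
  then show ?case by (simp add: iota_Pi_def[of "(iota_Pi ^^ l) w"])
qed

section \<open>Evaluation at the origin\<close>

lemma form_sigma_nth: "fls_nth (form_sigma w) N = mcoeff (fls_nth (w $ {}) N) (\<lambda>_. 0)"
  by (simp add: form_sigma_def zero_mps.rep_eq)

lemma form_sigma_add: "form_sigma (v + w) = form_sigma v + form_sigma w"
  by (rule fls_eqI) (simp add: form_sigma_nth plus_mps.rep_eq)

lemma form_sigma_scale: "form_sigma (fscale c w) = c * form_sigma w"
proof (rule fls_eqI)
  fix N
  obtain d where d: "vb d c" using vb_ex by blast
  obtain e where e: "vb e (w $ {})" using vb_ex by blast
  have "vb e (form_sigma w)" using e by (simp add: vb_def form_sigma_nth zero_mps.rep_eq)
  then show "fls_nth (form_sigma (fscale c w)) N = fls_nth (c * form_sigma w) N"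
    by (simp add: form_sigma_nth fls_times_nth_vb[OF vb_emb[OF d] e] fls_times_nth_vb[OF d] mcoeff_sum mcoeff_mconst_mult)
qed

lemma form_sigma_minus: "form_sigma (v - w) = form_sigma v - form_sigma w"
  using form_sigma_add[of "v - w" w] by simp

lemma form_sigma_0 [simp]: "form_sigma 0 = 0"
  using form_sigma_minus[of 0 0] by simp

lemma form_sigma_de_rham: "form_sigma (de_rham w) = 0"
  by (rule fls_eqI) (simp add: form_sigma_nth de_rham_def zero_mps.rep_eq)

definition berezin_single :: "int \<Rightarrow> 'n::{finite,linorder} form \<Rightarrow> KK" where
  "berezin_single j w = (\<Sum>l\<le>CARD('n). Poly_Mapping.single (int CARD('n) - int l + j)
       (form_sigma (fscale (hbar ^ l / fact l) ((iota_Pi ^^ l) w))))"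

lemma berezin_single_add: "berezin_single j (v + w) = berezin_single j v + berezin_single j w"
  by (simp add: berezin_single_def module_hom.add[OF flin_iota_pow] fs.scale_right_distrib form_sigma_add single_add sum.distrib)

lemma berezin_single_scale: "berezin_single (i + j) (fscale c w) = Poly_Mapping.single i c * berezin_single j w"
  by (simp add: berezin_single_def module_hom.scale[OF flin_iota_pow] form_sigma_scale sum_distrib_left mult_single algebra_simps)

lemma berezin_single_0 [simp]: "berezin_single j 0 = 0"
  using berezin_single_add[of j 0 0] by simp

lemma fact_Suc_fls: "(of_nat (Suc l) :: complex fls) * (hbar ^ Suc l / fact (Suc l)) = hbar * (hbar ^ l / fact l)"
proof -
  have "(of_nat (Suc l) :: complex fls) \<noteq> 0" by (rule of_nat_neq_0)
  then show ?thesis by (simp add: field_simps del: of_nat_Suc)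
qed

text \<open>The exponential of \<open>hbar\<close> times \<open>iota_Pi\<close> over u intertwines
  the left-hand operator with u times \<open>de_rham\<close>, and \<open>form_sigma\<close> kills
  exact forms. In coefficients, order \<open>l + 1\<close> of the second summand cancels order
  \<open>l\<close> of the first.\<close>

theorem berezin_closed: "berezin_single j (fscale hbar (BV w)) + berezin_single (j + 1) (de_rham w) = 0"
  for w :: "'n::{finite,linorder} form"
proof -
  define n where "n = CARD('n)"
  define s where "s l v = form_sigma (fscale (hbar ^ l / fact l) ((iota_Pi ^^ l) v))" for l and v :: "'n form"
  have 0: "s 0 (de_rham w) = 0" by (simp add: s_def form_sigma_de_rham)
  \<comment> \<open>The \<open>Suc l\<close> copies of the commutator reduce the factorial from
    \<open>Suc l\<close> to \<open>l\<close>, so the two orders match exactly.\<close>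
  have S: "s (Suc l) (de_rham w) = - s l (fscale hbar (BV w))" for l
  proof -
    have "(iota_Pi ^^ Suc l) (de_rham w) =
        de_rham ((iota_Pi ^^ Suc l) w) - fscale (of_nat (Suc l)) ((iota_Pi ^^ l) (BV w))"
      using iota_pow_BV[of "Suc l" w] by (metis add_diff_cancel_right' diff_Suc_1)
    then have "s (Suc l) (de_rham w) = form_sigma (fscale (hbar ^ Suc l / fact (Suc l))
        (de_rham ((iota_Pi ^^ Suc l) w) - fscale (of_nat (Suc l)) ((iota_Pi ^^ l) (BV w))))"
      by (simp only: s_def)
    also have "\<dots> = - (of_nat (Suc l) * (hbar ^ Suc l / fact (Suc l)) * form_sigma ((iota_Pi ^^ l) (BV w)))"
      unfolding form_sigma_scale form_sigma_minus form_sigma_de_rham by (simp only: mult_ac diff_0 mult_minus_right)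
    also have "\<dots> = - s l (fscale hbar (BV w))"
      unfolding fact_Suc_fls s_def module_hom.scale[OF flin_iota_pow] form_sigma_scale by (simp only: mult_ac)
    finally show ?thesis .
  qed
  \<comment> \<open>The exponential is cut at order n. The term left over there vanishes because in
    the commutator identity of order n + 1 both other terms contain n + 1 contractions and are
    zero.\<close>
  have n: "s n (fscale hbar (BV w)) = 0"
  proof -
    have z: "(iota_Pi ^^ Suc n) v = 0" for v :: "'n form"
      unfolding vec_eq_iff by (intro allI, subst iota_pow_zero) (auto simp: n_def)
    then have "fscale (of_nat (Suc n)) ((iota_Pi ^^ n) (BV w)) = 0"
      using iota_pow_BV[of "Suc n" w] by (simp add: de_rham_lin del: of_nat_Suc funpow.simps)
    then have "fscale (1 / of_nat (Suc n)) (fscale (of_nat (Suc n)) ((iota_Pi ^^ n) (BV w))) = 0"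
      by (simp only: fs.scale_zero_right)
    moreover have "(1 / of_nat (Suc n)) * of_nat (Suc n) = (1 :: complex fls)"
      by (simp del: of_nat_Suc)
    ultimately have "(iota_Pi ^^ n) (BV w) = 0" by (simp only: fs.scale_scale fs.scale_one)
    then show ?thesis by (simp add: s_def module_hom.scale[OF flin_iota_pow] form_sigma_scale)
  qed
  have "berezin_single (j + 1) (de_rham w) = (\<Sum>l<Suc n. Poly_Mapping.single (int n - int l + (j + 1)) (s l (de_rham w)))"
    by (simp add: berezin_single_def s_def n_def lessThan_Suc_atMost)
  also have "\<dots> = (\<Sum>l<n. Poly_Mapping.single (int n - int l + j) (- s l (fscale hbar (BV w))))"
    unfolding sum.lessThan_Suc_shift 0 S by (simp add: algebra_simps)
  moreover have "berezin_single j (fscale hbar (BV w)) = (\<Sum>l<Suc n. Poly_Mapping.single (int n - int l + j) (s l (fscale hbar (BV w))))"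
    by (simp add: berezin_single_def s_def n_def lessThan_Suc_atMost)
  ultimately show ?thesis
    by (simp add: n single_uminus sum_negf)
qed

text \<open>All coefficients are required to vanish at the origin, not only the one of degree 0,
  because the contractions in the Berezin integral bring higher coefficients down.\<close>

definition base_zero :: "'n::finite form \<Rightarrow> bool" where
  "base_zero w \<longleftrightarrow> (\<forall>I N. mcoeff (fls_nth (w $ I) N) (\<lambda>_. 0) = 0)"

lemma mcoeff_times_zero: "mcoeff (f * g) (\<lambda>_. 0) = mcoeff f (\<lambda>_. 0) * mcoeff (g :: 'v::finite mps) (\<lambda>_. 0)"
proof -
  have "msplit (\<lambda>_. 0) = {(\<lambda>_. 0, \<lambda>_. 0 :: nat) :: ('v \<Rightarrow> nat) \<times> _}" by (auto simp: msplit_def)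
  then show ?thesis by (simp add: times_mps.rep_eq)
qed

lemma mcoeff_sign: "mcoeff (fls_nth ((-1) ^ k * f) N) y = (-1) ^ k * mcoeff (fls_nth f N) y"
  by (cases "even k") (auto simp: uminus_mps.rep_eq)

lemma base_zero_sum: "(\<And>x. x \<in> S \<Longrightarrow> base_zero (f x)) \<Longrightarrow> base_zero (sum f S)"
  by (auto simp: base_zero_def fls_nth_sum mcoeff_sum)

lemma base_zero_wedge: "base_zero v \<Longrightarrow> base_zero (wedge v w)"
proof -
  assume v: "base_zero v"
  have "mcoeff (fls_nth (v $ J * w $ K) N) (\<lambda>_. 0) = 0" for J K N
  proof -
    obtain d where d: "vb d (v $ J)" using vb_ex by blast
    obtain e where e: "vb e (w $ K)" using vb_ex by blast
    show ?thesis using v by (simp add: fls_times_nth_vb[OF d e] mcoeff_sum mcoeff_times_zero base_zero_def)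
  qed
  then show ?thesis
    by (simp add: base_zero_def wedge_nth fls_nth_sum mcoeff_sum mult.assoc mcoeff_sign)
qed

text \<open>Scaling is the product with a constant function, so the ideal property
  \<open>base_zero_wedge\<close> covers it.\<close>

lemma base_zero_scale: "base_zero w \<Longrightarrow> base_zero (fscale c w)" for w :: "'n::{finite,linorder} form"
  using base_zero_wedge[of w "form0 (emb c)"] wedge_even[OF even_form0[of "emb c"], of w]
  by (simp add: wedge_form0 fscale_def)

lemma base_zero_contract: "base_zero w \<Longrightarrow> base_zero (contract i w)"
  by (simp add: base_zero_def contract_nth mcoeff_sign zero_mps.rep_eq)

lemma berezin_single_base_zero: "base_zero w \<Longrightarrow> berezin_single j w = 0"
proof -
  assume w: "base_zero w"
  have "base_zero ((iota_Pi ^^ l) w)" for l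
    by (induction l) (auto simp: w iota_Pi_def intro!: base_zero_scale base_zero_sum base_zero_contract)
  moreover have "form_sigma v = 0" if "base_zero v" for v :: "'a form"
    by (rule fls_eqI) (use that in \<open>simp add: form_sigma_nth base_zero_def\<close>)
  ultimately show ?thesis by (simp add: berezin_single_def form_sigma_scale)
qed

section \<open>Traces of products of matrices of forms\<close>

lemma mf_mult_assoc: "mf_mult (mf_mult x y) z = mf_mult x (mf_mult y z)"
proof -
  have "(\<Sum>k\<in>UNIV. wedge (\<Sum>l\<in>UNIV. wedge (x $ i $ l) (y $ l $ k)) (z $ k $ j)) =
      (\<Sum>l\<in>UNIV. wedge (x $ i $ l) (\<Sum>k\<in>UNIV. wedge (y $ l $ k) (z $ k $ j)))" for i j
    unfolding wedge_lin wedge_assoc by (rule sum.swap)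
  then show ?thesis by (simp add: mf_mult_def vec_eq_iff del: sum_component)
qed

lemma mf_mult_one [simp]: "mf_mult (mat (form0 1)) x = x" "mf_mult x (mat (form0 1)) = x"
  by (simp_all add: mf_mult_def mat_def vec_eq_iff if_distrib[of "\<lambda>f. wedge f _"] if_distrib[of "wedge _"] wedge_lin cong: if_cong)

definition mprod :: "('n::{finite,linorder}, 'r::finite) mform list \<Rightarrow> ('n, 'r) mform" where
  "mprod T = foldr mf_mult T (mat (form0 1))"

definition mtr :: "('n::{finite,linorder}, 'r::finite) mform \<Rightarrow> 'n form" where
  "mtr x = (\<Sum>i\<in>UNIV. x $ i $ i)"

lemma mprod_simps [simp]: "mprod [] = mat (form0 1)" "mprod (x # T) = mf_mult x (mprod T)"
  by (simp_all add: mprod_def)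

lemma mprod_append [simp]: "mprod (T @ T') = mf_mult (mprod T) (mprod T')"
  by (induction T) (auto simp: mf_mult_assoc)

lemma trace_prod: "mf_trace_prod T = mtr (mprod T)"
  by (simp add: mf_trace_prod_def mtr_def mprod_def)

lemma trace_prod_merge: "mf_trace_prod (l @ mf_mult x y # l') = mf_trace_prod (l @ x # y # l')"
  by (simp add: trace_prod mf_mult_assoc)

definition even_mform where "even_mform x \<longleftrightarrow> (\<forall>i j. even_form (x $ i $ j))"
definition odd_mform where "odd_mform x \<longleftrightarrow> (\<forall>i j. odd_form (x $ i $ j))"

lemma trace_even: "even_mform x \<Longrightarrow> mtr (mf_mult y x) = mtr (mf_mult x y)"
  unfolding mtr_def mf_mult_def vec_lambda_beta
  by (subst sum.swap) (simp add: even_mform_def flip: wedge_even)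

text \<open>Graded cyclicity: \<open>x\<close> passes \<open>y\<close> at the cost of the parity of
  \<open>y\<close>, entry by entry.\<close>

lemma trace_odd: "odd_mform x \<Longrightarrow> mtr (mf_mult (mf_map grade y) x) = mtr (mf_mult x y)"
  unfolding mtr_def mf_mult_def vec_lambda_beta mf_map_def
  by (subst sum.swap) (simp add: odd_mform_def flip: wedge_odd)

lemma grade_mprod: "mf_map grade (mprod T) = mprod (map (mf_map grade) T)"
proof (induction T)
  case Nil show ?case by (simp add: mf_map_def mat_def vec_eq_iff grade_even even_form0 grade_lin)
next
  case (Cons x T)
  have "mf_map grade (mf_mult x y) = mf_mult (mf_map grade x) (mf_map grade y)" for x y :: "('a, 'b) mform"
    by (simp add: mf_mult_def mf_map_def vec_eq_iff grade_lin grade_wedge)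
  with Cons show ?case by simp
qed

lemma trace_prod_central:
  fixes l l' :: "('n::{finite,linorder}, 'r::finite) mform list"
  assumes "odd_form w"
  shows "mf_trace_prod (l @ mat w # l') = wedge w (mf_trace_prod (map (mf_map grade) l @ l'))"
proof -
  have "mf_mult x (mf_mult (mat w) y) = (\<chi> i j. wedge w (mf_mult (mf_map grade x) y $ i $ j))" for x y :: "('n, 'r) mform"
  proof -
    have "wedge a (wedge w b) = wedge w (wedge (grade a) b)" for a b
      using wedge_odd[OF assms, of "grade a"] by (simp flip: wedge_assoc)
    moreover have "mf_mult (mat w) y = (\<chi> i j. wedge w (y $ i $ j))"
      by (simp add: mf_mult_def mat_def vec_eq_iff if_distrib[of "\<lambda>f. wedge f _"] wedge_lin cong: if_cong)
    moreover have "mf_mult x (\<chi> i j. wedge w (y $ i $ j)) = (\<chi> i j. wedge w (mf_mult (mf_map grade x) y $ i $ j))"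
      by (simp add: mf_mult_def mf_map_def vec_eq_iff wedge_lin calculation(1))
    ultimately show ?thesis by simp
  qed
  then show ?thesis by (simp add: trace_prod mtr_def wedge_lin flip: grade_mprod)
qed

text \<open>Skew derivations relative to an automorphism \<open>g\<close>: Lie derivatives have
  \<open>g\<close> the identity, \<open>contract\<close> and \<open>de_rham\<close> have
  \<open>g = grade\<close>. One Leibniz rule for traces then serves all three.\<close>

definition gder :: "('n::{finite,linorder} form \<Rightarrow> 'n form) \<Rightarrow> ('n form \<Rightarrow> 'n form) \<Rightarrow> bool" where
  "gder g \<delta> \<longleftrightarrow> flin g \<and> flin \<delta> \<and> (\<forall>v w. g (wedge v w) = wedge (g v) (g w)) \<and> g (form0 1) = form0 1
     \<and> (\<forall>v w. \<delta> (wedge v w) = wedge (\<delta> v) w + wedge (g v) (\<delta> w)) \<and> \<delta> (form0 1) = 0"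

definition der_at :: "('n::{finite,linorder} form \<Rightarrow> 'n form) \<Rightarrow> ('n form \<Rightarrow> 'n form) \<Rightarrow> nat \<Rightarrow>
    ('n, 'r::finite) mform list \<Rightarrow> ('n, 'r) mform list" where
  "der_at g \<delta> a T = map (\<lambda>c. if c < a then mf_map g (T ! c) else if c = a then mf_map \<delta> (T ! c) else T ! c) [0..<length T]"

lemma length_der_at [simp]: "length (der_at g \<delta> a T) = length T" by (simp add: der_at_def)

lemma nth_der_at: "c < length T \<Longrightarrow> der_at g \<delta> a T ! c =
    (if c < a then mf_map g (T ! c) else if c = a then mf_map \<delta> (T ! c) else T ! c)"
  by (simp add: der_at_def)

lemma der_at_Cons: "der_at g \<delta> (Suc a) (x # T) = mf_map g x # der_at g \<delta> a T"
  "der_at g \<delta> 0 (x # T) = mf_map \<delta> x # T"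
  by (simp_all add: der_at_def map_upt_Suc map_nth del: upt_Suc)

lemma gder_trace_prod:
  assumes "gder g \<delta>"
  shows "\<delta> (mf_trace_prod T) = (\<Sum>a<length T. mf_trace_prod (der_at g \<delta> a T))"
proof -
  have lin: "flin g" "flin \<delta>" using assms by (auto simp: gder_def)
  have mult: "mf_map \<delta> (mf_mult x y) = mf_mult (mf_map \<delta> x) y + mf_mult (mf_map g x) (mf_map \<delta> y)" for x y :: "('a, 'b) mform"
    using assms by (simp add: gder_def mf_mult_def mf_map_def vec_eq_iff module_hom.sum[OF lin(2)] sum.distrib)
  have "mf_map \<delta> (mprod T) = (\<Sum>a<length T. mprod (der_at g \<delta> a T))"
  proof (induction T)
    case Nil
    have "\<delta> (form0 1) = 0" using assms by (simp add: gder_def)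
    then show ?case by (simp add: mf_map_def mat_def vec_eq_iff module_hom.zero[OF lin(2)])
  next
    case (Cons x T)
    have "mf_mult y (sum f S) = (\<Sum>a\<in>S. mf_mult y (f a))" for y f and S :: "nat set"
    proof -
      have "mf_mult y 0 = 0" by (simp add: mf_mult_def vec_eq_iff wedge_lin)
      moreover have "mf_mult y (u + v) = mf_mult y u + mf_mult y v" for u v
        using mlin_mult(1)[of y] by (auto simp: mlin_def)
      ultimately show ?thesis by (induction S rule: infinite_finite_induct) auto
    qed
    with Cons show ?case
      by (simp add: mult sum.lessThan_Suc_shift der_at_Cons del: sum.lessThan_Suc)
  qed
  moreover have "\<delta> (mtr x) = mtr (mf_map \<delta> x)" for x :: "('a, 'b) mform"
    by (simp add: mtr_def mf_map_def module_hom.sum[OF lin(2)])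
  moreover have "mtr (\<Sum>a\<in>S. f a) = (\<Sum>a\<in>S. mtr (f a))" for f :: "nat \<Rightarrow> ('a, 'b) mform" and S
    unfolding mtr_def sum_component by (rule sum.swap)
  ultimately show ?thesis by (simp add: trace_prod)
qed

lemma lie_one: "lie_deriv i (form0 1) = 0"
  by (simp add: lie_deriv_def form0_def vec_eq_iff) (metis emb_1 wderiv_emb)

lemma gder_lie: "gder (\<lambda>w. w) (lie_deriv i)"
  by (auto simp: gder_def flin_lie lie_deriv_wedge lie_one intro!: flinI)

lemma gder_contract: "gder grade (contract i)"
  by (auto simp: gder_def flin_contract flin_grade contract_wedge grade_wedge grade_even even_form0)
     (simp add: vec_eq_iff contract_nth form0_def)

lemma gder_de_rham: "gder grade de_rham"
  by (auto simp: gder_def flin_de_rham flin_grade de_rham_wedge grade_wedge grade_even even_form0)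
     (simp add: de_rham_dy lie_one wedge_lin)

section \<open>Polynomial differential operators on tensors\<close>

text \<open>The variable \<open>\<partial>_(a, i)\<close> of \<open>op_poly\<close> stands for \<open>\<L>_{\<partial>_i}\<close> in the tensor slot \<open>a\<close>; these operators
  commute, so that powers of \<open>\<partial>_P\<close> are computed in a polynomial ring.\<close>

type_synonym 'n op_poly = "((nat \<times> 'n coord) \<Rightarrow>\<^sub>0 nat) \<Rightarrow>\<^sub>0 complex"

definition Dvar :: "nat \<Rightarrow> 'n coord \<Rightarrow> 'n op_poly" where
  "Dvar a i = Poly_Mapping.single (Poly_Mapping.single (a, i) 1) 1"

definition Dconst :: "complex \<Rightarrow> 'n op_poly" where
  "Dconst c = Poly_Mapping.single 0 c"

lemma pm_sum_single: "(\<Sum>k\<in>Poly_Mapping.keys p. Poly_Mapping.single k (Poly_Mapping.lookup p k)) = p"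
  by (rule poly_mapping_eqI)
     (auto simp: lookup_sum lookup_single when_def not_in_keys_iff_lookup_eq_zero cong: if_cong)

text \<open>Monomials arise from constants by one variable at a time, which matches
  \<open>act_Dvar\<close>: each variable is one Lie derivative in one slot.\<close>

lemma op_induct [case_names const add var]:
  assumes c: "\<And>c. P (Dconst c)" and add: "\<And>p q. P p \<Longrightarrow> P q \<Longrightarrow> P (p + q)"
    and var: "\<And>a i p. P p \<Longrightarrow> P (Dvar a i * p)"
  shows "P p"
proof -
  have one: "P (Poly_Mapping.single (Poly_Mapping.single k e + m) c)" if "P (Poly_Mapping.single m c)" for k e m c
  proof (induction e)
    case 0 then show ?case using that by simp
  next
    case (Suc e)
    obtain a i where k: "k = (a, i)" by (cases k)
    have "Poly_Mapping.single k (Suc e) = Poly_Mapping.single k 1 + Poly_Mapping.single k e"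
      by (simp flip: single_add)
    then have "Poly_Mapping.single (Poly_Mapping.single k (Suc e) + m) c = Dvar a i * Poly_Mapping.single (Poly_Mapping.single k e + m) c"
      by (simp add: Dvar_def mult_single k add.assoc)
    then show ?case using var[OF Suc] by simp
  qed
  have "P (Poly_Mapping.single (\<Sum>k\<in>S. Poly_Mapping.single k (f k)) c)" for S f c
    by (induction S rule: infinite_finite_induct) (use c in \<open>auto simp: one Dconst_def\<close>)
  then have mono: "P (Poly_Mapping.single m c)" for m c
    using pm_sum_single[of m] by metis
  have "P (\<Sum>m\<in>S. Poly_Mapping.single m (f m))" for S f
    by (induction S rule: infinite_finite_induct) (use c[of 0] in \<open>auto simp: Dconst_def intro: add mono\<close>)
  then show ?thesis using pm_sum_single[of p] by metis
qed

lemma Dconst_mult: "Dconst (a * b) = Dconst a * Dconst b" by (simp add: Dconst_def mult_single)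
lemma Dconst_add: "Dconst (a + b) = Dconst a + Dconst b" by (simp add: Dconst_def single_add)
lemma Dconst_1 [simp]: "Dconst 1 = 1" by (simp add: Dconst_def)
lemma Dconst_0 [simp]: "Dconst 0 = 0" by (simp add: Dconst_def)
lemma Dconst_neg: "Dconst (- a) = - Dconst a" by (simp add: Dconst_def single_uminus)
lemma Dconst_of_nat: "Dconst (of_nat k) = of_nat k" by (simp add: Dconst_def)

text \<open>The mixed derivative of multi-order \<open>e\<close> in closed form, with Pochhammer
  symbols collecting the factors; it makes the action of a monomial independent of any order of the
  variables.\<close>

lift_definition mder :: "('v::finite \<Rightarrow> nat) \<Rightarrow> 'v mps \<Rightarrow> 'v mps"
  is "\<lambda>e f y. (\<Prod>i\<in>UNIV. pochhammer (of_nat (y i) + 1) (e i)) * f (\<lambda>i. y i + e i)" .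

lemma mder_0 [simp]: "mder e 0 = 0" by (rule mps_eqI) (simp add: mder.rep_eq zero_mps.rep_eq)

lemma mder_Suc: "mder (e(i := Suc (e i))) f = mder e (mderiv i f)"
proof (rule mps_eqI)
  fix y :: "'a \<Rightarrow> nat"
  have "(\<Prod>j\<in>UNIV. pochhammer (of_nat (y j) + 1) ((e(i := Suc (e i))) j)) =
     of_nat (y i + e i + 1) * (\<Prod>j\<in>UNIV. pochhammer (of_nat (y j) + 1 :: complex) (e j))"
  proof -
    have "(\<Prod>j\<in>UNIV. pochhammer (of_nat (y j) + 1 :: complex) ((e(i := Suc (e i))) j)) =
       pochhammer (of_nat (y i) + 1) (Suc (e i)) * (\<Prod>j\<in>UNIV - {i}. pochhammer (of_nat (y j) + 1) (e j))"
      by (subst prod.remove[of _ i]) auto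
    then show ?thesis
      by (subst (2) prod.remove[of _ i]) (auto simp: pochhammer_Suc algebra_simps)
  qed
  moreover have "(\<lambda>j. y j + (e(i := Suc (e i))) j) = (\<lambda>j. y j + e j)(i := y i + e i + 1)"
    by auto
  ultimately show "mcoeff (mder (e(i := Suc (e i))) f) y = mcoeff (mder e (mderiv i f)) y"
    by (simp add: mder.rep_eq mderiv.rep_eq mult_ac)
qed

definition form_der :: "('n::finite coord \<Rightarrow> nat) \<Rightarrow> 'n form \<Rightarrow> 'n form" where
  "form_der e w = (\<chi> I. fls_map (mder e) (w $ I))"

lemma form_der_Suc: "form_der (e(i := Suc (e i))) w = form_der e (lie_deriv i w)"
  by (simp add: form_der_def lie_deriv_def vec_eq_iff) (auto intro!: fls_eqI simp: mder_Suc)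

lemma form_der_0: "form_der (\<lambda>_. 0) w = w"
proof -
  have "mder (\<lambda>_. 0) f = f" for f :: "'a coord mps" by (rule mps_eqI) (simp add: mder.rep_eq)
  then show ?thesis by (simp add: form_der_def vec_eq_iff) (auto intro!: fls_eqI)
qed

definition op_mono :: "((nat \<times> 'n coord) \<Rightarrow>\<^sub>0 nat) \<Rightarrow> ('n::{finite,linorder}, 'r::finite) mform list \<Rightarrow> 'n form" where
  "op_mono m T = mf_trace_prod
     (map (\<lambda>a. mf_map (form_der (\<lambda>i. Poly_Mapping.lookup m (a, i))) (T ! a)) [0..<length T])"

text \<open>The tensor stays a list and the trace of the product is included: applying an operator
  gives a sum of tensors, of which only the trace is ever used.\<close>

definition act :: "'n op_poly \<Rightarrow> ('n::{finite,linorder}, 'r::finite) mform list \<Rightarrow> 'n form" where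
  "act p T = (\<Sum>m\<in>Poly_Mapping.keys p. fscale (fls_const (Poly_Mapping.lookup p m)) (op_mono m T))"

lemma act_superset:
  "finite S \<Longrightarrow> Poly_Mapping.keys p \<subseteq> S \<Longrightarrow>
    act p T = (\<Sum>m\<in>S. fscale (fls_const (Poly_Mapping.lookup p m)) (op_mono m T))"
  unfolding act_def by (rule sum.mono_neutral_left) (auto simp: in_keys_iff)

lemma fls_const_add: "fls_const (a + b) = fls_const a + fls_const (b :: complex)"
  by (simp add: fls_plus_const)
lemma fls_const_mult: "fls_const (a * b) = fls_const a * fls_const (b :: complex)"
  by (simp add: fls_const_mult_const)

lemma act_add: "act (p + q) T = act p T + act q T"
proof -
  let ?S = "Poly_Mapping.keys p \<union> Poly_Mapping.keys q"
  show ?thesis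
    by (simp add: act_superset[of ?S] keys_add lookup_add fls_const_add fs.scale_left_distrib sum.distrib)
qed

lemma act_0 [simp]: "act 0 T = 0" by (simp add: act_def)
lemma act_sum: "act (sum f S) T = (\<Sum>x\<in>S. act (f x) T)"
  by (induction S rule: infinite_finite_induct) (auto simp: act_add)

lemma act_single: "act (Poly_Mapping.single m c) T = fscale (fls_const c) (op_mono m T)"
  by (simp add: act_superset[of "{m}"])

lemma act_Dconst_mult: "act (Dconst c * p) T = fscale (fls_const c) (act p T)"
proof -
  have "Dconst c * p = (\<Sum>m\<in>Poly_Mapping.keys p. Poly_Mapping.single m (c * Poly_Mapping.lookup p m))"
    using arg_cong[OF pm_sum_single[of p], of "(*) (Dconst c)", symmetric]
    by (simp add: Dconst_def sum_distrib_left mult_single)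
  then show ?thesis
    unfolding act_def[of p] by (simp only: act_sum act_single fs.scale_sum_right fls_const_mult fs.scale_scale)
qed

lemma act_one: "act 1 T = mf_trace_prod T"
proof -
  have "op_mono 0 T = mf_trace_prod T"
  proof -
    have "mf_map (form_der (\<lambda>_. 0)) x = x" for x :: "('a, 'b) mform"
      by (simp add: mf_map_def form_der_0 vec_eq_iff)
    then show ?thesis by (simp add: op_mono_def map_nth)
  qed
  then show ?thesis using act_single[of 0 1 T] by simp
qed

lemma act_Dconst: "act (Dconst c) T = fscale (fls_const c) (mf_trace_prod T)"
  using act_Dconst_mult[of c 1] by (simp add: act_one)

text \<open>For a slot beyond the list both sides ignore the variable: \<open>op_mono\<close> visits
  only existing slots, and the list update is void.\<close>

lemma act_Dvar: "act (Dvar a i * p) T = act p (T[a := mf_map (lie_deriv i) (T ! a)])"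
proof -
  have "op_mono (Poly_Mapping.single (a, i) 1 + m) T = op_mono m (T[a := mf_map (lie_deriv i) (T ! a)])" for m
  proof -
    have "mf_map (form_der (\<lambda>j. Poly_Mapping.lookup (Poly_Mapping.single (a, i) 1 + m) (c, j))) (T ! c) =
        mf_map (form_der (\<lambda>j. Poly_Mapping.lookup m (c, j))) (T[a := mf_map (lie_deriv i) (T ! a)] ! c)"
      if "c < length T" for c
    proof (cases "c = a")
      case True
      have "(\<lambda>j. Poly_Mapping.lookup (Poly_Mapping.single (a, i) 1 + m) (a, j)) =
          (\<lambda>j. Poly_Mapping.lookup m (a, j))(i := Suc (Poly_Mapping.lookup m (a, i)))"
        by (auto simp: lookup_add lookup_single when_def)
      then show ?thesis
        using True that by (simp add: form_der_Suc[of "\<lambda>j. Poly_Mapping.lookup m (a, j)" i] mf_map_def)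
    next
      case False
      then show ?thesis by (simp add: lookup_add lookup_single when_def)
    qed
    then show ?thesis by (auto simp: op_mono_def intro!: arg_cong[where f = mf_trace_prod])
  qed
  moreover have "Dvar a i * p = (\<Sum>m\<in>Poly_Mapping.keys p.
      Poly_Mapping.single (Poly_Mapping.single (a, i) 1 + m) (Poly_Mapping.lookup p m))"
    using arg_cong[OF pm_sum_single[of p], of "(*) (Dvar a i)", symmetric]
    by (simp add: Dvar_def sum_distrib_left mult_single)
  ultimately show ?thesis unfolding act_def[of p] by (simp only: act_sum act_single)
qed

lemma act_slot:
  "mslot g \<Longrightarrow> act p (g (x + y)) = act p (g x) + act p (g y)
     \<and> act p (g (mscale c x)) = fscale c (act p (g x))"
proof (induction p arbitrary: g rule: op_induct)
  case (const d)
  then obtain l l' h where h: "mlin h" "\<And>a. g a = l @ h a # l'" by (auto simp: mslot_def)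
  then show ?case by (simp add: mlin_def act_Dconst tp_lin fs.scale_right_distrib mult.commute)
next
  case (add p q)
  then show ?case by (simp add: act_add fs.scale_right_distrib algebra_simps)
next
  case (var a i p)
  show ?case
    using var.IH[OF mslot_upd[OF var.prems mlin_lie]] by (simp add: act_Dvar)
qed

lemma mslot_mid: "mslot (\<lambda>x. l @ x # l')"
  by (rule mslotI[of "\<lambda>x. x"]) auto

lemmas act_mid_add = act_slot[OF mslot_mid, THEN conjunct1]
lemmas act_mid_scale = act_slot[OF mslot_mid, THEN conjunct2]

lemma act_mid_0: "act p (l @ 0 # l') = 0"
  using act_mid_add[of p l 0 0 l'] by simp

lemma act_mid_sum: "act p (l @ sum f S # l') = (\<Sum>x\<in>S. act p (l @ f x # l'))"
  by (induction S rule: infinite_finite_induct) (auto simp: act_mid_add act_mid_0)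

text \<open>A derivation that commutes with Lie derivatives is compatible with the differentiations
  in the slots, so the Leibniz rule for the trace carries over.\<close>

lemma gder_act:
  assumes g: "gder g \<delta>" and c: "\<And>i w. g (lie_deriv i w) = lie_deriv i (g w)" "\<And>i w. \<delta> (lie_deriv i w) = lie_deriv i (\<delta> w)"
  shows "\<delta> (act p T) = (\<Sum>a<length T. act p (der_at g \<delta> a T))"
proof (induction p arbitrary: T rule: op_induct)
  case (const d)
  have "flin \<delta>" using g by (simp add: gder_def)
  then show ?case by (simp add: act_Dconst module_hom.scale gder_trace_prod[OF g] fs.scale_sum_right)
next
  case (add p q)
  have "flin \<delta>" using g by (simp add: gder_def)
  then show ?case using add by (simp add: act_add module_hom.add sum.distrib)
next
  case (var b i p)
  have "der_at g \<delta> a (T[b := mf_map (lie_deriv i) (T ! b)]) = (der_at g \<delta> a T)[b := mf_map (lie_deriv i) (der_at g \<delta> a T ! b)]" for a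
  proof (rule nth_equalityI)
    fix k assume "k < length (der_at g \<delta> a (T[b := mf_map (lie_deriv i) (T ! b)]))"
    then show "der_at g \<delta> a (T[b := mf_map (lie_deriv i) (T ! b)]) ! k =
        (der_at g \<delta> a T)[b := mf_map (lie_deriv i) (der_at g \<delta> a T ! b)] ! k"
      by (cases "k = b") (auto simp: nth_der_at mf_map_def c vec_eq_iff)
  qed simp
  then show ?case by (simp add: act_Dvar var)
qed

lemma lie_act: "lie_deriv i (act p T) = (\<Sum>a<length T. act (Dvar a i * p) T)"
proof -
  have "der_at (\<lambda>w. w) (lie_deriv i) a T = T[a := mf_map (lie_deriv i) (T ! a)]" for a
  proof (rule nth_equalityI)
    fix k assume "k < length (der_at (\<lambda>w. w) (lie_deriv i) a T)"
    then show "der_at (\<lambda>w. w) (lie_deriv i) a T ! k = T[a := mf_map (lie_deriv i) (T ! a)] ! k"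
      by (cases "k = a") (auto simp: nth_der_at mf_map_def vec_eq_iff)
  qed simp
  then show ?thesis
    by (simp add: gder_act[OF gder_lie] lie_deriv_commute[of i] act_Dvar)
qed

lemma grade_lie: "grade (lie_deriv i w) = lie_deriv i (grade w)"
  by (simp add: grade_def lie_deriv_def vec_eq_iff wderiv_sign)

text \<open>The symbol of the exponent for \<open>N\<close> slots. The propagator is an arbitrary
  function, so that lifted, rotated and limiting propagators can be used in its place.\<close>

definition propagator_poly :: "(nat \<Rightarrow> nat \<Rightarrow> complex) \<Rightarrow> nat \<Rightarrow> 'n::finite op_poly" where
  "propagator_poly P N = (\<Sum>(a, b) | a < N \<and> b < N \<and> a \<noteq> b. \<Sum>i\<in>UNIV. \<Sum>j\<in>UNIV.
      Dconst (1 / 2 * (P a b * omega i j)) * (Dvar a i * Dvar b j))"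

lemma propagator_poly_mult: "propagator_poly P N * s = (\<Sum>(a, b) | a < N \<and> b < N \<and> a \<noteq> b. \<Sum>i\<in>UNIV. \<Sum>j\<in>UNIV.
      Dconst (1 / 2 * (P a b * omega i j)) * (Dvar a i * (Dvar b j * s)))"
  by (simp add: propagator_poly_def sum_distrib_right mult.assoc case_prod_unfold)

lemma tr_dP_act: "tr_dP \<theta> k T = act (propagator_poly (propagator \<theta>) (length T) ^ k) T"
proof (induction k arbitrary: T)
  case (Suc k)
  show ?case
    unfolding tr_dP.simps half_fls power_Suc propagator_poly_mult act_sum case_prod_unfold fs.scale_sum_right
    by (intro sum.cong refl) (clarsimp simp: Suc.IH act_Dconst_mult act_Dvar)
qed (simp add: act_one)

section \<open>Collisions: merging two neighbouring slots\<close>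

definition moyal_poly :: "nat \<Rightarrow> 'n::finite op_poly" where
  "moyal_poly a = (\<Sum>i\<in>UNIV. \<Sum>j\<in>UNIV. Dconst (1 / 2 * omega i j) * (Dvar a i * Dvar (Suc a) j))"

lemma moyal_poly_mult: "moyal_poly a * s =
    (\<Sum>i\<in>UNIV. \<Sum>j\<in>UNIV. Dconst (1 / 2 * omega i j) * (Dvar a i * (Dvar (Suc a) j * s)))"
  by (simp add: moyal_poly_def sum_distrib_right mult.assoc)

text \<open>The coefficient of \<open>hbar ^ k\<close> in the Moyal product, with 1/k! included. The
  recursion peels off one contraction, as one factor \<open>moyal_poly\<close> does.\<close>

primrec mf_moyal :: "nat \<Rightarrow> ('n::{finite,linorder}, 'r::finite) mform \<Rightarrow> ('n, 'r) mform \<Rightarrow> ('n, 'r) mform" where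
  "mf_moyal 0 x y = mf_mult x y"
| "mf_moyal (Suc k) x y = mscale (fls_const (1 / of_nat (Suc k))) (\<Sum>i\<in>UNIV. \<Sum>j\<in>UNIV.
     mscale (fls_const (1 / 2 * omega i j)) (mf_moyal k (mf_map (lie_deriv i) x) (mf_map (lie_deriv j) y)))"

text \<open>A relation between operators, closed under sums, constants and the variables matched by
  \<open>merge_var\<close>; this is how it passes to powers of propagator polynomials.\<close>

definition merges_to :: "nat \<Rightarrow> 'n::{finite,linorder} op_poly \<Rightarrow> 'n op_poly \<Rightarrow> 'r::finite itself \<Rightarrow> bool" where
  "merges_to a s s' R \<longleftrightarrow> (\<forall>l l' x (y :: ('n, 'r) mform). length l = a \<longrightarrow>
      act s (l @ x # y # l') = act s' (l @ mf_mult x y # l'))"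

text \<open>The Leibniz rule: a derivative of the merged slot \<open>a\<close> acts on either
  factor, and the numbering of later slots is shifted by one.\<close>

definition merge_var :: "nat \<Rightarrow> nat \<Rightarrow> 'n coord \<Rightarrow> 'n op_poly" where
  "merge_var a c i = (if c < a then Dvar c i else if c = a then Dvar a i + Dvar (Suc a) i else Dvar (Suc c) i)"

lemma merges_to_one: "merges_to a 1 1 R"
  by (simp add: merges_to_def act_one trace_prod_merge)

lemma merges_to_add: "merges_to a s s' R \<Longrightarrow> merges_to a t t' R \<Longrightarrow> merges_to a (s + t) (s' + t') R"
  by (simp add: merges_to_def act_add)
lemma merges_to_0: "merges_to a 0 0 R" by (simp add: merges_to_def)
lemma merges_to_sum: "(\<And>x. x \<in> S \<Longrightarrow> merges_to a (s x) (s' x) R) \<Longrightarrow> merges_to a (sum s S) (sum s' S) R"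
  by (induction S rule: infinite_finite_induct) (auto intro: merges_to_add merges_to_0)
lemma merges_to_const: "merges_to a s s' R \<Longrightarrow> merges_to a (Dconst c * s) (Dconst c * s') R"
  by (simp add: merges_to_def act_Dconst_mult)

lemma mf_map_lie_mult: "mf_map (lie_deriv i) (mf_mult x y) = mf_mult (mf_map (lie_deriv i) x) y + mf_mult x (mf_map (lie_deriv i) y)"
  by (simp add: mf_mult_def mf_map_def vec_eq_iff lie_lin lie_deriv_wedge sum.distrib)

lemma merges_to_var:
  assumes "merges_to a s s' R"
  shows "merges_to a (merge_var a c i * s) (Dvar c i * s') R"
  unfolding merges_to_def
proof (intro allI impI)
  fix l l' :: "('a, 'b) mform list" and x y :: "('a, 'b) mform" assume l: "length l = a"
  have m: "act s (l @ x # y # l') = act s' (l @ mf_mult x y # l')" if "length l = a"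
    for l l' :: "('a, 'b) mform list" and x y :: "('a, 'b) mform"
    using assms that by (auto simp: merges_to_def)
  consider "c < a" | "c = a" | k where "c = Suc (a + k)"
    by (metis less_imp_Suc_add linorder_neqE_nat)
  then show "act (merge_var a c i * s) (l @ x # y # l') = act (Dvar c i * s') (l @ mf_mult x y # l')"
  proof cases
    case 1
    then show ?thesis
      using m[of "l[c := mf_map (lie_deriv i) (l ! c)]" x y l'] l
      by (simp add: merge_var_def act_Dvar list_update_append nth_append)
  next
    case 2
    then show ?thesis
      using m[OF l, of "mf_map (lie_deriv i) x" y l'] m[OF l, of x "mf_map (lie_deriv i) y" l'] l
      by (simp add: merge_var_def act_Dvar distrib_right act_add list_update_append nth_append mf_map_lie_mult act_mid_add)
  next
    case 3
    then show ?thesis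
      using m[OF l, of x y "l'[k := mf_map (lie_deriv i) (l' ! k)]"] l
      by (simp add: merge_var_def act_Dvar list_update_append nth_append)
  qed
qed

text \<open>Each factor \<open>moyal_poly\<close> differentiates the two factors before they are
  multiplied. The factorial undoes the 1/k! in \<open>mf_moyal\<close>.\<close>

lemma merges_to_moyal:
  fixes x y :: "('n::{finite,linorder}, 'r::finite) mform"
  assumes "merges_to a s s' TYPE('r)" "length l = a"
  shows "act (moyal_poly a ^ k * s) (l @ x # y # l') = fscale (fls_const (fact k)) (act s' (l @ mf_moyal k x y # l'))"
proof (induction k arbitrary: x y)
  case 0
  then show ?case using assms by (simp add: merges_to_def)
next
  case (Suc k)
  have "act (moyal_poly a ^ Suc k * s) (l @ x # y # l') = (\<Sum>i\<in>UNIV. \<Sum>j\<in>UNIV. fscale (fls_const (1 / 2 * omega i j))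
      (fscale (fls_const (fact k)) (act s' (l @ mf_moyal k (mf_map (lie_deriv i) x) (mf_map (lie_deriv j) y) # l'))))"
  proof -
    have "moyal_poly a ^ Suc k * s = (\<Sum>i\<in>UNIV. \<Sum>j\<in>UNIV. Dconst (1 / 2 * omega i j) * (Dvar a i * (Dvar (Suc a) j * (moyal_poly a ^ k * s))))"
      unfolding power_Suc mult.assoc by (rule moyal_poly_mult)
    then show ?thesis
      using assms(2) by (simp add: act_sum act_Dconst_mult act_Dvar list_update_append nth_append Suc.IH)
  qed
  also have "\<dots> = fscale (fls_const (fact (Suc k))) (act s' (l @ mf_moyal (Suc k) x y # l'))"
  proof -
    have "(1 / 2 * c) * fact k = fact (Suc k) * (1 / of_nat (Suc k)) * (1 / 2 * c)" for c :: complex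
      by (simp add: field_simps del: of_nat_Suc)
    then have "fls_const (1 / 2 * c) * fls_const (fact k) =
        fls_const (fact (Suc k)) * fls_const (1 / of_nat (Suc k)) * fls_const (1 / 2 * c)" for c :: complex
      by (simp only: flip: fls_const_mult)
    then show ?thesis
      by (simp only: mf_moyal.simps act_mid_scale act_mid_sum fs.scale_sum_right fs.scale_scale mult.assoc)
  qed
  finally show ?case .
qed

definition collapse :: "nat \<Rightarrow> nat \<Rightarrow> nat" where
  "collapse a c = (if c \<le> a then c else c - 1)"

lemma merge_var_collapse:
  assumes "a < N"
  shows "c < N \<Longrightarrow> merge_var a c i = (\<Sum>x | x < Suc N \<and> collapse a x = c. Dvar x i)"
proof -
  assume c: "c < N"
  have "{x. x < Suc N \<and> collapse a x = c} = (if c < a then {c} else if c = a then {a, Suc a} else {Suc c})"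
    using c assms by (auto simp: collapse_def split: if_splits)
  then show ?thesis by (simp add: merge_var_def)
qed

text \<open>Two points at the same place see every third point alike, so the pairs can be grouped by
  their images under \<open>collapse\<close>, and each fibre sums to derivatives of the merged slot.
  Only the two pairs inside \<open>{a, Suc a}\<close> are lost; with values 1/2 and -1/2 they make
  up \<open>moyal_poly a\<close>.\<close>

lemma propagator_poly_merge:
  fixes P P' :: "nat \<Rightarrow> nat \<Rightarrow> complex"
  assumes a: "Suc a < Suc N"
    and P: "P a (Suc a) = 1 / 2" "P (Suc a) a = - 1 / 2"
    and eq: "\<And>x y. x < Suc N \<Longrightarrow> y < Suc N \<Longrightarrow> collapse a x \<noteq> collapse a y \<Longrightarrow> P x y = P' (collapse a x) (collapse a y)"
  shows "merges_to a ((propagator_poly P (Suc N) - moyal_poly a) ^ k)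
     (propagator_poly P' N ^ k :: 'n::{finite,linorder} op_poly) R"
proof -
  define K where "K f = (\<Sum>i\<in>UNIV. \<Sum>j\<in>UNIV. Dconst (1 / 2 * omega i j) * f i j)"
    for f :: "'n coord \<Rightarrow> 'n coord \<Rightarrow> 'n op_poly"
  have Kc: "Dconst c * K f = K (\<lambda>i j. Dconst c * f i j)" for c f
    by (simp add: K_def sum_distrib_left mult.left_commute)
  have Ks: "(\<Sum>x\<in>S. K (f x)) = K (\<lambda>i j. \<Sum>x\<in>S. f x i j)" for f and S :: "(nat \<times> nat) set"
    unfolding K_def sum_distrib_left by (subst sum.swap, rule sum.cong[OF refl], subst sum.swap) simp
  have pp: "propagator_poly Q M = (\<Sum>(x, y) | x < M \<and> y < M \<and> x \<noteq> y. Dconst (Q x y) * K (\<lambda>i j. Dvar x i * Dvar y j))" for Q M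
  proof -
    have d: "Dconst (1 / 2 * (q * w)) = Dconst q * Dconst (1 / 2 * w)" for q w
      by (simp only: Dconst_mult[symmetric]) simp
    show ?thesis
      by (simp only: propagator_poly_def d K_def case_prod_unfold sum_distrib_left mult.assoc)
  qed
  have fin: "finite {(x, y). x < M \<and> y < M \<and> Q x y}" for M :: nat and Q
    by (rule finite_subset[of _ "{..<M} \<times> {..<M}"]) auto
  define A where "A = {(x, y). x < Suc N \<and> y < Suc N \<and> collapse a x \<noteq> collapse a y}"
  define C where "C = (\<lambda>(x, y). (collapse a x, collapse a y))"
  have finA: "finite A" unfolding A_def by (rule fin)
  have split: "{(x, y). x < Suc N \<and> y < Suc N \<and> x \<noteq> y} = A \<union> {(a, Suc a), (Suc a, a)}"
    using a by (auto simp: A_def collapse_def split: if_splits)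
  \<comment> \<open>The reversed pair has the opposite contraction and also the opposite propagator
    value, so both orders contribute the same.\<close>
  have sw: "K (\<lambda>i j. Dvar (Suc a) i * Dvar a j) = - K (\<lambda>i j. Dvar a i * Dvar (Suc a) j)"
  proof -
    have "K (\<lambda>i j. Dvar (Suc a) i * Dvar a j) = (\<Sum>i\<in>UNIV. \<Sum>j\<in>UNIV. Dconst (1 / 2 * omega j i) * (Dvar (Suc a) j * Dvar a i))"
      unfolding K_def by (rule sum.swap)
    also have "\<dots> = (\<Sum>i\<in>UNIV. \<Sum>j\<in>UNIV. - (Dconst (1 / 2 * omega i j) * (Dvar a i * Dvar (Suc a) j)))"
    proof (intro sum.cong refl)
      fix i j :: "'n coord"
      show "Dconst (1 / 2 * omega j i) * (Dvar (Suc a) j * Dvar a i) = - (Dconst (1 / 2 * omega i j) * (Dvar a i * Dvar (Suc a) j))"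
        unfolding omega_antisym[of j i] by (simp add: Dconst_neg mult.commute)
    qed
    finally show ?thesis by (simp add: K_def sum_negf)
  qed
  have psi: "moyal_poly a = K (\<lambda>i j. Dvar a i * Dvar (Suc a) j)" by (simp add: K_def moyal_poly_def)
  have disj: "A \<inter> {(a, Suc a), (Suc a, a)} = {}" by (auto simp: A_def collapse_def)
  have half: "Dconst (1 / 2) * x + Dconst (1 / 2) * x = (x :: 'n op_poly)" for x
    by (simp flip: distrib_right Dconst_add)
  have "propagator_poly P (Suc N) = (\<Sum>(x, y)\<in>A. Dconst (P x y) * K (\<lambda>i j. Dvar x i * Dvar y j)) + moyal_poly a"
    unfolding pp split
    by (subst sum.union_disjoint[OF finA _ disj]) (simp_all add: P sw psi Dconst_neg half)
  then have "propagator_poly P (Suc N) - moyal_poly a =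
      (\<Sum>(x, y)\<in>A. Dconst (P x y) * K (\<lambda>i j. Dvar x i * Dvar y j))" by simp
  also have "\<dots> = (\<Sum>(c, d) | c < N \<and> d < N \<and> c \<noteq> d. \<Sum>xy | xy \<in> A \<and> C xy = (c, d).
      Dconst (P (fst xy) (snd xy)) * K (\<lambda>i j. Dvar (fst xy) i * Dvar (snd xy) j))"
  proof -
    define h where "h xy = Dconst (P (fst xy) (snd xy)) * K (\<lambda>i j. Dvar (fst xy) i * Dvar (snd xy) j)" for xy
    have sub: "C ` A \<subseteq> {(c, d). c < N \<and> d < N \<and> c \<noteq> d}"
    proof
      fix q assume "q \<in> C ` A"
      then obtain x y where xy: "x < Suc N" "y < Suc N" "collapse a x \<noteq> collapse a y" "q = (collapse a x, collapse a y)"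
        by (auto simp: A_def C_def)
      have "collapse a x < N" if "x < Suc N" for x using that a by (auto simp: collapse_def)
      with xy show "q \<in> {(c, d). c < N \<and> d < N \<and> c \<noteq> d}" by auto
    qed
    have "(\<Sum>(x, y)\<in>A. Dconst (P x y) * K (\<lambda>i j. Dvar x i * Dvar y j)) = (\<Sum>xy\<in>A. h xy)"
      by (simp add: h_def case_prod_unfold)
    also have "\<dots> = (\<Sum>q\<in>{(c, d). c < N \<and> d < N \<and> c \<noteq> d}. \<Sum>xy | xy \<in> A \<and> C xy = q. h xy)"
      by (rule sum.group[OF finA fin sub, symmetric])
    also have "\<dots> = (\<Sum>(c, d) | c < N \<and> d < N \<and> c \<noteq> d. \<Sum>xy | xy \<in> A \<and> C xy = (c, d). h xy)"
      by (rule sum.cong[OF refl]) auto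
    finally show ?thesis by (simp only: h_def)
  qed
  also have "\<dots> = (\<Sum>(c, d) | c < N \<and> d < N \<and> c \<noteq> d. Dconst (P' c d) * K (\<lambda>i j. merge_var a c i * merge_var a d j))"
  proof (rule sum.cong[OF refl], clarify)
    fix c d assume cd: "c < N" "d < N" "c \<noteq> d"
    \<comment> \<open>The fibre is a product of two fibres of \<open>collapse\<close>, so the double
      sum factors into two variables \<open>merge_var\<close>.\<close>
    have set: "{xy. xy \<in> A \<and> C xy = (c, d)} = {x. x < Suc N \<and> collapse a x = c} \<times> {x. x < Suc N \<and> collapse a x = d}"
      using cd by (auto simp: A_def C_def)
    have "(\<Sum>xy | xy \<in> A \<and> C xy = (c, d). Dconst (P (fst xy) (snd xy)) * K (\<lambda>i j. Dvar (fst xy) i * Dvar (snd xy) j)) =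
        (\<Sum>xy | xy \<in> A \<and> C xy = (c, d). Dconst (P' c d) * K (\<lambda>i j. Dvar (fst xy) i * Dvar (snd xy) j))"
      by (rule sum.cong[OF refl]) (auto simp: A_def C_def eq)
    also have "\<dots> = Dconst (P' c d) * K (\<lambda>i j. merge_var a c i * merge_var a d j)"
      unfolding sum_distrib_left[symmetric] Ks set
      using a cd by (simp add: merge_var_collapse[of a N] sum_product sum.cartesian_product case_prod_unfold)
    finally show "(\<Sum>xy | xy \<in> A \<and> C xy = (c, d). Dconst (P (fst xy) (snd xy)) * K (\<lambda>i j. Dvar (fst xy) i * Dvar (snd xy) j)) =
       Dconst (P' c d) * K (\<lambda>i j. merge_var a c i * merge_var a d j)" .
  qed
  finally have rho: "propagator_poly P (Suc N) - moyal_poly a = \<dots>" .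
  have step: "merges_to a (Dconst (P' c d) * K (\<lambda>i j. merge_var a c i * merge_var a d j) * s)
      (Dconst (P' c d) * K (\<lambda>i j. Dvar c i * Dvar d j) * s') R" if "merges_to a s s' R" for c d s s' R
  proof -
    have "Dconst (P' c d) * K (\<lambda>i j. X i * Y j) * t = Dconst (P' c d) * (\<Sum>i\<in>UNIV. \<Sum>j\<in>UNIV. Dconst (1 / 2 * omega i j) * (X i * (Y j * t)))"
      for X Y t by (simp add: K_def sum_distrib_right mult.assoc)
    then show ?thesis
      by (simp only:) (intro merges_to_const merges_to_sum merges_to_var that)
  qed
  show ?thesis
  proof (induction k)
    case 0 then show ?case by (simp add: merges_to_one)
  next
    case (Suc k)
    show ?case
      unfolding power_Suc rho pp[of P'] sum_distrib_right case_prod_unfold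
      by (intro merges_to_sum step Suc[unfolded rho pp[of P'] case_prod_unfold])
  qed
qed

text \<open>\<open>moyal_poly\<close> commutes with the rest, and the binomial theorem makes each
  term of the exponential a Cauchy product: \<open>i\<close> contractions inside the pair,
  \<open>k - i\<close> of the merged tensor.\<close>

lemma act_collision:
  fixes x y :: "('n::{finite,linorder}, 'r::finite) mform" and P P' :: "nat \<Rightarrow> nat \<Rightarrow> complex"
  assumes a: "length l = a" and N: "N = Suc (length l + length l')"
    and P: "P a (Suc a) = 1 / 2" "P (Suc a) a = - 1 / 2"
    and eq: "\<And>x y. x < Suc N \<Longrightarrow> y < Suc N \<Longrightarrow> collapse a x \<noteq> collapse a y \<Longrightarrow> P x y = P' (collapse a x) (collapse a y)"
  shows "fscale (hbar ^ k / fact k) (act (propagator_poly P (Suc N) ^ k) (l @ x # y # l')) =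
    (\<Sum>i\<le>k. fscale (hbar ^ (k - i) / fact (k - i)) (act (propagator_poly P' N ^ (k - i)) (l @ mscale (hbar ^ i) (mf_moyal i x y) # l')))"
proof -
  define \<rho> :: "'n op_poly" where "\<rho> = propagator_poly P (Suc N) - moyal_poly a"
  have aN: "Suc a < Suc N" using a N by simp
  have m: "merges_to a (\<rho> ^ j) (propagator_poly P' N ^ j) TYPE('r)" for j
    unfolding \<rho>_def by (rule propagator_poly_merge[OF aN P eq])
  have "propagator_poly P (Suc N) = moyal_poly a + \<rho>" by (simp add: \<rho>_def)
  then have "propagator_poly P (Suc N) ^ k = (\<Sum>i\<le>k. of_nat (k choose i) * moyal_poly a ^ i * \<rho> ^ (k - i))"
    by (simp only: binomial_ring)
  then have "propagator_poly P (Suc N) ^ k = (\<Sum>i\<le>k. Dconst (of_nat (k choose i)) * (moyal_poly a ^ i * \<rho> ^ (k - i)))"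
    by (simp only: Dconst_of_nat mult.assoc)
  then have "fscale (hbar ^ k / fact k) (act (propagator_poly P (Suc N) ^ k) (l @ x # y # l')) =
     (\<Sum>i\<le>k. fscale (hbar ^ k / fact k * fls_const (of_nat (k choose i) * fact i)) (act (propagator_poly P' N ^ (k - i)) (l @ mf_moyal i x y # l')))"
    by (simp only: act_sum act_Dconst_mult merges_to_moyal[OF m a] fs.scale_sum_right fs.scale_scale fls_const_mult mult.assoc)
  also have "\<dots> = (\<Sum>i\<le>k. fscale (hbar ^ (k - i) / fact (k - i)) (act (propagator_poly P' N ^ (k - i)) (l @ mscale (hbar ^ i) (mf_moyal i x y) # l')))"
  proof (rule sum.cong[OF refl])
    fix i assume "i \<in> {..k}"
    then have i: "i \<le> k" by simp
    have "(1 / fact k) * (of_nat (k choose i) * fact i) = (1 / fact (k - i) :: complex)"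
      using binomial_fact[OF i, where 'a = complex] by simp
    have "hbar ^ k / fact k * fls_const (of_nat (k choose i) * fact i) =
        fls_const (1 / fact k) * fls_const (of_nat (k choose i) * fact i) * hbar ^ k"
      unfolding hk by (simp only: mult_ac)
    also have "\<dots> = fls_const (1 / fact (k - i)) * hbar ^ k"
      unfolding fls_const_mult[symmetric] \<open>1 / fact k * _ = _\<close> ..
    also have "\<dots> = hbar ^ (k - i) / fact (k - i) * hbar ^ i"
      unfolding hk mult.assoc power_add[symmetric] using i by simp
    finally show "fscale (hbar ^ k / fact k * fls_const (of_nat (k choose i) * fact i)) (act (propagator_poly P' N ^ (k - i)) (l @ mf_moyal i x y # l')) =
       fscale (hbar ^ (k - i) / fact (k - i)) (act (propagator_poly P' N ^ (k - i)) (l @ mscale (hbar ^ i) (mf_moyal i x y) # l'))"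
      by (simp only: act_mid_scale fs.scale_scale)
  qed
  finally show ?thesis .
qed

section \<open>Integration over configurations of points on the circle\<close>

interpretation pl: product_sigma_finite "\<lambda>_ :: nat. lborel :: real measure"
  by standard

text \<open>Product measures are determined by boxes, and renaming coordinates permutes the factors
  of the volume. It is used both to renumber the points after one is integrated out and to rotate a
  configuration.\<close>

lemma lborel_reindex:
  fixes f :: "nat \<Rightarrow> nat"
  assumes K: "finite K" and f: "bij_betw f K I"
  shows "distr (Pi\<^sub>M I (\<lambda>_. lborel :: real measure)) (Pi\<^sub>M K (\<lambda>_. lborel)) (\<lambda>\<omega>. \<lambda>k\<in>K. \<omega> (f k)) = Pi\<^sub>M K (\<lambda>_. lborel)"
proof (rule pl.PiM_eqI[OF K])
  have I: "finite I" using bij_betw_finite[OF f] K by simp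
  have meas: "(\<lambda>\<omega>. \<lambda>k\<in>K. \<omega> (f k)) \<in> measurable (Pi\<^sub>M I (\<lambda>_. lborel :: real measure)) (Pi\<^sub>M K (\<lambda>_. lborel))"
    by (intro measurable_restrict measurable_component_singleton) (use f in \<open>auto simp: bij_betw_def\<close>)
  fix A :: "nat \<Rightarrow> real set" assume A: "\<And>i. i \<in> K \<Longrightarrow> A i \<in> sets lborel"
  define g where "g = the_inv_into K f"
  have g: "g (f k) = k" if "k \<in> K" for k
    using f that by (simp add: g_def bij_betw_def the_inv_into_f_f)
  have img: "f ` K = I" using f by (simp add: bij_betw_def)
  have "(\<lambda>\<omega>. \<lambda>k\<in>K. \<omega> (f k)) -` Pi\<^sub>E K A \<inter> space (Pi\<^sub>M I (\<lambda>_. lborel :: real measure)) = Pi\<^sub>E I (\<lambda>i. A (g i))"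
    using g by (auto simp: space_PiM PiE_def Pi_def img[symmetric])
  then have "emeasure (distr (Pi\<^sub>M I (\<lambda>_. lborel)) (Pi\<^sub>M K (\<lambda>_. lborel)) (\<lambda>\<omega>. \<lambda>k\<in>K. \<omega> (f k))) (Pi\<^sub>E K A)
      = emeasure (Pi\<^sub>M I (\<lambda>_. lborel)) (Pi\<^sub>E I (\<lambda>i. A (g i)))"
    using A K by (subst emeasure_distr[OF meas]) (auto intro!: sets_PiM_I_finite)
  also have "\<dots> = (\<Prod>i\<in>I. emeasure lborel (A (g i)))"
    by (rule pl.emeasure_PiM[OF I]) (use A g img in auto)
  also have "\<dots> = (\<Prod>k\<in>K. emeasure lborel (A k))"
    unfolding img[symmetric] using f g by (subst prod.reindex) (auto simp: bij_betw_def)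
  finally show "emeasure (distr (Pi\<^sub>M I (\<lambda>_. lborel)) (Pi\<^sub>M K (\<lambda>_. lborel)) (\<lambda>\<omega>. \<lambda>k\<in>K. \<omega> (f k))) (Pi\<^sub>E K A)
      = (\<Prod>k\<in>K. emeasure lborel (A k))" .
qed simp

lemma integral_reindex:
  fixes f :: "nat \<Rightarrow> nat" and \<phi> :: "(nat \<Rightarrow> real) \<Rightarrow> complex"
  assumes K: "finite K" and f: "bij_betw f K I" and \<phi>: "\<phi> \<in> borel_measurable (Pi\<^sub>M K (\<lambda>_. lborel))"
  shows "(\<integral>\<omega>. \<phi> (\<lambda>k\<in>K. \<omega> (f k)) \<partial>Pi\<^sub>M I (\<lambda>_. lborel)) = (\<integral>\<omega>. \<phi> \<omega> \<partial>Pi\<^sub>M K (\<lambda>_. lborel))"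
proof -
  have "(\<lambda>\<omega>. \<lambda>k\<in>K. \<omega> (f k)) \<in> measurable (Pi\<^sub>M I (\<lambda>_. lborel :: real measure)) (Pi\<^sub>M K (\<lambda>_. lborel))"
    by (intro measurable_restrict measurable_component_singleton) (use f in \<open>auto simp: bij_betw_def\<close>)
  from integral_distr[OF this \<phi>] show ?thesis by (simp add: lborel_reindex[OF K f])
qed

section \<open>Positions on the circle relative to point 0\<close>

lemma circ_dist_range: "0 \<le> circ_dist x y" "circ_dist x y < 1"
  by (simp_all add: circ_dist_def frac_lt_1)

lemma circ_dist_self [simp]: "circ_dist x x = 0" by (simp add: circ_dist_def)

text \<open>Both sides lie in [0,1) and differ by an integer.\<close>

lemma circ_dist_base:
  "circ_dist x y = (if circ_dist z x \<le> circ_dist z y then circ_dist z y - circ_dist z x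
     else 1 + circ_dist z y - circ_dist z x)"
proof -
  have "(y - x) - (circ_dist z y - circ_dist z x) = of_int (\<lfloor>y - z\<rfloor> - \<lfloor>x - z\<rfloor>)"
    by (simp add: circ_dist_def frac_def)
  then have "(y - x) - (circ_dist z y - circ_dist z x) \<in> \<int>" by simp
  moreover from this have "(y - x) - (1 + circ_dist z y - circ_dist z x) \<in> \<int>"
    by (metis Ints_1 Ints_diff add_diff_eq diff_diff_eq add.commute)
  ultimately show ?thesis
    using circ_dist_range[of z x] circ_dist_range[of z y]
    by (auto simp: circ_dist_def[of x y] frac_unique_iff)
qed

text \<open>In the frame of point 0 a cyclic configuration is an increasing sequence in [0,1) that
  starts with 0. The value beyond \<open>m\<close> is a dummy.\<close>

definition cvec :: "nat \<Rightarrow> (nat \<Rightarrow> real) \<Rightarrow> nat \<Rightarrow> real" where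
  "cvec m \<theta> a = (if a \<le> m then circ_dist (\<theta> 0) (\<theta> a) else 0)"

lemma cvec_0 [simp]: "cvec m \<theta> 0 = 0" by (simp add: cvec_def)

lemma cvec_range: "0 \<le> cvec m \<theta> a" "cvec m \<theta> a < 1"
  by (simp_all add: cvec_def circ_dist_range)

lemma cyc_config_cvec: "\<theta> \<in> cyc_config m \<Longrightarrow> a < b \<Longrightarrow> b \<le> m \<Longrightarrow> cvec m \<theta> a < cvec m \<theta> b"
  by (auto simp: cyc_config_def cvec_def)

text \<open>The branch depends on the order of the indices instead of the positions. On
  configurations this is the propagator, but the formula remains affine at collisions and at
  position 1, where the propagator itself jumps.\<close>

definition lifted_prop :: "(nat \<Rightarrow> real) \<Rightarrow> nat \<Rightarrow> nat \<Rightarrow> complex" where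
  "lifted_prop c a b = of_real (if a < b then 1 / 2 - (c b - c a) else - 1 / 2 - (c b - c a))"

lemma propagator_lifted:
  assumes \<theta>: "\<theta> \<in> cyc_config m" and ab: "a \<le> m" "b \<le> m" "a \<noteq> b"
  shows "propagator \<theta> a b = lifted_prop (cvec m \<theta>) a b"
proof -
  have "circ_dist (\<theta> 0) (\<theta> a) \<le> circ_dist (\<theta> 0) (\<theta> b) \<longleftrightarrow> a < b"
  proof (cases "a < b")
    case True then show ?thesis using cyc_config_cvec[OF \<theta> True] ab by (simp add: cvec_def)
  next
    case False
    then have "b < a" using ab by simp
    from cyc_config_cvec[OF \<theta> this] ab show ?thesis using False by (simp add: cvec_def)
  qed
  then show ?thesis
    using ab circ_dist_base[of "\<theta> a" "\<theta> b" "\<theta> 0"] by (simp add: propagator_def lifted_prop_def cvec_def)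
qed

lemma propagator_poly_cong:
  "(\<And>a b. a < N \<Longrightarrow> b < N \<Longrightarrow> a \<noteq> b \<Longrightarrow> P a b = Q a b) \<Longrightarrow> propagator_poly P N = propagator_poly Q N"
  unfolding propagator_poly_def by (intro sum.cong refl) auto

definition insert_point :: "nat \<Rightarrow> 'a \<Rightarrow> (nat \<Rightarrow> 'a) \<Rightarrow> nat \<Rightarrow> 'a" where
  "insert_point \<beta> x c a = (if a < \<beta> then c a else if a = \<beta> then x else c (a - 1))"

text \<open>The next point on the circle, or a full turn back to point 0 if the new point is the
  last one.\<close>

definition arc_end :: "nat \<Rightarrow> nat \<Rightarrow> (nat \<Rightarrow> real) \<Rightarrow> real" where
  "arc_end m \<beta> c = (if \<beta> \<le> m then c \<beta> else 1)"

text \<open>The circle is cut at 0, whereas \<open>x\<close> is measured from \<open>t\<close>; the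
  pieces on the two sides of the cut are two translates.\<close>

lemma integral_rotate_unit:
  fixes f :: "real \<Rightarrow> complex"
  assumes t: "0 \<le> t" "t < 1" and lu: "0 \<le> lo" "lo \<le> up" "up \<le> 1"
    and f: "integrable lborel (\<lambda>x. indicator {lo..up} x *\<^sub>R f x)"
  shows "(\<integral>s. indicator {s. 0 \<le> s \<and> s < 1 \<and> lo < circ_dist t s \<and> circ_dist t s < up} s *\<^sub>R f (circ_dist t s) \<partial>lborel)
    = (\<integral>x. indicator {lo..up} x *\<^sub>R f x \<partial>lborel)"
proof -
  define h where "h x = indicator {lo<..<up} x *\<^sub>R (indicator {lo..up} x *\<^sub>R f x)" for x
  have h: "integrable lborel h"
    unfolding h_def by (rule integrable_mult_indicator[OF _ f]) simp
  have hA: "integrable lborel (\<lambda>x. indicator A x *\<^sub>R h x)" if "A \<in> sets borel" for A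
    by (rule integrable_mult_indicator[OF _ h]) (use that in simp)
  \<comment> \<open>\<open>h1\<close> belongs to positions in [t,1) and \<open>h2\<close> to
    positions in [0,t), where the distance from \<open>t\<close> has wrapped around.\<close>
  define h1 h2 where "h1 x = indicator {0..<1 - t} x *\<^sub>R h x" and "h2 x = indicator {1 - t..<1} x *\<^sub>R h x" for x
  have h12: "integrable lborel h1" "integrable lborel h2"
    unfolding h1_def h2_def by (auto intro!: hA)
  have shift: "integrable lborel (\<lambda>s. g (c + s))" "(\<integral>s. g (c + s) \<partial>lborel) = (\<integral>s. g s \<partial>lborel)"
    if "integrable lborel g" for g :: "real \<Rightarrow> complex" and c
    using lborel_integrable_real_affine[OF that, of 1 c] lborel_integral_real_affine[of 1 g c] by simp_all
  have fr: "circ_dist t s = (if t \<le> s then s - t else 1 + s - t)" if "0 \<le> s" "s < 1" for s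
  proof -
    have "frac (s - t) = (if t \<le> s then s - t else 1 + s - t)"
      unfolding frac_unique_iff using that t by (auto intro: Ints_1 Ints_minus)
    then show ?thesis by (simp add: circ_dist_def)
  qed
  have "(\<lambda>s. indicator {s. 0 \<le> s \<and> s < 1 \<and> lo < circ_dist t s \<and> circ_dist t s < up} s *\<^sub>R f (circ_dist t s))
      = (\<lambda>s. h1 (- t + s) + h2 (1 - t + s))"
  proof
    fix s
    show "indicator {s. 0 \<le> s \<and> s < 1 \<and> lo < circ_dist t s \<and> circ_dist t s < up} s *\<^sub>R f (circ_dist t s)
      = h1 (- t + s) + h2 (1 - t + s)"
    proof (cases "0 \<le> s \<and> s < 1")
      case True
      then show ?thesis
        using fr[of s] t lu by (auto simp: h1_def h2_def h_def indicator_def algebra_simps)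
    next
      case False
      then show ?thesis
        using t lu by (auto simp: h1_def h2_def h_def indicator_def)
    qed
  qed
  then have "(\<integral>s. indicator {s. 0 \<le> s \<and> s < 1 \<and> lo < circ_dist t s \<and> circ_dist t s < up} s *\<^sub>R f (circ_dist t s) \<partial>lborel)
      = (\<integral>s. h1 s \<partial>lborel) + (\<integral>s. h2 s \<partial>lborel)"
    using shift(2)[OF h12(1), of "- t"] shift(2)[OF h12(2), of "1 - t"] shift(1)[OF h12(1), of "- t"] shift(1)[OF h12(2), of "1 - t"]
    by simp
  also have "\<dots> = (\<integral>s. h1 s + h2 s \<partial>lborel)" using h12 by simp
  also have "\<dots> = (\<integral>x. h x \<partial>lborel)"
  proof (rule Bochner_Integration.integral_cong[OF refl])
    fix x show "h1 x + h2 x = h x"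
      using t lu by (auto simp: h1_def h2_def h_def indicator_def)
  qed
  \<comment> \<open>Configurations exclude the ends of the arc, the closed interval includes them;
    the difference is a null set.\<close>
  also have "\<dots> = (\<integral>x. indicator {lo..up} x *\<^sub>R f x \<partial>lborel)"
  proof (rule integral_cong_AE)
    show "AE x in lborel. h x = indicator {lo..up} x *\<^sub>R f x"
      using AE_lborel_singleton[of lo] AE_lborel_singleton[of up]
      by eventually_elim (auto simp: h_def indicator_def)
  qed (use h f in auto)
  finally show ?thesis .
qed

text \<open>Only the two neighbours of the new point matter, because the old points are already in
  order.\<close>

lemma insert_point_cyc:
  assumes \<omega>: "\<omega> \<in> space (cfg m)" and \<beta>: "1 \<le> \<beta>" "\<beta> \<le> Suc m"
  shows "(\<lambda>k\<in>{..Suc m}. insert_point \<beta> s \<omega> k) \<in> cyc_config (Suc m) \<longleftrightarrow>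
    \<omega> \<in> cyc_config m \<and> 0 \<le> s \<and> s < 1 \<and> cvec m \<omega> (\<beta> - 1) < circ_dist (\<omega> 0) s \<and> circ_dist (\<omega> 0) s < arc_end m \<beta> (cvec m \<omega>)"
    (is "?z \<in> _ \<longleftrightarrow> ?R")
proof
  have ext: "\<omega> \<in> extensional {..m}" using \<omega> by (auto simp: cfg_def space_PiM PiE_def)
  have z0: "?z 0 = \<omega> 0" using \<beta> by (simp add: insert_point_def)
  have i0: "insert_point \<beta> s \<omega> 0 = \<omega> 0" using \<beta> by (simp add: insert_point_def)
  {
    assume "?z \<in> cyc_config (Suc m)"
    then have r: "\<And>k. k \<le> Suc m \<Longrightarrow> ?z k \<in> {0..<1}"
      and o: "\<And>a b. a < b \<Longrightarrow> b \<le> Suc m \<Longrightarrow> circ_dist (\<omega> 0) (?z a) < circ_dist (\<omega> 0) (?z b)"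
      unfolding cyc_config_def by (auto simp: PiE_def Pi_def i0)
    have r': "\<omega> k \<in> {0..<1}" if "k \<le> m" for k
    proof (cases "k < \<beta>")
      case True then show ?thesis using r[of k] that by (simp add: insert_point_def)
    next
      case False then show ?thesis using r[of "Suc k"] that by (simp add: insert_point_def)
    qed
    have o': "circ_dist (\<omega> 0) (\<omega> a) < circ_dist (\<omega> 0) (\<omega> b)" if "a < b" "b \<le> m" for a b
    proof -
      define a' b' where "a' = (if a < \<beta> then a else Suc a)" "b' = (if b < \<beta> then b else Suc b)"
      have "?z a' = \<omega> a" "?z b' = \<omega> b" using that by (auto simp: a'_b'_def insert_point_def)
      moreover have "a' < b'" "b' \<le> Suc m" using that by (auto simp: a'_b'_def)
      ultimately show ?thesis using o[of a' b'] by simp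
    qed
    have "\<omega> \<in> cyc_config m" using r' o' ext by (auto simp: cyc_config_def PiE_def Pi_def)
    moreover have "s \<in> {0..<1}" using r[of \<beta>] \<beta> by (simp add: insert_point_def)
    moreover have "cvec m \<omega> (\<beta> - 1) < circ_dist (\<omega> 0) s"
      using o[of "\<beta> - 1" \<beta>] \<beta> by (cases \<beta>) (auto simp: insert_point_def cvec_def)
    moreover have "circ_dist (\<omega> 0) s < arc_end m \<beta> (cvec m \<omega>)"
      using o[of \<beta> "Suc \<beta>"] \<beta> circ_dist_range[of "\<omega> 0" s] by (auto simp: insert_point_def cvec_def arc_end_def)
    ultimately show ?R by simp
  next
    assume R: ?R
    obtain j where j: "\<beta> = Suc j" using \<beta> by (cases \<beta>) auto
    have mono: "cvec m \<omega> a \<le> cvec m \<omega> b" if "a \<le> b" "b \<le> m" for a b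
      using cyc_config_cvec[of \<omega> m a b] R that by (cases "a = b") auto
    have "circ_dist (\<omega> 0) (?z a) < circ_dist (\<omega> 0) (?z b)" if ab: "a < b" "b \<le> Suc m" for a b
    proof -
      obtain i where i: "b = Suc i" using ab by (cases b) auto
      consider "b < \<beta>" | "b = \<beta>" | "a < \<beta>" "\<beta> < b" | "a = \<beta>" | "\<beta> < a" using ab by linarith
      then show ?thesis
      proof cases
        case 1 then show ?thesis using cyc_config_cvec[of \<omega> m a b] R ab \<beta> by (auto simp: i j insert_point_def cvec_def)
      next
        case 2 then show ?thesis using mono[of a "\<beta> - 1"] R ab \<beta> by (auto simp: i j insert_point_def cvec_def)
      next
        case 3 then show ?thesis using cyc_config_cvec[of \<omega> m a "b - 1"] mono[of a "b - 1"] R ab \<beta>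
          by (cases "a = b - 1") (auto simp: i j insert_point_def cvec_def)
      next
        case 4 then show ?thesis using mono[of \<beta> "b - 1"] R ab \<beta> by (auto simp: i j insert_point_def cvec_def arc_end_def)
      next
        case 5 then show ?thesis using cyc_config_cvec[of \<omega> m "a - 1" "b - 1"] R ab \<beta> by (auto simp: i j insert_point_def cvec_def)
      qed
    qed
    moreover have "?z k \<in> {0..<1}" if "k \<le> Suc m" for k
    proof -
      have "\<omega> j \<in> {0..<1}" if "j \<le> m" for j using R that by (auto simp: cyc_config_def)
      then show ?thesis using that R \<beta> by (auto simp: insert_point_def)
    qed
    ultimately show "?z \<in> cyc_config (Suc m)"
      unfolding cyc_config_def by (auto simp: PiE_def Pi_def i0)
  }
qed

lemma insert_point_cvec:
  "1 \<le> \<beta> \<Longrightarrow> \<beta> \<le> Suc m \<Longrightarrow>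
    cvec (Suc m) (\<lambda>k\<in>{..Suc m}. insert_point \<beta> s \<omega> k) = insert_point \<beta> (circ_dist (\<omega> 0) s) (cvec m \<omega>)"
  by (auto simp: fun_eq_iff cvec_def insert_point_def)

text \<open>The point \<open>\<beta>\<close> is integrated over the arc between its neighbours while
  the others are held fixed. Point 0 is excluded as the origin of all positions.\<close>

theorem cyc_config_fubini:
  fixes \<Psi> :: "(nat \<Rightarrow> real) \<Rightarrow> complex"
  assumes \<beta>: "1 \<le> \<beta>" "\<beta> \<le> Suc m" and n: "nice (Suc m) (\<lambda>\<theta>. \<Psi> (cvec (Suc m) \<theta>))"
    and cont: "\<And>c. continuous_on {0..1} (\<lambda>x. \<Psi> (insert_point \<beta> x c))"
  shows "(LINT \<theta>:cyc_config (Suc m)|cfg (Suc m). \<Psi> (cvec (Suc m) \<theta>)) =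
    (LINT \<theta>:cyc_config m|cfg m. (\<integral>x. indicator {cvec m \<theta> (\<beta> - 1)..arc_end m \<beta> (cvec m \<theta>)} x *\<^sub>R \<Psi> (insert_point \<beta> x (cvec m \<theta>)) \<partial>lborel))"
proof -
  define J where "J = {..Suc m} - {\<beta>}"
  define \<Phi> where "\<Phi> \<theta> = indicator (cyc_config (Suc m)) \<theta> *\<^sub>R \<Psi> (cvec (Suc m) \<theta>)" for \<theta>
  have int: "integrable (Pi\<^sub>M (insert \<beta> J) (\<lambda>_. lborel)) \<Phi>"
    using nice_integrable[OF n] \<beta> by (simp add: J_def insert_absorb set_integrable_def \<Phi>_def[abs_def] cfg_def)
  \<comment> \<open>Closing the gap at \<open>\<beta>\<close> identifies the remaining coordinates
    with those of an \<open>m\<close>-configuration.\<close>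
  have bij: "bij_betw (\<lambda>k. if k < \<beta> then k else k - 1) J {..m}"
    by (rule bij_betw_byWitness[where f' = "\<lambda>k. if k < \<beta> then k else Suc k"]) (use \<beta> in \<open>auto simp: J_def\<close>)
  have meas: "(\<lambda>x. \<integral>s. \<Phi> (x(\<beta> := s)) \<partial>lborel) \<in> borel_measurable (Pi\<^sub>M J (\<lambda>_. lborel))"
  proof -
    have "(\<lambda>(x, s). x(\<beta> := s)) \<in> measurable (Pi\<^sub>M J (\<lambda>_. lborel) \<Otimes>\<^sub>M lborel) (Pi\<^sub>M (insert \<beta> J) (\<lambda>_. lborel :: real measure))"
      by (rule measurable_add_dim)
    from measurable_compose[OF this, of \<Phi> borel] int
    have "(\<lambda>(x, s). \<Phi> (x(\<beta> := s))) \<in> borel_measurable (Pi\<^sub>M J (\<lambda>_. lborel) \<Otimes>\<^sub>M lborel)"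
      by (auto simp: case_prod_unfold)
    then show ?thesis by (rule lborel.borel_measurable_lebesgue_integral)
  qed
  have "(LINT \<theta>:cyc_config (Suc m)|cfg (Suc m). \<Psi> (cvec (Suc m) \<theta>)) = integral\<^sup>L (Pi\<^sub>M (insert \<beta> J) (\<lambda>_. lborel)) \<Phi>"
    using \<beta> by (simp add: J_def insert_absorb set_lebesgue_integral_def \<Phi>_def[abs_def] cfg_def)
  also have "\<dots> = (\<integral>x. (\<integral>s. \<Phi> (x(\<beta> := s)) \<partial>lborel) \<partial>Pi\<^sub>M J (\<lambda>_. lborel))"
    by (rule pl.product_integral_insert[OF _ _ int]) (auto simp: J_def)
  also have "\<dots> = (\<integral>\<omega>. (\<integral>s. \<Phi> ((\<lambda>k\<in>J. \<omega> (if k < \<beta> then k else k - 1))(\<beta> := s)) \<partial>lborel) \<partial>cfg m)"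
    unfolding cfg_def by (rule integral_reindex[OF _ bij meas, symmetric]) (simp add: J_def)
  also have "\<dots> = (LINT \<theta>:cyc_config m|cfg m. (\<integral>x. indicator {cvec m \<theta> (\<beta> - 1)..arc_end m \<beta> (cvec m \<theta>)} x *\<^sub>R \<Psi> (insert_point \<beta> x (cvec m \<theta>)) \<partial>lborel))"
    unfolding set_lebesgue_integral_def
  proof (rule Bochner_Integration.integral_cong[OF refl])
    fix \<omega> assume \<omega>: "\<omega> \<in> space (cfg m)"
    define lo up where "lo = cvec m \<omega> (\<beta> - 1)" and "up = arc_end m \<beta> (cvec m \<omega>)"
    define f where "f x = \<Psi> (insert_point \<beta> x (cvec m \<omega>))" for x
    have upd: "(\<lambda>k\<in>J. \<omega> (if k < \<beta> then k else k - 1))(\<beta> := s) = (\<lambda>k\<in>{..Suc m}. insert_point \<beta> s \<omega> k)" for s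
      using \<beta> by (auto simp: fun_eq_iff J_def insert_point_def)
    have eq: "\<Phi> ((\<lambda>k\<in>J. \<omega> (if k < \<beta> then k else k - 1))(\<beta> := s)) = indicator (cyc_config m) \<omega> *\<^sub>R
        (indicator {s. 0 \<le> s \<and> s < 1 \<and> lo < circ_dist (\<omega> 0) s \<and> circ_dist (\<omega> 0) s < up} s *\<^sub>R f (circ_dist (\<omega> 0) s))" for s
      unfolding upd \<Phi>_def insert_point_cvec[OF \<beta>] f_def
      using insert_point_cyc[OF \<omega> \<beta>, of s] by (auto simp: indicator_def lo_def up_def)
    show "(\<integral>s. \<Phi> ((\<lambda>k\<in>J. \<omega> (if k < \<beta> then k else k - 1))(\<beta> := s)) \<partial>lborel) =
        indicator (cyc_config m) \<omega> *\<^sub>R (\<integral>x. indicator {lo..up} x *\<^sub>R f x \<partial>lborel)"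
    proof (cases "\<omega> \<in> cyc_config m")
      case True
      then have t: "0 \<le> \<omega> 0" "\<omega> 0 < 1" by (auto simp: cyc_config_def)
      have lu: "0 \<le> lo" "lo \<le> up" "up \<le> 1"
        using cvec_range[of m \<omega>] cyc_config_cvec[OF True, of "\<beta> - 1" \<beta>] \<beta>
        by (auto simp: lo_def up_def arc_end_def less_imp_le)
      have "continuous_on {lo..up} f"
        using continuous_on_subset[OF cont] lu by (auto simp: f_def)
      then have "integrable lborel (\<lambda>x. indicator {lo..up} x *\<^sub>R f x)"
        using borel_integrable_atLeastAtMost'[of lo up f] by (simp add: set_integrable_def)
      from integral_rotate_unit[OF t lu this] True show ?thesis by (simp add: eq)
    qed (simp add: eq)
  qed
  finally show ?thesis .
qed

section \<open>Cyclic relabelling of the points\<close>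

definition rot_cfg :: "nat \<Rightarrow> (nat \<Rightarrow> real) \<Rightarrow> nat \<Rightarrow> real" where
  "rot_cfg m \<theta> = (\<lambda>a\<in>{..m}. \<theta> (Suc a mod Suc m))"

lemma rot_cfg_cyc: "\<theta> \<in> cyc_config m \<Longrightarrow> rot_cfg m \<theta> \<in> cyc_config m"
proof (cases "m = 0")
  case False
  assume \<theta>: "\<theta> \<in> cyc_config m"
  have c: "circ_dist (\<theta> 1) (\<theta> a) = cvec m \<theta> a - cvec m \<theta> 1" if "1 \<le> a" "a \<le> m" for a
    using circ_dist_base[of "\<theta> 1" "\<theta> a" "\<theta> 0"] cyc_config_cvec[OF \<theta>, of 1 a] that
    by (cases "a = 1") (auto simp: cvec_def)
  have c0: "circ_dist (\<theta> 1) (\<theta> 0) = 1 - cvec m \<theta> 1"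
    using circ_dist_base[of "\<theta> 1" "\<theta> 0" "\<theta> 0"] cyc_config_cvec[OF \<theta>, of 0 1] False
    by (auto simp: cvec_def)
  have r0: "rot_cfg m \<theta> 0 = \<theta> 1" using False by (simp add: rot_cfg_def)
  have "circ_dist (\<theta> 1) (rot_cfg m \<theta> a) < circ_dist (\<theta> 1) (rot_cfg m \<theta> b)" if "a < b" "b \<le> m" for a b
  proof (cases "b = m")
    case True
    then have "rot_cfg m \<theta> b = \<theta> 0" "rot_cfg m \<theta> a = \<theta> (Suc a)" using that by (auto simp: rot_cfg_def)
    then show ?thesis using c[of "Suc a"] c0 that cvec_range[of m \<theta> "Suc a"] by simp
  next
    case False
    then have "rot_cfg m \<theta> b = \<theta> (Suc b)" "rot_cfg m \<theta> a = \<theta> (Suc a)" using that by (auto simp: rot_cfg_def)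
    then show ?thesis using c[of "Suc a"] c[of "Suc b"] that False cyc_config_cvec[OF \<theta>, of "Suc a" "Suc b"] by simp
  qed
  moreover have "rot_cfg m \<theta> \<in> {..m} \<rightarrow>\<^sub>E {0..<1}"
  proof -
    have "\<theta> (Suc a mod Suc m) \<in> {0..<1}" for a
      using \<theta> mod_less_divisor[of "Suc m" "Suc a"] by (auto simp: cyc_config_def PiE_def Pi_def less_Suc_eq_le simp del: mod_less_divisor)
    then show ?thesis by (auto simp: rot_cfg_def)
  qed
  ultimately show "rot_cfg m \<theta> \<in> cyc_config m" by (simp add: cyc_config_def r0)
next
  case True
  assume "\<theta> \<in> cyc_config m"
  moreover from this have "rot_cfg m \<theta> = \<theta>"
    using True by (auto simp: rot_cfg_def fun_eq_iff cyc_config_def PiE_def extensional_def)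
  ultimately show "rot_cfg m \<theta> \<in> cyc_config m" by simp
qed

text \<open>Rotation has order \<open>m + 1\<close>, so it is inverted by \<open>m\<close> further
  rotations, and one implication gives the other.\<close>

lemma rot_cfg_cyc_iff:
  assumes "\<theta> \<in> extensional {..m}"
  shows "rot_cfg m \<theta> \<in> cyc_config m \<longleftrightarrow> \<theta> \<in> cyc_config m"
proof
  assume r: "rot_cfg m \<theta> \<in> cyc_config m"
  have pow: "(rot_cfg m ^^ Suc k) \<theta> = (\<lambda>a\<in>{..m}. \<theta> ((a + Suc k) mod Suc m))" for k
  proof (induction k)
    case 0 show ?case by (simp add: rot_cfg_def)
  next
    case (Suc k)
    have "Suc a mod Suc m \<le> m" for a by (simp add: less_Suc_eq_le[symmetric])
    moreover have "(Suc a mod Suc m + Suc k) mod Suc m = (a + Suc (Suc k)) mod Suc m" for a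
      using mod_add_left_eq[of "Suc a" "Suc m" "Suc k"] by simp
    ultimately show ?case
      by (subst funpow.simps(2), unfold o_def Suc.IH) (simp add: rot_cfg_def fun_eq_iff)
  qed
  have "(rot_cfg m ^^ k) (rot_cfg m \<theta>) \<in> cyc_config m" for k
    by (induction k) (auto simp: r rot_cfg_cyc)
  from this[of m] have "(rot_cfg m ^^ Suc m) \<theta> \<in> cyc_config m" by (simp only: funpow_Suc_right o_def)
  moreover have "(rot_cfg m ^^ Suc m) \<theta> = \<theta>"
  proof -
    have "(a + Suc m) mod Suc m = a" if "a \<le> m" for a
      unfolding mod_add_self2 using that by simp
    then show ?thesis
      unfolding pow using assms by (auto simp: fun_eq_iff extensional_def simp del: add_Suc_right)
  qed
  ultimately show "\<theta> \<in> cyc_config m" by simp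
qed (rule rot_cfg_cyc)

lemma cyc_config_rotate:
  fixes \<phi> :: "(nat \<Rightarrow> real) \<Rightarrow> complex"
  assumes n: "nice m \<phi>"
  shows "(LINT \<theta>:cyc_config m|cfg m. \<phi> (rot_cfg m \<theta>)) = (LINT \<theta>:cyc_config m|cfg m. \<phi> \<theta>)"
proof -
  define \<Phi> where "\<Phi> \<theta> = indicator (cyc_config m) \<theta> *\<^sub>R \<phi> \<theta>" for \<theta>
  have bij: "bij_betw (\<lambda>a. Suc a mod Suc m) {..m} {..m}"
  proof (rule bij_betwI')
    fix x y assume "x \<in> {..m}" "y \<in> {..m}"
    then show "(Suc x mod Suc m = Suc y mod Suc m) = (x = y)"
      by (cases "x = m"; cases "y = m") auto
  next
    fix y assume "y \<in> {..m}"
    show "\<exists>x\<in>{..m}. y = Suc x mod Suc m"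
    proof (cases y)
      case 0 then show ?thesis by (intro bexI[of _ m]) auto
    next
      case (Suc x) with \<open>y \<in> {..m}\<close> show ?thesis by (intro bexI[of _ x]) auto
    qed
  qed (simp add: less_Suc_eq_le[symmetric])
  have meas: "\<Phi> \<in> borel_measurable (Pi\<^sub>M {..m} (\<lambda>_. lborel))"
    using nice_integrable[OF n] by (auto simp: set_integrable_def \<Phi>_def[abs_def] cfg_def)
  have "(LINT \<theta>:cyc_config m|cfg m. \<phi> (rot_cfg m \<theta>)) = (\<integral>\<theta>. \<Phi> (rot_cfg m \<theta>) \<partial>cfg m)"
    unfolding set_lebesgue_integral_def
  proof (rule Bochner_Integration.integral_cong[OF refl])
    fix \<theta> assume "\<theta> \<in> space (cfg m)"
    then have "\<theta> \<in> extensional {..m}" by (auto simp: cfg_def space_PiM PiE_def)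
    then show "indicator (cyc_config m) \<theta> *\<^sub>R \<phi> (rot_cfg m \<theta>) = \<Phi> (rot_cfg m \<theta>)"
      by (simp add: \<Phi>_def indicator_def rot_cfg_cyc_iff)
  qed
  also have "\<dots> = (\<integral>\<theta>. \<Phi> \<theta> \<partial>cfg m)"
    unfolding cfg_def rot_cfg_def by (rule integral_reindex[OF _ bij meas]) simp
  finally show ?thesis by (simp add: set_lebesgue_integral_def \<Phi>_def)
qed

text \<open>Applied to single coefficients of \<open>act p T\<close>; through such functionals all
  calculus takes place in the complex numbers.\<close>

definition op_functional :: "('n op_poly \<Rightarrow> complex) \<Rightarrow> bool" where
  "op_functional \<Lambda> \<longleftrightarrow> (\<forall>p q. \<Lambda> (p + q) = \<Lambda> p + \<Lambda> q) \<and> (\<forall>c p. \<Lambda> (Dconst c * p) = c * \<Lambda> p)"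

lemma op_functional_sum: "op_functional \<Lambda> \<Longrightarrow> \<Lambda> (sum f S) = (\<Sum>x\<in>S. \<Lambda> (f x))"
proof -
  assume "op_functional \<Lambda>"
  then have "\<Lambda> (p + q) = \<Lambda> p + \<Lambda> q" for p q by (simp add: op_functional_def)
  moreover from this[of 0 0] have "\<Lambda> 0 = 0" by simp
  ultimately show ?thesis by (induction S rule: infinite_finite_induct) auto
qed

text \<open>Expanding one factor leaves propagator values as scalars and moves the variables into
  \<open>s\<close>, so boundedness and measurability are inherited from \<open>P\<close>.\<close>

lemma nice_propagator_power:
  fixes P :: "(nat \<Rightarrow> real) \<Rightarrow> nat \<Rightarrow> nat \<Rightarrow> complex"
  assumes P: "\<And>a b. a < N \<Longrightarrow> b < N \<Longrightarrow> nice m (\<lambda>\<theta>. P \<theta> a b)"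
  shows "op_functional \<Lambda> \<Longrightarrow> nice m (\<lambda>\<theta>. \<Lambda> (propagator_poly (P \<theta>) N ^ k * s))"
proof (induction k arbitrary: s)
  case (Suc k)
  have lin: "\<Lambda> (Dconst c * p) = c * \<Lambda> p" for c p using Suc.prems by (simp add: op_functional_def)
  have "\<Lambda> (propagator_poly (P \<theta>) N ^ Suc k * s) = (\<Sum>(a, b) | a < N \<and> b < N \<and> a \<noteq> b. \<Sum>i\<in>UNIV. \<Sum>j\<in>UNIV.
      1 / 2 * (P \<theta> a b * omega i j) * \<Lambda> (propagator_poly (P \<theta>) N ^ k * (Dvar a i * (Dvar b j * s))))" for \<theta>
  proof -
    have ac: "x * (y * (z * s)) = z * (x * (y * s))" for x y z s :: "'a op_poly" by (simp add: mult_ac)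
    have "propagator_poly (P \<theta>) N ^ Suc k * s = propagator_poly (P \<theta>) N * (propagator_poly (P \<theta>) N ^ k * s)"
      by (simp add: mult.assoc)
    then show ?thesis
      unfolding propagator_poly_mult[of _ _ "propagator_poly (P \<theta>) N ^ k * s"] ac[of _ _ "propagator_poly (P \<theta>) N ^ k"]
      by (simp only: op_functional_sum[OF Suc.prems] case_prod_unfold lin)
  qed
  then show ?case
    by (simp only: case_prod_unfold) (intro nice_sum nice_mult nice_const P Suc; auto)
qed simp

section \<open>Dependence of the exponent on the position of one point\<close>

definition omega_op :: "nat \<Rightarrow> nat \<Rightarrow> 'n::finite op_poly" where
  "omega_op a b = (\<Sum>i\<in>UNIV. \<Sum>j\<in>UNIV. Dconst (omega i j) * (Dvar a i * Dvar b j))"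

lemma omega_op_swap: "omega_op b a = - (omega_op a b :: 'n::finite op_poly)"
proof -
  have "omega_op b a = (\<Sum>i\<in>UNIV. \<Sum>j\<in>UNIV. Dconst (omega j i) * (Dvar b j * Dvar a i :: 'n op_poly))"
    unfolding omega_op_def by (rule sum.swap)
  also have "\<dots> = (\<Sum>i\<in>UNIV. \<Sum>j\<in>UNIV. - (Dconst (omega i j) * (Dvar a i * Dvar b j)))"
  proof (intro sum.cong refl)
    fix i j :: "'n coord"
    show "Dconst (omega j i) * (Dvar b j * Dvar a i) = - (Dconst (omega i j) * (Dvar a i * Dvar b j) :: 'n op_poly)"
      unfolding omega_antisym[of j i] by (simp add: Dconst_neg mult.commute)
  qed
  finally show ?thesis by (simp add: omega_op_def sum_negf)
qed

lemma propagator_poly_omega: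
  "propagator_poly R N = (\<Sum>(a, b) | a < N \<and> b < N \<and> a \<noteq> b. Dconst (1 / 2 * R a b) * omega_op a b)"
  by (simp only: propagator_poly_def omega_op_def case_prod_unfold sum_distrib_left mult.assoc[symmetric] Dconst_mult)

lemma omega_op_pair: "P b a = - P a b \<Longrightarrow>
    Dconst (1 / 2 * P a b) * omega_op a b + Dconst (1 / 2 * P b a) * omega_op b a = Dconst (P a b) * omega_op a b"
proof -
  assume "P b a = - P a b"
  moreover have "Dconst (P a b) * omega_op a b = Dconst (1 / 2 * P a b) * omega_op a b + Dconst (1 / 2 * P a b) * omega_op a b"
    by (simp flip: distrib_right Dconst_add)
  moreover from calculation(1) have "Dconst (1 / 2 * P b a) * omega_op b a = Dconst (1 / 2 * P a b) * omega_op a b"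
    by (simp add: omega_op_swap[of b a] Dconst_neg)
  ultimately show ?thesis by metis
qed

text \<open>Isolates the pairs through one slot, both when its position varies and when it carries a
  scalar matrix.\<close>

lemma sum_pairs_through:
  fixes f :: "nat \<times> nat \<Rightarrow> 'a::comm_monoid_add"
  assumes "\<beta> < N"
  shows "(\<Sum>p | fst p < N \<and> snd p < N \<and> fst p \<noteq> snd p. f p) =
     (\<Sum>p | fst p < N \<and> snd p < N \<and> fst p \<noteq> snd p \<and> fst p \<noteq> \<beta> \<and> snd p \<noteq> \<beta>. f p) + (\<Sum>a | a < N \<and> a \<noteq> \<beta>. f (a, \<beta>) + f (\<beta>, a))"
proof -
  let ?A = "{p :: nat \<times> nat. fst p < N \<and> snd p < N \<and> fst p \<noteq> snd p \<and> fst p \<noteq> \<beta> \<and> snd p \<noteq> \<beta>}"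
  let ?B = "(\<lambda>a. (a, \<beta>)) ` {a. a < N \<and> a \<noteq> \<beta>}" and ?C = "(\<lambda>a. (\<beta>, a)) ` {a. a < N \<and> a \<noteq> \<beta>}"
  have fin: "finite ?A" by (rule finite_subset[of _ "{..<N} \<times> {..<N}"]) auto
  have "{p :: nat \<times> nat. fst p < N \<and> snd p < N \<and> fst p \<noteq> snd p} = ?A \<union> (?B \<union> ?C)"
    using assms by (auto simp: image_iff)
  then have "(\<Sum>p | fst p < N \<and> snd p < N \<and> fst p \<noteq> snd p. f p) = sum f ?A + (sum f ?B + sum f ?C)"
    using fin by (simp add: sum.union_disjoint[of ?A "?B \<union> ?C"] sum.union_disjoint[of ?B ?C] disjoint_iff image_iff)
  also have "sum f ?B + sum f ?C = (\<Sum>a | a < N \<and> a \<noteq> \<beta>. f (a, \<beta>) + f (\<beta>, a))"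
    by (simp add: sum.reindex inj_on_def sum.distrib)
  finally show ?thesis .
qed

text \<open>By \<open>propagator_poly_insert\<close> this is minus the derivative of the exponent in
  the position of point \<open>\<beta>\<close>.\<close>

definition edge_poly :: "nat \<Rightarrow> nat \<Rightarrow> 'n::finite op_poly" where
  "edge_poly N \<beta> = (\<Sum>a | a < N \<and> a \<noteq> \<beta>. omega_op a \<beta>)"

text \<open>Only pairs through \<open>\<beta>\<close> change, by opposite amounts in the two orders.
  Since \<open>omega_op\<close> is antisymmetric as well, each pair counts twice and cancels the
  1/2.\<close>

lemma propagator_poly_affine:
  assumes \<beta>: "\<beta> < N"
    and PQ: "\<And>a b. a < N \<Longrightarrow> b < N \<Longrightarrow> a \<noteq> b \<Longrightarrow> P a b = Q a b + (if b = \<beta> then - x else if a = \<beta> then x else 0)"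
  shows "propagator_poly P N = propagator_poly Q N - Dconst x * (edge_poly N \<beta> :: 'n::finite op_poly)"
proof -
  define R where "R a b = (if b = \<beta> then - x else if a = \<beta> then x else 0)" for a b
  have "propagator_poly P N = (\<Sum>(a, b) | a < N \<and> b < N \<and> a \<noteq> b. Dconst (1 / 2 * Q a b) * omega_op a b + Dconst (1 / 2 * R a b) * omega_op a b)"
    unfolding propagator_poly_omega distrib_right[symmetric] Dconst_add[symmetric] distrib_left[symmetric]
    by (rule sum.cong) (auto simp: PQ R_def)
  also have "\<dots> = propagator_poly Q N + (\<Sum>p | fst p < N \<and> snd p < N \<and> fst p \<noteq> snd p. Dconst (1 / 2 * R (fst p) (snd p)) * omega_op (fst p) (snd p))"
    by (simp add: propagator_poly_omega case_prod_unfold sum.distrib)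
  also have "(\<Sum>p | fst p < N \<and> snd p < N \<and> fst p \<noteq> snd p. Dconst (1 / 2 * R (fst p) (snd p)) * (omega_op (fst p) (snd p) :: 'n op_poly))
      = (\<Sum>a | a < N \<and> a \<noteq> \<beta>. Dconst (R a \<beta>) * omega_op a \<beta>)"
  proof -
    have z: "(\<Sum>p | fst p < N \<and> snd p < N \<and> fst p \<noteq> snd p \<and> fst p \<noteq> \<beta> \<and> snd p \<noteq> \<beta>.
        Dconst (1 / 2 * R (fst p) (snd p)) * (omega_op (fst p) (snd p) :: 'n op_poly)) = 0"
      by (rule sum.neutral) (auto simp: R_def)
    show ?thesis
      unfolding sum_pairs_through[OF \<beta>] z fst_conv snd_conv add_0
      by (intro sum.cong refl omega_op_pair) (auto simp: R_def)
  qed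
  finally show ?thesis by (simp add: R_def edge_poly_def sum_distrib_left Dconst_neg sum_negf)
qed

lemma lifted_prop_insert:
  "a \<noteq> b \<Longrightarrow> lifted_prop (insert_point \<beta> x c) a b =
     lifted_prop (insert_point \<beta> 0 c) a b + (if b = \<beta> then - of_real x else if a = \<beta> then of_real x else 0)"
  by (auto simp: lifted_prop_def insert_point_def)

lemma propagator_poly_insert:
  "\<beta> < N \<Longrightarrow> propagator_poly (lifted_prop (insert_point \<beta> x c)) N =
     propagator_poly (lifted_prop (insert_point \<beta> 0 c)) N - Dconst (of_real x) * edge_poly N \<beta>"
  by (rule propagator_poly_affine, assumption, rule lifted_prop_insert)

text \<open>The power rule, proved on scalars. The induction moves one factor into \<open>s\<close>,
  which must therefore be arbitrary.\<close>

lemma op_functional_power_deriv: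
  fixes p q :: "'n op_poly"
  assumes "op_functional \<Lambda>"
  shows "((\<lambda>x. \<Lambda> ((p - Dconst (of_real x) * q) ^ k * s)) has_vector_derivative
     - (of_nat k * \<Lambda> ((p - Dconst (of_real x) * q) ^ (k - 1) * (q * s)))) (at x within S)"
proof (induction k arbitrary: s)
  case (Suc k)
  define z where "z x = p - Dconst (of_real x) * q" for x
  have lin: "\<Lambda> (a + b) = \<Lambda> a + \<Lambda> b" "\<Lambda> (Dconst c * a) = c * \<Lambda> a" for a b c
    using assms by (auto simp: op_functional_def)
  have neg: "\<Lambda> (- a) = - \<Lambda> a" for a using lin(2)[of "-1" a] by (simp add: Dconst_neg)
  have diff: "\<Lambda> (a - b) = \<Lambda> a - \<Lambda> b" for a b using lin(1)[of a "- b"] neg[of b] by simp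
  have e: "\<Lambda> (z x ^ k * (z x * s)) = \<Lambda> (z x ^ k * (p * s)) - of_real x * \<Lambda> (z x ^ k * (q * s))" for x k s
    unfolding lin(2)[symmetric] diff[symmetric]
    by (rule arg_cong[of _ _ \<Lambda>]) (simp add: z_def algebra_simps)
  have "((\<lambda>x. \<Lambda> (z x ^ k * (p * s)) - of_real x * \<Lambda> (z x ^ k * (q * s))) has_vector_derivative
     (- (of_nat k * \<Lambda> (z x ^ (k - 1) * (q * (p * s)))) - (of_real x * - (of_nat k * \<Lambda> (z x ^ (k - 1) * (q * (q * s)))) + 1 * \<Lambda> (z x ^ k * (q * s))))) (at x within S)"
    unfolding z_def
    by (intro has_vector_derivative_diff has_vector_derivative_mult Suc)
       (auto intro!: derivative_eq_intros has_vector_derivative_of_real)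
  moreover have "- (of_nat k * \<Lambda> (z x ^ (k - 1) * (q * (p * s)))) - (of_real x * - (of_nat k * \<Lambda> (z x ^ (k - 1) * (q * (q * s)))) + 1 * \<Lambda> (z x ^ k * (q * s)))
      = - (of_nat (Suc k) * \<Lambda> (z x ^ k * (q * s)))"
  proof (cases k)
    case (Suc j)
    define X where "X = \<Lambda> (z x ^ k * (q * s))"
    define Y where "Y = \<Lambda> (z x ^ (k - 1) * (q * (q * s)))"
    define W where "W = \<Lambda> (z x ^ (k - 1) * (q * (p * s)))"
    \<comment> \<open>Splits one factor off the power: the derivative contains \<open>W\<close>, the
      goal only \<open>X\<close>, and they differ by a multiple of \<open>Y\<close>.\<close>
    have "X = W - of_real x * Y"
      using e[of x j "q * s"] by (simp only: X_def Y_def W_def Suc power_Suc2 mult.assoc diff_Suc_1 mult.left_commute[of p q])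
    then have W: "W = X + of_real x * Y" by simp
    show ?thesis
      unfolding X_def[symmetric] Y_def[symmetric] W_def[symmetric] W by (simp add: algebra_simps)
  qed simp
  moreover have "z x ^ Suc k * s = z x ^ k * (z x * s)" for x
    by (simp only: power_Suc2 mult.assoc)
  ultimately show ?case
    unfolding z_def[symmetric] diff_Suc_1 by (simp only: e)
qed simp

lemma op_functional_FTC:
  fixes c :: "nat \<Rightarrow> real" and \<Lambda> :: "'n::finite op_poly \<Rightarrow> complex"
  assumes \<Lambda>: "op_functional \<Lambda>" and \<beta>: "\<beta> < N" and lu: "lo \<le> up"
  shows "(\<integral>x. indicator {lo..up} x *\<^sub>R (of_nat (Suc k) * \<Lambda> (propagator_poly (lifted_prop (insert_point \<beta> x c)) N ^ k * edge_poly N \<beta>)) \<partial>lborel)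
    = \<Lambda> (propagator_poly (lifted_prop (insert_point \<beta> lo c)) N ^ Suc k) - \<Lambda> (propagator_poly (lifted_prop (insert_point \<beta> up c)) N ^ Suc k)"
proof -
  define z :: "real \<Rightarrow> 'n op_poly" where "z x = propagator_poly (lifted_prop (insert_point \<beta> x c)) N" for x
  define F where "F x = - \<Lambda> (z x ^ Suc k)" for x
  define f where "f x = of_nat (Suc k) * \<Lambda> (z x ^ k * edge_poly N \<beta>)" for x
  have z: "z x = z 0 - Dconst (of_real x) * edge_poly N \<beta>" for x
    unfolding z_def by (rule propagator_poly_insert[OF \<beta>])
  have dd: "((\<lambda>x. \<Lambda> (z x ^ j * s)) has_vector_derivative - (of_nat j * \<Lambda> (z x ^ (j - 1) * (edge_poly N \<beta> * s)))) (at x within S)" for j s x S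
    using op_functional_power_deriv[OF \<Lambda>, of "z 0" "edge_poly N \<beta>" j s x S] unfolding z[symmetric] .
  have d: "(F has_vector_derivative f x) (at x within {lo..up})" for x
    using has_vector_derivative_minus[OF dd[of "Suc k" 1 x "{lo..up}"]] by (simp add: F_def[abs_def] f_def)
  have "continuous_on {lo..up} f"
    unfolding f_def continuous_on_eq_continuous_within
    by (intro ballI continuous_intros has_vector_derivative_continuous[OF dd])
  from integral_FTC_Icc[OF lu d this] show ?thesis
    by (simp add: F_def f_def z_def)
qed

section \<open>Series and integrals of forms\<close>

abbreviation fcoef :: "'n::finite form \<Rightarrow> 'n coord set \<Rightarrow> int \<Rightarrow> ('n coord \<Rightarrow> nat) \<Rightarrow> complex" where
  "fcoef w I N y \<equiv> mcoeff (fls_nth (w $ I) N) y"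

lemma coeff_add: "fcoef (v + w) I N y = fcoef v I N y + fcoef w I N y"
  by (simp add: plus_mps.rep_eq)
lemma coeff_sum: "fcoef (sum f S) I N y = (\<Sum>x\<in>S. fcoef (f x) I N y)"
  by (simp add: fls_nth_sum mcoeff_sum)
lemma coeff_fvb: "fvb d w \<Longrightarrow> N < d \<Longrightarrow> fcoef w I N y = 0"
  by (simp add: fvb_def vb_def zero_mps.rep_eq)

text \<open>Every output coefficient uses finitely many input coefficients at the same power of
  \<open>hbar\<close>, hence such operators pass through \<open>form_integral\<close> and
  \<open>fser\<close>.\<close>

definition local_op :: "('n::finite form \<Rightarrow> 'n form) \<Rightarrow> bool" where
  "local_op h \<longleftrightarrow> flin h \<and> (\<forall>I y. \<exists>xs. \<forall>w N. fcoef (h w) I N y = (\<Sum>(c, J, z)\<leftarrow>xs. c * fcoef w J N z))"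

lemma local_op_comp: "local_op g \<Longrightarrow> local_op h \<Longrightarrow> local_op (\<lambda>w. g (h w))"
  unfolding local_op_def
proof (intro conjI allI)
  assume g: "flin g \<and> (\<forall>I y. \<exists>xs. \<forall>w N. fcoef (g w) I N y = (\<Sum>(c, J, z)\<leftarrow>xs. c * fcoef w J N z))"
  assume h: "flin h \<and> (\<forall>I y. \<exists>xs. \<forall>w N. fcoef (h w) I N y = (\<Sum>(c, J, z)\<leftarrow>xs. c * fcoef w J N z))"
  show "flin (\<lambda>w. g (h w))" using g h by (auto intro!: flinI simp: module_hom.add module_hom.scale)
  fix I y
  obtain xs where xs: "\<And>w N. fcoef (g w) I N y = (\<Sum>(c, J, z)\<leftarrow>xs. c * fcoef w J N z)" using g by blast
  from h obtain ys where ys: "\<And>J z w N. fcoef (h w) J N z = (\<Sum>(c, J, z)\<leftarrow>ys J z. c * fcoef w J N z)" by metis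
  have "(\<Sum>(c, J, z)\<leftarrow>xs. c * fcoef (h w) J N z) =
      (\<Sum>(c, J, z)\<leftarrow>concat (map (\<lambda>(c, J, z). map (\<lambda>(c', J', z'). (c * c', J', z')) (ys J z)) xs). c * fcoef w J N z)" for w N
    by (induction xs) (auto simp: ys sum_list_const_mult[symmetric] o_def case_prod_unfold mult.assoc)
  with xs show "\<exists>xs. \<forall>w N. fcoef (g (h w)) I N y = (\<Sum>(c, J, z)\<leftarrow>xs. c * fcoef w J N z)" by auto
qed

lemma local_op_add: "local_op g \<Longrightarrow> local_op h \<Longrightarrow> local_op (\<lambda>w. g w + h w)"
  unfolding local_op_def
proof (intro conjI allI)
  assume g: "flin g \<and> (\<forall>I y. \<exists>xs. \<forall>w N. fcoef (g w) I N y = (\<Sum>(c, J, z)\<leftarrow>xs. c * fcoef w J N z))"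
  assume h: "flin h \<and> (\<forall>I y. \<exists>xs. \<forall>w N. fcoef (h w) I N y = (\<Sum>(c, J, z)\<leftarrow>xs. c * fcoef w J N z))"
  show "flin (\<lambda>w. g w + h w)" using g h by (auto intro!: flinI simp: module_hom.add module_hom.scale fs.scale_right_distrib)
  fix I y
  obtain xs ys where "\<And>w N. fcoef (g w) I N y = (\<Sum>(c, J, z)\<leftarrow>xs. c * fcoef w J N z)"
    "\<And>w N. fcoef (h w) I N y = (\<Sum>(c, J, z)\<leftarrow>ys. c * fcoef w J N z)" using g h by metis
  then show "\<exists>xs. \<forall>w N. fcoef (g w + h w) I N y = (\<Sum>(c, J, z)\<leftarrow>xs. c * fcoef w J N z)"
    by (intro exI[of _ "xs @ ys"]) (simp add: plus_mps.rep_eq)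
qed

lemma local_op_0: "local_op (\<lambda>w. 0)"
  unfolding local_op_def by (intro conjI flinI allI exI[of _ "[]"]) (auto simp: zero_mps.rep_eq)

lemma local_op_sum: "(\<And>x. x \<in> S \<Longrightarrow> local_op (h x)) \<Longrightarrow> local_op (\<lambda>w. \<Sum>x\<in>S. h x w)"
  by (induction S rule: infinite_finite_induct) (auto intro: local_op_0 local_op_add)

lemma local_op_const: "local_op (fscale (fls_const c))"
  unfolding local_op_def
  by (intro conjI flinI allI exI[of _ "[(c, _, _)]"])
     (auto simp: fs.scale_right_distrib mult.commute simp del: fscale_nth simp: coeff_fscale_const)

lemma local_op_lie: "local_op (lie_deriv i)"
  unfolding local_op_def
  by (intro conjI flin_lie allI exI[of _ "[(of_nat (_ i + 1), _, _(i := _ i + 1))]"])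
     (auto simp: lie_deriv_def mderiv.rep_eq)

lemma local_op_contract: "local_op (contract i)"
  unfolding local_op_def
proof (intro conjI flin_contract allI)
  fix I y
  show "\<exists>xs. \<forall>w N. fcoef (contract i w) I N y = (\<Sum>(c, J, z)\<leftarrow>xs. c * fcoef w J N z)"
    by (cases "i \<in> I")
       (auto simp: contract_nth mcoeff_sign zero_mps.rep_eq intro: exI[of _ "[]"] exI[of _ "[((-1) ^ card {j \<in> I. j < i}, insert i I, y)]"])
qed

lemma local_op_dy: "local_op (wedge (dy i))"
  unfolding local_op_def
proof (intro conjI flin_wedge allI)
  fix I y
  show "\<exists>xs. \<forall>w N. fcoef (wedge (dy i) w) I N y = (\<Sum>(c, J, z)\<leftarrow>xs. c * fcoef w J N z)"
    by (cases "i \<in> I")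
       (auto simp: wedge_dy_nth mcoeff_sign zero_mps.rep_eq intro: exI[of _ "[]"] exI[of _ "[((-1) ^ card {j \<in> I. j < i}, I - {i}, y)]"])
qed

lemma local_op_de_rham: "local_op de_rham"
  unfolding de_rham_dy[abs_def] by (intro local_op_sum local_op_comp[OF local_op_dy local_op_lie])

lemma local_op_BV: "local_op BV"
  unfolding BV_omega[abs_def] omega_sum_def
  by (intro local_op_sum local_op_comp[OF local_op_const] local_op_comp[OF local_op_lie local_op_contract])

lemma local_op_fvb: "local_op h \<Longrightarrow> fvb d w \<Longrightarrow> fvb d (h w)"
  unfolding fvb_def vb_def
proof (intro allI impI)
  fix I N assume "local_op h" and v: "\<forall>I. \<forall>N<d. fls_nth (w $ I) N = 0" and N: "N < d"
  show "fls_nth (h w $ I) N = 0"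
  proof (rule mps_eqI)
    fix y
    obtain xs where "fcoef (h w) I N y = (\<Sum>(c, J, z)\<leftarrow>xs. c * fcoef w J N z)"
      using \<open>local_op h\<close> unfolding local_op_def by blast
    moreover have "(\<Sum>(c, J, z)\<leftarrow>xs. c * fcoef w J N z) = 0" for xs
      using v N by (induction xs) (auto simp: zero_mps.rep_eq)
    ultimately show "fcoef (h w) I N y = mcoeff 0 y" by (simp add: zero_mps.rep_eq)
  qed
qed

lemma good_local: "local_op h \<Longrightarrow> good m F \<Longrightarrow> good m (\<lambda>\<theta>. h (F \<theta>))"
proof -
  assume h: "local_op h" and F: "good m F"
  obtain d where "\<forall>\<theta>. fvb d (F \<theta>)" using F unfolding good_def by blast
  then have "\<forall>\<theta>. fvb d (h (F \<theta>))" using local_op_fvb[OF h] by blast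
  moreover have "nice m (\<lambda>\<theta>. fcoef (h (F \<theta>)) I N y)" for I N y
  proof -
    obtain xs where "\<And>w. fcoef (h w) I N y = (\<Sum>(c, J, z)\<leftarrow>xs. c * fcoef w J N z)"
      using h unfolding local_op_def by blast
    moreover have "nice m (\<lambda>\<theta>. (\<Sum>(c, J, z)\<leftarrow>xs. c * fcoef (F \<theta>) J N z))"
      using F by (induction xs) (auto simp: good_def intro!: nice_add nice_mult)
    ultimately show ?thesis by simp
  qed
  ultimately show ?thesis unfolding good_def by blast
qed

lemma set_integral_nice_sum_list:
  "(\<And>x. x \<in> set xs \<Longrightarrow> nice m (f x)) \<Longrightarrow>
    nice m (\<lambda>\<theta>. \<Sum>x\<leftarrow>xs. f x \<theta>) \<and> (LINT \<theta>:cyc_config m|cfg m. (\<Sum>x\<leftarrow>xs. f x \<theta>)) = (\<Sum>x\<leftarrow>xs. LINT \<theta>:cyc_config m|cfg m. f x \<theta>)"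
proof (induction xs)
  case (Cons x xs)
  then have "nice m (f x)" and IH: "nice m (\<lambda>\<theta>. \<Sum>x\<leftarrow>xs. f x \<theta>)"
    "(LINT \<theta>:cyc_config m|cfg m. (\<Sum>x\<leftarrow>xs. f x \<theta>)) = (\<Sum>x\<leftarrow>xs. LINT \<theta>:cyc_config m|cfg m. f x \<theta>)" by auto
  then show ?case
    using set_integral_add(2)[OF nice_integrable nice_integrable, of m "f x" "\<lambda>\<theta>. \<Sum>x\<leftarrow>xs. f x \<theta>"]
    by (auto intro: nice_add)
qed simp

lemma form_integral_local: "local_op h \<Longrightarrow> good m F \<Longrightarrow> h (form_integral m F) = form_integral m (\<lambda>\<theta>. h (F \<theta>))"
proof (rule form_eqI)
  fix I N y assume h: "local_op h" and F: "good m F"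
  obtain xs where xs: "\<And>w. fcoef (h w) I N y = (\<Sum>(c, J, z)\<leftarrow>xs. c * fcoef w J N z)"
    using h unfolding local_op_def by blast
  have "fcoef (form_integral m (\<lambda>\<theta>. h (F \<theta>))) I N y = (LINT \<theta>:cyc_config m|cfg m. (\<Sum>x\<leftarrow>xs. (\<lambda>(c, J, z). c * fcoef (F \<theta>) J N z) x))"
    by (simp add: form_integral_coeff[OF good_local[OF h F]] xs case_prod_unfold)
  also have "\<dots> = (\<Sum>x\<leftarrow>xs. LINT \<theta>:cyc_config m|cfg m. (\<lambda>(c, J, z). c * fcoef (F \<theta>) J N z) x)"
    by (rule set_integral_nice_sum_list[THEN conjunct2]) (use F in \<open>auto simp: good_def intro!: nice_mult\<close>)
  also have "\<dots> = fcoef (h (form_integral m F)) I N y"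
    by (simp add: xs form_integral_coeff[OF F] case_prod_unfold)
  finally show "fcoef (h (form_integral m F)) I N y = fcoef (form_integral m (\<lambda>\<theta>. h (F \<theta>))) I N y" ..
qed

lemma form_integral_cong: "(\<And>\<theta>. \<theta> \<in> cyc_config m \<Longrightarrow> F \<theta> = G \<theta>) \<Longrightarrow> form_integral m F = form_integral m G"
proof -
  assume *: "\<And>\<theta>. \<theta> \<in> cyc_config m \<Longrightarrow> F \<theta> = G \<theta>"
  have "(LINT \<theta>:cyc_config m|(\<Pi>\<^sub>M a\<in>{..m}. lborel). fcoef (F \<theta>) I N y) = (LINT \<theta>:cyc_config m|(\<Pi>\<^sub>M a\<in>{..m}. lborel). fcoef (G \<theta>) I N y)" for I N y
    unfolding set_lebesgue_integral_def by (intro Bochner_Integration.integral_cong refl) (auto simp: indicator_def *)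
  then show ?thesis by (simp add: form_integral_def)
qed

lemma good_0: "good m (\<lambda>_. 0)" by (auto simp: good_def fvb_def zero_mps.rep_eq)

lemma form_integral_0: "form_integral m (\<lambda>_. 0) = 0"
  using form_integral_add[OF good_0 good_0, of m] by simp

lemma form_integral_sum:
  "(\<And>x. x \<in> S \<Longrightarrow> good m (F x)) \<Longrightarrow>
    good m (\<lambda>\<theta>. \<Sum>x\<in>S. F x \<theta>) \<and> form_integral m (\<lambda>\<theta>. \<Sum>x\<in>S. F x \<theta>) = (\<Sum>x\<in>S. form_integral m (F x))"
  by (induction S rule: infinite_finite_induct) (auto simp: form_integral_0 good_0 form_integral_add intro: good_add)

lemma fser_coeff:
  assumes "\<And>k. fvb d (w k)" "N < d + int K"
  shows "fcoef (fser w) I N y = (\<Sum>k<K. fcoef (fscale (hbar ^ k / fact k) (w k)) I N y)"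
  using hs_sums(2)[OF hs_ser[of d w, OF assms(1)] assms(2), of I]
  by (simp add: fser_nth[OF assms(1)] mcoeff_sum)

lemma fser_local: "local_op h \<Longrightarrow> (\<And>k. fvb d (w k)) \<Longrightarrow> h (fser w) = fser (\<lambda>k. h (w k))"
proof (rule form_eqI)
  fix I N y assume h: "local_op h" and w: "\<And>k. fvb d (w k)"
  define K where "K = nat (N - d + 1)"
  have N: "N < d + int K" by (simp add: K_def)
  obtain xs where xs: "\<And>w. fcoef (h w) I N y = (\<Sum>(c, J, z)\<leftarrow>xs. c * fcoef w J N z)"
    using h unfolding local_op_def by blast
  have lin: "h (fscale c v) = fscale c (h v)" for c v using h by (simp add: local_op_def module_hom.scale)
  have "fcoef (h (fser w)) I N y = fcoef (h (\<Sum>k<K. fscale (hbar ^ k / fact k) (w k))) I N y"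
    unfolding xs by (simp only: fser_coeff[OF w N] coeff_sum)
  also have "h (\<Sum>k<K. fscale (hbar ^ k / fact k) (w k)) = (\<Sum>k<K. fscale (hbar ^ k / fact k) (h (w k)))"
    using h by (simp add: module_hom.sum[of fscale fscale h] local_op_def lin)
  finally show "fcoef (h (fser w)) I N y = fcoef (fser (\<lambda>k. h (w k))) I N y"
    by (simp only: fser_coeff[OF local_op_fvb[OF h w] N] coeff_sum)
qed

text \<open>The lower bound \<open>d\<close> holds for all configurations, so at a given power of
  \<open>hbar\<close> the same finite partial sum represents the series everywhere.\<close>

lemma form_integral_fser:
  assumes v: "\<And>\<theta> k. fvb d (w \<theta> k)" and g: "\<And>k. good m (\<lambda>\<theta>. w \<theta> k)"
  shows "form_integral m (\<lambda>\<theta>. fser (w \<theta>)) = fser (\<lambda>k. form_integral m (\<lambda>\<theta>. w \<theta> k))"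
proof (rule form_eqI)
  fix I N y
  define K where "K = nat (N - d + 1)"
  have N: "N < d + int K" by (simp add: K_def)
  have gg: "good m (\<lambda>\<theta>. fser (w \<theta>))"
    by (rule good_fser[OF v]) (use g in \<open>auto simp: good_def\<close>)
  have gs: "good m (\<lambda>\<theta>. \<Sum>k<K. fscale (hbar ^ k / fact k) (w \<theta> k))"
    by (rule form_integral_sum[THEN conjunct1]) (intro good_scale g)
  have "fcoef (form_integral m (\<lambda>\<theta>. fser (w \<theta>))) I N y = fcoef (form_integral m (\<lambda>\<theta>. \<Sum>k<K. fscale (hbar ^ k / fact k) (w \<theta> k))) I N y"
    by (simp only: form_integral_coeff[OF gg] form_integral_coeff[OF gs] fser_coeff[OF v N] coeff_sum)
  also have "form_integral m (\<lambda>\<theta>. \<Sum>k<K. fscale (hbar ^ k / fact k) (w \<theta> k)) = (\<Sum>k<K. fscale (hbar ^ k / fact k) (form_integral m (\<lambda>\<theta>. w \<theta> k)))"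
    by (subst form_integral_sum[THEN conjunct2]) (auto intro!: good_scale g simp: form_integral_scale[OF g])
  also have "fcoef \<dots> I N y = fcoef (fser (\<lambda>k. form_integral m (\<lambda>\<theta>. w \<theta> k))) I N y"
    by (simp only: fser_coeff[OF form_integral_vb[OF _ g] N] v coeff_sum)
       (subst fser_coeff[OF form_integral_vb[OF _ g] N], use v in \<open>auto simp: coeff_sum\<close>)
  finally show "fcoef (form_integral m (\<lambda>\<theta>. fser (w \<theta>))) I N y = fcoef (fser (\<lambda>k. form_integral m (\<lambda>\<theta>. w \<theta> k))) I N y" .
qed

lemma fser_sum: "(\<And>x k. x \<in> S \<Longrightarrow> fvb d (w x k)) \<Longrightarrow> fser (\<lambda>k. \<Sum>x\<in>S. w x k) = (\<Sum>x\<in>S. fser (w x))"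
proof (induction S rule: infinite_finite_induct)
  case (insert x S)
  then show ?case
    by (simp add: fser_add[of d "w x" "\<lambda>k. \<Sum>x\<in>S. w x k"] fvb_sum)
qed (simp_all add: fser_def)

text \<open>The extra \<open>hbar\<close> raises the order by one and the factor
  \<open>Suc k\<close> adjusts the factorial. This is where the factor \<open>hbar\<close> in front
  of \<open>BV\<close> comes from.\<close>

lemma fser_shift:
  assumes "\<And>k. fvb d (U k)" "\<And>k. fvb d (V k)" "V 0 = 0" "\<And>k. V (Suc k) = fscale (of_nat (Suc k)) (U k)"
  shows "fscale hbar (fser U) = fser V"
proof -
  have "fscale hbar (fser U) = fser (\<lambda>k. fscale hbar (U k))" by (rule fser_scale[OF assms(1), symmetric])
  also have "\<dots> = fser V"
  proof (rule form_eqI)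
    fix I N y
    define K where "K = nat (N - d + 1)"
    have N: "N < d + int (Suc K)" "N < (d + 1) + int K" by (simp_all add: K_def)
    have h: "fvb (d + 1) (fscale hbar (U k))" for k
      using fvb_scale[OF vb_X[of 1] assms(1), of k] by (simp add: add.commute)
    have s: "fscale (hbar ^ Suc k / fact (Suc k)) (V (Suc k)) = fscale (hbar ^ k / fact k) (fscale hbar (U k))" for k
      unfolding assms(4) fs.scale_scale using fact_Suc_fls[of k] by (simp only: mult.commute)
    show "fcoef (fser (\<lambda>k. fscale hbar (U k))) I N y = fcoef (fser V) I N y"
      unfolding fser_coeff[OF assms(2) N(1)] fser_coeff[OF h N(2)] sum.lessThan_Suc_shift s assms(3)
      by (simp add: zero_mps.rep_eq)
  qed
  finally show ?thesis .
qed

lemma mvb_lie: "mvb d x \<Longrightarrow> mvb d (mf_map (lie_deriv i) x)"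
  by (auto simp: mvb_def fvb_def mf_map_def lie_deriv_def vb_wderiv)

text \<open>One bound for each slot, since in \<open>collision\<close> the order of the merged slot
  grows while the others stay fixed.\<close>

lemma fvb_act_list: "list_all2 mvb ds T \<Longrightarrow> fvb (sum_list ds) (act p T)"
proof (induction p arbitrary: T rule: op_induct)
  case (const c)
  have "mvb (sum_list ds) (foldr mf_mult T (mat (form0 1)))"
    using const by (induction rule: list_all2_induct) (auto intro: mvb_one mvb_mult)
  then have "fvb (sum_list ds) (mf_trace_prod T)" by (auto simp: mf_trace_prod_def mvb_def intro!: fvb_sum)
  from fvb_scale[OF vb_const this] show ?case by (simp add: act_Dconst)
next
  case (add p q)
  then show ?case by (auto simp: act_add fvb_def vb_def)
next
  case (var a i p)
  have "list_all2 mvb ds (T[a := mf_map (lie_deriv i) (T ! a)])"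
  proof (cases "a < length T")
    case True
    have "list_all2 mvb (ds[a := ds ! a]) (T[a := mf_map (lie_deriv i) (T ! a)])"
      using var.prems True by (intro list_all2_update_cong) (auto simp: list_all2_conv_all_nth intro: mvb_lie)
    then show ?thesis by simp
  qed (use var.prems in \<open>simp add: not_less list_update_beyond\<close>)
  then show ?case by (simp add: act_Dvar var.IH)
qed

lemma fvb_act: "(\<And>x. x \<in> set T \<Longrightarrow> mvb d x) \<Longrightarrow> fvb (int (length T) * d) (act p T)"
  using fvb_act_list[of "replicate (length T) d" T p]
  by (simp add: list_all2_conv_all_nth sum_list_replicate)

lemma op_functional_coeff: "op_functional (\<lambda>p. fcoef (act p T) I N y)"
  unfolding op_functional_def by (simp only: act_add coeff_add act_Dconst_mult coeff_fscale_const) simp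

lemma good_act:
  assumes "\<And>a b. a < M \<Longrightarrow> b < M \<Longrightarrow> nice m (\<lambda>\<theta>. P \<theta> a b)"
  shows "good m (\<lambda>\<theta>. act (propagator_poly (P \<theta>) M ^ k * s) T)"
proof -
  obtain d where "\<forall>x\<in>set T. mvb d x" using mvb_list by blast
  then have "\<And>p. fvb (int (length T) * d) (act p T)" by (intro fvb_act) auto
  then show ?thesis
    using nice_propagator_power[OF assms op_functional_coeff] by (auto simp: good_def)
qed

text \<open>The interval is closed because ends of arcs are inserted as positions, and the last arc
  ends at 1.\<close>

definition good_pos :: "nat \<Rightarrow> ((nat \<Rightarrow> real) \<Rightarrow> nat \<Rightarrow> real) \<Rightarrow> bool" where
  "good_pos m c \<longleftrightarrow> (\<forall>a. (\<lambda>\<theta>. c \<theta> a) \<in> borel_measurable (cfg m)) \<and> (\<forall>\<theta> a. 0 \<le> c \<theta> a \<and> c \<theta> a \<le> 1)"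

lemma good_pos_cvec: "good_pos m (cvec m)"
proof -
  have "(\<lambda>\<theta>. cvec m \<theta> a) \<in> borel_measurable (cfg m)" for a
    using meas_circ[of 0 m a] by (cases "a \<le> m") (auto simp: cvec_def)
  then show ?thesis by (auto simp: good_pos_def cvec_range less_imp_le)
qed

lemma good_pos_insert:
  "(\<lambda>\<theta>. x \<theta>) \<in> borel_measurable (cfg m) \<Longrightarrow> (\<And>\<theta>. 0 \<le> x \<theta> \<and> x \<theta> \<le> 1) \<Longrightarrow>
    good_pos m (\<lambda>\<theta>. insert_point \<beta> (x \<theta>) (cvec m \<theta>))"
proof -
  assume x: "x \<in> borel_measurable (cfg m)" "\<And>\<theta>. 0 \<le> x \<theta> \<and> x \<theta> \<le> 1"
  have "(\<lambda>\<theta>. insert_point \<beta> (x \<theta>) (cvec m \<theta>) a) \<in> borel_measurable (cfg m)" for a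
    using x good_pos_cvec[of m] unfolding insert_point_def good_pos_def by (cases "a < \<beta>"; cases "a = \<beta>") auto
  then show ?thesis
    using x good_pos_cvec[of m] by (auto simp: good_pos_def insert_point_def)
qed

lemma nice_good_pos: "good_pos m c \<Longrightarrow> nice m (\<lambda>\<theta>. lifted_prop (c \<theta>) a b)"
proof -
  assume c: "good_pos m c"
  then have [measurable]: "(\<lambda>\<theta>. c \<theta> a) \<in> borel_measurable (cfg m)" for a by (simp add: good_pos_def)
  have "(\<lambda>\<theta>. lifted_prop (c \<theta>) a b) \<in> borel_measurable (cfg m)"
    unfolding lifted_prop_def by measurable
  moreover have "norm (lifted_prop (c \<theta>) a b) \<le> 2" for \<theta>
  proof -
    have "0 \<le> c \<theta> a" "c \<theta> a \<le> 1" "0 \<le> c \<theta> b" "c \<theta> b \<le> 1" using c by (auto simp: good_pos_def)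
    then show ?thesis unfolding lifted_prop_def norm_of_real by auto
  qed
  ultimately show ?thesis by (auto simp: nice_def cfg_def)
qed

lemma arc_end_pos: "good_pos m (\<lambda>\<theta>. insert_point \<beta> (cvec m \<theta> j) (cvec m \<theta>))"
  "good_pos m (\<lambda>\<theta>. insert_point \<beta> (arc_end m j (cvec m \<theta>)) (cvec m \<theta>))"
proof -
  have "(\<lambda>\<theta>. arc_end m j (cvec m \<theta>)) \<in> borel_measurable (cfg m)"
    using good_pos_cvec[of m] by (cases "j \<le> m") (auto simp: arc_end_def good_pos_def)
  moreover have "0 \<le> arc_end m j (cvec m \<theta>) \<and> arc_end m j (cvec m \<theta>) \<le> 1" for \<theta>
    using good_pos_cvec[of m] by (auto simp: arc_end_def good_pos_def)
  ultimately show "good_pos m (\<lambda>\<theta>. insert_point \<beta> (arc_end m j (cvec m \<theta>)) (cvec m \<theta>))"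
    by (rule good_pos_insert)
  show "good_pos m (\<lambda>\<theta>. insert_point \<beta> (cvec m \<theta> j) (cvec m \<theta>))"
    by (rule good_pos_insert) (use good_pos_cvec[of m] in \<open>auto simp: good_pos_def\<close>)
qed

lemma arc_order: "\<theta> \<in> cyc_config m \<Longrightarrow> 1 \<le> \<beta> \<Longrightarrow> \<beta> \<le> Suc m \<Longrightarrow> cvec m \<theta> (\<beta> - 1) \<le> arc_end m \<beta> (cvec m \<theta>)"
  using cyc_config_cvec[of \<theta> m "\<beta> - 1" \<beta>] cvec_range[of m \<theta> "\<beta> - 1"] by (auto simp: arc_end_def less_imp_le)

section \<open>Integrating a total derivative over an arc\<close>

lemma propagator_poly_lifted:
  "\<theta> \<in> cyc_config m \<Longrightarrow> propagator_poly (propagator \<theta>) (Suc m) = propagator_poly (lifted_prop (cvec m \<theta>)) (Suc m)"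
  by (rule propagator_poly_cong) (simp add: propagator_lifted)

lemma continuous_functional:
  fixes \<Lambda> :: "'n::finite op_poly \<Rightarrow> complex"
  assumes "op_functional \<Lambda>" "\<beta> < M"
  shows "continuous_on S (\<lambda>x. \<Lambda> (propagator_poly (lifted_prop (insert_point \<beta> x c)) M ^ k * s))"
proof -
  define z :: "real \<Rightarrow> 'n op_poly" where "z x = propagator_poly (lifted_prop (insert_point \<beta> x c)) M" for x
  have z: "z x = z 0 - Dconst (of_real x) * edge_poly M \<beta>" for x
    unfolding z_def by (rule propagator_poly_insert[OF assms(2)])
  have "((\<lambda>x. \<Lambda> (z x ^ k * s)) has_vector_derivative - (of_nat k * \<Lambda> (z x ^ (k - 1) * (edge_poly M \<beta> * s)))) (at x within S)" for x
    using op_functional_power_deriv[OF assms(1), of "z 0" "edge_poly M \<beta>" k s x S] unfolding z[symmetric] .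
  then show ?thesis
    unfolding z_def[symmetric] continuous_on_eq_continuous_within by (intro ballI has_vector_derivative_continuous)
qed

text \<open>The fundamental theorem of calculus on the arc of point \<open>\<beta>\<close>, one
  power of the exponent at a time. Because of \<open>lifted_prop\<close> the end values are honest
  evaluations at positions where two points coincide.\<close>

theorem stokes:
  fixes T :: "('n::{finite,linorder}, 'r::finite) mform list"
  assumes \<beta>: "1 \<le> \<beta>" "\<beta> \<le> Suc m"
  shows "fscale (of_nat (Suc k)) (form_integral (Suc m) (\<lambda>\<theta>. act (propagator_poly (propagator \<theta>) (Suc (Suc m)) ^ k * edge_poly (Suc (Suc m)) \<beta>) T)) =
     form_integral m (\<lambda>\<theta>. act (propagator_poly (lifted_prop (insert_point \<beta> (cvec m \<theta> (\<beta> - 1)) (cvec m \<theta>))) (Suc (Suc m)) ^ Suc k) T)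
   - form_integral m (\<lambda>\<theta>. act (propagator_poly (lifted_prop (insert_point \<beta> (arc_end m \<beta> (cvec m \<theta>)) (cvec m \<theta>))) (Suc (Suc m)) ^ Suc k) T)"
    (is "_ = form_integral m ?L - form_integral m ?U")
proof -
  let ?M = "Suc (Suc m)"
  have \<beta>M: "\<beta> < ?M" using \<beta> by simp
  have gL: "good m ?L" and gU: "good m ?U"
    using good_act[OF nice_good_pos[OF arc_end_pos(1)[of m \<beta> "\<beta> - 1"]], where M = ?M and k = "Suc k" and s = 1 and T = T]
      good_act[OF nice_good_pos[OF arc_end_pos(2)[of m \<beta> \<beta>]], where M = ?M and k = "Suc k" and s = 1 and T = T]
    by simp_all
  have g: "good (Suc m) (\<lambda>\<theta>. act (propagator_poly (lifted_prop (cvec (Suc m) \<theta>)) ?M ^ k * edge_poly ?M \<beta>) T)"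
    by (rule good_act[OF nice_good_pos[OF good_pos_cvec]])
  have "fscale (of_nat (Suc k)) (form_integral (Suc m) (\<lambda>\<theta>. act (propagator_poly (propagator \<theta>) ?M ^ k * edge_poly ?M \<beta>) T)) =
    form_integral (Suc m) (\<lambda>\<theta>. fscale (of_nat (Suc k)) (act (propagator_poly (lifted_prop (cvec (Suc m) \<theta>)) ?M ^ k * edge_poly ?M \<beta>) T))"
    unfolding form_integral_scale[OF g]
    by (intro arg_cong[where f = "fscale _"] form_integral_cong) (simp add: propagator_poly_lifted)
  also have "\<dots> = form_integral m ?L - form_integral m ?U"
  proof (rule form_eqI)
    fix I N y
    define \<Lambda> where "\<Lambda> p = fcoef (act p T) I N y" for p
    have \<Lambda>: "op_functional \<Lambda>" unfolding \<Lambda>_def by (rule op_functional_coeff)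
    define \<Psi> where "\<Psi> c = of_nat (Suc k) * \<Lambda> (propagator_poly (lifted_prop c) ?M ^ k * edge_poly ?M \<beta>)" for c
    have of: "fcoef (fscale (of_nat (Suc k)) w) I N y = of_nat (Suc k) * fcoef w I N y" for w :: "'n form"
      unfolding fls_of_nat by (rule coeff_fscale_const)
    have "fcoef (form_integral (Suc m) (\<lambda>\<theta>. fscale (of_nat (Suc k)) (act (propagator_poly (lifted_prop (cvec (Suc m) \<theta>)) ?M ^ k * edge_poly ?M \<beta>) T))) I N y
        = (LINT \<theta>:cyc_config (Suc m)|cfg (Suc m). \<Psi> (cvec (Suc m) \<theta>))"
      unfolding form_integral_coeff[OF good_scale[OF g]] of \<Psi>_def \<Lambda>_def ..
    also have "\<dots> = (LINT \<theta>:cyc_config m|cfg m. (\<integral>x. indicator {cvec m \<theta> (\<beta> - 1)..arc_end m \<beta> (cvec m \<theta>)} x *\<^sub>R \<Psi> (insert_point \<beta> x (cvec m \<theta>)) \<partial>lborel))"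
    proof (rule cyc_config_fubini[OF \<beta>])
      show "nice (Suc m) (\<lambda>\<theta>. \<Psi> (cvec (Suc m) \<theta>))"
        unfolding \<Psi>_def by (intro nice_mult nice_const nice_propagator_power[OF nice_good_pos[OF good_pos_cvec] \<Lambda>])
      show "continuous_on {0..1} (\<lambda>x. \<Psi> (insert_point \<beta> x c))" for c
        unfolding \<Psi>_def by (intro continuous_on_mult continuous_on_const continuous_functional[OF \<Lambda> \<beta>M])
    qed
    also have "\<dots> = (LINT \<theta>:cyc_config m|cfg m. fcoef (?L \<theta>) I N y - fcoef (?U \<theta>) I N y)"
      unfolding set_lebesgue_integral_def
    proof (rule Bochner_Integration.integral_cong[OF refl])
      fix \<theta>
      show "indicator (cyc_config m) \<theta> *\<^sub>R (\<integral>x. indicator {cvec m \<theta> (\<beta> - 1)..arc_end m \<beta> (cvec m \<theta>)} x *\<^sub>R \<Psi> (insert_point \<beta> x (cvec m \<theta>)) \<partial>lborel)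
        = indicator (cyc_config m) \<theta> *\<^sub>R (fcoef (?L \<theta>) I N y - fcoef (?U \<theta>) I N y)"
      proof (cases "\<theta> \<in> cyc_config m")
        case True
        show ?thesis
          unfolding \<Psi>_def op_functional_FTC[OF \<Lambda> \<beta>M arc_order[OF True \<beta>]] by (simp only: \<Lambda>_def)
      qed simp
    qed
    also have "\<dots> = (LINT \<theta>:cyc_config m|cfg m. fcoef (?L \<theta>) I N y) - (LINT \<theta>:cyc_config m|cfg m. fcoef (?U \<theta>) I N y)"
      by (rule set_integral_diff(2)) (use gL gU in \<open>auto simp only: good_def intro!: nice_integrable\<close>)
    also have "\<dots> = fcoef (form_integral m ?L - form_integral m ?U) I N y"
      unfolding form_integral_coeff[OF gL, symmetric] form_integral_coeff[OF gU, symmetric]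
      by (simp add: minus_mps.rep_eq)
    finally show "fcoef (form_integral (Suc m) (\<lambda>\<theta>. fscale (of_nat (Suc k)) (act (propagator_poly (lifted_prop (cvec (Suc m) \<theta>)) ?M ^ k * edge_poly ?M \<beta>) T))) I N y
      = fcoef (form_integral m ?L - form_integral m ?U) I N y" .
  qed
  finally show ?thesis .
qed

text \<open>\<open>fser\<close> divides by k!, but \<open>mf_moyal\<close> has done so already; the
  factorial compensates.\<close>

definition mf_star :: "('n::{finite,linorder}, 'r::finite) mform \<Rightarrow> ('n, 'r) mform \<Rightarrow> ('n, 'r) mform" where
  "mf_star x y = (\<chi> i j. fser (\<lambda>k. fscale (fact k) (mf_moyal k x y $ i $ j)))"

lemma mvb_scale: "vb e c \<Longrightarrow> mvb d x \<Longrightarrow> mvb (e + d) (mscale c x)"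
  by (auto simp: mvb_def mscale_def intro!: fvb_scale)

lemma mvb_sum: "(\<And>x. x \<in> S \<Longrightarrow> mvb d (f x)) \<Longrightarrow> mvb d (sum f S)"
  by (auto simp: mvb_def intro!: fvb_sum)

lemma mvb_moyal: "mvb d x \<Longrightarrow> mvb e y \<Longrightarrow> mvb (d + e) (mf_moyal k x y)"
proof (induction k arbitrary: x y)
  case (Suc k)
  have "mvb (0 + (0 + (d + e))) (mf_moyal (Suc k) x y)"
    unfolding mf_moyal.simps
    by (intro mvb_scale vb_const mvb_sum[where d = "0 + (d + e)"] Suc.IH mvb_lie Suc.prems)
  then show ?case by simp
qed (simp add: mvb_mult)

lemma fvb_fact: "fvb d w \<Longrightarrow> fvb d (fscale (fact k) w)"
  using fvb_scale[OF vb_const, of d w "fact k"] by (simp add: fact_fls)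

lemma fact_hbar: "fscale (hbar ^ k / fact k) (fscale (fact k) w) = fscale (hbar ^ k) w"
  by simp

text \<open>Lets the product in a slot be replaced by a finite sum, to which the linearity of
  \<open>act\<close> applies, with an error whose order is higher by \<open>K\<close>.\<close>

lemma mf_star_remainder:
  assumes "mvb d x" "mvb e y"
  shows "mvb (d + e + int K) (mf_star x y - (\<Sum>k<K. mscale (hbar ^ k) (mf_moyal k x y)))"
  unfolding mvb_def fvb_def vb_def
proof (intro allI impI)
  fix i j I N assume N: "N < d + e + int K"
  have v: "fvb (d + e) (fscale (fact k) (mf_moyal k x y $ i $ j))" for k
    using mvb_moyal[OF assms, of k] by (auto simp: mvb_def intro: fvb_fact)
  show "fls_nth ((mf_star x y - (\<Sum>k<K. mscale (hbar ^ k) (mf_moyal k x y))) $ i $ j $ I) N = 0"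
  proof (rule mps_eqI)
    fix z
    have "fcoef (mf_star x y $ i $ j) I N z = fcoef ((\<Sum>k<K. mscale (hbar ^ k) (mf_moyal k x y)) $ i $ j) I N z"
      unfolding mf_star_def vec_lambda_beta fser_coeff[OF v N] fact_hbar sum_component coeff_sum[symmetric]
      by (simp add: mscale_def)
    then show "mcoeff (fls_nth ((mf_star x y - (\<Sum>k<K. mscale (hbar ^ k) (mf_moyal k x y))) $ i $ j $ I) N) z = mcoeff 0 z"
      by (simp add: minus_mps.rep_eq zero_mps.rep_eq)
  qed
qed

text \<open>The Cauchy products of \<open>act_collision\<close> add up to a product of two series,
  one of which is the Moyal product. At a fixed power of \<open>hbar\<close> everything is cut at
  the same \<open>K\<close>.\<close>

theorem collision:
  fixes x y :: "('n::{finite,linorder}, 'r::finite) mform" and P P' :: "nat \<Rightarrow> nat \<Rightarrow> complex"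
  assumes a: "length l = a" and M: "M = Suc (length l + length l')"
    and P: "P a (Suc a) = 1 / 2" "P (Suc a) a = - 1 / 2"
    and eq: "\<And>x y. x < Suc M \<Longrightarrow> y < Suc M \<Longrightarrow> collapse a x \<noteq> collapse a y \<Longrightarrow> P x y = P' (collapse a x) (collapse a y)"
  shows "fser (\<lambda>k. act (propagator_poly P (Suc M) ^ k) (l @ x # y # l')) =
     fser (\<lambda>k. act (propagator_poly P' M ^ k) (l @ mf_star x y # l'))"
proof -
  obtain d where d: "\<forall>z\<in>set (x # y # l @ l'). mvb d z" using mvb_list by blast
  define B where "B j z = act (propagator_poly P' M ^ j) (l @ z # l')" for j z
  define D where "D = int (length l + length l') * d"
  have vB: "fvb (D + e) (B j z)" if "mvb e z" for e z j
  proof -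
    have "list_all2 mvb (replicate (length l) d @ e # replicate (length l') d) (l @ z # l')"
    proof -
      have "list_all2 mvb (replicate (length l) d) l" if "\<forall>z\<in>set l. mvb d z" for l :: "('n, 'r) mform list"
        using that by (simp add: list_all2_conv_all_nth)
      with d that show ?thesis by (intro list_all2_appendI) simp_all
    qed
    from fvb_act_list[OF this] show ?thesis by (simp add: B_def D_def sum_list_replicate algebra_simps)
  qed
  define e where "e = d + d"
  have vm: "mvb e (mf_moyal k x y)" for k unfolding e_def by (rule mvb_moyal) (use d in auto)
  have vh: "mvb (int i + e) (mscale (hbar ^ i) (mf_moyal i x y))" for i by (rule mvb_scale[OF vb_X vm])
  have vs: "mvb e (mf_star x y)"
    using mf_star_remainder[of d x d y 0] d by (simp add: e_def)
  have vA: "fvb (D + e) (act p (l @ x # y # l'))" for p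
    using fvb_act[of "l @ x # y # l'" d p] d by (simp add: D_def e_def algebra_simps)
  show ?thesis
  proof (rule form_eqI)
    fix I N z
    define K where "K = nat (N - (D + e) + 1)"
    have N: "N < D + e + int K" by (simp add: K_def)
    define g where "g i j = fcoef (fscale (hbar ^ j / fact j) (B j (mscale (hbar ^ i) (mf_moyal i x y)))) I N z" for i j
    have col: "fscale (hbar ^ k / fact k) (act (propagator_poly P (Suc M) ^ k) (l @ x # y # l')) =
        (\<Sum>i\<le>k. fscale (hbar ^ (k - i) / fact (k - i)) (B (k - i) (mscale (hbar ^ i) (mf_moyal i x y))))" for k
      unfolding B_def by (rule act_collision[OF a M P eq])
    have g0: "g i j = 0" if "K \<le> i + j" for i j
      unfolding g_def
      by (rule coeff_fvb[OF fvb_scale[OF vb_hk vB[OF vh]]]) (use that N in simp)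
    have "fcoef (fser (\<lambda>k. act (propagator_poly P (Suc M) ^ k) (l @ x # y # l'))) I N z = (\<Sum>k<K. \<Sum>i\<le>k. g i (k - i))"
      unfolding fser_coeff[OF vA N] col g_def coeff_sum ..
    also have "\<dots> = (\<Sum>(i, j)\<in>{(i, j). i + j < K}. g i j)" by (rule sum.triangle_reindex[symmetric])
    \<comment> \<open>Beyond the triangle all terms have too high an order, so the sum may be
      extended to the square and the two indices separated.\<close>
    also have "\<dots> = (\<Sum>(i, j)\<in>{..<K} \<times> {..<K}. g i j)"
      by (rule sum.mono_neutral_left) (auto, metis g0 not_less)
    also have "\<dots> = (\<Sum>j<K. \<Sum>i<K. g i j)" by (subst sum.swap) (simp add: sum.cartesian_product)
    also have "\<dots> = (\<Sum>j<K. fcoef (fscale (hbar ^ j / fact j) (B j (mf_star x y))) I N z)"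
    proof (rule sum.cong[OF refl])
      fix j
      define R where "R = mf_star x y - (\<Sum>k<K. mscale (hbar ^ k) (mf_moyal k x y))"
      have vR: "mvb (e + int K) R" unfolding R_def e_def by (rule mf_star_remainder) (use d in auto)
      have "mf_star x y = (\<Sum>k<K. mscale (hbar ^ k) (mf_moyal k x y)) + R" by (simp add: R_def)
      then have "B j (mf_star x y) = (\<Sum>k<K. B j (mscale (hbar ^ k) (mf_moyal k x y))) + B j R"
        by (simp add: B_def act_mid_add act_mid_sum)
      \<comment> \<open>The tail of the Moyal series does not reach the coefficient
        \<open>N\<close>.\<close>
      moreover have "fcoef (fscale (hbar ^ j / fact j) (B j R)) I N z = 0"
        by (rule coeff_fvb[OF fvb_scale[OF vb_hk vB[OF vR]]]) (use N in simp)
      ultimately show "(\<Sum>i<K. g i j) = fcoef (fscale (hbar ^ j / fact j) (B j (mf_star x y))) I N z"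
        by (simp only: fs.scale_right_distrib fs.scale_sum_right coeff_add coeff_sum g_def add_0_right)
    qed
    also have "\<dots> = fcoef (fser (\<lambda>k. act (propagator_poly P' M ^ k) (l @ mf_star x y # l'))) I N z"
      unfolding fser_coeff[OF vB[OF vs, unfolded B_def] N] B_def ..
    finally show "fcoef (fser (\<lambda>k. act (propagator_poly P (Suc M) ^ k) (l @ x # y # l'))) I N z =
      fcoef (fser (\<lambda>k. act (propagator_poly P' M ^ k) (l @ mf_star x y # l'))) I N z" .
  qed
qed

section \<open>Rotating a tensor and inserting a slot\<close>

text \<open>The Koszul sign for passing an element of parity \<open>b\<close>, where
  \<open>True\<close> means odd.\<close>

definition twist :: "bool \<Rightarrow> 'n::finite form \<Rightarrow> 'n form" where
  "twist b = (if b then grade else (\<lambda>w. w))"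

definition parity_form :: "bool \<Rightarrow> 'n::finite form \<Rightarrow> bool" where
  "parity_form b w \<longleftrightarrow> (if b then odd_form w else even_form w)"

definition parity_mform :: "bool \<Rightarrow> ('n::finite, 'r::finite) mform \<Rightarrow> bool" where
  "parity_mform b x \<longleftrightarrow> (\<forall>i j. parity_form b (x $ i $ j))"

lemma mf_map_id [simp]: "mf_map (\<lambda>w. w) x = x"
  by (simp add: mf_map_def vec_eq_iff)

lemma mf_map_comp: "mf_map g (mf_map h x) = mf_map (\<lambda>w. g (h w)) x"
  by (simp add: mf_map_def vec_eq_iff)

lemma twist_twist [simp]: "twist b (twist b w) = w" by (simp add: twist_def)
lemma twist_lie: "twist b (lie_deriv i w) = lie_deriv i (twist b w)"
  by (simp add: twist_def grade_lie)

lemma parity_lie: "parity_form b w \<Longrightarrow> parity_form b (lie_deriv i w)"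
  by (auto simp: parity_form_def odd_form_def even_form_def lie_deriv_def)
lemma parity_mlie: "parity_mform b x \<Longrightarrow> parity_mform b (mf_map (lie_deriv i) x)"
  by (simp add: parity_mform_def mf_map_def parity_lie)

lemma twist_mprod: "mf_map (twist b) (mprod T) = mprod (map (mf_map (twist b)) T)"
proof (cases b)
  case True
  then show ?thesis using grade_mprod[of T] by (simp add: twist_def)
next
  case False
  have "mf_map (\<lambda>w. w) = (\<lambda>x :: ('a, 'b) mform. x)" by (rule ext) simp
  with False show ?thesis by (simp add: twist_def)
qed

lemma trace_prod_rotate: "parity_mform b x \<Longrightarrow> mf_trace_prod (l @ [x]) = mf_trace_prod (x # map (mf_map (twist b)) l)"
proof -
  assume x: "parity_mform b x"
  have "mtr (mf_mult y x) = mtr (mf_mult x (mf_map (twist b) y))" for y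
  proof (cases b)
    case True
    then have "odd_mform x" using x by (simp add: parity_mform_def parity_form_def odd_mform_def)
    from trace_odd[OF this, of "mf_map grade y"] True show ?thesis by (simp add: mf_map_comp twist_def)
  next
    case False
    then have "even_mform x" using x by (simp add: parity_mform_def parity_form_def even_mform_def)
    from trace_even[OF this] False show ?thesis by (simp add: twist_def)
  qed
  then show ?thesis by (simp add: trace_prod flip: twist_mprod)
qed

lemma map_twist_lie:
  "(map (mf_map (twist b)) l)[c := mf_map (lie_deriv i) (map (mf_map (twist b)) l ! c)] =
    map (mf_map (twist b)) (l[c := mf_map (lie_deriv i) (l ! c)])"
  by (cases "c < length l") (simp_all add: map_update mf_map_comp twist_lie list_update_beyond not_less)

definition rotates_to :: "nat \<Rightarrow> bool \<Rightarrow> 'n::{finite,linorder} op_poly \<Rightarrow> 'n op_poly \<Rightarrow> 'r::finite itself \<Rightarrow> bool" where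
  "rotates_to n b s s' R \<longleftrightarrow> (\<forall>l. \<forall>x :: ('n, 'r) mform. length l = n \<longrightarrow> parity_mform b x \<longrightarrow>
      act s (l @ [x]) = act s' (x # map (mf_map (twist b)) l))"

lemma rotates_to_one: "rotates_to n b 1 1 R"
  by (simp add: rotates_to_def act_one trace_prod_rotate)
lemma rotates_to_sum: "(\<And>x. x \<in> S \<Longrightarrow> rotates_to n b (s x) (s' x) R) \<Longrightarrow> rotates_to n b (sum s S) (sum s' S) R"
  by (simp add: rotates_to_def act_sum)
lemma rotates_to_const: "rotates_to n b s s' R \<Longrightarrow> rotates_to n b (Dconst c * s) (Dconst c * s') R"
  by (simp add: rotates_to_def act_Dconst_mult)

definition rot_index :: "nat \<Rightarrow> nat \<Rightarrow> nat" where
  "rot_index n c = (if c = n then 0 else Suc c)"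

lemma rotates_to_var: "rotates_to n b s s' R \<Longrightarrow> rotates_to n b (Dvar c i * s) (Dvar (rot_index n c) i * s') R"
  unfolding rotates_to_def
proof (intro allI impI)
  fix l :: "('a, 'b) mform list" and x :: "('a, 'b) mform"
  assume r: "\<forall>l. \<forall>x :: ('a, 'b) mform. length l = n \<longrightarrow> parity_mform b x \<longrightarrow> act s (l @ [x]) = act s' (x # map (mf_map (twist b)) l)"
    and l: "length l = n" and x: "parity_mform b x"
  consider "c = n" | "c < n" | "n < c" by linarith
  then show "act (Dvar c i * s) (l @ [x]) = act (Dvar (rot_index n c) i * s') (x # map (mf_map (twist b)) l)"
  proof cases
    case 1
    then show ?thesis using r l parity_mlie[OF x, of i] by (simp add: act_Dvar rot_index_def list_update_append nth_append)
  next
    case 2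
    then show ?thesis using r[rule_format, of "l[c := mf_map (lie_deriv i) (l ! c)]" x] l x map_twist_lie[of b l c i]
      by (simp add: act_Dvar rot_index_def list_update_append nth_append)
  next
    case 3
    then show ?thesis using r l x by (simp add: act_Dvar rot_index_def list_update_beyond)
  qed
qed

lemma propagator_poly_rotate:
  assumes P: "\<And>a b. a \<le> n \<Longrightarrow> b \<le> n \<Longrightarrow> a \<noteq> b \<Longrightarrow> P a b = P' (rot_index n a) (rot_index n b)"
  shows "rotates_to n b (propagator_poly P (Suc n) ^ k) (propagator_poly P' (Suc n) ^ k) R"
proof (induction k)
  case 0 show ?case by (simp add: rotates_to_one)
next
  case (Suc k)
  let ?S = "{p :: nat \<times> nat. fst p < Suc n \<and> snd p < Suc n \<and> fst p \<noteq> snd p}"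
  have "propagator_poly P' (Suc n) * s' = (\<Sum>p\<in>?S. \<Sum>i\<in>UNIV. \<Sum>j\<in>UNIV.
      Dconst (1 / 2 * (P (fst p) (snd p) * omega i j)) * (Dvar (rot_index n (fst p)) i * (Dvar (rot_index n (snd p)) j * s')))"
    for s' :: "'a op_poly"
    unfolding propagator_poly_mult case_prod_unfold
    by (rule sum.reindex_bij_witness[where i = "\<lambda>p. (rot_index n (fst p), rot_index n (snd p))"
          and j = "\<lambda>p. (if fst p = 0 then n else fst p - 1, if snd p = 0 then n else snd p - 1)"])
       (auto simp: rot_index_def P split: if_splits)
  then show ?case
    unfolding power_Suc propagator_poly_mult[of P] case_prod_unfold
    by (simp only:) (intro rotates_to_sum rotates_to_const rotates_to_var Suc)
qed

lemma act_rotate: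
  fixes x :: "('n::{finite,linorder}, 'r::finite) mform"
  assumes "\<And>a b. a \<le> length l \<Longrightarrow> b \<le> length l \<Longrightarrow> a \<noteq> b \<Longrightarrow> P a b = P' (rot_index (length l) a) (rot_index (length l) b)"
    and "parity_mform b x"
  shows "act (propagator_poly P (Suc (length l)) ^ k) (l @ [x]) = act (propagator_poly P' (Suc (length l)) ^ k) (x # map (mf_map (twist b)) l)"
proof -
  have "rotates_to (length l) b (propagator_poly P (Suc (length l)) ^ k) (propagator_poly P' (Suc (length l)) ^ k :: 'n op_poly) TYPE('r)"
    by (rule propagator_poly_rotate) (rule assms(1))
  then show ?thesis using assms(2) by (simp add: rotates_to_def)
qed

lemma fint_act: "length T = Suc m \<Longrightarrow> fint m T = form_integral m (\<lambda>\<theta>. fser (\<lambda>k. act (propagator_poly (propagator \<theta>) (Suc m) ^ k) T))"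
  by (simp add: fint_def tr_dP_act)

lemma fint_fser:
  assumes T: "length T = Suc m"
  shows "good m (\<lambda>\<theta>. act (propagator_poly (propagator \<theta>) (Suc m) ^ k) T)"
    and "fint m T = fser (\<lambda>k. form_integral m (\<lambda>\<theta>. act (propagator_poly (propagator \<theta>) (Suc m) ^ k) T))"
proof -
  have g: "good m (\<lambda>\<theta>. act (propagator_poly (propagator \<theta>) (Suc m) ^ k) T)" for k
    using good_act[of "Suc m" m propagator k 1 T] nice_prop by simp
  then show "good m (\<lambda>\<theta>. act (propagator_poly (propagator \<theta>) (Suc m) ^ k) T)" .
  obtain d where "\<forall>x\<in>set T. mvb d x" using mvb_list by blast
  then have "fvb (int (length T) * d) (act p T)" for p by (intro fvb_act) auto
  from form_integral_fser[OF this g] show "fint m T = fser (\<lambda>k. form_integral m (\<lambda>\<theta>. act (propagator_poly (propagator \<theta>) (Suc m) ^ k) T))"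
    by (simp add: fint_act[OF T])
qed

lemma form_integral_rotate:
  assumes F: "good m F"
  shows "form_integral m (\<lambda>\<theta>. F (rot_cfg m \<theta>)) = form_integral m F"
proof -
  have "(LINT \<theta>:cyc_config m|cfg m. fcoef (F (rot_cfg m \<theta>)) I N y) = (LINT \<theta>:cyc_config m|cfg m. fcoef (F \<theta>) I N y)" for I N y
    by (rule cyc_config_rotate) (use F in \<open>auto simp: good_def\<close>)
  then show ?thesis by (simp add: form_integral_def flip: cfg_def)
qed

text \<open>A cyclic relabelling preserves the domain and the distances between points, so what
  remains is the graded cyclicity of the trace.\<close>

lemma fint_rotate:
  assumes l: "length l = m" and x: "parity_mform b x"
  shows "fint m (l @ [x]) = fint m (x # map (mf_map (twist b)) l)"
proof -
  have "fint m (l @ [x]) = form_integral m (\<lambda>\<theta>. fser (\<lambda>k. tr_dP (rot_cfg m \<theta>) k (l @ [x])))"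
    unfolding fint_def by (rule form_integral_rotate[symmetric], rule good_tr) (simp add: l)
  also have "\<dots> = fint m (x # map (mf_map (twist b)) l)"
  proof -
    have "tr_dP (rot_cfg m \<theta>) k (l @ [x]) = tr_dP \<theta> k (x # map (mf_map (twist b)) l)" for \<theta> k
    proof -
      have "rot_cfg m \<theta> a = \<theta> (rot_index m a)" if "a \<le> m" for a
        using that by (auto simp: rot_cfg_def rot_index_def)
      then show ?thesis
        using act_rotate[of l "propagator (rot_cfg m \<theta>)" "propagator \<theta>" b x k] x
        by (simp add: tr_dP_act l propagator_def)
    qed
    then show ?thesis by (simp add: fint_def)
  qed
  finally show ?thesis .
qed

section \<open>Slots that contain a scalar matrix\<close>

definition skip_slot :: "nat \<Rightarrow> nat \<Rightarrow> nat" where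
  "skip_slot \<beta> c = (if c < \<beta> then c else Suc c)"

text \<open>A scalar matrix commutes with all slots up to sign and can be pulled out, as long as the
  operator does not differentiate it; \<open>skip_slot\<close> never hits its index.\<close>

definition drops_slot :: "bool \<Rightarrow> nat \<Rightarrow> 'n::{finite,linorder} op_poly \<Rightarrow> 'n op_poly \<Rightarrow> 'r::finite itself \<Rightarrow> bool" where
  "drops_slot b \<beta> s s' R \<longleftrightarrow> (\<forall>l w. \<forall>l' :: ('n, 'r) mform list. length l = \<beta> \<longrightarrow> parity_form b w \<longrightarrow>
      act s (l @ mat w # l') = wedge w (act s' (map (mf_map (twist b)) l @ l')))"

lemma drops_slot_one: "drops_slot b \<beta> 1 1 R"
proof -
  have "mf_trace_prod (l @ mat w # l') = wedge w (mf_trace_prod (map (mf_map (twist b)) l @ l'))"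
    if "parity_form b w" for l l' :: "('a, 'b) mform list" and w :: "'a form"
  proof (cases b)
    case True
    then show ?thesis using trace_prod_central[of w l l'] that by (simp add: twist_def parity_form_def)
  next
    case False
    then have w: "even_form w" using that by (simp add: parity_form_def)
    have "mf_mult x (mf_mult (mat w) y) = (\<chi> i j. wedge w (mf_mult x y $ i $ j))" for x y :: "('a, 'b) mform"
    proof -
      have "mf_mult (mat w) y = (\<chi> i j. wedge w (y $ i $ j))"
        by (simp add: mf_mult_def mat_def vec_eq_iff if_distrib[of "\<lambda>f. wedge f _"] wedge_lin cong: if_cong)
      moreover have "wedge a (wedge w c) = wedge w (wedge a c)" for a c
        using wedge_even[OF w, of a] by (simp flip: wedge_assoc)
      then have "mf_mult x (\<chi> i j. wedge w (y $ i $ j)) = (\<chi> i j. wedge w (mf_mult x y $ i $ j))"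
        by (simp add: mf_mult_def vec_eq_iff wedge_lin)
      ultimately show ?thesis by simp
    qed
    moreover have "map (mf_map (twist b)) l = l" using False by (simp add: twist_def map_idI)
    ultimately show ?thesis by (simp add: trace_prod mtr_def wedge_lin)
  qed
  then show ?thesis by (simp add: drops_slot_def act_one)
qed

lemma drops_slot_sum: "(\<And>x. x \<in> S \<Longrightarrow> drops_slot b \<beta> (s x) (s' x) R) \<Longrightarrow> drops_slot b \<beta> (sum s S) (sum s' S) R"
  by (simp add: drops_slot_def act_sum wedge_lin)
lemma drops_slot_const: "drops_slot b \<beta> s s' R \<Longrightarrow> drops_slot b \<beta> (Dconst c * s) (Dconst c * s') R"
  by (simp add: drops_slot_def act_Dconst_mult wedge_lin)

lemma drops_slot_var: "drops_slot b \<beta> s s' R \<Longrightarrow> drops_slot b \<beta> (Dvar (skip_slot \<beta> c) i * s) (Dvar c i * s') R"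
  unfolding drops_slot_def
proof (intro allI impI)
  fix l l' :: "('a, 'b) mform list" and w :: "'a form"
  assume r: "\<forall>l w. \<forall>l' :: ('a, 'b) mform list. length l = \<beta> \<longrightarrow> parity_form b w \<longrightarrow>
      act s (l @ mat w # l') = wedge w (act s' (map (mf_map (twist b)) l @ l'))"
    and l: "length l = \<beta>" and w: "parity_form b w"
  show "act (Dvar (skip_slot \<beta> c) i * s) (l @ mat w # l') = wedge w (act (Dvar c i * s') (map (mf_map (twist b)) l @ l'))"
  proof (cases "c < \<beta>")
    case True
    then show ?thesis
      using r[rule_format, of "l[c := mf_map (lie_deriv i) (l ! c)]" w l'] l w map_twist_lie[of b l c i]
      by (simp add: act_Dvar skip_slot_def list_update_append nth_append)
  next
    case False
    then obtain k where k: "c = \<beta> + k" by (metis le_iff_add not_less)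
    show ?thesis
      using r[rule_format, of l w "l'[k := mf_map (lie_deriv i) (l' ! k)]"] l w
      by (simp add: k act_Dvar skip_slot_def list_update_append nth_append)
  qed
qed

text \<open>The remainder is kept with two explicit factors \<open>\<eta>\<close>, each of which
  will differentiate the same slot once.\<close>

lemma power_first_order:
  fixes \<rho> \<eta> :: "'a::comm_ring_1"
  shows "\<exists>r. (\<rho> + \<eta>) ^ k = \<rho> ^ k + of_nat k * (\<eta> * \<rho> ^ (k - 1)) + \<eta> * (\<eta> * r)"
proof (induction k)
  case 0 show ?case by (rule exI[of _ 0]) simp
next
  case (Suc k)
  then obtain r where r: "(\<rho> + \<eta>) ^ k = \<rho> ^ k + of_nat k * (\<eta> * \<rho> ^ (k - 1)) + \<eta> * (\<eta> * r)" by blast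
  have "(\<rho> + \<eta>) ^ Suc k = \<rho> ^ Suc k + of_nat (Suc k) * (\<eta> * \<rho> ^ k) + \<eta> * (\<eta> * (of_nat k * \<rho> ^ (k - 1) + (\<rho> + \<eta>) * r))"
    unfolding power_Suc r by (cases k) (simp_all add: algebra_simps)
  then show ?case by auto
qed

definition slot_edge :: "(nat \<Rightarrow> complex) \<Rightarrow> nat \<Rightarrow> 'n::finite coord \<Rightarrow> 'n op_poly" where
  "slot_edge q N j = (\<Sum>a<N. \<Sum>i\<in>UNIV. Dconst (q a * omega i j) * Dvar a i)"

text \<open>Second derivatives of \<open>w\<close> vanish, so at most one contraction can end at its
  slot. The exponent is split into \<open>\<rho>\<close>, which avoids the slot, and
  \<open>\<eta>\<close>, which is linear in its variables, and the power is expanded to first order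
  in \<open>\<eta>\<close>.\<close>

lemma act_linear_slot:
  fixes l l' :: "('n::{finite,linorder}, 'r::finite) mform list"
  assumes w: "parity_form b w" "\<And>i j. lie_deriv i (lie_deriv j w) = 0"
    and l: "length l = \<beta>" and N: "N = length l + length l'"
    and anti: "\<And>a. a \<noteq> \<beta> \<Longrightarrow> P \<beta> a = - P a \<beta>"
  shows "act (propagator_poly P (Suc N) ^ k) (l @ mat w # l') =
      wedge w (act (propagator_poly (\<lambda>a c. P (skip_slot \<beta> a) (skip_slot \<beta> c)) N ^ k) (map (mf_map (twist b)) l @ l'))
    + fscale (of_nat k) (\<Sum>j\<in>UNIV. wedge (lie_deriv j w) (act (slot_edge (\<lambda>a. P (skip_slot \<beta> a) \<beta>) N j *
        propagator_poly (\<lambda>a c. P (skip_slot \<beta> a) (skip_slot \<beta> c)) N ^ (k - 1)) (map (mf_map (twist b)) l @ l')))"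
proof -
  let ?sk = "skip_slot \<beta>" and ?T = "l @ mat w # l'" and ?T' = "map (mf_map (twist b)) l @ l'"
  define P' where "P' a c = P (?sk a) (?sk c)" for a c
  define \<rho> :: "'n op_poly" where "\<rho> = (\<Sum>p | fst p < N \<and> snd p < N \<and> fst p \<noteq> snd p. \<Sum>i\<in>UNIV. \<Sum>j\<in>UNIV.
      Dconst (1 / 2 * (P' (fst p) (snd p) * omega i j)) * (Dvar (?sk (fst p)) i * Dvar (?sk (snd p)) j))"
  define g :: "'n coord \<Rightarrow> 'n op_poly" where "g j = (\<Sum>a<N. \<Sum>i\<in>UNIV. Dconst (P (?sk a) \<beta> * omega i j) * Dvar (?sk a) i)" for j
  define \<eta> where "\<eta> = (\<Sum>j\<in>UNIV. Dvar \<beta> j * g j)"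
  have \<beta>: "\<beta> < Suc N" using l N by simp
  have inj: "inj ?sk" by (auto simp: inj_on_def skip_slot_def split: if_splits)
  have sk: "?sk ` {..<N} = {a. a < Suc N \<and> a \<noteq> \<beta>}"
  proof
    show "{a. a < Suc N \<and> a \<noteq> \<beta>} \<subseteq> ?sk ` {..<N}"
    proof
      fix a assume "a \<in> {a. a < Suc N \<and> a \<noteq> \<beta>}"
      then have "a = ?sk (if a < \<beta> then a else a - 1)" "(if a < \<beta> then a else a - 1) < N"
        using \<beta> by (auto simp: skip_slot_def)
      then show "a \<in> ?sk ` {..<N}" by blast
    qed
  qed (use \<beta> in \<open>auto simp: skip_slot_def\<close>)
  have "propagator_poly P (Suc N) = \<rho> + \<eta>"
  proof -
    have 1: "(\<Sum>p | fst p < Suc N \<and> snd p < Suc N \<and> fst p \<noteq> snd p \<and> fst p \<noteq> \<beta> \<and> snd p \<noteq> \<beta>. Dconst (1 / 2 * P (fst p) (snd p)) * omega_op (fst p) (snd p)) = \<rho>"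
    proof -
      have img: "{p. fst p < Suc N \<and> snd p < Suc N \<and> fst p \<noteq> snd p \<and> fst p \<noteq> \<beta> \<and> snd p \<noteq> \<beta>} =
          map_prod ?sk ?sk ` {p. fst p < N \<and> snd p < N \<and> fst p \<noteq> snd p}" (is "?A = ?B")
      proof
        show "?A \<subseteq> ?B"
        proof
          fix p assume p: "p \<in> ?A"
          then have "fst p \<in> ?sk ` {..<N}" "snd p \<in> ?sk ` {..<N}" by (auto simp: sk)
          then obtain a c where "a < N" "c < N" "fst p = ?sk a" "snd p = ?sk c" by auto
          with p show "p \<in> ?B" by (intro image_eqI[of _ _ "(a, c)"]) (auto simp: prod_eq_iff)
        qed
        show "?B \<subseteq> ?A"
        proof
          fix p assume "p \<in> ?B"
          then obtain a c where ac: "a < N" "c < N" "a \<noteq> c" "p = (?sk a, ?sk c)" by auto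
          then have "?sk a \<in> {a. a < Suc N \<and> a \<noteq> \<beta>}" "?sk c \<in> {a. a < Suc N \<and> a \<noteq> \<beta>}" by (auto simp flip: sk)
          with ac show "p \<in> ?A" using inj by (auto simp: inj_eq)
        qed
      qed
      have "inj_on (map_prod ?sk ?sk) S" for S
        by (rule inj_on_subset[OF prod.inj_map[OF inj inj]]) simp
      then show ?thesis
        unfolding img
        by (subst sum.reindex, assumption)
           (simp only: \<rho>_def omega_op_def o_def P'_def sum_distrib_left Dconst_mult mult.assoc fst_map_prod snd_map_prod)
    qed
    \<comment> \<open>Both orders of a pair through the slot agree, since \<open>P\<close> and
      \<open>omega\<close> are antisymmetric there.\<close>
    have 2: "(\<Sum>a | a < Suc N \<and> a \<noteq> \<beta>. Dconst (1 / 2 * P a \<beta>) * omega_op a \<beta> + Dconst (1 / 2 * P \<beta> a) * omega_op \<beta> a) = \<eta>"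
    proof -
      have "(\<Sum>a | a < Suc N \<and> a \<noteq> \<beta>. Dconst (1 / 2 * P a \<beta>) * omega_op a \<beta> + Dconst (1 / 2 * P \<beta> a) * omega_op \<beta> a) =
          (\<Sum>a | a < Suc N \<and> a \<noteq> \<beta>. Dconst (P a \<beta>) * omega_op a \<beta>)"
        by (intro sum.cong refl omega_op_pair anti) auto
      also have "\<dots> = (\<Sum>a<N. Dconst (P (?sk a) \<beta>) * omega_op (?sk a) \<beta>)"
        unfolding sk[symmetric] by (subst sum.reindex[OF inj_on_subset[OF inj]]) simp_all
      also have "\<dots> = (\<Sum>a<N. \<Sum>j\<in>UNIV. \<Sum>i\<in>UNIV. Dvar \<beta> j * (Dconst (P (?sk a) \<beta> * omega i j) * Dvar (?sk a) i))"
        unfolding omega_op_def by (intro sum.cong refl, subst sum.swap) (simp only: sum_distrib_left Dconst_mult mult_ac)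
      also have "\<dots> = \<eta>"
        unfolding \<eta>_def g_def sum_distrib_left by (rule sum.swap)
      finally show ?thesis .
    qed
    show ?thesis
      unfolding propagator_poly_omega case_prod_unfold sum_pairs_through[OF \<beta>] fst_conv snd_conv 1 2 ..
  qed
  moreover obtain r where r: "(\<rho> + \<eta>) ^ k = \<rho> ^ k + of_nat k * (\<eta> * \<rho> ^ (k - 1)) + \<eta> * (\<eta> * r)"
    using power_first_order by blast
  have upd: "act (Dvar \<beta> j * s) (l @ mat v # l') = act s (l @ mat (lie_deriv j v) # l')" for j s v
  proof -
    have "mf_map (lie_deriv j) (mat v :: ('n, 'r) mform) = mat (lie_deriv j v)" by (simp add: mf_map_def mat_def vec_eq_iff lie_lin)
    then show ?thesis using l by (simp add: act_Dvar list_update_append nth_append)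
  qed
  \<comment> \<open>Two factors \<open>\<eta>\<close> differentiate \<open>w\<close> twice.\<close>
  have "act (\<eta> * (\<eta> * r)) ?T = 0"
  proof -
    have "\<eta> * (\<eta> * r) = (\<Sum>j\<in>UNIV. \<Sum>j'\<in>UNIV. Dvar \<beta> j * (Dvar \<beta> j' * (g j * (g j' * r))))"
      unfolding \<eta>_def sum_distrib_right sum_distrib_left by (simp add: mult_ac)
    moreover have "(mat 0 :: ('n, 'r) mform) = 0" by (simp add: mat_def vec_eq_iff)
    ultimately show ?thesis by (simp add: act_sum upd w(2) act_mid_0)
  qed
  moreover have dp: "drops_slot b \<beta> (\<rho> ^ j) (propagator_poly P' N ^ j) TYPE('r)" for j
  proof (induction j)
    case 0 show ?case by (simp add: drops_slot_one)
  next
    case (Suc j)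
    have "\<rho> * s = (\<Sum>p | fst p < N \<and> snd p < N \<and> fst p \<noteq> snd p. \<Sum>i\<in>UNIV. \<Sum>j\<in>UNIV.
      Dconst (1 / 2 * (P' (fst p) (snd p) * omega i j)) * (Dvar (?sk (fst p)) i * (Dvar (?sk (snd p)) j * s)))" for s
      by (simp add: \<rho>_def sum_distrib_right mult.assoc)
    then show ?case
      unfolding power_Suc propagator_poly_mult case_prod_unfold
      by (simp only:) (intro drops_slot_sum drops_slot_const drops_slot_var Suc)
  qed
  have "drops_slot b \<beta> (g j * s) (slot_edge (\<lambda>a. P (?sk a) \<beta>) N j * s') TYPE('r)" if "drops_slot b \<beta> s s' TYPE('r)" for j s s'
    unfolding g_def slot_edge_def sum_distrib_right mult.assoc
    by (intro drops_slot_sum drops_slot_const drops_slot_var that)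
  then have dg: "act (g j * \<rho> ^ i) (l @ mat v # l') = wedge v (act (slot_edge (\<lambda>a. P (?sk a) \<beta>) N j * propagator_poly P' N ^ i) ?T')"
    if "parity_form b v" for i j v
    using dp[of i] l that unfolding drops_slot_def by blast
  have "act (of_nat k * (\<eta> * \<rho> ^ (k - 1))) ?T = fscale (of_nat k) (\<Sum>j\<in>UNIV. wedge (lie_deriv j w) (act (slot_edge (\<lambda>a. P (?sk a) \<beta>) N j * propagator_poly P' N ^ (k - 1)) ?T'))"
    unfolding Dconst_of_nat[symmetric] act_Dconst_mult fls_of_nat[symmetric]
    by (simp add: \<eta>_def sum_distrib_right mult.assoc act_sum upd dg parity_lie w(1))
  moreover have "act (\<rho> ^ k) ?T = wedge w (act (propagator_poly P' N ^ k) ?T')"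
    using dp[of k] l w(1) unfolding drops_slot_def by blast
  ultimately show ?thesis
    by (simp add: r act_add P'_def[abs_def])
qed

lemma lifted_prop_anti: "a \<noteq> b \<Longrightarrow> lifted_prop c b a = - lifted_prop c a b"
  by (auto simp: lifted_prop_def)

lemma lifted_prop_skip: "a \<noteq> b \<Longrightarrow> lifted_prop (insert_point \<beta> x c) (skip_slot \<beta> a) (skip_slot \<beta> b) = lifted_prop c a b"
  by (auto simp: lifted_prop_def insert_point_def skip_slot_def)

text \<open>Summing over \<open>r\<close> lets the new point run through all arcs. The contractions
  with \<open>w\<close> have a primitive built from the squares of the propagators, which is
  continuous across the other points; so the arcs telescope, and its equal values at 0 and 1 cancel.
  Only the uncontracted term, which is constant in the new position, is left.\<close>

theorem insert_central:
  fixes T :: "('n::{finite,linorder}, 'r::finite) mform list"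
  assumes T: "length T = Suc m" and w: "parity_form b w" "\<And>i j. lie_deriv i (lie_deriv j w) = 0"
  shows "(\<Sum>r<Suc m. form_integral (Suc m) (\<lambda>\<theta>. act (propagator_poly (propagator \<theta>) (Suc (Suc m)) ^ k)
      (map (mf_map (twist b)) (take (Suc r) T) @ mat w # drop (Suc r) T)))
    = form_integral m (\<lambda>\<theta>. wedge w (act (propagator_poly (propagator \<theta>) (Suc m) ^ k) T))"
proof (rule form_eqI)
  fix I N y
  define TT where "TT r = map (mf_map (twist b)) (take (Suc r) T) @ mat w # drop (Suc r) T" for r
  define \<Lambda>0 where "\<Lambda>0 p = fcoef (wedge w (act p T)) I N y" for p
  define \<Lambda>1 where "\<Lambda>1 j p = fcoef (wedge (lie_deriv j w) (act p T)) I N y" for j p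
  define pp :: "(nat \<Rightarrow> real) \<Rightarrow> 'n op_poly" where "pp c = propagator_poly (lifted_prop c) (Suc m)" for c
  \<comment> \<open>\<open>A\<close> is the uncontracted part and \<open>B c a\<close> the
    coefficient of a contraction of \<open>w\<close> with slot \<open>a\<close>; neither depends on
    the new position.\<close>
  define A where "A c = \<Lambda>0 (pp c ^ k)" for c
  define B where "B c a = of_nat k * (\<Sum>j\<in>UNIV. \<Sum>i\<in>UNIV. omega i j * \<Lambda>1 j (pp c ^ (k - 1) * Dvar a i))" for c a
  have wl: "op_functional (\<lambda>p. fcoef (wedge v (act p T)) I N y)" for v
    unfolding op_functional_def
    by (simp only: act_add wedge_lin coeff_add act_Dconst_mult coeff_fscale_const) simp
  then have \<Lambda>0: "op_functional \<Lambda>0" and \<Lambda>1: "op_functional (\<Lambda>1 j)" for j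
    by (simp_all add: \<Lambda>0_def[abs_def] \<Lambda>1_def[abs_def])
  have nA: "nice m (\<lambda>\<theta>. A (cvec m \<theta>))"
    unfolding A_def pp_def using nice_propagator_power[OF nice_good_pos[OF good_pos_cvec] \<Lambda>0, where N = "Suc m" and k = k and s = 1] by simp
  have nB: "nice m (\<lambda>\<theta>. B (cvec m \<theta>) a)" for a
    unfolding B_def pp_def by (intro nice_mult nice_const nice_sum nice_propagator_power[OF nice_good_pos[OF good_pos_cvec] \<Lambda>1])
  define P where "P \<beta> x c a = lifted_prop (insert_point \<beta> x c) (skip_slot \<beta> a) \<beta>" for \<beta> x c a
  define \<Psi> where "\<Psi> r c = fcoef (act (propagator_poly (lifted_prop c) (Suc (Suc m)) ^ k) (TT r)) I N y" for r c
  have \<Psi>: "\<Psi> r (insert_point (Suc r) x c) = A c + (\<Sum>a<Suc m. P (Suc r) x c a * B c a)" if r: "r < Suc m" for r x c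
  proof -
    let ?Q = "lifted_prop (insert_point (Suc r) x c)"
    have tt: "map (mf_map (twist b)) (map (mf_map (twist b)) (take (Suc r) T)) @ drop (Suc r) T = T"
      by (simp add: mf_map_comp o_def)
    have len: "length (map (mf_map (twist b)) (take (Suc r) T)) = Suc r" "Suc m = length (map (mf_map (twist b)) (take (Suc r) T)) + length (drop (Suc r) T)"
      using T r by auto
    have sp: "propagator_poly (\<lambda>a c'. ?Q (skip_slot (Suc r) a) (skip_slot (Suc r) c')) (Suc m) = pp c"
      unfolding pp_def by (rule propagator_poly_cong) (rule lifted_prop_skip)
    have "act (propagator_poly ?Q (Suc (Suc m)) ^ k) (TT r) = wedge w (act (pp c ^ k) T) +
      fscale (of_nat k) (\<Sum>j\<in>UNIV. wedge (lie_deriv j w) (act (slot_edge (P (Suc r) x c) (Suc m) j * pp c ^ (k - 1)) T))"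
    proof -
      have "?Q (Suc r) a = - ?Q a (Suc r)" if "a \<noteq> Suc r" for a by (rule lifted_prop_anti[OF that])
      from act_linear_slot[where P = "?Q" and k = k, OF w len this] show ?thesis
        unfolding tt sp TT_def P_def[abs_def] .
    qed
    then have "\<Psi> r (insert_point (Suc r) x c) = A c + of_nat k * (\<Sum>j\<in>UNIV. \<Lambda>1 j (slot_edge (P (Suc r) x c) (Suc m) j * pp c ^ (k - 1)))"
      unfolding \<Psi>_def A_def \<Lambda>0_def \<Lambda>1_def by (simp only: coeff_add coeff_sum fls_of_nat coeff_fscale_const)
    also have "(\<Sum>j\<in>UNIV. \<Lambda>1 j (slot_edge (P (Suc r) x c) (Suc m) j * pp c ^ (k - 1))) =
       (\<Sum>j\<in>UNIV. \<Sum>a<Suc m. \<Sum>i\<in>UNIV. P (Suc r) x c a * omega i j * \<Lambda>1 j (pp c ^ (k - 1) * Dvar a i))"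
    proof (rule sum.cong[OF refl])
      fix j
      have "slot_edge (P (Suc r) x c) (Suc m) j * pp c ^ (k - 1) = (\<Sum>a<Suc m. \<Sum>i\<in>UNIV. Dconst (P (Suc r) x c a * omega i j) * (pp c ^ (k - 1) * Dvar a i))"
        unfolding slot_edge_def sum_distrib_right by (intro sum.cong refl) (simp add: mult_ac)
      moreover have "\<Lambda>1 j (Dconst d * p) = d * \<Lambda>1 j p" for d p using \<Lambda>1 by (simp add: op_functional_def)
      ultimately show "\<Lambda>1 j (slot_edge (P (Suc r) x c) (Suc m) j * pp c ^ (k - 1)) =
          (\<Sum>a<Suc m. \<Sum>i\<in>UNIV. P (Suc r) x c a * omega i j * \<Lambda>1 j (pp c ^ (k - 1) * Dvar a i))"
        by (simp only: op_functional_sum[OF \<Lambda>1])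
    qed
    also have "of_nat k * \<dots> = (\<Sum>a<Suc m. P (Suc r) x c a * B c a)"
      unfolding B_def by (subst sum.swap) (simp only: sum_distrib_left mult_ac)
    finally show ?thesis .
  qed
  \<comment> \<open>Up to the factor -1/2 a primitive of the propagator to slot \<open>a\<close>;
    the absolute value lets one formula cover the arcs on both sides of that slot.\<close>
  define Q where "Q c a x = complex_of_real ((1 / 2 - \<bar>x - c a\<bar>)\<^sup>2)" for c :: "nat \<Rightarrow> real" and a and x :: real
  define G where "G c x = of_real x * A c - 1 / 2 * (\<Sum>a<Suc m. Q c a x * B c a)" for c x
  have arc: "(\<integral>x. indicator {cvec m \<theta> r..arc_end m (Suc r) (cvec m \<theta>)} x *\<^sub>R \<Psi> r (insert_point (Suc r) x (cvec m \<theta>)) \<partial>lborel) =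
      G (cvec m \<theta>) (arc_end m (Suc r) (cvec m \<theta>)) - G (cvec m \<theta>) (arc_end m r (cvec m \<theta>))"
    if \<theta>: "\<theta> \<in> cyc_config m" and r: "r < Suc m" for \<theta> r
  proof -
    define c where "c = cvec m \<theta>"
    define lo up where "lo = c r" and "up = arc_end m (Suc r) c"
    have lu: "lo \<le> up" using arc_order[OF \<theta>, of "Suc r"] r by (simp add: lo_def up_def c_def)
    \<comment> \<open>On a single arc the sign inside the absolute value is fixed, which makes the
      primitive differentiable there.\<close>
    define s where "s a x = (if a < Suc r then x - c a else c a - x)" for a x
    define F where "F x = of_real x * A c - 1 / 2 * (\<Sum>a<Suc m. of_real ((1 / 2 - s a x)\<^sup>2) * B c a)" for x
    have "((\<lambda>x. complex_of_real ((1 / 2 - s a x)\<^sup>2)) has_vector_derivative - 2 * P (Suc r) x c a) (at x within S)" for a x S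
    proof -
      have "((\<lambda>x. (1 / 2 - s a x)\<^sup>2) has_real_derivative - 2 * (if a < Suc r then 1 / 2 - (x - c a) else - 1 / 2 - (x - c a))) (at x within S)"
        unfolding s_def by (cases "a < Suc r") (auto intro!: derivative_eq_intros simp: field_simps)
      then have "((\<lambda>x. complex_of_real ((1 / 2 - s a x)\<^sup>2)) has_vector_derivative
          of_real (- 2 * (if a < Suc r then 1 / 2 - (x - c a) else - 1 / 2 - (x - c a)))) (at x within S)"
        by (intro has_vector_derivative_of_real) (simp add: has_real_derivative_iff_has_vector_derivative)
      moreover have "P (Suc r) x c a = of_real (if a < Suc r then 1 / 2 - (x - c a) else - 1 / 2 - (x - c a))"
        by (auto simp: P_def lifted_prop_def insert_point_def skip_slot_def)
      ultimately show ?thesis by simp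
    qed
    note ds = this
    have "(F has_vector_derivative 1 * A c - 1 / 2 * (\<Sum>a<Suc m. - 2 * P (Suc r) x c a * B c a)) (at x within S)" for x S
      unfolding F_def
      by (intro has_vector_derivative_diff has_vector_derivative_mult_right has_vector_derivative_mult_left has_vector_derivative_sum ds)
         (auto intro!: derivative_eq_intros has_vector_derivative_of_real)
    moreover have "1 * A c - 1 / 2 * (\<Sum>a<Suc m. - 2 * P (Suc r) x c a * B c a) = \<Psi> r (insert_point (Suc r) x c)" for x
      unfolding \<Psi>[OF r] by (simp add: sum_distrib_left sum_negf mult.assoc del: sum.lessThan_Suc)
    ultimately have d: "(F has_vector_derivative \<Psi> r (insert_point (Suc r) x c)) (at x within S)" for x S by simp
    have cont: "continuous_on {lo..up} (\<lambda>x. \<Psi> r (insert_point (Suc r) x c))"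
      unfolding \<Psi>_def using continuous_functional[OF op_functional_coeff, where s = 1 and M = "Suc (Suc m)" and \<beta> = "Suc r"] r by simp
    have sQ: "of_real ((1 / 2 - s a x)\<^sup>2) = Q c a x" if "a < Suc m" "x \<in> {lo, up}" for a x
    proof -
      have "a \<le> r \<Longrightarrow> c a \<le> lo" using cyc_config_cvec[OF \<theta>, of a r] r by (cases "a = r") (auto simp: lo_def c_def)
      moreover have "r < a \<Longrightarrow> up \<le> c a"
        using cyc_config_cvec[OF \<theta>, of "Suc r" a] that by (cases "a = Suc r") (auto simp: up_def c_def arc_end_def)
      ultimately have "s a x = \<bar>x - c a\<bar>" using that lu by (auto simp: s_def)
      then show ?thesis by (simp add: Q_def)
    qed
    have "F x = G c x" if "x \<in> {lo, up}" for x
      unfolding F_def G_def by (intro arg_cong2[where f = "(-)"] arg_cong2[where f = "(*)"] sum.cong refl sQ that) simp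
    moreover have "arc_end m r c = lo" using r by (simp add: arc_end_def lo_def)
    ultimately show ?thesis
      using integral_FTC_Icc[OF lu d cont] by (simp add: lo_def up_def c_def)
  qed
  have nG: "nice m (\<lambda>\<theta>. G (cvec m \<theta>) (arc_end m r (cvec m \<theta>)))" for r
  proof -
    have [measurable]: "(\<lambda>\<theta>. cvec m \<theta> a) \<in> borel_measurable (cfg m)" for a using good_pos_cvec by (simp add: good_pos_def)
    have [measurable]: "(\<lambda>\<theta>. arc_end m r (cvec m \<theta>)) \<in> borel_measurable (cfg m)"
      unfolding arc_end_def by measurable
    have u: "0 \<le> arc_end m r (cvec m \<theta>)" "arc_end m r (cvec m \<theta>) \<le> 1" for \<theta>
      using cvec_range[of m \<theta> r] by (auto simp: arc_end_def)
    have "nice m (\<lambda>\<theta>. of_real (arc_end m r (cvec m \<theta>)))"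
      unfolding nice_def cfg_def[symmetric] using u by (intro conjI exI[of _ 1]) auto
    moreover have "nice m (\<lambda>\<theta>. Q (cvec m \<theta>) a (arc_end m r (cvec m \<theta>)))" for a
      unfolding nice_def cfg_def[symmetric] Q_def
    proof (intro conjI exI[of _ 1] allI)
      fix \<theta>
      have "\<bar>1 / 2 - \<bar>arc_end m r (cvec m \<theta>) - cvec m \<theta> a\<bar>\<bar> \<le> 1"
        using u[of \<theta>] cvec_range[of m \<theta> a] by auto
      then have "(1 / 2 - \<bar>arc_end m r (cvec m \<theta>) - cvec m \<theta> a\<bar>)\<^sup>2 \<le> 1" by (simp only: abs_square_le_1)
      then show "norm (complex_of_real ((1 / 2 - \<bar>arc_end m r (cvec m \<theta>) - cvec m \<theta> a\<bar>)\<^sup>2)) \<le> 1" by (simp del: of_real_power)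
    qed measurable
    ultimately show ?thesis
      unfolding G_def diff_conv_add_uminus minus_mult_left
      by (intro nice_add nice_mult nice_sum nice_const nA nB)
  qed
  have int: "set_integrable (cfg m) (cyc_config m) (\<lambda>\<theta>. G (cvec m \<theta>) (arc_end m (Suc r) (cvec m \<theta>)) - G (cvec m \<theta>) (arc_end m r (cvec m \<theta>)))" for r
    by (intro set_integral_diff(1) nice_integrable nG)
  have lenTT: "length (TT r) = Suc (Suc m)" if "r < Suc m" for r using that T by (auto simp: TT_def)
  have "fcoef (\<Sum>r<Suc m. form_integral (Suc m) (\<lambda>\<theta>. act (propagator_poly (propagator \<theta>) (Suc (Suc m)) ^ k) (TT r))) I N y =
      (\<Sum>r<Suc m. LINT \<theta>:cyc_config (Suc m)|cfg (Suc m). \<Psi> r (cvec (Suc m) \<theta>))"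
    unfolding coeff_sum
  proof (intro sum.cong refl)
    fix r assume "r \<in> {..<Suc m}"
    have g: "good (Suc m) (\<lambda>\<theta>. act (propagator_poly (lifted_prop (cvec (Suc m) \<theta>)) (Suc (Suc m)) ^ k) (TT r))"
      using good_act[OF nice_good_pos[OF good_pos_cvec], where k = k and s = 1 and T = "TT r"] by simp
    have "form_integral (Suc m) (\<lambda>\<theta>. act (propagator_poly (propagator \<theta>) (Suc (Suc m)) ^ k) (TT r)) =
      form_integral (Suc m) (\<lambda>\<theta>. act (propagator_poly (lifted_prop (cvec (Suc m) \<theta>)) (Suc (Suc m)) ^ k) (TT r))"
      by (rule form_integral_cong) (simp add: propagator_poly_lifted)
    then show "fcoef (form_integral (Suc m) (\<lambda>\<theta>. act (propagator_poly (propagator \<theta>) (Suc (Suc m)) ^ k) (TT r))) I N y =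
      (LINT \<theta>:cyc_config (Suc m)|cfg (Suc m). \<Psi> r (cvec (Suc m) \<theta>))"
      by (simp only: form_integral_coeff[OF g] \<Psi>_def)
  qed
  also have "\<dots> = (\<Sum>r<Suc m. LINT \<theta>:cyc_config m|cfg m. G (cvec m \<theta>) (arc_end m (Suc r) (cvec m \<theta>)) - G (cvec m \<theta>) (arc_end m r (cvec m \<theta>)))"
  proof (intro sum.cong refl)
    fix r assume "r \<in> {..<Suc m}"
    then have r: "r < Suc m" by simp
    have "(LINT \<theta>:cyc_config (Suc m)|cfg (Suc m). \<Psi> r (cvec (Suc m) \<theta>)) = (LINT \<theta>:cyc_config m|cfg m.
       (\<integral>x. indicator {cvec m \<theta> (Suc r - 1)..arc_end m (Suc r) (cvec m \<theta>)} x *\<^sub>R \<Psi> r (insert_point (Suc r) x (cvec m \<theta>)) \<partial>lborel))"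
    proof (rule cyc_config_fubini)
      show "nice (Suc m) (\<lambda>\<theta>. \<Psi> r (cvec (Suc m) \<theta>))"
        unfolding \<Psi>_def using nice_propagator_power[OF nice_good_pos[OF good_pos_cvec] op_functional_coeff, where k = k and s = 1] by simp
      show "continuous_on {0..1} (\<lambda>x. \<Psi> r (insert_point (Suc r) x c))" for c
        unfolding \<Psi>_def using continuous_functional[OF op_functional_coeff, where s = 1 and M = "Suc (Suc m)" and \<beta> = "Suc r"] r by simp
    qed (use r in auto)
    also have "\<dots> = (LINT \<theta>:cyc_config m|cfg m. G (cvec m \<theta>) (arc_end m (Suc r) (cvec m \<theta>)) - G (cvec m \<theta>) (arc_end m r (cvec m \<theta>)))"
      unfolding set_lebesgue_integral_def diff_Suc_1
      by (intro Bochner_Integration.integral_cong refl) (auto simp: indicator_def[of "cyc_config m"] arc r)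
    finally show "(LINT \<theta>:cyc_config (Suc m)|cfg (Suc m). \<Psi> r (cvec (Suc m) \<theta>)) =
      (LINT \<theta>:cyc_config m|cfg m. G (cvec m \<theta>) (arc_end m (Suc r) (cvec m \<theta>)) - G (cvec m \<theta>) (arc_end m r (cvec m \<theta>)))" .
  qed
  also have "\<dots> = (LINT \<theta>:cyc_config m|cfg m. (\<Sum>r<Suc m. G (cvec m \<theta>) (arc_end m (Suc r) (cvec m \<theta>)) - G (cvec m \<theta>) (arc_end m r (cvec m \<theta>))))"
    using int unfolding set_integrable_def set_lebesgue_integral_def scaleR_sum_right
    by (intro Bochner_Integration.integral_sum[symmetric]) auto
  also have "\<dots> = (LINT \<theta>:cyc_config m|cfg m. A (cvec m \<theta>))"
  proof -
    have "(\<Sum>r<Suc m. G (cvec m \<theta>) (arc_end m (Suc r) (cvec m \<theta>)) - G (cvec m \<theta>) (arc_end m r (cvec m \<theta>))) = A (cvec m \<theta>)" for \<theta>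
    proof -
      have "(\<Sum>r<Suc m. G (cvec m \<theta>) (arc_end m (Suc r) (cvec m \<theta>)) - G (cvec m \<theta>) (arc_end m r (cvec m \<theta>))) =
          G (cvec m \<theta>) (arc_end m (Suc m) (cvec m \<theta>)) - G (cvec m \<theta>) (arc_end m 0 (cvec m \<theta>))"
        by (rule sum_lessThan_telescope)
      also have "\<dots> = G (cvec m \<theta>) 1 - G (cvec m \<theta>) 0" by (simp add: arc_end_def)
      also have "\<dots> = A (cvec m \<theta>)"
      proof -
        \<comment> \<open>The square is symmetric about distance 1/2; this equality is the mean-zero
          property of the propagator.\<close>
        have "Q (cvec m \<theta>) a 1 = Q (cvec m \<theta>) a 0" for a
        proof -
          have "\<bar>1 - cvec m \<theta> a\<bar> = 1 - cvec m \<theta> a" "\<bar>0 - cvec m \<theta> a\<bar> = cvec m \<theta> a" using cvec_range[of m \<theta> a] by auto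
          then have "(1 / 2 - \<bar>1 - cvec m \<theta> a\<bar>)\<^sup>2 = (1 / 2 - \<bar>0 - cvec m \<theta> a\<bar>)\<^sup>2"
            by (simp only:) (simp add: power2_eq_square algebra_simps)
          then show ?thesis by (simp only: Q_def)
        qed
        then show ?thesis by (simp add: G_def)
      qed
      finally show ?thesis .
    qed
    then show ?thesis by simp
  qed
  also have "\<dots> = fcoef (form_integral m (\<lambda>\<theta>. wedge w (act (propagator_poly (propagator \<theta>) (Suc m) ^ k) T))) I N y"
  proof -
    obtain d where "\<forall>x\<in>set T. mvb d x" using mvb_list by blast
    then have v: "fvb (int (length T) * d) (act p T)" for p by (intro fvb_act) auto
    obtain e where "\<forall>x\<in>set [mat w :: ('n, 'r) mform]. mvb e x" using mvb_list by blast
    then have e: "fvb e w" by (auto simp: mvb_def mat_def split: if_splits)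
    have "nice m (\<lambda>\<theta>. fcoef (wedge w (act (propagator_poly (lifted_prop (cvec m \<theta>)) (Suc m) ^ k) T)) I N y)" for I N y
    proof -
      have "op_functional (\<lambda>p. fcoef (wedge w (act p T)) I N y)"
        unfolding op_functional_def
        by (simp only: act_add wedge_lin coeff_add act_Dconst_mult coeff_fscale_const) simp
      from nice_propagator_power[OF nice_good_pos[OF good_pos_cvec] this, where k = k and s = 1] show ?thesis by simp
    qed
    then have g: "good m (\<lambda>\<theta>. wedge w (act (propagator_poly (lifted_prop (cvec m \<theta>)) (Suc m) ^ k) T))"
      using fvb_wedge[OF e v] by (auto simp: good_def intro!: exI[of _ "e + int (length T) * d"])
    have "form_integral m (\<lambda>\<theta>. wedge w (act (propagator_poly (propagator \<theta>) (Suc m) ^ k) T)) =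
        form_integral m (\<lambda>\<theta>. wedge w (act (propagator_poly (lifted_prop (cvec m \<theta>)) (Suc m) ^ k) T))"
      by (rule form_integral_cong) (simp add: propagator_poly_lifted)
    then show ?thesis by (simp only: form_integral_coeff[OF g] A_def \<Lambda>0_def pp_def)
  qed
  finally show "fcoef (\<Sum>r<Suc m. form_integral (Suc m) (\<lambda>\<theta>. act (propagator_poly (propagator \<theta>) (Suc (Suc m)) ^ k)
      (map (mf_map (twist b)) (take (Suc r) T) @ mat w # drop (Suc r) T))) I N y
    = fcoef (form_integral m (\<lambda>\<theta>. wedge w (act (propagator_poly (propagator \<theta>) (Suc m) ^ k) T))) I N y"
    by (simp only: TT_def)
qed

section \<open>Free expectation values\<close>

text \<open>The recursion of \<open>mf_moyal\<close> for single functions;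
  \<open>mt_weyl_moyal\<close> relates it to the sum over index lists in the definition of the Moyal
  product.\<close>

primrec weyl_moyal :: "nat \<Rightarrow> 'n::finite weyl \<Rightarrow> 'n weyl \<Rightarrow> 'n weyl" where
  "weyl_moyal 0 f g = f * g"
| "weyl_moyal (Suc k) f g = emb (fls_const (1 / of_nat (Suc k))) * (\<Sum>i\<in>UNIV. \<Sum>j\<in>UNIV.
     emb (fls_const (1 / 2 * omega i j)) * weyl_moyal k (wderiv i f) (wderiv j g))"

lemma foldr_wderiv_commute: "foldr wderiv is (wderiv i f) = wderiv i (foldr wderiv is f)"
  by (induction "is") (auto simp: wderiv_commute)

lemma sum_length_Suc:
  fixes h :: "'c::finite list \<Rightarrow> 'b::comm_monoid_add"
  shows "(\<Sum>is | length is = Suc k. h is) = (\<Sum>i\<in>UNIV. \<Sum>is | length is = k. h (i # is))"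
proof -
  have "{is :: 'c list. length is = Suc k} = (\<lambda>(i, is). i # is) ` (UNIV \<times> {is. length is = k})"
    by (auto simp: length_Suc_conv image_iff)
  then have "(\<Sum>is | length is = Suc k. h is) = (\<Sum>p\<in>UNIV \<times> {is. length is = k}. h (fst p # snd p))"
    by (simp add: sum.reindex inj_on_def case_prod_unfold prod_eq_iff)
  then show ?thesis by (simp add: sum.cartesian_product case_prod_unfold)
qed

lemma mt_weyl_moyal: "mt k f g = emb (hbar ^ k) * weyl_moyal k f g"
proof -
  define S where "S k f g = (\<Sum>is | length is = k. \<Sum>js | length js = k.
      emb (fls_const (\<Prod>l<k. omega (is ! l) (js ! l))) * foldr wderiv is f * foldr wderiv js (g :: 'a weyl))" for k f g
  have S: "S (Suc k) f g = (\<Sum>i\<in>UNIV. \<Sum>j\<in>UNIV. emb (fls_const (omega i j)) * S k (wderiv i f) (wderiv j g))" for k f g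
  proof -
    have "S (Suc k) f g = (\<Sum>i\<in>UNIV. \<Sum>is | length is = k. \<Sum>j\<in>UNIV. \<Sum>js | length js = k.
        emb (fls_const (omega i j)) * (emb (fls_const (\<Prod>l<k. omega (is ! l) (js ! l))) * foldr wderiv is (wderiv i f) * foldr wderiv js (wderiv j g)))"
      unfolding S_def sum_length_Suc prod.lessThan_Suc_shift fls_const_mult emb_mult
      by (simp add: foldr_wderiv_commute mult.assoc o_def)
    also have "\<dots> = (\<Sum>i\<in>UNIV. \<Sum>j\<in>UNIV. \<Sum>is | length is = k. \<Sum>js | length js = k.
        emb (fls_const (omega i j)) * (emb (fls_const (\<Prod>l<k. omega (is ! l) (js ! l))) * foldr wderiv is (wderiv i f) * foldr wderiv js (wderiv j g)))"
      by (intro sum.cong refl sum.swap)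
    finally show ?thesis by (simp only: S_def sum_distrib_left)
  qed
  have w: "weyl_moyal k f g = emb (fls_const (1 / fact k * (1 / 2) ^ k)) * S k f g" for k f g
  proof (induction k arbitrary: f g)
    case 0 show ?case by (simp add: S_def)
  next
    case (Suc k)
    have c: "1 / of_nat (Suc k) * (1 / 2 * (z * (1 / fact k * (1 / 2) ^ k))) = 1 / fact (Suc k) * ((1 / 2) ^ Suc k * z)" for z :: complex
      by (simp add: field_simps del: of_nat_Suc)
    show ?case
      unfolding weyl_moyal.simps Suc.IH S sum_distrib_left mult.assoc[symmetric] emb_mult[symmetric] fls_const_mult[symmetric]
      unfolding mult.assoc c ..
  qed
  have "1 / fact k * (hbar / 2) ^ k = hbar ^ k * fls_const (1 / fact k * (1 / 2) ^ k)"
  proof -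
    have "1 / fact k * (hbar / 2) ^ k = fls_const (1 / 2 ^ k) * (hbar ^ k / fact k)"
      unfolding two_fls power_divide fls_const_power[symmetric] by (subst fls_const_divide) simp_all
    also have "\<dots> = hbar ^ k * (fls_const (1 / 2 ^ k) * fls_const (1 / fact k))"
      unfolding hk by (simp only: mult_ac)
    finally show ?thesis by (simp add: power_one_over mult.commute)
  qed
  then show ?thesis unfolding w S_def mt_def by (simp only: emb_mult mult.assoc)
qed

lemma form0_sum: "form0 (sum f S) = (\<Sum>x\<in>S. form0 (f x))"
  by (auto simp: form0_def vec_eq_iff)
lemma fscale_form0: "fscale c (form0 f) = form0 (emb c * f)"
  by (auto simp: form0_def vec_eq_iff)
lemma lie_form0: "lie_deriv i (form0 f) = form0 (wderiv i f)"
  by (auto simp: form0_def lie_deriv_def vec_eq_iff)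
lemma grade_form0 [simp]: "grade (form0 f) = form0 f" by (simp add: grade_even even_form0)
lemma contract_form0 [simp]: "contract i (form0 f) = 0" by (simp add: vec_eq_iff contract_nth form0_def)

lemma mf_moyal_to_mform: "mf_moyal k (to_mform x) (to_mform y) = (\<chi> i j. form0 (\<Sum>l\<in>UNIV. weyl_moyal k (x $ i $ l) (y $ l $ j)))"
proof (induction k arbitrary: x y)
  case 0
  have "wedge (form0 f) (form0 g) = form0 (f * g)" for f g :: "'a weyl"
    unfolding wedge_form0 by (auto simp: form0_def vec_eq_iff)
  then show ?case by (simp add: mf_mult_def to_mform_def form0_sum)
next
  case (Suc k)
  have "mf_map (lie_deriv i) (to_mform x) = to_mform (\<chi> a b. wderiv i (x $ a $ b))" for i and x :: "('a, 'b) gl"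
    by (simp add: mf_map_def to_mform_def lie_form0)
  note IH = Suc.IH[of "\<chi> a b. wderiv _ (x $ a $ b)" "\<chi> a b. wderiv _ (y $ a $ b)", folded this]
  have "(\<Sum>i\<in>UNIV. \<Sum>j\<in>UNIV. emb (fls_const (1 / 2 * omega i j)) * (\<Sum>l\<in>UNIV. weyl_moyal k (wderiv i (x $ a $ l)) (wderiv j (y $ l $ c)))) =
     (\<Sum>l\<in>UNIV. \<Sum>i\<in>UNIV. \<Sum>j\<in>UNIV. emb (fls_const (1 / 2 * omega i j)) * weyl_moyal k (wderiv i (x $ a $ l)) (wderiv j (y $ l $ c)))" for a c
  proof -
    have "(\<Sum>i\<in>UNIV. \<Sum>j\<in>UNIV. \<Sum>l\<in>UNIV. h i j l) = (\<Sum>l\<in>UNIV. \<Sum>i\<in>UNIV. \<Sum>j\<in>UNIV. h i j l)"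
      for h :: "'a coord \<Rightarrow> 'a coord \<Rightarrow> 'b \<Rightarrow> 'a weyl"
    proof -
      have "(\<Sum>i\<in>UNIV. \<Sum>j\<in>UNIV. \<Sum>l\<in>UNIV. h i j l) = (\<Sum>i\<in>UNIV. \<Sum>l\<in>UNIV. \<Sum>j\<in>UNIV. h i j l)"
        by (intro sum.cong refl sum.swap)
      also have "\<dots> = (\<Sum>l\<in>UNIV. \<Sum>i\<in>UNIV. \<Sum>j\<in>UNIV. h i j l)" by (rule sum.swap)
      finally show ?thesis .
    qed
    then show ?thesis unfolding sum_distrib_left .
  qed
  then show ?case
    unfolding mf_moyal.simps IH weyl_moyal.simps
    by (simp only: mscale_def vec_eq_iff vec_lambda_beta sum_component fscale_form0 form0_sum[symmetric] sum_distrib_left[symmetric] simp_thms)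
qed

lemma fser_form0:
  assumes "\<And>k. vb d (g k)"
  shows "fser (\<lambda>k. fscale (fact k) (form0 (g k))) = form0 (suminf (\<lambda>k. emb (hbar ^ k) * g k))"
proof -
  have v: "fvb d (fscale (fact k) (form0 (g k)))" for k
    by (intro fvb_fact) (use assms in \<open>auto simp: fvb_def form0_def\<close>)
  have "emb (hbar ^ k / fact k) * (emb (fact k) * x) = emb (hbar ^ k) * x" for k and x :: "'a weyl"
    by (simp flip: emb_mult mult.assoc)
  then have "fser (\<lambda>k. fscale (fact k) (form0 (g k))) $ I = form0 (suminf (\<lambda>k. emb (hbar ^ k) * g k)) $ I" for I
    unfolding fser_nth[OF v] fscale_nth by (cases "I = {}") (simp_all add: form0_def)
  then show ?thesis by (simp add: vec_eq_iff)
qed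

text \<open>Identifies what a collision of two functions produces with the product of the algebra
  itself.\<close>

lemma mf_star_to_mform: "mf_star (to_mform x) (to_mform y) = to_mform (x \<star>\<^sub>G y)"
proof -
  obtain d where d: "\<forall>z\<in>set [to_mform x, to_mform y]. mvb d z" using mvb_list by blast
  have v: "vb (d + d) (weyl_moyal k (x $ i $ l) (y $ l $ j))" for k i j l
  proof -
    have "vb d (z $ p $ q)" if "mvb d (to_mform z)" for z :: "('a, 'b) gl" and p q
    proof -
      from that have "vb d (to_mform z $ p $ q $ {})" unfolding mvb_def fvb_def by blast
      then show ?thesis by (simp add: to_mform_def form0_def)
    qed
    then have 1: "vb d (x $ i $ l)" "vb d (y $ l $ j)" using d by auto
    have "vb (d' + e') (weyl_moyal k f g)" if "vb d' f" "vb e' g" for d' e' and f g :: "'a weyl"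
      using that
    proof (induction k arbitrary: f g)
      case (Suc k)
      have "vb (0 + (0 + (d' + e'))) (weyl_moyal (Suc k) f g)"
        unfolding weyl_moyal.simps
        by (intro vb_mult vb_emb vb_const vb_sum[where d = "0 + (d' + e')"] Suc.IH vb_wderiv Suc.prems)
      then show ?case by simp
    qed (simp add: vb_mult)
    from this[OF 1] show ?thesis .
  qed
  have "fser (\<lambda>k. fscale (fact k) (form0 (\<Sum>l\<in>UNIV. weyl_moyal k (x $ i $ l) (y $ l $ j)))) = form0 (\<Sum>l\<in>UNIV. (x $ i $ l) \<star>\<^sub>M (y $ l $ j))" for i j
  proof -
    have "fser (\<lambda>k. fscale (fact k) (form0 (\<Sum>l\<in>UNIV. weyl_moyal k (x $ i $ l) (y $ l $ j)))) =
        fser (\<lambda>k. \<Sum>l\<in>UNIV. fscale (fact k) (form0 (weyl_moyal k (x $ i $ l) (y $ l $ j))))"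
      by (simp only: form0_sum fs.scale_sum_right)
    also have "\<dots> = (\<Sum>l\<in>UNIV. fser (\<lambda>k. fscale (fact k) (form0 (weyl_moyal k (x $ i $ l) (y $ l $ j)))))"
      by (rule fser_sum[where d = "d + d"], intro fvb_fact) (use v in \<open>auto simp: fvb_def form0_def\<close>)
    also have "\<dots> = form0 (\<Sum>l\<in>UNIV. (x $ i $ l) \<star>\<^sub>M (y $ l $ j))"
      by (simp only: fser_form0[OF v] form0_sum moyal_mt mt_weyl_moyal)
    finally show ?thesis .
  qed
  then show ?thesis by (simp add: mf_star_def mf_moyal_to_mform) (simp add: to_mform_def gmult_def)
qed

text \<open>The bidifferential operators have constant coefficients and \<open>de_rham\<close>
  commutes with \<open>lie_deriv\<close>, so the Leibniz rule of the ordinary product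
  persists.\<close>

lemma mf_moyal_de_rham:
  "mf_map de_rham (mf_moyal k x y) = mf_moyal k (mf_map de_rham x) y + mf_moyal k (mf_map grade x) (mf_map de_rham y)"
proof (induction k arbitrary: x y)
  case 0
  show ?case by (simp add: mf_mult_def mf_map_def vec_eq_iff de_rham_lin de_rham_wedge sum.distrib)
next
  case (Suc k)
  have c: "mf_map (lie_deriv i) (mf_map de_rham x) = mf_map de_rham (mf_map (lie_deriv i) x)"
    "mf_map (lie_deriv i) (mf_map grade x) = mf_map grade (mf_map (lie_deriv i) x)" for i and x :: "('a, 'b) mform"
    by (simp_all add: mf_map_comp lie_de_rham grade_lie)
  have lin: "mf_map de_rham (mscale d x) = mscale d (mf_map de_rham x)" "mf_map de_rham (sum f S) = (\<Sum>s\<in>S. mf_map de_rham (f s))"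
    for d and x :: "('a, 'b) mform" and f and S :: "'a coord set"
    by (simp_all add: mf_map_def mscale_def vec_eq_iff de_rham_lin)
  have ms: "mscale d (x + y) = mscale d x + mscale d y" for d and x y :: "('a, 'b) mform"
    by (simp add: mscale_def vec_eq_iff fs.scale_right_distrib)
  show ?case
    by (simp only: mf_moyal.simps lin Suc.IH c ms sum.distrib)
qed

lemma mf_star_de_rham: "mf_map de_rham (mf_star x y) = mf_star (mf_map de_rham x) y + mf_star (mf_map grade x) (mf_map de_rham y)"
proof -
  obtain d where d: "\<forall>z\<in>set [x, y, mf_map de_rham x, mf_map grade x, mf_map de_rham y]. mvb d z" using mvb_list by blast
  have v: "fvb (d + d) (fscale (fact k) (mf_moyal k u v $ i $ j))" if "mvb d u" "mvb d v" for k i j and u v :: "('a, 'b) mform"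
    using mvb_moyal[OF that, of k] by (auto simp: mvb_def intro: fvb_fact)
  have "de_rham (fser (\<lambda>k. fscale (fact k) (mf_moyal k x y $ i $ j))) =
     fser (\<lambda>k. fscale (fact k) (mf_moyal k (mf_map de_rham x) y $ i $ j)) + fser (\<lambda>k. fscale (fact k) (mf_moyal k (mf_map grade x) (mf_map de_rham y) $ i $ j))" for i j
  proof -
    have "de_rham (mf_moyal k x y $ i $ j) = mf_moyal k (mf_map de_rham x) y $ i $ j + mf_moyal k (mf_map grade x) (mf_map de_rham y) $ i $ j" for k
      using arg_cong[OF mf_moyal_de_rham[of k x y], of "\<lambda>z. z $ i $ j"] by (simp add: mf_map_def)
    note eq = this
    have ds: "mvb d x" "mvb d y" "mvb d (mf_map de_rham x)" "mvb d (mf_map grade x)" "mvb d (mf_map de_rham y)" using d by auto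
    have "de_rham (fser (\<lambda>k. fscale (fact k) (mf_moyal k x y $ i $ j))) = fser (\<lambda>k. de_rham (fscale (fact k) (mf_moyal k x y $ i $ j)))"
      by (rule fser_local[OF local_op_de_rham v[OF ds(1) ds(2)]])
    also have "\<dots> = fser (\<lambda>k. fscale (fact k) (mf_moyal k (mf_map de_rham x) y $ i $ j) + fscale (fact k) (mf_moyal k (mf_map grade x) (mf_map de_rham y) $ i $ j))"
      by (simp only: de_rham_lin eq fs.scale_right_distrib)
    also have "\<dots> = fser (\<lambda>k. fscale (fact k) (mf_moyal k (mf_map de_rham x) y $ i $ j)) + fser (\<lambda>k. fscale (fact k) (mf_moyal k (mf_map grade x) (mf_map de_rham y) $ i $ j))"
      by (rule fser_add[OF v[OF ds(3) ds(2)] v[OF ds(4) ds(5)]])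
    finally show ?thesis .
  qed
  then show ?thesis by (simp add: mf_star_def mf_map_def[of de_rham "_ :: ('a, 'b) mform"] vec_eq_iff)
qed

section \<open>Free expectations: from \<open>BV\<close> to the Hochschild boundary\<close>

definition arg_form :: "('n::{finite,linorder}, 'r::finite) gl \<Rightarrow> ('n, 'r) mform" where
  "arg_form x = mf_map de_rham (to_mform x)"

definition arg_list :: "('n::{finite,linorder}, 'r::finite) gl list \<Rightarrow> ('n, 'r) mform list" where
  "arg_list a = to_mform (hd a) # map arg_form (tl a)"

lemma length_arg_list [simp]: "a \<noteq> [] \<Longrightarrow> length (arg_list a) = length a" by (simp add: arg_list_def)

lemma nth_arg_list: "c < length a \<Longrightarrow> arg_list a ! c = (if c = 0 then to_mform (a ! 0) else arg_form (a ! c))"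
  by (cases a) (auto simp: arg_list_def nth_Cons split: nat.splits)

lemma free_exp_arg: "free_exp a = fint (length a - 1) (arg_list a)"
  by (simp add: free_exp_fint arg_list_def arg_form_def[abs_def] o_def)

lemma grade_arg: "mf_map grade (arg_form x) = mscale (-1) (arg_form x)" "mf_map grade (to_mform x) = to_mform x"
proof -
  have "odd_form (de_rham (form0 f))" for f :: "'a weyl"
    unfolding odd_form_def de_rham_def form0_def
  proof (intro allI impI)
    fix I :: "'a coord set" assume "even (card I)"
    then have "I - {i} \<noteq> {}" if "i \<in> I" for i
      using that by (metis Diff_eq_empty_iff card_1_singleton_iff card.empty odd_one subset_singletonD empty_iff One_nat_def)
    then show "(\<chi> I. \<Sum>i\<in>I. (-1) ^ card {j \<in> I. j < i} * wderiv i ((\<chi> I. if I = {} then f else 0) $ (I - {i}))) $ I = 0"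
      by simp
  qed
  then show "mf_map grade (arg_form x) = mscale (-1) (arg_form x)"
    by (simp add: arg_form_def mf_map_def to_mform_def mscale_def grade_odd)
  show "mf_map grade (to_mform x) = to_mform x"
    by (simp add: mf_map_def to_mform_def)
qed

lemma parity_arg: "parity_mform True (arg_form x)" "parity_mform False (to_mform x)"
proof -
  have "odd_form w" if "grade w = - w" for w :: "'a form"
    unfolding odd_form_def
  proof (intro allI impI)
    fix I :: "'a coord set" assume "even (card I)"
    then have "w $ I = - w $ I" using arg_cong[OF that, of "\<lambda>v. v $ I"] by (simp add: grade_def)
    then have "w $ I + w $ I = 0" by (metis add.right_inverse)
    then have "emb (1 / 2) * (w $ I + w $ I) = 0" by simp
    then show "w $ I = 0" unfolding distrib_left distrib_right[symmetric] emb_add[symmetric] by simp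
  qed
  moreover have "grade (arg_form x $ i $ j) = - arg_form x $ i $ j" for i j
    using arg_cong[OF grade_arg(1)[of x], of "\<lambda>z. z $ i $ j"] by (simp add: mf_map_def mscale_def)
  ultimately show "parity_mform True (arg_form x)" by (simp add: parity_mform_def parity_form_def)
  show "parity_mform False (to_mform x)" by (simp add: parity_mform_def parity_form_def to_mform_def even_form0)
qed

lemma act_zero_slot: "c < length T \<Longrightarrow> T ! c = 0 \<Longrightarrow> act p T = 0"
  using id_take_nth_drop[of c T] act_mid_0 by metis

lemma act_scale_slots:
  assumes len: "length T' = length T" and s: "\<And>c. c < length T \<Longrightarrow> T' ! c = mscale (s c) (T ! c)"
  shows "act p T' = fscale (\<Prod>c<length T. s c) (act p T)"
proof -
  have "n \<le> length T \<Longrightarrow> act p (take n T' @ drop n T) = fscale (\<Prod>c<n. s c) (act p T)" for n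
  proof (induction n)
    case (Suc n)
    then have n: "n < length T" by simp
    have "take (Suc n) T' @ drop (Suc n) T = take n T' @ mscale (s n) (T ! n) # drop (Suc n) T"
      using n len by (simp add: take_Suc_conv_app_nth s)
    moreover have "take n T' @ drop n T = take n T' @ T ! n # drop (Suc n) T"
      using n by (simp add: Cons_nth_drop_Suc)
    ultimately show ?case using Suc by (simp add: act_mid_scale mult.commute)
  qed simp
  from this[of "length T"] show ?thesis using len by simp
qed

lemma fint_scale_slots:
  assumes T: "length T = Suc m" and len: "length T' = length T" and s: "\<And>c. c < length T \<Longrightarrow> T' ! c = mscale (s c) (T ! c)"
  shows "fint m T' = fscale (\<Prod>c<length T. s c) (fint m T)"
proof -
  obtain d where "\<forall>x\<in>set T. mvb d x" using mvb_list by blast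
  then have v: "fvb (int (length T) * d) (tr_dP \<theta> k T)" for \<theta> k by (intro fvb_tr) auto
  have "tr_dP \<theta> k T' = fscale (\<Prod>c<length T. s c) (tr_dP \<theta> k T)" for \<theta> k
    unfolding tr_dP_act len by (rule act_scale_slots[OF len s])
  then show ?thesis
    unfolding fint_def by (simp only: fser_scale[OF v] form_integral_scale[OF good_tr[OF T]])
qed

lemma prod_signs: "S \<subseteq> {..<n :: nat} \<Longrightarrow> (\<Prod>c<n. if c \<in> S then - 1 else 1) = ((-1) ^ card S :: 'a::comm_ring_1)"
proof -
  assume S: "S \<subseteq> {..<n}"
  then have "(\<Prod>c<n. if c \<in> S then - 1 else 1) = (\<Prod>c\<in>S. - 1 :: 'a)"
    by (subst prod.mono_neutral_right[where S = S]) auto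
  then show ?thesis by simp
qed

lemma omega_op_self: "omega_op a a = 0"
proof -
  have "omega_op a a + omega_op a a = (0 :: 'a op_poly)" using omega_op_swap[of a a] by (metis add.right_inverse)
  then have "Dconst (1 / 2) * (omega_op a a + omega_op a a) = (0 :: 'a op_poly)" by simp
  then show ?thesis unfolding distrib_left distrib_right[symmetric] Dconst_add[symmetric] by simp
qed

lemma act_omega_op: "act (omega_op e c * p) T = omega_sum (\<lambda>i j. act (Dvar e i * (Dvar c j * p)) T)"
  by (simp add: omega_op_def omega_sum_def sum_distrib_right act_sum act_Dconst_mult mult.assoc)

text \<open>Contraction turns the 1-form of one slot into a derivative of its function and
  annihilates slot 0; the outer Lie derivative then hits every slot. The term where both hit the
  same slot vanishes by antisymmetry of \<open>omega\<close>, and the rest is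
  \<open>edge_poly\<close>.\<close>

lemma BV_act:
  assumes a: "a \<noteq> []"
  shows "BV (act p (arg_list a)) = (\<Sum>r<length a - 1. fscale ((-1) ^ r)
     (act (edge_poly (length a) (Suc r) * p) ((arg_list a)[Suc r := to_mform (a ! Suc r)])))"
proof -
  define N where "N = length a"
  have N: "N = Suc (N - 1)" using a by (simp add: N_def)
  let ?T = "arg_list a" and ?Tc = "\<lambda>c. (arg_list a)[c := to_mform (a ! c)]"
  have len: "length ?T = N" using a by (simp add: N_def)
  have c: "contract j (act p ?T) = (\<Sum>r<N - 1. fscale ((-1) ^ r) (act (Dvar (Suc r) j * p) (?Tc (Suc r))))" for j
  proof -
    have "contract j (act p ?T) = (\<Sum>c<N. act p (der_at grade (contract j) c ?T))"
      using gder_act[OF gder_contract grade_lie lie_contract[symmetric], of j p ?T] by (simp add: len)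
    also have "\<dots> = act p (der_at grade (contract j) 0 ?T) + (\<Sum>r<N - 1. act p (der_at grade (contract j) (Suc r) ?T))"
      by (subst N) (rule sum.lessThan_Suc_shift)
    \<comment> \<open>Slot 0 holds functions, which have no contraction.\<close>
    also have "act p (der_at grade (contract j) 0 ?T) = 0"
      by (rule act_zero_slot[of 0]) (use a in \<open>auto simp: nth_der_at nth_arg_list mf_map_def to_mform_def vec_eq_iff\<close>)
    also have "(\<Sum>r<N - 1. act p (der_at grade (contract j) (Suc r) ?T)) = (\<Sum>r<N - 1. fscale ((-1) ^ r) (act (Dvar (Suc r) j * p) (?Tc (Suc r))))"
    proof (rule sum.cong[OF refl])
      fix r assume "r \<in> {..<N - 1}"
      then have r: "Suc r < N" by simp
      let ?U = "?T[Suc r := mf_map (lie_deriv j) (to_mform (a ! Suc r))]"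
      \<comment> \<open>The contraction passes the 1-forms in the slots 1 to \<open>r\<close>, with
        one sign for each.\<close>
      have "act p (der_at grade (contract j) (Suc r) ?T) = fscale (\<Prod>c<length ?U. if c \<in> {1..r} then - 1 else 1) (act p ?U)"
      proof (rule act_scale_slots)
        fix c assume "c < length ?U"
        then have c: "c < N" by (simp add: len)
        have ca: "mf_map (contract j) (arg_form x) = mf_map (lie_deriv j) (to_mform x)" for x :: "('a, 'b) gl"
          by (simp add: arg_form_def mf_map_def to_mform_def vec_eq_iff cartan de_rham_lin)
        have m1: "mscale 1 x = x" for x :: "('a, 'b) mform" by (simp add: mscale_def vec_eq_iff)
        show "der_at grade (contract j) (Suc r) ?T ! c = mscale (if c \<in> {1..r} then - 1 else 1) (?U ! c)"
          using c r by (auto simp: nth_der_at len nth_arg_list N_def[symmetric] nth_list_update grade_arg ca m1)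
      qed simp
      also have "(\<Prod>c<length ?U. if c \<in> {1..r} then - 1 else 1) = ((-1) ^ r :: complex fls)"
        using r by (subst prod_signs) (auto simp: len)
      also have "act p ?U = act (Dvar (Suc r) j * p) (?Tc (Suc r))"
        using r by (simp add: act_Dvar len)
      finally show "act p (der_at grade (contract j) (Suc r) ?T) = fscale ((-1) ^ r) (act (Dvar (Suc r) j * p) (?Tc (Suc r)))" .
    qed
    finally show ?thesis by simp
  qed
  have "BV (act p ?T) = omega_sum (\<lambda>i j. \<Sum>r<N - 1. fscale ((-1) ^ r) (\<Sum>e<N. act (Dvar e i * (Dvar (Suc r) j * p)) (?Tc (Suc r))))"
    unfolding BV_omega c lie_lin by (simp only: lie_act length_list_update len)
  also have "\<dots> = (\<Sum>r<N - 1. fscale ((-1) ^ r) (\<Sum>e<N. omega_sum (\<lambda>i j. act (Dvar e i * (Dvar (Suc r) j * p)) (?Tc (Suc r)))))"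
  proof -
    have os: "omega_sum (\<lambda>i j. \<Sum>x\<in>S. f x i j) = (\<Sum>x\<in>S. omega_sum (f x))" for f :: "nat \<Rightarrow> 'a coord \<Rightarrow> 'a coord \<Rightarrow> 'a form" and S
      by (induction S rule: infinite_finite_induct) (simp_all add: omega_sum_add, simp_all add: omega_sum_def)
    have sc: "omega_sum (\<lambda>i j. fscale d (f i j)) = fscale d (omega_sum f)" for d and f :: "'a coord \<Rightarrow> 'a coord \<Rightarrow> 'a form"
      by (simp add: omega_sum_def fs.scale_sum_right mult.commute)
    show ?thesis by (simp only: os sc)
  qed
  also have "\<dots> = (\<Sum>r<N - 1. fscale ((-1) ^ r) (act (edge_poly N (Suc r) * p) (?Tc (Suc r))))"
  proof (intro sum.cong refl arg_cong[where f = "fscale _"])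
    fix r assume "r \<in> {..<N - 1}"
    then have "{..<N} = insert (Suc r) {e. e < N \<and> e \<noteq> Suc r}" by auto
    then have "(\<Sum>e<N. omega_op e (Suc r)) = (edge_poly N (Suc r) :: 'a op_poly)"
      by (simp add: edge_poly_def omega_op_self)
    then show "(\<Sum>e<N. omega_sum (\<lambda>i j. act (Dvar e i * (Dvar (Suc r) j * p)) (?Tc (Suc r)))) = act (edge_poly N (Suc r) * p) (?Tc (Suc r))"
      unfolding act_omega_op[symmetric] act_sum[symmetric] sum_distrib_right[symmetric] by simp
  qed
  finally show ?thesis by (simp only: N_def)
qed

lemma collision_lifted:
  fixes x y :: "('n::{finite,linorder}, 'r::finite) mform"
  assumes \<theta>: "\<theta> \<in> cyc_config m" and m: "m = length l + length l'"
    and c: "\<And>e. e \<le> Suc m \<Longrightarrow> c e = cvec m \<theta> (collapse (length l) e)"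
  shows "fser (\<lambda>k. act (propagator_poly (lifted_prop c) (Suc (Suc m)) ^ k) (l @ x # y # l')) =
    fser (\<lambda>k. act (propagator_poly (propagator \<theta>) (Suc m) ^ k) (l @ mf_star x y # l'))"
  unfolding propagator_poly_lifted[OF \<theta>]
proof (rule collision[OF refl])
  show "Suc m = Suc (length l + length l')" by (simp add: m)
  show "lifted_prop c (length l) (Suc (length l)) = 1 / 2" "lifted_prop c (Suc (length l)) (length l) = - 1 / 2"
    using c[of "length l"] c[of "Suc (length l)"] m by (simp_all add: lifted_prop_def collapse_def)
  fix e f assume "e < Suc (Suc m)" "f < Suc (Suc m)" "collapse (length l) e \<noteq> collapse (length l) f"
  moreover have "collapse (length l) e < collapse (length l) f \<longleftrightarrow> e < f" if "collapse (length l) e \<noteq> collapse (length l) f"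
    using that by (auto simp: collapse_def split: if_splits)
  ultimately show "lifted_prop c e f = lifted_prop (cvec m \<theta>) (collapse (length l) e) (collapse (length l) f)"
    using c[of e] c[of f] by (auto simp: lifted_prop_def)
qed

text \<open>An interior collision is reached from two arcs, once with the left and once with the
  right factor turned into a function; together these are the differential of the product. The
  collision of slots 0 and 1 occurs once, between functions, and the upper end of the last arc
  closes the circle and gives the cyclic term.\<close>

theorem free_exp_hoch:
  fixes a :: "('n::{finite,linorder}, 'r::finite) gl list"
  assumes a: "length a = Suc (Suc m)"
  shows "fscale hbar (BV (free_exp a)) =
     (\<Sum>r<Suc m. fscale ((-1) ^ r) (free_exp (mrg r a))) + fscale ((-1) ^ Suc m) (free_exp (cyc a))"
proof -
  let ?M = "Suc (Suc m)"
  define T where "T = arg_list a"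
  define Tr where "Tr r = T[Suc r := to_mform (a ! Suc r)]" for r
  have ne: "a \<noteq> []" using a by auto
  have len: "length T = ?M" using a ne by (simp add: T_def)
  have lenr: "length (Tr r) = ?M" for r by (simp add: Tr_def len)
  obtain d where d: "\<forall>z\<in>set (T @ map to_mform a). mvb d z" using mvb_list by blast
  define D where "D = int ?M * d"
  have v: "fvb D (act p T)" for p
    using fvb_act[of T d p] d by (simp add: D_def len)
  have vr: "fvb D (act p (Tr r))" if "r < Suc m" for p r
  proof -
    have "mvb d x" if "x \<in> set (Tr r)" for x
      using that set_update_subset_insert[of T "Suc r" "to_mform (a ! Suc r)"] d \<open>r < Suc m\<close> a by (auto simp: Tr_def)
    from fvb_act[of "Tr r" d p, OF this] show ?thesis by (simp add: D_def lenr)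
  qed
  define U where "U k = form_integral (Suc m) (\<lambda>\<theta>. act (propagator_poly (propagator \<theta>) ?M ^ k) T)" for k
  define cl where "cl r \<theta> = insert_point (Suc r) (cvec m \<theta> r) (cvec m \<theta>)" for r \<theta>
  define cu where "cu r \<theta> = insert_point (Suc r) (arc_end m (Suc r) (cvec m \<theta>)) (cvec m \<theta>)" for r \<theta>
  define LL where "LL r k = form_integral m (\<lambda>\<theta>. act (propagator_poly (lifted_prop (cl r \<theta>)) ?M ^ k) (Tr r))" for r k
  define UU where "UU r k = form_integral m (\<lambda>\<theta>. act (propagator_poly (lifted_prop (cu r \<theta>)) ?M ^ k) (Tr r))" for r k
  have gL: "good m (\<lambda>\<theta>. act (propagator_poly (lifted_prop (cl r \<theta>)) ?M ^ k) (Tr r))" for r k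
    using good_act[OF nice_good_pos[OF arc_end_pos(1)[of m "Suc r" r]], where M = ?M and k = k and s = 1 and T = "Tr r"] by (simp add: cl_def)
  have gU: "good m (\<lambda>\<theta>. act (propagator_poly (lifted_prop (cu r \<theta>)) ?M ^ k) (Tr r))" for r k
    using good_act[OF nice_good_pos[OF arc_end_pos(2)[of m "Suc r" "Suc r"]], where M = ?M and k = k and s = 1 and T = "Tr r"] by (simp add: cu_def)
  have vL: "fvb D (LL r k)" and vU: "fvb D (UU r k)" if "r < Suc m" for r k
    unfolding LL_def UU_def by (intro form_integral_vb allI vr[OF that] gL gU)+
  have gT: "good (Suc m) (\<lambda>\<theta>. act (propagator_poly (propagator \<theta>) ?M ^ k) T)" for k
    by (rule fint_fser(1)) (simp add: len)
  define V where "V k = (\<Sum>r<Suc m. fscale ((-1) ^ r) (LL r k - UU r k))" for k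
  have sgn: "vb 0 ((-1) ^ r :: complex fls)" for r
  proof -
    have "vb 0 (1 :: complex fls)" by (simp add: vb_def)
    from vb_sign[OF this, of r] show ?thesis by simp
  qed
  have vd: "fvb D (fscale ((-1) ^ r) (LL r k - UU r k))" if "r < Suc m" for r k
  proof -
    have "fvb D (LL r k - UU r k)" using vL[OF that, of k] vU[OF that, of k] by (simp add: fvb_def vb_def)
    from fvb_scale[OF sgn this] show ?thesis by simp
  qed
  have "fscale hbar (BV (free_exp a)) = fscale hbar (fser (\<lambda>k. BV (U k)))"
  proof -
    have vU': "fvb D (U k)" for k unfolding U_def by (intro form_integral_vb allI v gT)
    have "free_exp a = fser U"
      unfolding free_exp_arg U_def T_def[symmetric] using fint_fser(2)[of T "Suc m"] len a by simp
    then show ?thesis by (simp add: fser_local[OF local_op_BV vU'])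
  qed
  also have "\<dots> = fser V"
  \<comment> \<open>Order \<open>Suc k\<close> of the boundary terms is \<open>Suc k\<close> times
    order \<open>k\<close> of the integrated derivative. At order 0 the exponent does not enter, so
    the two ends of each arc agree.\<close>
  proof (rule fser_shift)
    show "fvb D (BV (U k))" for k
      unfolding U_def by (rule local_op_fvb[OF local_op_BV], intro form_integral_vb allI v gT)
    show "fvb D (V k)" for k unfolding V_def by (intro fvb_sum vd) simp
    show "V 0 = 0" by (simp add: V_def LL_def UU_def)
    show "V (Suc k) = fscale (of_nat (Suc k)) (BV (U k))" for k
    proof -
      have g: "good (Suc m) (\<lambda>\<theta>. act (propagator_poly (propagator \<theta>) ?M ^ k * edge_poly ?M (Suc r)) (Tr r))" for r
        by (rule good_act) (simp add: nice_prop)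
      have "BV (U k) = form_integral (Suc m) (\<lambda>\<theta>. \<Sum>r<Suc m. fscale ((-1) ^ r) (act (propagator_poly (propagator \<theta>) ?M ^ k * edge_poly ?M (Suc r)) (Tr r)))"
        unfolding U_def form_integral_local[OF local_op_BV gT] unfolding T_def BV_act[OF ne] Tr_def a
        by (simp only: mult.commute[of "edge_poly _ _"] diff_Suc_1)
      also have "\<dots> = (\<Sum>r<Suc m. fscale ((-1) ^ r) (form_integral (Suc m) (\<lambda>\<theta>. act (propagator_poly (propagator \<theta>) ?M ^ k * edge_poly ?M (Suc r)) (Tr r))))"
        by (subst form_integral_sum[THEN conjunct2]) (auto intro!: good_scale g simp: form_integral_scale[OF g])
      finally have "fscale (of_nat (Suc k)) (BV (U k)) = (\<Sum>r<Suc m. fscale ((-1) ^ r)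
          (fscale (of_nat (Suc k)) (form_integral (Suc m) (\<lambda>\<theta>. act (propagator_poly (propagator \<theta>) ?M ^ k * edge_poly ?M (Suc r)) (Tr r)))))"
        by (simp only: fs.scale_sum_right fs.scale_left_commute)
      also have "\<dots> = V (Suc k)"
        unfolding V_def
      proof (intro sum.cong refl arg_cong[where f = "fscale _"])
        fix r assume "r \<in> {..<Suc m}"
        then show "fscale (of_nat (Suc k)) (form_integral (Suc m) (\<lambda>\<theta>. act (propagator_poly (propagator \<theta>) ?M ^ k * edge_poly ?M (Suc r)) (Tr r))) = LL r (Suc k) - UU r (Suc k)"
          using stokes[of "Suc r" m k "Tr r"] by (simp add: LL_def UU_def cl_def cu_def)
      qed
      finally show ?thesis ..
    qed
  qed
  also have "\<dots> = (\<Sum>r<Suc m. fscale ((-1) ^ r) (fser (LL r) - fser (UU r)))"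
  proof -
    have "fser V = (\<Sum>r<Suc m. fser (\<lambda>k. fscale ((-1) ^ r) (LL r k - UU r k)))"
      unfolding V_def by (rule fser_sum[where d = D]) (use vd in auto)
    also have "\<dots> = (\<Sum>r<Suc m. fscale ((-1) ^ r) (fser (LL r) - fser (UU r)))"
    proof (intro sum.cong refl)
      fix r assume "r \<in> {..<Suc m}"
      then have r: "r < Suc m" by simp
      have m: "fvb D (fscale (-1) (UU r k))" for k
        using fvb_scale[OF sgn[of 1] vU[OF r, of k]] by simp
      have s: "fvb D (LL r k + fscale (-1) (UU r k))" for k
        using vL[OF r, of k] m[of k] by (simp add: fvb_def vb_def)
      have "fser (\<lambda>k. fscale ((-1) ^ r) (LL r k - UU r k)) = fser (\<lambda>k. fscale ((-1) ^ r) (LL r k + fscale (-1) (UU r k)))"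
        by simp
      also have "\<dots> = fscale ((-1) ^ r) (fser (LL r) + fscale (-1) (fser (UU r)))"
        by (simp only: fser_scale[OF s] fser_add[OF vL[OF r] m] fser_scale[OF vU[OF r]])
      finally show "fser (\<lambda>k. fscale ((-1) ^ r) (LL r k - UU r k)) = fscale ((-1) ^ r) (fser (LL r) - fser (UU r))" by simp
    qed
    finally show ?thesis .
  qed
  also have "\<dots> = (\<Sum>r<Suc m. fscale ((-1) ^ r) (fser (LL r))) - (\<Sum>r<Suc m. fscale ((-1) ^ r) (fser (UU r)))"
    by (simp only: fs.scale_right_diff_distrib sum_subtractf)
  also have "\<dots> = (\<Sum>r<Suc m. fscale ((-1) ^ r) (free_exp (mrg r a))) + fscale ((-1) ^ Suc m) (free_exp (cyc a))"
  proof -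
    define g where "g r z = fint m (take r T @ z # drop (Suc (Suc r)) T)" for r z
    have fL: "fser (LL r) = form_integral m (\<lambda>\<theta>. fser (\<lambda>k. act (propagator_poly (lifted_prop (cl r \<theta>)) ?M ^ k) (Tr r)))"
      and fU: "fser (UU r) = form_integral m (\<lambda>\<theta>. fser (\<lambda>k. act (propagator_poly (lifted_prop (cu r \<theta>)) ?M ^ k) (Tr r)))" if "r < Suc m" for r
      unfolding LL_def UU_def by (rule form_integral_fser[OF vr[OF that], symmetric], rule gL gU)+
    have L: "fser (LL r) = g r (mf_star (T ! r) (to_mform (a ! Suc r)))" if r: "r < Suc m" for r
    proof -
      have "Tr r = take r T @ T ! r # to_mform (a ! Suc r) # drop (Suc (Suc r)) T"
        using r len by (simp add: Tr_def upd_conv_take_nth_drop take_Suc_conv_app_nth)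
      moreover have "cl r \<theta> e = cvec m \<theta> (collapse r e)" for \<theta> e
        by (auto simp: cl_def insert_point_def collapse_def)
      ultimately have "fser (\<lambda>k. act (propagator_poly (lifted_prop (cl r \<theta>)) ?M ^ k) (Tr r)) =
          fser (\<lambda>k. act (propagator_poly (propagator \<theta>) (Suc m) ^ k) (take r T @ mf_star (T ! r) (to_mform (a ! Suc r)) # drop (Suc (Suc r)) T))"
        if "\<theta> \<in> cyc_config m" for \<theta>
        using that r len by (simp only:) (rule collision_lifted, auto)
      then show ?thesis
        unfolding fL[OF r] g_def using r len by (subst fint_act) (auto intro: form_integral_cong)
    qed
    have Um: "fser (UU r) = g (Suc r) (mf_star (to_mform (a ! Suc r)) (T ! Suc (Suc r)))" if r: "r < m" for r
    proof -
      have "Tr r = take (Suc r) T @ to_mform (a ! Suc r) # T ! Suc (Suc r) # drop (Suc (Suc (Suc r))) T"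
        using r len by (simp add: Tr_def upd_conv_take_nth_drop Cons_nth_drop_Suc)
      moreover have "cu r \<theta> e = cvec m \<theta> (collapse (Suc r) e)" for \<theta> e
        using r by (auto simp: cu_def insert_point_def collapse_def arc_end_def)
      ultimately have "fser (\<lambda>k. act (propagator_poly (lifted_prop (cu r \<theta>)) ?M ^ k) (Tr r)) =
          fser (\<lambda>k. act (propagator_poly (propagator \<theta>) (Suc m) ^ k) (take (Suc r) T @ mf_star (to_mform (a ! Suc r)) (T ! Suc (Suc r)) # drop (Suc (Suc (Suc r))) T))"
        if "\<theta> \<in> cyc_config m" for \<theta>
        using that r len by (simp only:) (rule collision_lifted, auto)
      then show ?thesis
        using r len unfolding g_def by (subst fU, simp, subst fint_act) (auto intro: form_integral_cong)
    qed
    \<comment> \<open>The end 1 of the last arc is point 0 after a full turn. Rotating the last slot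
      to the front makes the colliding slots adjacent.\<close>
    have Uc: "fser (UU m) = free_exp (cyc a)"
    proof -
      let ?l = "take (Suc m) T" and ?x = "to_mform (a ! Suc m)"
      have Tm: "Tr m = ?l @ [?x]"
        using len by (simp add: Tr_def upd_conv_take_nth_drop)
      have ll: "length ?l = Suc m" using len by simp
      have id: "map (mf_map (twist False)) l = l" for l :: "('n, 'r) mform list"
        by (simp add: twist_def map_idI)
      define z where "z = mf_star ?x (T ! 0) # take m (drop 1 T)"
      have "fser (\<lambda>k. act (propagator_poly (lifted_prop (cu m \<theta>)) ?M ^ k) (Tr m)) =
          fser (\<lambda>k. act (propagator_poly (propagator \<theta>) (Suc m) ^ k) z)" if \<theta>: "\<theta> \<in> cyc_config m" for \<theta>
      proof -
        define P where "P e f = lifted_prop (cu m \<theta>) (if e = 0 then Suc m else e - 1) (if f = 0 then Suc m else f - 1)" for e f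
        have pr: "lifted_prop (cu m \<theta>) e f = P (rot_index (length ?l) e) (rot_index (length ?l) f)" for e f
          unfolding ll by (simp add: P_def rot_index_def)
        have "act (propagator_poly (lifted_prop (cu m \<theta>)) ?M ^ k) (?l @ [?x]) = act (propagator_poly P ?M ^ k) (?x # ?l)" for k
          using act_rotate[of ?l "lifted_prop (cu m \<theta>)" P False ?x k, OF pr parity_arg(2)] unfolding ll id .
        moreover have "?x # ?l = [] @ ?x # T ! 0 # take m (drop 1 T)"
          using len by (cases T) auto
        moreover have "fser (\<lambda>k. act (propagator_poly P ?M ^ k) ([] @ ?x # T ! 0 # take m (drop 1 T))) =
            fser (\<lambda>k. act (propagator_poly (lifted_prop (cvec m \<theta>)) (Suc m) ^ k) ([] @ mf_star ?x (T ! 0) # take m (drop 1 T)))"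
        proof (rule collision[where a = 0])
          show "Suc m = Suc (length ([] :: ('n, 'r) mform list) + length (take m (drop 1 T)))" using len by simp
          \<comment> \<open>The position 1 of the rotated slot turns the branch -1/2 into the value
            1/2 that \<open>collision\<close> expects.\<close>
          show "P 0 (Suc 0) = 1 / 2" "P (Suc 0) 0 = - 1 / 2"
            by (simp_all add: P_def lifted_prop_def cu_def insert_point_def arc_end_def)
          fix e f assume "e < ?M" "f < ?M" "collapse 0 e \<noteq> collapse 0 f"
          then show "P e f = lifted_prop (cvec m \<theta>) (collapse 0 e) (collapse 0 f)"
            by (auto simp: P_def lifted_prop_def cu_def insert_point_def arc_end_def collapse_def)
        qed simp
        ultimately show ?thesis
          unfolding Tm propagator_poly_lifted[OF \<theta>] z_def by simp
      qed
      then have "fser (UU m) = fint m z"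
        using len by (subst fU, simp, subst fint_act) (auto simp: z_def intro: form_integral_cong)
      also have "z = arg_list (cyc a)"
      proof -
        have "T ! 0 = to_mform (a ! 0)" using ne by (simp add: T_def nth_arg_list)
        moreover have "drop 1 T = map arg_form (tl a)" by (simp add: T_def arg_list_def)
        ultimately show ?thesis using a by (simp add: z_def cyc_def arg_list_def mf_star_to_mform take_map drop_Suc)
      qed
      finally show ?thesis using a by (simp add: free_exp_arg cyc_def)
    qed
    have g_add: "g r (x + y) = g r x + g r y" if "r < Suc m" for r x y
      unfolding g_def by (rule fint_lin(1)[OF mslot_mid]) (use that len in auto)
    have m0: "free_exp (mrg 0 a) = g 0 (mf_star (T ! 0) (to_mform (a ! Suc 0)))"
    proof -
      have "mrg 0 a = (a ! 0 \<star>\<^sub>G a ! 1) # drop 2 a" by (simp add: mrg_def numeral_2_eq_2)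
      moreover have "drop (Suc (Suc 0)) T = map arg_form (drop 2 a)" 
        unfolding numeral_2_eq_2 using ne by (cases a) (simp_all add: T_def arg_list_def drop_map)
      ultimately show ?thesis
        using a ne by (simp add: free_exp_arg arg_list_def g_def T_def nth_arg_list mf_star_to_mform numeral_2_eq_2 hd_conv_nth)
    qed
    have mS: "free_exp (mrg (Suc r) a) = g (Suc r) (mf_star (T ! Suc r) (to_mform (a ! Suc (Suc r)))) + g (Suc r) (mf_star (to_mform (a ! Suc r)) (T ! Suc (Suc r)))"
      if r: "r < m" for r
    proof -
      have t: "T ! Suc r = arg_form (a ! Suc r)" "T ! Suc (Suc r) = arg_form (a ! Suc (Suc r))" using r a by (simp_all add: T_def nth_arg_list)
      have "mf_star (T ! Suc r) (to_mform (a ! Suc (Suc r))) + mf_star (to_mform (a ! Suc r)) (T ! Suc (Suc r)) = arg_form (a ! Suc r \<star>\<^sub>G a ! Suc (Suc r))"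
        unfolding t arg_form_def mf_star_to_mform[symmetric] mf_star_de_rham by (simp add: grade_arg)
      moreover have "arg_list (mrg (Suc r) a) = take (Suc r) T @ arg_form (a ! Suc r \<star>\<^sub>G a ! Suc (Suc r)) # drop (Suc (Suc (Suc r))) T"
        using r a by (cases a) (simp_all add: mrg_def T_def arg_list_def take_map drop_map)
      moreover have "length (mrg (Suc r) a) - 1 = m" using r a by (simp add: mrg_def)
      ultimately have "free_exp (mrg (Suc r) a) = g (Suc r) (mf_star (T ! Suc r) (to_mform (a ! Suc (Suc r))) + mf_star (to_mform (a ! Suc r)) (T ! Suc (Suc r)))"
        by (simp only: free_exp_arg g_def)
      then show ?thesis using r by (simp only: g_add Suc_mono)
    qed
    let ?gL = "\<lambda>r. g (Suc r) (mf_star (T ! Suc r) (to_mform (a ! Suc (Suc r))))"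
      and ?gU = "\<lambda>r. g (Suc r) (mf_star (to_mform (a ! Suc r)) (T ! Suc (Suc r)))"
    have e1: "(\<Sum>r<Suc m. fscale ((-1) ^ r) (fser (LL r))) = free_exp (mrg 0 a) + (\<Sum>r<m. fscale ((-1) ^ Suc r) (?gL r))"
      unfolding sum.lessThan_Suc_shift m0 by (simp add: L)
    have e2: "(\<Sum>r<Suc m. fscale ((-1) ^ r) (fser (UU r))) = (\<Sum>r<m. fscale ((-1) ^ r) (?gU r)) + fscale ((-1) ^ m) (free_exp (cyc a))"
      by (simp add: Um Uc)
    have "(\<Sum>r<Suc m. fscale ((-1) ^ r) (free_exp (mrg r a))) = free_exp (mrg 0 a) + (\<Sum>r<m. fscale ((-1) ^ Suc r) (?gL r) - fscale ((-1) ^ r) (?gU r))"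
      unfolding sum.lessThan_Suc_shift by (simp add: mS fs.scale_right_distrib)
    then have e3: "(\<Sum>r<Suc m. fscale ((-1) ^ r) (free_exp (mrg r a))) =
        free_exp (mrg 0 a) + ((\<Sum>r<m. fscale ((-1) ^ Suc r) (?gL r)) - (\<Sum>r<m. fscale ((-1) ^ r) (?gU r)))"
      by (simp only: sum_subtractf)
    show ?thesis
      unfolding e1 e2 e3 by (simp add: algebra_simps)
  qed
  finally show ?thesis .
qed

lemma free_exp_BV_0: "BV (free_exp [x]) = 0"
proof -
  have len: "length (arg_list [x]) = Suc 0" by simp
  have g: "good 0 (\<lambda>\<theta>. act (propagator_poly (propagator \<theta>) (Suc 0) ^ k) (arg_list [x]))" for k by (rule fint_fser(1)[OF len])
  obtain d where "\<forall>z\<in>set (arg_list [x]). mvb d z" using mvb_list by blast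
  then have va: "fvb (int (length (arg_list [x])) * d) (act p (arg_list [x]))" for p by (intro fvb_act) auto
  have v: "fvb (int (length (arg_list [x])) * d) (form_integral 0 (\<lambda>\<theta>. act (propagator_poly (propagator \<theta>) (Suc 0) ^ k) (arg_list [x])))" for k
    by (intro form_integral_vb allI va g)
  have "BV (free_exp [x]) = fser (\<lambda>k. form_integral 0 (\<lambda>\<theta>. BV (act (propagator_poly (propagator \<theta>) (Suc 0) ^ k) (arg_list [x]))))"
    unfolding free_exp_arg using fint_fser(2)[OF len] by (simp add: fser_local[OF local_op_BV v] form_integral_local[OF local_op_BV g])
  also have "\<dots> = 0" by (simp add: BV_act form_integral_0 fser_def)
  finally show ?thesis .
qed

lemma insert_fint:
  fixes T :: "('n::{finite,linorder}, 'r::finite) mform list"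
  assumes T: "length T = Suc m" and w: "parity_form b w" "\<And>i j. lie_deriv i (lie_deriv j w) = 0"
  shows "(\<Sum>r<Suc m. fint (Suc m) (map (mf_map (twist b)) (take (Suc r) T) @ mat w # drop (Suc r) T)) =
    fser (\<lambda>k. form_integral m (\<lambda>\<theta>. wedge w (act (propagator_poly (propagator \<theta>) (Suc m) ^ k) T)))"
proof -
  define U where "U r = map (mf_map (twist b)) (take (Suc r) T) @ mat w # drop (Suc r) T" for r
  have len: "length (U r) = Suc (Suc m)" if "r < Suc m" for r using T that by (simp add: U_def)
  obtain d where d: "\<forall>x\<in>set (concat (map U [0..<Suc m])). mvb d x" using mvb_list by blast
  define D where "D = int (Suc (Suc m)) * d"
  define f where "f r k = form_integral (Suc m) (\<lambda>\<theta>. act (propagator_poly (propagator \<theta>) (Suc (Suc m)) ^ k) (U r))" for r k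
  have v: "fvb D (f r k)" if r: "r \<in> {..<Suc m}" for r k
  proof -
    have "mvb d x" if "x \<in> set (U r)" for x using d that r by (auto simp del: upt_Suc)
    then have "fvb D (act p (U r))" for p using fvb_act[of "U r" d p] len[of r] r by (simp add: D_def)
    then show ?thesis unfolding f_def using fint_fser(1)[OF len[of r]] r by (intro form_integral_vb) auto
  qed
  have "(\<Sum>r<Suc m. fint (Suc m) (U r)) = (\<Sum>r<Suc m. fser (f r))"
    by (intro sum.cong refl) (simp add: fint_fser(2)[OF len] f_def[abs_def])
  also have "\<dots> = fser (\<lambda>k. \<Sum>r<Suc m. f r k)"
    by (rule fser_sum[symmetric, OF v])
  also have "\<dots> = fser (\<lambda>k. form_integral m (\<lambda>\<theta>. wedge w (act (propagator_poly (propagator \<theta>) (Suc m) ^ k) T)))"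
    unfolding f_def U_def insert_central[OF T w] ..
  finally show ?thesis unfolding U_def .
qed

section \<open>Connes' operator and the de Rham differential\<close>

lemma to_mform_mat: "to_mform (mat f) = mat (form0 f)"
  by (simp add: to_mform_def mat_def vec_eq_iff) (simp add: form0_def vec_eq_iff)

lemma mscale_1 [simp]: "mscale 1 x = x" by (simp add: mscale_def vec_eq_iff)

text \<open>The unit is rotated into place \<open>i\<close>. Every step takes one 1-form past the
  \<open>p\<close> others, and the total sign is the one in Connes' operator.\<close>

lemma free_exp_unit:
  fixes a :: "('n::{finite,linorder}, 'r::finite) gl list"
  assumes len: "length a = Suc p" and i: "i \<le> Suc p"
  shows "fscale ((-1) ^ (p * i)) (free_exp (mat 1 # drop i a @ take i a)) =
    fint (Suc p) (take i (map arg_form a) @ mat (form0 1) # drop i (map arg_form a))"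
proof -
  define T where "T = map arg_form a"
  let ?e = "mat (form0 1) :: ('n, 'r) mform"
  have T: "length T = Suc p" using len by (simp add: T_def)
  have ge: "mf_map grade ?e = ?e"
    by (simp add: mf_map_def mat_def vec_eq_iff) (simp add: grade_def vec_eq_iff)
  \<comment> \<open>The word after \<open>j\<close> of the \<open>i\<close> rotations.\<close>
  define X where "X j = drop (i - j) (take i T) @ ?e # drop i T @ take (i - j) T" for j
  have lX: "length (X j) = Suc (Suc p)" if "j \<le> i" for j
    using T i that by (simp add: X_def)
  have rot: "fint (Suc p) (X j) = fscale ((-1) ^ p) (fint (Suc p) (X (Suc j)))" if j: "Suc j \<le> i" for j
  proof -
    define q where "q = i - Suc j"
    define Y where "Y = drop (i - j) (take i T) @ ?e # drop i T @ take q T"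
    have q: "i - j = Suc q" "q < Suc p" using j i by (auto simp: q_def)
    have XY: "X j = Y @ [T ! q]"
      using q T by (simp add: X_def Y_def take_Suc_conv_app_nth)
    have "T ! q # drop (i - j) (take i T) = drop q (take i T)"
      using Cons_nth_drop_Suc[of q "take i T"] q T i j by (simp add: q_def)
    then have XS: "X (Suc j) = T ! q # Y" by (simp add: X_def Y_def q_def)
    have lY: "length Y = Suc p" using lX[of j] j unfolding XY by simp
    have Ye: "Y ! j = ?e" using i j T by (simp add: Y_def nth_append)
    have Yo: "mf_map grade (Y ! c) = mscale (- 1) (Y ! c)" if c: "c < Suc p" "c \<noteq> j" for c
    proof -
      define A B where "A = drop (i - j) (take i T)" and "B = drop i T @ take q T"
      have Y: "Y = A @ ?e # B" by (simp add: Y_def A_def B_def)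
      have lA: "length A = j" using i j T by (simp add: A_def)
      have "Y ! c \<in> set A \<union> set B"
      proof (cases "c < j")
        case True
        then show ?thesis by (simp add: Y lA nth_append)
      next
        case False
        then obtain k where k: "c = Suc (j + k)" using c(2) by (metis less_imp_Suc_add linorder_neqE_nat)
        then have "k < length B" using lY c(1) lA by (simp add: Y)
        then show ?thesis by (simp add: Y nth_append lA k)
      qed
      then have "Y ! c \<in> set T" by (auto simp: A_def B_def dest: in_set_dropD in_set_takeD)
      then show ?thesis by (auto simp: T_def grade_arg)
    qed
    have "fint (Suc p) (X j) = fint (Suc p) (T ! q # map (mf_map (twist True)) Y)"
      unfolding XY by (rule fint_rotate[OF lY]) (use q T in \<open>simp add: T_def parity_arg len\<close>)
    also have "\<dots> = fscale (\<Prod>c<length (T ! q # Y). case c of 0 \<Rightarrow> 1 | Suc c \<Rightarrow> if c \<in> {..<Suc p} - {j} then - 1 else 1) (fint (Suc p) (T ! q # Y))"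
    proof (rule fint_scale_slots)
      fix c assume "c < length (T ! q # Y)"
      then show "(T ! q # map (mf_map (twist True)) Y) ! c = mscale (case c of 0 \<Rightarrow> 1 | Suc c \<Rightarrow> if c \<in> {..<Suc p} - {j} then - 1 else 1) ((T ! q # Y) ! c)"
        using lY by (cases c) (auto simp: twist_def Ye ge Yo)
    qed (use lY in auto)
    also have "(\<Prod>c<length (T ! q # Y). (case c of 0 \<Rightarrow> 1 | Suc c \<Rightarrow> if c \<in> {..<Suc p} - {j} then - 1 else 1) :: complex fls) = (-1) ^ p"
      unfolding list.size lY add_Suc_right add_0_right prod.lessThan_Suc_shift[of _ "Suc p"] nat.case
      using prod_signs[of "{..<Suc p} - {j}" "Suc p", where 'a = "complex fls"] i j by simp
    finally show ?thesis unfolding XS .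
  qed
  have "j \<le> i \<Longrightarrow> fint (Suc p) (X 0) = fscale ((-1) ^ (p * j)) (fint (Suc p) (X j))" for j
  proof (induction j)
    case (Suc j)
    then show ?case using rot[of j] by (simp add: power_add mult.commute)
  qed simp
  from this[of i] have "fscale ((-1) ^ (p * i)) (fint (Suc p) (X 0)) = fint (Suc p) (X i)"
    by simp
  moreover have "free_exp (mat 1 # drop i a @ take i a) = fint (Suc p) (X 0)"
    using len i by (simp add: free_exp_arg arg_list_def to_mform_mat X_def T_def drop_map take_map)
  ultimately show ?thesis by (simp add: X_def T_def)
qed

lemma de_rham_arg_form [simp]: "mf_map de_rham (arg_form x) = 0"
  by (simp add: arg_form_def mf_map_def vec_eq_iff)

text \<open>The slots after the first are exact, so only slot 0 contributes and becomes a 1-form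
  like the others.\<close>

lemma de_rham_free_exp:
  assumes len: "length a = Suc p"
  shows "de_rham (free_exp a) = fint p (map arg_form a)"
proof -
  have ne: "a \<noteq> []" using len by auto
  define T where "T = arg_list a"
  have T: "length T = Suc p" using len ne by (simp add: T_def)
  have act: "de_rham (act q T) = act q (map arg_form a)" for q
  proof -
    have "de_rham (act q T) = (\<Sum>c<Suc p. act q (der_at grade de_rham c T))"
      using gder_act[OF gder_de_rham grade_lie lie_de_rham[symmetric], of q T] unfolding T .
    also have "\<dots> = act q (der_at grade de_rham 0 T) + (\<Sum>c<p. act q (der_at grade de_rham (Suc c) T))"
      by (rule sum.lessThan_Suc_shift)
    also have "(\<Sum>c<p. act q (der_at grade de_rham (Suc c) T)) = 0"
    proof (rule sum.neutral, rule ballI)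
      fix c assume "c \<in> {..<p}"
      then show "act q (der_at grade de_rham (Suc c) T) = 0"
        using T len by (intro act_zero_slot[of "Suc c"]) (auto simp: nth_der_at T_def nth_arg_list)
    qed
    also have "der_at grade de_rham 0 T = map arg_form a"
      using ne by (cases a) (simp_all add: T_def arg_list_def der_at_Cons arg_form_def)
    finally show ?thesis by simp
  qed
  obtain d where "\<forall>z\<in>set T. mvb d z" using mvb_list by blast
  then have va: "fvb (int (length T) * d) (act q T)" for q by (intro fvb_act) auto
  have v: "fvb (int (length T) * d) (form_integral p (\<lambda>\<theta>. act (propagator_poly (propagator \<theta>) (Suc p) ^ k) T))" for k
    by (intro form_integral_vb allI va fint_fser(1)[OF T])
  have "de_rham (free_exp a) = de_rham (fint p T)" by (simp add: free_exp_arg len T_def)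
  also have "\<dots> = fser (\<lambda>k. form_integral p (\<lambda>\<theta>. act (propagator_poly (propagator \<theta>) (Suc p) ^ k) (map arg_form a)))"
    unfolding fint_fser(2)[OF T] fser_local[OF local_op_de_rham v]
      form_integral_local[OF local_op_de_rham fint_fser(1)[OF T]] act ..
  also have "\<dots> = fint p (map arg_form a)"
    by (rule fint_fser(2)[symmetric]) (simp add: len)
  finally show ?thesis .
qed

text \<open>By \<open>free_exp_unit\<close> the sum runs over the places 0 to \<open>p\<close> of
  the unit among the 1-forms, while \<open>insert_fint\<close> uses the places 1 to
  \<open>p + 1\<close>. One more rotation, without sign as the unit is even, carries place 0 to
  place \<open>p + 1\<close>.\<close>

theorem free_exp_connes:
  fixes a :: "('n::{finite,linorder}, 'r::finite) gl list"
  assumes len: "length a = Suc p"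
  shows "(\<Sum>i\<le>p. fscale ((-1) ^ (p * i)) (free_exp (mat 1 # drop i a @ take i a))) = de_rham (free_exp a)"
proof -
  define T where "T = map arg_form a"
  let ?e = "mat (form0 1) :: ('n, 'r) mform"
  define g where "g i = fint (Suc p) (take i T @ ?e # drop i T)" for i
  have T: "length T = Suc p" using len by (simp add: T_def)
  have "(\<Sum>i\<le>p. fscale ((-1) ^ (p * i)) (free_exp (mat 1 # drop i a @ take i a))) = (\<Sum>i\<le>p. g i)"
    by (intro sum.cong refl) (simp add: free_exp_unit[OF len] g_def T_def)
  also have "\<dots> = g 0 + (\<Sum>i<p. g (Suc i))"
    by (simp only: lessThan_Suc_atMost[symmetric] sum.lessThan_Suc_shift)
  also have "g 0 = g (Suc p)"
  proof -
    have "parity_mform False ?e"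
      by (simp add: parity_mform_def parity_form_def mat_def even_form0) (simp add: even_form_def)
    from fint_rotate[OF T this] show ?thesis using T by (simp add: g_def twist_def map_idI)
  qed
  also have "g (Suc p) + (\<Sum>i<p. g (Suc i)) = (\<Sum>r<Suc p. g (Suc r))" by simp
  also have "\<dots> = fser (\<lambda>k. form_integral p (\<lambda>\<theta>. act (propagator_poly (propagator \<theta>) (Suc p) ^ k) T))"
    using insert_fint[OF T, of False "form0 1"]
    by (simp add: g_def twist_def map_idI parity_form_def even_form0 lie_one lie_lin del: sum.lessThan_Suc)
  also have "\<dots> = de_rham (free_exp a)"
    unfolding de_rham_free_exp[OF len] T_def[symmetric] by (rule fint_fser(2)[OF T, symmetric])
  finally show ?thesis .
qed

section \<open>Insertion of an element of \<open>lie_h\<close>\<close>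

lemma good_wedge:
  fixes F :: "(nat \<Rightarrow> real) \<Rightarrow> 'n::{finite,linorder} form"
  assumes F: "good m F"
  shows "good m (\<lambda>\<theta>. wedge v (F \<theta>))"
proof -
  obtain d where d: "\<And>\<theta>. fvb d (F \<theta>)" using F by (auto simp: good_def)
  \<comment> \<open>Wrapped as a matrix so that \<open>mvb_list\<close> supplies a lower bound for
    \<open>v\<close>.\<close>
  obtain e where "\<forall>x\<in>set [\<chi> i j. v :: ('n, bool) mform]. mvb e x" using mvb_list by blast
  then have e: "fvb e v" by (auto simp: mvb_def)
  have "nice m (\<lambda>\<theta>. fcoef (wedge v (F \<theta>)) I N y)" for I N y
  proof -
    have 1: "vb e ((-1) ^ inversions J (I - J) * v $ J)" for J
      using e by (intro vb_sign) (simp add: fvb_def)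
    have 2: "vb d (F \<theta> $ K)" for \<theta> K using d by (simp add: fvb_def)
    have "nice m (\<lambda>\<theta>. fcoef (F \<theta>) K M z)" for K M z using F by (simp add: good_def)
    then show ?thesis
      unfolding wedge_nth fls_nth_sum mcoeff_sum fls_times_nth_vb[OF 1 2] times_mps.rep_eq case_prod_unfold
      by (intro nice_sum nice_mult nice_const)
  qed
  with fvb_wedge[OF e d] show ?thesis unfolding good_def by blast
qed

lemma base_zero_fser:
  assumes v: "\<And>k. fvb d (w k)" and z: "\<And>k. base_zero (w k)"
  shows "base_zero (fser w :: 'n::{finite,linorder} form)"
proof -
  have "fcoef (fser w) I N (\<lambda>_. 0) = 0" for I N
  proof -
    have N: "N < d + int (nat (N - d + 1))" by simp
    have "base_zero (fscale (hbar ^ k / fact k) (w k))" for k by (rule base_zero_scale[OF z])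
    then show ?thesis unfolding fser_coeff[OF v N] by (simp add: base_zero_def del: fscale_nth)
  qed
  then show ?thesis by (simp add: base_zero_def)
qed

lemma base_zero_form_integral: "good m F \<Longrightarrow> (\<And>\<theta>. base_zero (F \<theta>)) \<Longrightarrow> base_zero (form_integral m F)"
  by (simp add: base_zero_def form_integral_coeff set_lebesgue_integral_def)

lemma de_rham_form0_0: "(\<And>i. wderiv i f = 0) \<Longrightarrow> de_rham (form0 f) = 0"
  by (auto simp: de_rham_def form0_def vec_eq_iff intro!: sum.neutral)

text \<open>The matrix and scalar parts of \<open>\<eta>\<close> are constant in y and disappear
  under \<open>de_rham\<close>. The differential of a quadratic polynomial has linear coefficients,
  whence the two vanishing properties.\<close>

lemma lie_h_arg_form:
  assumes "\<eta> \<in> lie_h"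
  obtains w where "arg_form \<eta> = mat w" "odd_form w" "\<And>i j. lie_deriv i (lie_deriv j w) = 0" "base_zero w"
proof -
  obtain q M s where q: "q \<in> sp_quad"
    and \<eta>: "\<eta> = mat (fls_const q) + gscale hbar (\<chi> i j. fls_const (mconst (M $ i $ j))) + mat (emb (fps_to_fls s))"
    using assms unfolding lie_h_def by blast
  define w where "w = de_rham (form0 (fls_const q))"
  have upd: "(\<Sum>k\<in>UNIV. (a(i := Suc (a i))) k) = Suc (sum a UNIV)" for a :: "'a coord \<Rightarrow> nat" and i
  proof -
    have "sum (a(i := Suc (a i))) UNIV = (a(i := Suc (a i))) i + sum (a(i := Suc (a i))) (UNIV - {i})"
      by (rule sum.remove) auto
    also have "sum (a(i := Suc (a i))) (UNIV - {i}) = sum a (UNIV - {i})" by (rule sum.cong) auto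
    also have "(a(i := Suc (a i))) i + \<dots> = Suc (sum a UNIV)" using sum.remove[of UNIV i a] by simp
    finally show ?thesis .
  qed
  have dd: "de_rham (form0 (emb c)) = 0" for c by (rule de_rham_form0_0) simp
  have "fls_const (mconst c) = emb (fls_const c)" for c :: complex and x :: "'a weyl"
    by (rule fls_eqI) simp
  then have fc: "(fls_const (mconst c) :: 'a weyl) = emb (fls_const c)" for c by blast
  have add: "form0 (f + g) = form0 f + form0 g" for f g :: "'a weyl" by (auto simp: form0_def vec_eq_iff)
  have if0: "(if b then x else (0 :: 'a weyl)) = (if b then 1 else 0) * x" for b x by simp
  have "arg_form \<eta> = mat w"
  proof -
    have z: "de_rham (form0 (0 :: 'a weyl)) = 0" using dd[of 0] by simp
    show ?thesis
      by (simp add: z \<eta> arg_form_def mf_map_def to_mform_def gscale_def mat_def vec_eq_iff w_def add de_rham_lin fc dd flip: emb_mult)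
  qed
  moreover have "odd_form w"
  proof -
    have "parity_mform True (arg_form (mat (fls_const q) :: ('a, 'b) gl))" by (rule parity_arg)
    moreover have "arg_form (mat (fls_const q) :: ('a, 'b) gl) $ i $ i = w" for i :: 'b
      by (simp add: arg_form_def to_mform_mat mf_map_def w_def) (simp add: mat_def)
    ultimately show ?thesis by (metis parity_mform_def parity_form_def)
  qed
  moreover have "lie_deriv i (lie_deriv j w) = 0" for i j
  proof -
    have "mderiv k (mderiv i (mderiv j q)) = 0" for k
    proof (rule mps_eqI)
      fix a
      have "mcoeff q b = 0" if "sum b UNIV \<noteq> 2" for b using q that by (auto simp: sp_quad_def)
      then show "mcoeff (mderiv k (mderiv i (mderiv j q))) a = mcoeff 0 a"
        by (simp add: mderiv.rep_eq zero_mps.rep_eq upd del: fun_upd_apply)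
    qed
    then have "wderiv k (wderiv i (wderiv j (fls_const q))) = 0" for k
      by (intro fls_eqI) simp
    then show ?thesis by (simp add: w_def lie_de_rham lie_form0 de_rham_form0_0)
  qed
  moreover have "base_zero w"
  proof -
    have "mcoeff (mderiv i q) (\<lambda>_. 0) = 0" for i
    proof -
      have "mcoeff q b = 0" if "sum b UNIV \<noteq> 2" for b using q that by (auto simp: sp_quad_def)
      then show ?thesis using upd[of "\<lambda>_. 0" i] by (simp add: mderiv.rep_eq del: fun_upd_apply)
    qed
    then show ?thesis
      by (auto simp: base_zero_def w_def de_rham_def form0_def fls_nth_sum mcoeff_sum mcoeff_sign zero_mps.rep_eq intro!: sum.neutral)
  qed
  ultimately show ?thesis by (rule that)
qed

text \<open>The alternating signs are those of an odd \<open>w\<close> passing the 1-forms in front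
  of it, which is the shape of the sum in \<open>insert_fint\<close>.\<close>

theorem base_zero_insert:
  fixes a :: "('n::{finite,linorder}, 'r::finite) gl list"
  assumes \<eta>: "\<eta> \<in> lie_h" and len: "length a = Suc m"
  shows "base_zero (\<Sum>r<Suc m. fscale ((-1) ^ r) (free_exp (take (Suc r) a @ \<eta> # drop (Suc r) a)))"
proof -
  obtain w where w: "arg_form \<eta> = mat w" "odd_form w" "\<And>i j. lie_deriv i (lie_deriv j w) = 0" "base_zero w"
    using lie_h_arg_form[OF \<eta>] by blast
  have ne: "a \<noteq> []" using len by auto
  define T where "T = arg_list a"
  have T: "length T = Suc m" using len ne by (simp add: T_def)
  have "fint (Suc m) (map (mf_map (twist True)) (take (Suc r) T) @ mat w # drop (Suc r) T) =
      fscale ((-1) ^ r) (free_exp (take (Suc r) a @ \<eta> # drop (Suc r) a))" if r: "r < Suc m" for r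
  proof -
    define V where "V = take (Suc r) T @ mat w # drop (Suc r) T"
    have V: "length V = Suc (Suc m)" using T r by (simp add: V_def)
    have "fint (Suc m) (map (mf_map (twist True)) (take (Suc r) T) @ mat w # drop (Suc r) T) =
        fscale (\<Prod>c<length V. if c \<in> {1..r} then - 1 else 1) (fint (Suc m) V)"
    proof (rule fint_scale_slots[OF V])
      fix c assume "c < length V"
      then show "(map (mf_map (twist True)) (take (Suc r) T) @ mat w # drop (Suc r) T) ! c =
          mscale (if c \<in> {1..r} then - 1 else 1) (V ! c)"
        using T r len by (auto simp: V_def nth_append twist_def T_def nth_arg_list grade_arg)
    qed (simp add: V_def)
    also have "(\<Prod>c<length V. if c \<in> {1..r} then - 1 else 1 :: complex fls) = (-1) ^ r"
      by (subst prod_signs) (use V r in auto)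
    also have "V = arg_list (take (Suc r) a @ \<eta> # drop (Suc r) a)"
      using ne by (cases a) (simp_all add: V_def T_def arg_list_def w(1) take_map drop_map)
    finally show ?thesis using len r by (simp add: free_exp_arg)
  qed
  then have "(\<Sum>r<Suc m. fscale ((-1) ^ r) (free_exp (take (Suc r) a @ \<eta> # drop (Suc r) a))) =
      fser (\<lambda>k. form_integral m (\<lambda>\<theta>. wedge w (act (propagator_poly (propagator \<theta>) (Suc m) ^ k) T)))"
    using insert_fint[OF T, of True w] w(2,3) by (simp add: parity_form_def del: sum.lessThan_Suc)
  moreover have "base_zero \<dots>"
  proof -
    obtain d where d: "\<forall>x\<in>set T. mvb d x" using mvb_list by blast
    obtain e where "\<forall>x\<in>set [arg_form \<eta>]. mvb e x" using mvb_list by blast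
    then have "mvb e (mat w :: ('n, 'r) mform)" by (simp add: w(1))
    then have "fvb e ((mat w :: ('n, 'r) mform) $ i $ i)" for i unfolding mvb_def by blast
    then have e: "fvb e w" by (simp add: mat_def)
    have g: "good m (\<lambda>\<theta>. wedge w (act (propagator_poly (propagator \<theta>) (Suc m) ^ k) T))" for k
      by (rule good_wedge[OF fint_fser(1)[OF T]])
    have "fvb (e + int (length T) * d) (form_integral m (\<lambda>\<theta>. wedge w (act (propagator_poly (propagator \<theta>) (Suc m) ^ k) T)))" for k
      by (intro form_integral_vb allI g fvb_wedge e fvb_act) (use d in auto)
    then show ?thesis
      by (rule base_zero_fser) (intro base_zero_form_integral g base_zero_wedge w(4))
  qed
  ultimately show ?thesis by simp
qed

section \<open>Vanishing above the top degree\<close>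

definition min_deg :: "nat \<Rightarrow> 'n::finite form \<Rightarrow> bool" where
  "min_deg d w \<longleftrightarrow> (\<forall>I. card I < d \<longrightarrow> w $ I = 0)"

lemma min_deg_sum: "(\<And>x. x \<in> S \<Longrightarrow> min_deg d (f x)) \<Longrightarrow> min_deg d (sum f S)"
  by (auto simp: min_deg_def intro!: sum.neutral)

lemma min_deg_wedge:
  fixes v w :: "'n::{finite,linorder} form"
  shows "min_deg d v \<Longrightarrow> min_deg e w \<Longrightarrow> min_deg (d + e) (wedge v w)"
  unfolding min_deg_def
proof (intro allI impI)
  fix I :: "'n coord set" assume v: "\<forall>I. card I < d \<longrightarrow> v $ I = 0" and w: "\<forall>I. card I < e \<longrightarrow> w $ I = 0" and I: "card I < d + e"
  have "v $ J * w $ (I - J) = 0" if "J \<subseteq> I" for J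
  proof -
    have "card I = card J + card (I - J)" using that by (simp add: card_Diff_subset card_mono)
    then have "card J < d \<or> card (I - J) < e" using I by linarith
    then show ?thesis using v w by auto
  qed
  then show "wedge v w $ I = 0" by (auto simp: wedge_nth mult.assoc intro!: sum.neutral)
qed

lemma min_deg_act:
  fixes T :: "('n::{finite,linorder}, 'r::finite) mform list"
  shows "list_all2 (\<lambda>d x. \<forall>i j. min_deg d (x $ i $ j)) ds T \<Longrightarrow> min_deg (sum_list ds) (act p T)"
proof (induction p arbitrary: T rule: op_induct)
  case (const c)
  have "\<forall>i j. min_deg (sum_list ds) (mprod T $ i $ j)"
    using const
  proof (induction rule: list_all2_induct)
    case Nil show ?case by (simp add: min_deg_def)
  next
    case (Cons d ds x T)
    then show ?case by (auto simp: mf_mult_def intro!: min_deg_sum min_deg_wedge)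
  qed
  then have "min_deg (sum_list ds) (mtr (mprod T))" unfolding mtr_def by (intro min_deg_sum) auto
  then show ?case by (auto simp: act_Dconst trace_prod min_deg_def)
next
  case (add p q)
  then show ?case by (auto simp: act_add min_deg_def)
next
  case (var a i p)
  have "list_all2 (\<lambda>d x. \<forall>i j. min_deg d (x $ i $ j)) ds (T[a := mf_map (lie_deriv i) (T ! a)])"
    using var.prems by (cases "a < length T") (auto simp: list_all2_conv_all_nth nth_list_update mf_map_def min_deg_def lie_deriv_def)
  from var.IH[OF this] show ?case by (simp add: act_Dvar)
qed

text \<open>The product contains \<open>m\<close> one-forms, and its degree would exceed 2n.\<close>

lemma free_exp_degree:
  fixes a :: "('n::{finite,linorder}, 'r::finite) gl list"
  assumes len: "length a = Suc m" and m: "2 * CARD('n) < m"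
  shows "free_exp a = 0"
proof -
  have ne: "a \<noteq> []" using len by auto
  define T where "T = arg_list a"
  have T: "length T = Suc m" using len ne by (simp add: T_def)
  have "min_deg 1 (de_rham (form0 f))" for f :: "'n weyl"
    by (auto simp: min_deg_def de_rham_def)
  then have "list_all2 (\<lambda>d x. \<forall>i j. min_deg d (x $ i $ j)) (0 # replicate m 1) T"
    using len ne by (cases a) (auto simp: T_def arg_list_def list_all2_conv_all_nth min_deg_def[of 0] arg_form_def mf_map_def to_mform_def nth_Cons split: nat.splits)
  from min_deg_act[OF this] have act: "min_deg m (act p T)" for p by (simp add: sum_list_replicate)
  have "card I < m" for I :: "'n coord set"
    using card_mono[of "UNIV :: 'n coord set" I] m by (simp add: card_coord)
  with act have "act p T = 0" for p by (simp add: min_deg_def vec_eq_iff)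
  then have "fint m T = 0" unfolding fint_fser(2)[OF T] by (simp add: form_integral_0 fser_def)
  then show ?thesis by (simp add: free_exp_arg len T_def)
qed

section \<open>Signed insertions\<close>

text \<open>Signed insertion at all places, both ends included. The recursion on the head makes the
  identities below plain list inductions; \<open>ins_sum\<close> is the closed form.\<close>

fun ins :: "'a \<Rightarrow> ('a list \<Rightarrow> 'b::ab_group_add) \<Rightarrow> 'a list \<Rightarrow> 'b" where
  "ins \<xi> F [] = F [\<xi>]"
| "ins \<xi> F (x # l) = F (\<xi> # x # l) - ins \<xi> (\<lambda>m. F (x # m)) l"

text \<open>The head is never displaced, because slot 0 is reserved for the first tensor
  factor.\<close>

fun ins_tail :: "'a \<Rightarrow> ('a list \<Rightarrow> 'b::ab_group_add) \<Rightarrow> 'a list \<Rightarrow> 'b" where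
  "ins_tail \<xi> F [] = 0"
| "ins_tail \<xi> F (x # l) = ins \<xi> (\<lambda>m. F (x # m)) l"

fun der_sum :: "('a \<Rightarrow> 'a) \<Rightarrow> ('a list \<Rightarrow> 'b::ab_group_add) \<Rightarrow> 'a list \<Rightarrow> 'b" where
  "der_sum D F [] = 0"
| "der_sum D F (x # l) = F (D x # l) + der_sum D (\<lambda>m. F (x # m)) l"

lemma ins_cong: "(\<And>m. length m = Suc (length l) \<Longrightarrow> F m = G m) \<Longrightarrow> ins \<xi> F l = ins \<xi> G l"
proof (induction l arbitrary: F G)
  case (Cons x l)
  have "ins \<xi> (\<lambda>m. F (x # m)) l = ins \<xi> (\<lambda>m. G (x # m)) l"
    by (rule Cons.IH) (use Cons.prems in auto)
  then show ?case using Cons.prems by simp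
qed simp

lemma ins_lin:
  "ins \<xi> (\<lambda>m. F m + G m) l = ins \<xi> F l + ins \<xi> G l"
  "ins \<xi> (\<lambda>m. F m - G m) l = ins \<xi> F l - ins \<xi> G l"
  "ins \<xi> (\<lambda>m. - F m) l = - ins \<xi> F l"
  "ins \<xi> (\<lambda>m. 0) l = 0"
  by (induction l arbitrary: F G) (simp_all add: algebra_simps)

lemma ins_tail_lin:
  "ins_tail \<xi> (\<lambda>m. F m + G m) l = ins_tail \<xi> F l + ins_tail \<xi> G l"
  "ins_tail \<xi> (\<lambda>m. F m - G m) l = ins_tail \<xi> F l - ins_tail \<xi> G l"
  "ins_tail \<xi> (\<lambda>m. - F m) l = - ins_tail \<xi> F l"
  "ins_tail \<xi> (\<lambda>m. 0) l = 0"
  by (cases l; simp add: ins_lin)+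

lemma der_sum_lin:
  "der_sum D (\<lambda>m. F m + G m) l = der_sum D F l + der_sum D G l"
  "der_sum D (\<lambda>m. F m - G m) l = der_sum D F l - der_sum D G l"
  "der_sum D (\<lambda>m. - F m) l = - der_sum D F l"
  "der_sum D (\<lambda>m. 0) l = 0"
  by (induction l arbitrary: F G) (simp_all add: algebra_simps)

lemma ins_anticommute: "ins \<xi> (ins \<eta> F) l + ins \<eta> (ins \<xi> F) l = 0"
proof (induction l arbitrary: F)
  case (Cons x l)
  show ?case using Cons[of "\<lambda>m. F (x # m)"] by (simp add: ins_lin algebra_simps)
qed simp

lemma ins_tail_anticommute: "ins_tail \<xi> (ins_tail \<eta> F) l = - ins_tail \<eta> (ins_tail \<xi> F) l"
  by (cases l) (simp_all add: ins_anticommute eq_neg_iff_add_eq_0)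

lemma ins_der: "ins \<eta> (der_sum D F) l = der_sum D (ins \<eta> F) l + ins (D \<eta>) F l"
proof (induction l arbitrary: F)
  case (Cons x l)
  show ?case using Cons[of "\<lambda>m. F (x # m)"] by (simp add: ins_lin der_sum_lin algebra_simps)
qed simp

lemma ins_tail_der: "ins_tail \<eta> (der_sum D F) l = der_sum D (ins_tail \<eta> F) l + ins_tail (D \<eta>) F l"
  by (cases l) (simp_all add: ins_lin ins_der algebra_simps)

lemma ins_snoc: "ins \<xi> F (l @ [z]) = ins \<xi> (\<lambda>m. F (m @ [z])) l -
   (if even (length l) then F (l @ [z, \<xi>]) else - F (l @ [z, \<xi>]))"
proof (induction l arbitrary: F)
  case (Cons x l)
  show ?case by (simp add: Cons algebra_simps)
qed simp

lemma ins_sum: "ins \<xi> F l = (\<Sum>q\<le>length l. if even q then F (take q l @ \<xi> # drop q l) else - F (take q l @ \<xi> # drop q l))"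
proof (induction l arbitrary: F)
  case (Cons x l)
  show ?case
    by (simp add: Cons sum.atMost_Suc_shift del: sum.atMost_Suc flip: sum_negf)
       (intro sum.cong refl, simp)
qed simp

lemma der_sum_update: "der_sum D F l = (\<Sum>i<length l. F (l[i := D (l ! i)]))"
  by (induction l arbitrary: F) (simp_all add: sum.lessThan_Suc_shift del: sum.lessThan_Suc)

text \<open>The sign \<open>(-1) ^ n\<close> in an abelian group, so that the combinatorics of
  insertions is independent of the target.\<close>

fun sgn_mult :: "nat \<Rightarrow> 'b::ab_group_add \<Rightarrow> 'b" where
  "sgn_mult 0 v = v"
| "sgn_mult (Suc n) v = - sgn_mult n v"

lemma sgn_mult_simps: "sgn_mult n (v + w) = sgn_mult n v + sgn_mult n w" "sgn_mult n (- v) = - sgn_mult n v"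
   "sgn_mult n (v - w) = sgn_mult n v - sgn_mult n w"  "sgn_mult n 0 = 0" "sgn_mult (n + k) v = sgn_mult n (sgn_mult k v)"
  by (induction n) simp_all

section \<open>Insertions and cyclic differentials\<close>

text \<open>Together with \<open>hoch_last\<close> the transpose of the Hochschild boundary: here a
  functional is composed with the products of neighbours, there with the cyclic product.
  \<open>hoch_inner_sum\<close> gives the closed form.\<close>

fun hoch_inner :: "(('n::finite, 'r::finite) gl list \<Rightarrow> 'b::ab_group_add) \<Rightarrow> ('n, 'r) gl list \<Rightarrow> 'b" where
  "hoch_inner F [] = 0"
| "hoch_inner F [x] = 0"
| "hoch_inner F (x # y # l) = F ((x \<star>\<^sub>G y) # l) - hoch_inner (\<lambda>m. F (x # m)) (y # l)"

definition hoch_last :: "(('n::finite, 'r::finite) gl list \<Rightarrow> 'b::ab_group_add) \<Rightarrow> ('n, 'r) gl list \<Rightarrow> 'b" where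
  "hoch_last F l = (if length l < 2 then 0 else sgn_mult (length l - 1) (F (cyc l)))"

lemma hoch_inner_cong: "(\<And>m. Suc (length m) = length l \<Longrightarrow> m \<noteq> [] \<Longrightarrow> F m = G m) \<Longrightarrow> hoch_inner F l = hoch_inner G l"
proof (induction l arbitrary: F G rule: induct_list012)
  case (3 x y l)
  have "hoch_inner (\<lambda>m. F (x # m)) (y # l) = hoch_inner (\<lambda>m. G (x # m)) (y # l)"
    by (rule "3.IH"(2)) (use "3.prems" in auto)
  then show ?case using "3.prems" by simp
qed auto

lemma hoch_inner_diff: "hoch_inner (\<lambda>m. F m - G m) l = hoch_inner F l - hoch_inner G l"
  by (induction l arbitrary: F G rule: induct_list012) (simp_all add: algebra_simps)

text \<open>Products of two old neighbours cancel between the two summands. What remains are the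
  products of \<open>\<xi>\<close> with a neighbour: every entry is multiplied from the right, and
  every entry but the head from the left.\<close>

lemma hoch_inner_ins:
  fixes F :: "('n::finite, 'r::finite) gl list \<Rightarrow> 'b::ab_group_add"
  shows "hoch_inner (ins_tail \<xi> F) (x # l) + ins_tail \<xi> (hoch_inner F) (x # l) =
    F ((x \<star>\<^sub>G \<xi>) # l) + der_sum (\<lambda>y. y \<star>\<^sub>G \<xi>) (\<lambda>m. F (x # m)) l - der_sum (\<lambda>y. \<xi> \<star>\<^sub>G y) (\<lambda>m. F (x # m)) l"
proof (induction l arbitrary: F x)
  case (Cons y l)
  have 1: "hoch_inner (\<lambda>m. ins_tail \<xi> F (x # m)) (y # l) =
      hoch_inner (\<lambda>m. F (x # \<xi> # m)) (y # l) - hoch_inner (ins_tail \<xi> (\<lambda>m. F (x # m))) (y # l)"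
    unfolding hoch_inner_diff[symmetric]
  proof (rule hoch_inner_cong)
    fix m :: "('n, 'r) gl list" assume "m \<noteq> []"
    then show "ins_tail \<xi> F (x # m) = F (x # \<xi> # m) - ins_tail \<xi> (\<lambda>m. F (x # m)) m"
      by (cases m) auto
  qed
  define Fx where "Fx m = F (x # m)" for m
  have "hoch_inner (\<lambda>m. F (x # \<xi> # m)) (y # l) =
      hoch_inner (\<lambda>m. ins_tail \<xi> F (x # m)) (y # l) + hoch_inner (ins_tail \<xi> Fx) (y # l)"
    by (simp only: 1 Fx_def[abs_def] diff_add_cancel)
  moreover have "hoch_inner (ins_tail \<xi> Fx) (y # l) = Fx ((y \<star>\<^sub>G \<xi>) # l) + der_sum (\<lambda>y. y \<star>\<^sub>G \<xi>) (\<lambda>m. Fx (y # m)) l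
      - der_sum (\<lambda>y. \<xi> \<star>\<^sub>G y) (\<lambda>m. Fx (y # m)) l - ins_tail \<xi> (hoch_inner Fx) (y # l)"
    using Cons.IH[of Fx y] by (simp only: eq_diff_eq)
  ultimately show ?case by (simp add: ins_lin Fx_def[abs_def])
qed simp

lemma ins_sgn_mult: "ins \<xi> (\<lambda>m. sgn_mult n (F m)) l = sgn_mult n (ins \<xi> F l)"
  by (induction n) (simp_all add: ins_lin)

lemma sgn_mult_eq: "sgn_mult n v = (if even n then v else - v)"
  by (induction n) auto

text \<open>Only \<open>\<xi>\<close> in the last place meets the head across the cycle; this
  supplies the product from the left that is missing in \<open>hoch_inner_ins\<close>.\<close>

lemma hoch_last_ins:
  fixes F :: "('n::finite, 'r::finite) gl list \<Rightarrow> 'b::ab_group_add"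
  shows "hoch_last (ins_tail \<xi> F) (x # l) + ins_tail \<xi> (hoch_last F) (x # l) = - F ((\<xi> \<star>\<^sub>G x) # l)"
proof (cases l rule: rev_cases)
  case Nil
  then show ?thesis using cyc_1[of x "[]" \<xi>] by (simp add: hoch_last_def)
next
  case (snoc k z)
  have 1: "hoch_last (ins_tail \<xi> F) (x # l) = - sgn_mult (length k) (ins \<xi> (\<lambda>m. F ((z \<star>\<^sub>G x) # m)) k)"
    by (simp add: snoc hoch_last_def cyc_1)
  have "ins \<xi> (\<lambda>m. hoch_last F (x # m @ [z])) k = ins \<xi> (\<lambda>m. sgn_mult (length k) (F ((z \<star>\<^sub>G x) # m))) k"
    by (rule ins_cong) (simp add: hoch_last_def cyc_1)
  also have "\<dots> = sgn_mult (length k) (ins \<xi> (\<lambda>m. F ((z \<star>\<^sub>G x) # m)) k)"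
    by (rule ins_sgn_mult)
  finally have 2: "ins \<xi> (\<lambda>m. hoch_last F (x # m @ [z])) k = sgn_mult (length k) (ins \<xi> (\<lambda>m. F ((z \<star>\<^sub>G x) # m)) k)" .
  have "hoch_last F (x # k @ [z, \<xi>]) = sgn_mult (length k) (F ((\<xi> \<star>\<^sub>G x) # k @ [z]))"
    using cyc_1[of x "k @ [z]" \<xi>] by (simp add: hoch_last_def)
  then show ?thesis using 1 2 by (simp add: snoc ins_snoc sgn_mult_eq)
qed

definition hoch_dual :: "(('n::finite, 'r::finite) gl list \<Rightarrow> 'b::ab_group_add) \<Rightarrow> ('n, 'r) gl list \<Rightarrow> 'b" where
  "hoch_dual F l = hoch_inner F l + hoch_last F l"

lemma hoch_dual_ins:
  "hoch_dual (ins_tail \<xi> F) (x # l) + ins_tail \<xi> (hoch_dual F) (x # l) =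
    der_sum (\<lambda>y. y \<star>\<^sub>G \<xi>) F (x # l) - der_sum (\<lambda>y. \<xi> \<star>\<^sub>G y) F (x # l)"
  unfolding hoch_dual_def ins_tail_lin using hoch_inner_ins[of \<xi> F x l] hoch_last_ins[of \<xi> F x l]
  by (simp add: algebra_simps)

definition connes_dual :: "(('n::finite, 'r::finite) gl list \<Rightarrow> 'b::ab_group_add) \<Rightarrow> ('n, 'r) gl list \<Rightarrow> 'b" where
  "connes_dual F l = (\<Sum>i<length l. sgn_mult ((length l - 1) * i) (F (mat 1 # drop i l @ take i l)))"

text \<open>Both sums run over the unit followed by a rotation of \<open>a\<close> with
  \<open>\<xi>\<close> inserted; rotating first or inserting first gives the same words, with
  opposite signs.\<close>

lemma connes_dual_ins:
  fixes F :: "('n::finite, 'r::finite) gl list \<Rightarrow> 'b::ab_group_add"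
  shows "connes_dual (ins_tail \<xi> F) (x # l) + ins_tail \<xi> (connes_dual F) (x # l) = 0"
proof -
  define a where "a = x # l"
  define n where "n = length a"
  define G where "G m = F (mat 1 # m)" for m
  define W where "W q = take q a @ \<xi> # drop q a" for q
  note sg = sgn_mult_eq
  have A: "connes_dual (ins_tail \<xi> F) a = (\<Sum>(i, q)\<in>{..<n} \<times> {..n}. sgn_mult ((n - 1) * i + q)
      (G (take q (drop i a @ take i a) @ \<xi> # drop q (drop i a @ take i a))))"
    unfolding connes_dual_def n_def[symmetric] sum.cartesian_product[symmetric]
    by (intro sum.cong refl) (auto simp: ins_sum G_def n_def sg simp flip: sum_negf intro!: sum.cong)
  have B: "ins_tail \<xi> (connes_dual F) a = (\<Sum>(q, i)\<in>{1..n} \<times> {..n}. - sgn_mult (q + n * i) (G (drop i (W q) @ take i (W q))))"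
  proof -
    have "ins_tail \<xi> (connes_dual F) a = (\<Sum>q\<le>length l. sgn_mult q (connes_dual F (W (Suc q))))"
      by (simp add: a_def W_def ins_sum sg)
    also have "\<dots> = (\<Sum>q\<in>{1..n}. - sgn_mult q (connes_dual F (W q)))"
    proof -
      have e: "{1..n} = Suc ` {..length l}" by (simp add: n_def a_def image_Suc_atMost)
      show ?thesis unfolding e by (subst sum.reindex) auto
    qed
    also have "\<dots> = (\<Sum>q\<in>{1..n}. \<Sum>i\<le>n. - sgn_mult (q + n * i) (G (drop i (W q) @ take i (W q))))"
    proof (intro sum.cong refl)
      fix q assume "q \<in> {1..n}"
      then have "length (W q) = Suc n" by (auto simp: W_def n_def)
      then show "- sgn_mult q (connes_dual F (W q)) = (\<Sum>i\<le>n. - sgn_mult (q + n * i) (G (drop i (W q) @ take i (W q))))"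
        by (auto simp: connes_dual_def G_def sg lessThan_Suc_atMost sum_negf[symmetric] simp del: sum_negf intro!: sum.cong)
    qed
    finally show ?thesis by (simp add: sum.cartesian_product)
  qed
  have "ins_tail \<xi> (connes_dual F) a = (\<Sum>(i, q)\<in>{..<n} \<times> {..n}. - sgn_mult ((n - 1) * i + q)
      (G (take q (drop i a @ take i a) @ \<xi> # drop q (drop i a @ take i a))))"
    unfolding B
  \<comment> \<open>Insertion at \<open>q\<close> followed by rotation by \<open>i\<close> becomes
    rotation by \<open>i\<close> or by \<open>i - 1\<close>, depending on whether the cut lies
    before \<open>\<xi>\<close> or after it. A cut directly before \<open>\<xi>\<close> at the very
    end is a full rotation of \<open>a\<close>, which counts as rotation by 0.\<close>
  proof (rule sum.reindex_bij_witness[where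
      j = "\<lambda>(q, i). if q = n \<and> i = n then (0, 0) else if i \<le> q then (i, q - i) else (i - 1, n + 1 + q - i)" and
      i = "\<lambda>(i, q). if i = 0 \<and> q = 0 then (n, n) else if i + q \<le> n then (i + q, i) else (i + q - n, i + 1)"])
    have n: "n > 0" by (simp add: n_def a_def)
    fix z assume z: "z \<in> {1..n} \<times> {..n}"
    obtain q i where qi: "z = (q, i)" "1 \<le> q" "q \<le> n" "i \<le> n" using z by auto
    show "(case case z of (q, i) \<Rightarrow> if q = n \<and> i = n then (0, 0) else if i \<le> q then (i, q - i) else (i - 1, n + 1 + q - i) of
        (i, q) \<Rightarrow> if i = 0 \<and> q = 0 then (n, n) else if i + q \<le> n then (i + q, i) else (i + q - n, i + 1)) = z"
      using qi by (auto split: if_splits)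
    show "(case z of (q, i) \<Rightarrow> if q = n \<and> i = n then (0, 0) else if i \<le> q then (i, q - i) else (i - 1, n + 1 + q - i)) \<in> {..<n} \<times> {..n}"
      using qi n by auto
    show "(case case z of (q, i) \<Rightarrow> if q = n \<and> i = n then (0, 0) else if i \<le> q then (i, q - i) else (i - 1, n + 1 + q - i) of
        (i, q) \<Rightarrow> - sgn_mult ((n - 1) * i + q) (G (take q (drop i a @ take i a) @ \<xi> # drop q (drop i a @ take i a)))) =
      (case z of (q, i) \<Rightarrow> - sgn_mult (q + n * i) (G (drop i (W q) @ take i (W q))))"
    proof -
      consider "q = n" "i = n" | "i \<le> q" "\<not> (q = n \<and> i = n)" | s where "i = q + 1 + s" by (metis add.commute add.left_commute le_iff_add not_less_eq_eq plus_1_eq_Suc)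
      then show ?thesis
      proof cases
        case 1
        then show ?thesis by (simp add: qi sg W_def n_def)
      next
        case 2
        then obtain t where t: "q = i + t" by (metis le_iff_add)
        have w: "drop i (W q) @ take i (W q) = take t (drop i a @ take i a) @ \<xi> # drop t (drop i a @ take i a)"
          using qi t by (simp add: W_def n_def drop_take min_def) (simp add: add.commute)
        obtain n' where "n = Suc n'" using n by (cases n) auto
        then have p: "even ((n - 1) * i + t) \<longleftrightarrow> even (q + n * i)" using t by auto
        have e: "(if q = n \<and> i = n then (0, 0) else if i \<le> q then (i, q - i) else (i - 1, n + 1 + q - i)) = (i, t)"
          using 2 t by auto
        show ?thesis unfolding qi(1) prod.case e w by (simp only: sg p)
      next
        case 3
        have sn: "q + s < n" using qi 3 by simp
        have w: "drop i (W q) @ take i (W q) = take (n - s) (drop (q + s) a @ take (q + s) a) @ \<xi> # drop (n - s) (drop (q + s) a @ take (q + s) a)"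
        proof -
          have "n - s = (n - (q + s)) + q" using sn by simp
          moreover have "take (q + s) a = take q a @ take s (drop q a)" by (rule take_add)
          ultimately show ?thesis using qi 3 sn by (simp add: W_def n_def add.commute)
        qed
        obtain n' where n': "n = q + s + Suc n'" using sn less_imp_Suc_add by (metis add_Suc_right)
        have "n - 1 = q + s + n'" "n - s = q + Suc n'" using n' by simp_all
        then have p: "even ((n - 1) * (q + s) + (n - s)) \<longleftrightarrow> even (q + n * i)" unfolding n' 3 by auto
        have e: "(if q = n \<and> i = n then (0, 0) else if i \<le> q then (i, q - i) else (i - 1, n + 1 + q - i)) = (q + s, n - s)"
          using 3 sn by auto
        show ?thesis unfolding qi(1) prod.case e w by (simp only: sg p)
      qed
    qed
  next
    have n: "n > 0" by (simp add: n_def a_def)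
    fix z assume z: "z \<in> {..<n} \<times> {..n}"
    obtain i q where iq: "z = (i, q)" "i < n" "q \<le> n" using z by auto
    show "(case case z of (i, q) \<Rightarrow> if i = 0 \<and> q = 0 then (n, n) else if i + q \<le> n then (i + q, i) else (i + q - n, i + 1) of
        (q, i) \<Rightarrow> if q = n \<and> i = n then (0, 0) else if i \<le> q then (i, q - i) else (i - 1, n + 1 + q - i)) = z"
      using iq by (auto split: if_splits)
    show "(case z of (i, q) \<Rightarrow> if i = 0 \<and> q = 0 then (n, n) else if i + q \<le> n then (i + q, i) else (i + q - n, i + 1)) \<in> {1..n} \<times> {..n}"
      using iq n by auto
  qed
  then show ?thesis using A by (simp add: a_def case_prod_unfold sum_negf)
qed

lemma hoch_dual_ins_tail:
  "ins_tail \<xi> (hoch_dual F) l = - hoch_dual (ins_tail \<xi> F) l +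
    (der_sum (\<lambda>y. y \<star>\<^sub>G \<xi>) F l - der_sum (\<lambda>y. \<xi> \<star>\<^sub>G y) F l)"
proof (cases l)
  case Nil
  then show ?thesis by (simp add: hoch_dual_def hoch_last_def)
next
  case (Cons x m)
  show ?thesis unfolding Cons hoch_dual_ins[of \<xi> F x m, symmetric] by simp
qed

lemma connes_dual_ins_tail: "ins_tail \<xi> (connes_dual F) l = - connes_dual (ins_tail \<xi> F) l"
proof (cases l)
  case Nil
  then show ?thesis by (simp add: connes_dual_def)
next
  case (Cons x m)
  show ?thesis unfolding Cons using connes_dual_ins[of \<xi> F x m] by (simp add: eq_neg_iff_add_eq_0 add.commute)
qed

section \<open>Iterated insertions and the anticommutators they produce\<close>

primrec multi_ins :: "'a list \<Rightarrow> ('a list \<Rightarrow> 'b::ab_group_add) \<Rightarrow> 'a list \<Rightarrow> 'b" where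
  "multi_ins [] F = F"
| "multi_ins (\<xi> # \<xi>s) F = multi_ins \<xi>s (ins_tail \<xi> F)"

lemma multi_ins_lin:
  "multi_ins \<xi>s (\<lambda>m. F m + G m) l = multi_ins \<xi>s F l + multi_ins \<xi>s G l"
  "multi_ins \<xi>s (\<lambda>m. F m - G m) l = multi_ins \<xi>s F l - multi_ins \<xi>s G l"
  "multi_ins \<xi>s (\<lambda>m. - F m) l = - multi_ins \<xi>s F l"
  by (induction \<xi>s arbitrary: F G) (simp_all add: ins_tail_lin[abs_def])

lemma ins_hom:
  assumes "\<And>x y. h (x - y) = h x - h y"
  shows "ins \<xi> (\<lambda>m. h (F m)) l = h (ins \<xi> F l)"
  by (induction l arbitrary: F) (simp_all add: assms)

lemma ins_tail_hom:
  assumes "\<And>x y. h (x - y) = h x - h y"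
  shows "ins_tail \<xi> (\<lambda>m. h (F m)) l = h (ins_tail \<xi> F l)"
proof -
  have "h 0 = 0" using assms[of 0 0] by simp
  then show ?thesis by (cases l) (simp_all add: ins_hom[of h, OF assms])
qed

lemma multi_ins_hom:
  assumes "\<And>x y. h (x - y) = h x - h y"
  shows "multi_ins \<xi>s (\<lambda>m. h (F m)) l = h (multi_ins \<xi>s F l)"
  by (induction \<xi>s arbitrary: F) (simp_all add: ins_tail_hom[of h, OF assms, abs_def])

text \<open>The identities for \<open>free_exp\<close> are stated for nonempty words, and an
  insertion never leads back to the empty word.\<close>

lemma multi_ins_cong:
  "(\<And>m. m \<noteq> [] \<Longrightarrow> F m = G m) \<Longrightarrow> l \<noteq> [] \<Longrightarrow> multi_ins \<xi>s F l = multi_ins \<xi>s G l"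
proof (induction \<xi>s arbitrary: F G)
  case (Cons \<xi> \<xi>s)
  have "ins_tail \<xi> F m = ins_tail \<xi> G m" if "m \<noteq> []" for m
    using that Cons.prems(1) by (cases m) (auto intro: ins_cong)
  from Cons.IH[OF this Cons.prems(2)] show ?case by simp
qed simp

lemma multi_ins_front: "multi_ins (xs @ \<eta> # ys) F = (\<lambda>l. sgn_mult (length xs) (multi_ins (\<eta> # xs @ ys) F l))"
proof (induction xs arbitrary: F)
  case (Cons x xs)
  have "ins_tail \<eta> (ins_tail x F) = (\<lambda>l. - ins_tail x (ins_tail \<eta> F) l)"
    by (rule ext) (rule ins_tail_anticommute)
  then show ?case using Cons[of "ins_tail x F"] by (simp add: multi_ins_lin sgn_mult_simps)
qed simp

text \<open>A derivation acts on the original entries and on the inserted ones alike; it is moved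
  past one insertion at a time.\<close>

lemma multi_ins_der:
  "multi_ins \<xi>s (der_sum D F) l = der_sum D (multi_ins \<xi>s F) l + der_sum D (\<lambda>xs. multi_ins xs F l) \<xi>s"
proof (induction \<xi>s arbitrary: F)
  case (Cons \<xi> \<xi>s)
  have "ins_tail \<xi> (der_sum D F) = (\<lambda>l. der_sum D (ins_tail \<xi> F) l + ins_tail (D \<xi>) F l)"
    by (rule ext) (rule ins_tail_der)
  then show ?case by (simp add: multi_ins_lin Cons)
qed simp

lemma multi_ins_connes: "multi_ins \<xi>s (connes_dual F) l = sgn_mult (length \<xi>s) (connes_dual (multi_ins \<xi>s F) l)"
  by (induction \<xi>s arbitrary: F) (simp_all add: connes_dual_ins_tail[abs_def] multi_ins_lin)

definition multilin :: "(('n::finite, 'r::finite) gl list \<Rightarrow> 'm::finite form) \<Rightarrow> bool" where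
  "multilin F \<longleftrightarrow> (\<forall>l l' x y. F (l @ (x + y) # l') = F (l @ x # l') + F (l @ y # l'))
     \<and> (\<forall>l l' c x. F (l @ gscale c x # l') = fscale c (F (l @ x # l')))"

lemma multilin_Cons: "multilin F \<Longrightarrow> multilin (\<lambda>m. F (x # m))"
  unfolding multilin_def
proof (intro conjI allI)
  fix l l' y z c
  assume F: "(\<forall>l l' x y. F (l @ (x + y) # l') = F (l @ x # l') + F (l @ y # l'))
     \<and> (\<forall>l l' c x. F (l @ gscale c x # l') = fscale c (F (l @ x # l')))"
  show "F (x # l @ (y + z) # l') = F (x # l @ y # l') + F (x # l @ z # l')"
    "F (x # l @ gscale c y # l') = fscale c (F (x # l @ y # l'))"
    using F[THEN conjunct1, rule_format, of "x # l"] F[THEN conjunct2, rule_format, of "x # l"] by simp_all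
qed

lemma multilinD:
  assumes "multilin F"
  shows "F (l @ (x + y) # l') = F (l @ x # l') + F (l @ y # l')" "F (l @ gscale c x # l') = fscale c (F (l @ x # l'))"
    "F ((x + y) # l') = F (x # l') + F (y # l')" "F (gscale c x # l') = fscale c (F (x # l'))"
proof -
  have a: "F (l @ (x + y) # l') = F (l @ x # l') + F (l @ y # l')" for l x y l'
    using assms unfolding multilin_def by blast
  have s: "F (l @ gscale c x # l') = fscale c (F (l @ x # l'))" for l c x l'
    using assms unfolding multilin_def by blast
  show "F (l @ (x + y) # l') = F (l @ x # l') + F (l @ y # l')" "F (l @ gscale c x # l') = fscale c (F (l @ x # l'))"
    by (rule a s)+
  show "F ((x + y) # l') = F (x # l') + F (y # l')" "F (gscale c x # l') = fscale c (F (x # l'))"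
    using a[of "[]" x y l'] s[of "[]" c x l'] by simp_all
qed

lemma ins_fscale: "ins \<xi> (\<lambda>m. fscale c (F m)) l = fscale c (ins \<xi> F l)"
  by (rule ins_hom) (rule fs.scale_right_diff_distrib)

lemma ins_multilin:
  assumes "multilin F"
  shows "ins \<xi> F (l @ (x + y) # l') = ins \<xi> F (l @ x # l') + ins \<xi> F (l @ y # l')"
    and "ins \<xi> F (l @ gscale c x # l') = fscale c (ins \<xi> F (l @ x # l'))"
    and "ins (\<xi> + \<xi>') F m = ins \<xi> F m + ins \<xi>' F m"
    and "ins (gscale c \<xi>) F m = fscale c (ins \<xi> F m)"
  using assms
proof (induction l arbitrary: F)
  case Nil
  have h: "F (\<xi> # gscale c x # l') = fscale c (F (\<xi> # x # l'))" "F (\<xi> # (x + y) # l') = F (\<xi> # x # l') + F (\<xi> # y # l')" if "multilin F" for F \<xi>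
    using multilinD[OF multilin_Cons[OF that]] by blast+
  { case 1 then show ?case by (simp add: multilinD(3)[of F] h(2) ins_lin) }
  { case 2 then show ?case by (simp add: multilinD(4)[of F] h(1) ins_fscale fs.scale_right_diff_distrib) }
  { case 3 then show ?case by (induction m arbitrary: F) (simp_all add: multilinD multilin_Cons) }
  { case 4 then show ?case by (induction m arbitrary: F) (simp_all add: multilinD multilin_Cons fs.scale_right_diff_distrib) }
next
  case (Cons z l)
  have h: "F (\<xi> # z # l @ gscale c x # l') = fscale c (F (\<xi> # z # l @ x # l'))"
    "F (\<xi> # z # l @ (x + y) # l') = F (\<xi> # z # l @ x # l') + F (\<xi> # z # l @ y # l')" if "multilin F" for F
    using multilinD(1,2)[OF multilin_Cons[OF multilin_Cons[OF that]]] by blast+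
  { case 1 then show ?case by (simp add: h(2) Cons.IH(1) multilin_Cons) }
  { case 2 then show ?case by (simp add: h(1) Cons.IH(2) multilin_Cons fs.scale_right_diff_distrib) }
  { case 3 then show ?case using Cons.IH(3)[OF 3] by simp }
  { case 4 then show ?case using Cons.IH(4)[OF 4] by simp }
qed

lemma ins_tail_multilin:
  assumes "multilin F"
  shows "multilin (ins_tail \<xi> F)"
    and "ins_tail (\<xi> + \<xi>') F m = ins_tail \<xi> F m + ins_tail \<xi>' F m"
    and "ins_tail (gscale c \<xi>) F m = fscale c (ins_tail \<xi> F m)"
proof -
  show "multilin (ins_tail \<xi> F)"
    unfolding multilin_def
  proof (intro conjI allI)
    fix l l' x y c
    show "ins_tail \<xi> F (l @ (x + y) # l') = ins_tail \<xi> F (l @ x # l') + ins_tail \<xi> F (l @ y # l')"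
      by (cases l) (simp_all add: multilinD(3)[OF assms] ins_lin ins_multilin[OF multilin_Cons[OF assms]])
    show "ins_tail \<xi> F (l @ gscale c x # l') = fscale c (ins_tail \<xi> F (l @ x # l'))"
      by (cases l) (simp_all add: multilinD(4)[OF assms] ins_fscale ins_multilin[OF multilin_Cons[OF assms]])
  qed
  show "ins_tail (\<xi> + \<xi>') F m = ins_tail \<xi> F m + ins_tail \<xi>' F m" "ins_tail (gscale c \<xi>) F m = fscale c (ins_tail \<xi> F m)"
    by (cases m; simp add: ins_multilin[OF multilin_Cons[OF assms]])+
qed

lemma multi_ins_multilin:
  assumes "multilin F"
  shows "multi_ins (xs @ (\<xi> + \<xi>') # ys) F m = multi_ins (xs @ \<xi> # ys) F m + multi_ins (xs @ \<xi>' # ys) F m"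
    and "multi_ins (xs @ gscale c \<xi> # ys) F m = fscale c (multi_ins (xs @ \<xi> # ys) F m)"
  using assms
proof (induction xs arbitrary: F)
  case Nil
  { case 1
    have "ins_tail (\<xi> + \<xi>') F = (\<lambda>m. ins_tail \<xi> F m + ins_tail \<xi>' F m)"
      by (rule ext) (rule ins_tail_multilin(2)[OF 1])
    then show ?case by (simp add: multi_ins_lin) }
  { case 2
    have "ins_tail (gscale c \<xi>) F = (\<lambda>m. fscale c (ins_tail \<xi> F m))"
      by (rule ext) (rule ins_tail_multilin(3)[OF 2])
    then show ?case by (simp add: multi_ins_hom[of "fscale c"] fs.scale_right_diff_distrib) }
qed (simp_all add: ins_tail_multilin(1))

text \<open>The commutator with \<open>\<xi>\<close> is \<open>hbar\<close> times the bracket. This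
  factor makes up for the inverse power of \<open>hbar\<close> attached to each Lie algebra
  argument.\<close>

lemma der_sum_multilin:
  fixes F :: "('n::finite, 'r::finite) gl list \<Rightarrow> 'm::finite form"
  assumes "multilin F"
  shows "der_sum (\<lambda>y. y \<star>\<^sub>G \<xi>) F l - der_sum (\<lambda>y. \<xi> \<star>\<^sub>G y) F l = - fscale hbar (der_sum (bracket \<xi>) F l)"
  using assms
proof (induction l arbitrary: F)
  case (Cons x l)
  have "gscale hbar (bracket \<xi> x) + x \<star>\<^sub>G \<xi> = \<xi> \<star>\<^sub>G x"
  proof -
    have "(hbar :: complex fls) \<noteq> 0" by simp
    then have "hbar * (1 / hbar) = (1 :: complex fls)"
      by (simp only: times_divide_eq_right mult_1_right) (rule divide_self)
    then have "gscale hbar (gscale (1 / hbar) z) = z" for z :: "('n, 'r) gl"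
      by (simp only: gscale_def vec_lambda_beta mult.assoc[symmetric] emb_mult[symmetric] emb_1 mult_1_left vec_lambda_eta)
    then show ?thesis by (simp only: bracket_def diff_add_cancel)
  qed
  then have "F ((\<xi> \<star>\<^sub>G x) # l) = fscale hbar (F (bracket \<xi> x # l)) + F ((x \<star>\<^sub>G \<xi>) # l)"
    using multilinD(3,4)[OF Cons.prems] by metis
  then show ?case
    using Cons.IH[OF multilin_Cons[OF Cons.prems], of x] by (simp add: fs.scale_right_distrib algebra_simps)
qed simp

text \<open>Collects the anticommutators of the successive insertions with the boundary, divided by
  \<open>hbar\<close>. \<open>hoch_defect_sum\<close> identifies them with the Chevalley-Eilenberg
  terms.\<close>

fun hoch_defect :: "('n::finite, 'r::finite) gl list \<Rightarrow> (('n, 'r) gl list \<Rightarrow> 'm::finite form) \<Rightarrow> ('n, 'r) gl list \<Rightarrow> 'm form" where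
  "hoch_defect [] F l = 0"
| "hoch_defect (\<xi> # \<xi>s) F l = - hoch_defect \<xi>s (ins_tail \<xi> F) l - der_sum (bracket \<xi>) (multi_ins \<xi>s F) l
     - der_sum (bracket \<xi>) (\<lambda>xs. multi_ins xs F l) \<xi>s"

lemma multi_ins_hoch:
  "multilin F \<Longrightarrow> multi_ins \<xi>s (hoch_dual F) l =
    sgn_mult (length \<xi>s) (hoch_dual (multi_ins \<xi>s F) l) + fscale hbar (hoch_defect \<xi>s F l)"
proof (induction \<xi>s arbitrary: F)
  case (Cons \<xi> \<xi>s)
  have "ins_tail \<xi> (hoch_dual F) = (\<lambda>l. - hoch_dual (ins_tail \<xi> F) l + - fscale hbar (der_sum (bracket \<xi>) F l))"
    by (rule ext) (simp only: hoch_dual_ins_tail der_sum_multilin[OF Cons.prems])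
  then have "multi_ins (\<xi> # \<xi>s) (hoch_dual F) l =
      - multi_ins \<xi>s (hoch_dual (ins_tail \<xi> F)) l - fscale hbar (multi_ins \<xi>s (der_sum (bracket \<xi>) F) l)"
    by (simp only: multi_ins.simps multi_ins_lin multi_ins_hom[of "fscale hbar"] fs.scale_right_diff_distrib) simp
  then show ?case
    by (simp add: Cons.IH[OF ins_tail_multilin(1)[OF Cons.prems]] multi_ins_der fs.scale_right_distrib fs.scale_right_diff_distrib)
qed simp

lemma sum_pairs_Suc:
  "(\<Sum>(i, j) | i < j \<and> j < Suc k. f i j) = (\<Sum>j<k. f 0 (Suc j)) + (\<Sum>(i, j) | i < j \<and> j < k. f (Suc i) (Suc j))"
  for f :: "nat \<Rightarrow> nat \<Rightarrow> 'b::comm_monoid_add"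
proof -
  have fin: "finite {(i, j). i < j \<and> j < (k :: nat)}"
    by (rule finite_subset[of _ "{..<k} \<times> {..<k}"]) auto
  have "{(i, j). i < j \<and> j < Suc k} = (\<lambda>j. (0, Suc j)) ` {..<k} \<union> (\<lambda>(i, j). (Suc i, Suc j)) ` {(i, j). i < j \<and> j < k}"
    (is "?A = ?B \<union> ?C")
  proof (intro equalityI subsetI)
    fix z assume "z \<in> ?A"
    then obtain i j where "z = (i, Suc j)" "i < Suc j" "j < k" by (cases z, cases "snd z") auto
    then show "z \<in> ?B \<union> ?C" by (cases i) (auto simp: image_iff)
  qed auto
  moreover have "sum (\<lambda>(i, j). f i j) (?B \<union> ?C) = sum (\<lambda>(i, j). f i j) ?B + sum (\<lambda>(i, j). f i j) ?C"
    using fin by (intro sum.union_disjoint) auto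
  ultimately show ?thesis
    by (simp add: sum.reindex inj_on_def case_prod_unfold prod_eq_iff)
qed

lemma nths_Cons_skip: "nths (x # l) (- {0}) = l" "nths (x # l) (- {Suc i}) = x # nths l (- {i})"
  "nths (x # l) (- {0, Suc j}) = nths l (- {j})" "nths (x # l) (- {Suc i, Suc j}) = x # nths l (- {i, j})"
proof -
  have "{j. Suc j \<in> - {0}} = UNIV" "{j. Suc j \<in> - {Suc i}} = - {i}" "{k. Suc k \<in> - {0, Suc j}} = - {j}"
    "{k. Suc k \<in> - {Suc i, Suc j}} = - {i, j}" by auto
  then show "nths (x # l) (- {0}) = l" "nths (x # l) (- {Suc i}) = x # nths l (- {i})"
    "nths (x # l) (- {0, Suc j}) = nths l (- {j})" "nths (x # l) (- {Suc i, Suc j}) = x # nths l (- {i, j})"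
    by (simp_all add: nths_Cons nths_all)
qed

lemma nths_skip: "i < length l \<Longrightarrow> nths l (- {i}) = take i l @ drop (Suc i) l"
  by (induction l arbitrary: i) (auto simp: nths_Cons_skip less_Suc_eq_0_disj)

lemma multi_ins_update:
  "j < length \<xi>s \<Longrightarrow> multi_ins (\<xi>s[j := \<eta>]) F l = sgn_mult j (multi_ins (\<eta> # nths \<xi>s (- {j})) F l)"
  by (simp add: upd_conv_take_nth_drop nths_skip multi_ins_front del: multi_ins.simps)

text \<open>Splitting off the first argument yields the summands with index 0. In the others all
  indices go up by one: a single index flips the sign, as the recursion does, and in the bracket
  terms the flip is offset by moving the bracket past the first argument.\<close>

lemma hoch_defect_sum:
  "hoch_defect \<xi>s F l = - (\<Sum>i<length \<xi>s. sgn_mult i (der_sum (bracket (\<xi>s ! i)) (multi_ins (nths \<xi>s (- {i})) F) l))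
    + (\<Sum>(i, j) | i < j \<and> j < length \<xi>s. sgn_mult (i + j) (multi_ins (bracket (\<xi>s ! i) (\<xi>s ! j) # nths \<xi>s (- {i, j})) F l))"
proof (induction \<xi>s arbitrary: F)
  case (Cons \<xi> \<xi>s)
  let ?F = "ins_tail \<xi> F"
  have 1: "der_sum (bracket \<xi>) (\<lambda>xs. multi_ins xs F l) \<xi>s =
      (\<Sum>j<length \<xi>s. sgn_mult j (multi_ins (bracket \<xi> (\<xi>s ! j) # nths \<xi>s (- {j})) F l))"
    unfolding der_sum_update by (intro sum.cong refl multi_ins_update) simp
  have 2: "multi_ins (x # \<xi> # r) F l = - multi_ins (x # r) ?F l" for x r
  proof -
    have "ins_tail \<xi> (ins_tail x F) = (\<lambda>l. - ins_tail x (ins_tail \<xi> F) l)"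
      by (rule ext) (rule ins_tail_anticommute)
    then show ?thesis by (simp add: multi_ins_lin)
  qed
  have 3: "multi_ins (\<xi> # r) F = multi_ins r ?F" for r by simp
  show ?case
    unfolding hoch_defect.simps Cons.IH[of ?F] 1 list.size add_Suc_right add_0_right sum_pairs_Suc sum.lessThan_Suc_shift[of _ "length \<xi>s"]
      nth_Cons_0 nth_Cons_Suc nths_Cons_skip 2 3
    by (simp add: sgn_mult_simps sum_negf case_prod_unfold del: multi_ins.simps)
qed simp

section \<open>Shuffles\<close>

definition shift_perm :: "(nat \<Rightarrow> nat) \<Rightarrow> nat \<Rightarrow> nat" where
  "shift_perm \<sigma> j = (case j of 0 \<Rightarrow> 0 | Suc i \<Rightarrow> Suc (\<sigma> i))"

text \<open>The cycle that sends 0 to \<open>p\<close> and lowers 1 to \<open>p\<close> by one,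
  written with \<open>p\<close> transpositions to exhibit its sign.\<close>

primrec cycle_to :: "nat \<Rightarrow> nat \<Rightarrow> nat" where
  "cycle_to 0 = id"
| "cycle_to (Suc p) = Transposition.transpose p (Suc p) \<circ> cycle_to p"

lemma cycle_to_apply: "cycle_to p j = (if j = 0 then p else if j \<le> p then j - 1 else j)"
  by (induction p) (auto simp: Transposition.transpose_def)

lemma cycle_to_permutes: "p \<le> N \<Longrightarrow> cycle_to p permutes {..<Suc N}"
  by (induction p) (auto intro!: permutes_compose permutes_swap_id simp: permutes_id)

lemma sign_cycle_to: "sign (cycle_to p) = (-1) ^ p"
proof (induction p)
  case (Suc p)
  have "permutation (cycle_to p)"
    using cycle_to_permutes[of p p] unfolding permutation_permutes by blast
  then have "sign (cycle_to (Suc p)) = sign (Transposition.transpose p (Suc p)) * sign (cycle_to p)"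
    unfolding cycle_to.simps by (intro sign_compose permutation_swap_id)
  then show ?case by (simp only: sign_swap_id Suc power_Suc) simp
qed (simp add: sign_id)

lemma shift_perm_simps [simp]: "shift_perm \<sigma> 0 = 0" "shift_perm \<sigma> (Suc i) = Suc (\<sigma> i)"
  by (simp_all add: shift_perm_def)

lemma shift_perm_permutes:
  assumes "\<sigma> permutes {..<N}"
  shows "shift_perm \<sigma> permutes {..<Suc N}" "sign (shift_perm \<sigma>) = sign \<sigma>"
proof -
  have comp: "shift_perm (f \<circ> g) = shift_perm f \<circ> shift_perm g" for f g
    by (rule ext) (simp add: shift_perm_def split: nat.splits)
  have tr: "shift_perm (Transposition.transpose a b) = Transposition.transpose (Suc a) (Suc b)" for a b
    by (rule ext) (auto simp: shift_perm_def Transposition.transpose_def split: nat.splits)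
  have "shift_perm \<sigma> permutes {..<Suc N} \<and> sign (shift_perm \<sigma>) = sign \<sigma>"
    using assms finite_lessThan
  proof (induction rule: permutes_induct)
    case id
    have "shift_perm id = id" by (rule ext) (simp add: shift_perm_def split: nat.splits)
    then show ?case by (simp only: permutes_id simp_thms)
  next
    case (swap a b p)
    have "permutation (shift_perm p)" "permutation p" "permutation (Transposition.transpose a b)" "permutation (Transposition.transpose (Suc a) (Suc b))"
      using swap permutation_permutes finite_lessThan by (blast, blast, blast intro: permutation_swap_id, blast intro: permutation_swap_id)
    then have "sign (Transposition.transpose (Suc a) (Suc b) \<circ> shift_perm p) = sign (Transposition.transpose (Suc a) (Suc b)) * sign (shift_perm p)"
      "sign (Transposition.transpose a b \<circ> p) = sign (Transposition.transpose a b) * sign p"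
      by (simp_all only: sign_compose)
    moreover have "Transposition.transpose (Suc a) (Suc b) \<circ> shift_perm p permutes {..<Suc N}"
      by (intro permutes_compose permutes_swap_id) (use swap in auto)
    ultimately show ?case using swap unfolding comp tr by (simp only: sign_swap_id nat.inject)
  qed
  then show "shift_perm \<sigma> permutes {..<Suc N}" "sign (shift_perm \<sigma>) = sign \<sigma>" by auto
qed

definition shuffles_from :: "nat \<Rightarrow> nat \<Rightarrow> (nat \<Rightarrow> nat) set" where
  "shuffles_from k N = {\<tau>. \<tau> permutes {..<N} \<and> strict_mono_on {k..<N} \<tau>}"

lemma cycle_to_mono: "(cycle_to p (Suc i) < cycle_to p (Suc j)) = (i < j)"
  by (auto simp: cycle_to_apply)

text \<open>A shuffle is determined by the place \<open>p\<close> of the first argument and by the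
  order of the rest, which is again a shuffle; \<open>cycle_to p\<close> makes room at
  \<open>p\<close>.\<close>

lemma shuffles_from_Suc:
  "bij_betw (\<lambda>(p, \<sigma>). cycle_to p \<circ> shift_perm \<sigma>) ({..N} \<times> shuffles_from k N) (shuffles_from (Suc k) (Suc N))"
  unfolding bij_betw_def
proof
  have inj: "inj (cycle_to p)" for p
    using permutes_inj[OF cycle_to_permutes[of p p]] by simp
  show "inj_on (\<lambda>(p, \<sigma>). cycle_to p \<circ> shift_perm \<sigma>) ({..N} \<times> shuffles_from k N)"
  proof (rule inj_onI, clarify)
    fix p \<sigma> q \<tau> assume eq: "cycle_to p \<circ> shift_perm \<sigma> = cycle_to q \<circ> shift_perm \<tau>"
    from fun_cong[OF eq, of 0] have "p = q" by (simp add: cycle_to_apply)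
    moreover have "\<sigma> i = \<tau> i" for i
      using fun_cong[OF eq, of "Suc i"] \<open>p = q\<close> by (simp add: inj_eq[OF inj])
    ultimately show "p = q \<and> \<sigma> = \<tau>" by auto
  qed
  show "(\<lambda>(p, \<sigma>). cycle_to p \<circ> shift_perm \<sigma>) ` ({..N} \<times> shuffles_from k N) = shuffles_from (Suc k) (Suc N)"
  proof (intro equalityI subsetI)
    fix \<tau> assume "\<tau> \<in> (\<lambda>(p, \<sigma>). cycle_to p \<circ> shift_perm \<sigma>) ` ({..N} \<times> shuffles_from k N)"
    then obtain p \<sigma> where \<tau>: "\<tau> = cycle_to p \<circ> shift_perm \<sigma>" "p \<le> N" "\<sigma> permutes {..<N}" "strict_mono_on {k..<N} \<sigma>"
      by (auto simp: shuffles_from_def)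
    have "\<tau> i < \<tau> j" if "i \<in> {Suc k..<Suc N}" "j \<in> {Suc k..<Suc N}" "i < j" for i j
    proof -
      obtain i' j' where "i = Suc i'" "j = Suc j'" using \<open>i \<in> _\<close> \<open>j \<in> _\<close> by (cases i; cases j) auto
      then show ?thesis using that strict_mono_onD[OF \<tau>(4), of i' j'] by (simp add: \<tau>(1) cycle_to_mono)
    qed
    then show "\<tau> \<in> shuffles_from (Suc k) (Suc N)"
      using \<tau> by (auto simp: shuffles_from_def intro!: permutes_compose shift_perm_permutes cycle_to_permutes strict_mono_onI)
  next
    fix \<tau> assume "\<tau> \<in> shuffles_from (Suc k) (Suc N)"
    then have \<tau>: "\<tau> permutes {..<Suc N}" "strict_mono_on {Suc k..<Suc N} \<tau>" by (auto simp: shuffles_from_def)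
    define p where "p = \<tau> 0"
    have p: "p \<le> N" using permutes_in_image[OF \<tau>(1), of 0] by (simp add: p_def)
    \<comment> \<open>Undoing \<open>cycle_to p\<close> leaves a permutation that fixes 0, from
      which \<open>\<sigma>\<close> is read off on the successors.\<close>
    define \<rho> where "\<rho> = inv (cycle_to p) \<circ> \<tau>"
    have cp: "cycle_to p permutes {..<Suc N}" by (rule cycle_to_permutes[OF p])
    have \<rho>: "\<rho> permutes {..<Suc N}" unfolding \<rho>_def by (intro permutes_compose permutes_inv \<tau>(1) cp)
    have \<rho>0: "\<rho> 0 = 0"
    proof -
      have "cycle_to p 0 = \<tau> 0" by (simp add: p_def cycle_to_apply)
      then show ?thesis unfolding \<rho>_def o_def using permutes_inverses(2)[OF cp, of 0] by simp
    qed
    have cr: "cycle_to p \<circ> \<rho> = \<tau>" unfolding \<rho>_def using permutes_inv_o(1)[OF cp] by (simp add: o_assoc)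
    have \<rho>S: "\<rho> (Suc i) = Suc (\<rho> (Suc i) - 1)" for i
    proof -
      have "\<rho> (Suc i) \<noteq> 0" using injD[OF permutes_inj[OF \<rho>], of "Suc i" 0] \<rho>0 by auto
      then show ?thesis by simp
    qed
    define \<sigma> where "\<sigma> i = \<rho> (Suc i) - 1" for i
    have sh: "shift_perm \<sigma> = \<rho>"
    proof
      fix j show "shift_perm \<sigma> j = \<rho> j" by (cases j) (simp_all only: shift_perm_simps \<sigma>_def \<rho>0 \<rho>S[symmetric])
    qed
    have "\<sigma> permutes {..<N}"
    proof (rule bij_imp_permutes)
      have "inj \<rho>" by (rule permutes_inj[OF \<rho>])
      then have "inj \<sigma>" by (intro injI) (metis sh shift_perm_simps(2) injD nat.inject)
      moreover have "\<sigma> ` {..<N} \<subseteq> {..<N}"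
      proof clarify
        fix i assume "i < N"
        then have "\<rho> (Suc i) \<in> {..<Suc N}" using permutes_in_image[OF \<rho>, of "Suc i"] by simp
        then show "\<sigma> i < N" using \<rho>S[of i] by (simp add: \<sigma>_def)
      qed
      moreover have "inj_on \<sigma> {..<N}" using calculation(1) by (rule inj_on_subset) simp
      ultimately show "bij_betw \<sigma> {..<N} {..<N}"
        unfolding bij_betw_def using endo_inj_surj[of "{..<N}" \<sigma>] by auto
      fix i assume "i \<notin> {..<N}"
      then show "\<sigma> i = i" using permutes_not_in[OF \<rho>, of "Suc i"] by (simp add: \<sigma>_def)
    qed
    moreover have "strict_mono_on {k..<N} \<sigma>"
    proof (rule strict_mono_onI)
      fix i j assume "i \<in> {k..<N}" "j \<in> {k..<N}" "i < j"
      then have "\<tau> (Suc i) < \<tau> (Suc j)" by (intro strict_mono_onD[OF \<tau>(2)]) auto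
      then show "\<sigma> i < \<sigma> j" unfolding cr[symmetric] sh[symmetric] o_def shift_perm_simps cycle_to_mono .
    qed
    ultimately show "\<tau> \<in> (\<lambda>(p, \<sigma>). cycle_to p \<circ> shift_perm \<sigma>) ` ({..N} \<times> shuffles_from k N)"
      using p cr sh by (intro image_eqI[of _ _ "(p, \<sigma>)"]) (auto simp: shuffles_from_def)
  qed
qed

text \<open>Links the decomposition of shuffles to the closed form \<open>ins_sum\<close> of an
  insertion.\<close>

lemma shuffle_word:
  assumes \<sigma>: "\<sigma> permutes {..<length v}" and p: "p \<le> length v"
  defines "w \<equiv> map (\<lambda>s. v ! inv \<sigma> s) [0..<length v]"
  shows "map (\<lambda>s. (x # v) ! inv (cycle_to p \<circ> shift_perm \<sigma>) s) [0..<Suc (length v)] = take p w @ x # drop p w"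
proof (rule nth_equalityI)
  let ?N = "length v"
  define \<tau> where "\<tau> = cycle_to p \<circ> shift_perm \<sigma>"
  have \<tau>: "\<tau> permutes {..<Suc ?N}"
    unfolding \<tau>_def by (intro permutes_compose shift_perm_permutes cycle_to_permutes \<sigma> p)
  have lw: "length w = ?N" by (simp add: w_def)
  show "length (map (\<lambda>s. (x # v) ! inv (cycle_to p \<circ> shift_perm \<sigma>) s) [0..<Suc (length v)]) = length (take p w @ x # drop p w)"
    using p lw by simp
  fix s assume "s < length (map (\<lambda>s. (x # v) ! inv (cycle_to p \<circ> shift_perm \<sigma>) s) [0..<Suc (length v)])"
  then have s: "s < Suc ?N" by simp
  define j where "j = inv \<tau> s"
  have ts: "\<tau> j = s" using permutes_inverses(1)[OF \<tau>] by (simp add: j_def)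
  have j: "j < Suc ?N" using s permutes_in_image[OF \<tau>, of j] ts by simp
  have "(x # v) ! j = (take p w @ x # drop p w) ! s"
  proof (cases j)
    case 0
    then have "s = p" using ts by (simp add: \<tau>_def cycle_to_apply)
    then show ?thesis using 0 p lw by (simp add: nth_append)
  next
    case (Suc i)
    have i: "i < ?N" using j Suc by simp
    have si: "\<sigma> i < ?N" using permutes_in_image[OF \<sigma>, of i] i by simp
    have "s = (if \<sigma> i < p then \<sigma> i else Suc (\<sigma> i))"
      using ts Suc by (auto simp: \<tau>_def cycle_to_apply)
    moreover have "w ! \<sigma> i = v ! i" using si by (simp add: w_def permutes_inverses(2)[OF \<sigma>])
    ultimately show ?thesis using Suc p lw si by (auto simp: nth_append Suc_diff_le)
  qed
  moreover have "map (\<lambda>s. (x # v) ! inv \<tau> s) [0..<Suc ?N] ! s = (x # v) ! j"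
    using s by (simp add: j_def del: upt_Suc)
  ultimately show "map (\<lambda>s. (x # v) ! inv (cycle_to p \<circ> shift_perm \<sigma>) s) [0..<Suc ?N] ! s = (take p w @ x # drop p w) ! s"
    by (simp only: \<tau>_def)
qed

text \<open>Insertion at every place, the front included: here slot 0 has already been split
  off.\<close>

primrec multi_ins_all :: "'a list \<Rightarrow> ('a list \<Rightarrow> 'b::ab_group_add) \<Rightarrow> 'a list \<Rightarrow> 'b" where
  "multi_ins_all [] G = G"
| "multi_ins_all (\<xi> # \<xi>s) G = multi_ins_all \<xi>s (ins \<xi> G)"

lemma multi_ins_tail: "multi_ins \<xi>s F (x # l) = multi_ins_all \<xi>s (\<lambda>m. F (x # m)) l"
  by (induction \<xi>s arbitrary: F) simp_all

lemma sum_shuffles: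
  fixes G :: "'a list \<Rightarrow> 'm::finite form"
  shows "(\<Sum>\<tau>\<in>shuffles_from (length \<xi>s) (length (\<xi>s @ l)). fscale (of_int (sign \<tau>))
      (G (map (\<lambda>s. (\<xi>s @ l) ! inv \<tau> s) [0..<length (\<xi>s @ l)]))) = multi_ins_all \<xi>s G l"
proof (induction \<xi>s arbitrary: G)
  case Nil
  \<comment> \<open>Strict monotonicity gives \<open>i \<le> \<tau> i\<close>, and a strict
    inequality anywhere would carry the last index out of range.\<close>
  have "\<tau> = id" if t: "\<tau> permutes {..<length l}" and m: "strict_mono_on {0..<length l} \<tau>" for \<tau>
  proof -
    have "i \<le> \<tau> i" if "i < length l" for i
      using that
    proof (induction i)
      case (Suc i)
      have "\<tau> i < \<tau> (Suc i)" by (rule strict_mono_onD[OF m]) (use Suc.prems in auto)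
      then show ?case using Suc by simp
    qed simp
    moreover have "inv \<tau> permutes {..<length l}" by (rule permutes_inv[OF t])
    moreover have "\<tau> i \<le> i" if "i < length l" for i
    proof (rule ccontr)
      assume "\<not> \<tau> i \<le> i"
      have "j < length l \<Longrightarrow> i \<le> j \<Longrightarrow> j < \<tau> j" for j
      proof (induction j)
        case (Suc j)
        show ?case
        proof (cases "i = Suc j")
          case False
          have "\<tau> j < \<tau> (Suc j)" by (rule strict_mono_onD[OF m]) (use Suc.prems in auto)
          then show ?thesis using Suc False by simp
        qed (use \<open>\<not> \<tau> i \<le> i\<close> in simp)
      qed (use \<open>\<not> \<tau> i \<le> i\<close> in simp)
      from this[of "length l - 1"] that permutes_in_image[OF t, of "length l - 1"] show False
        by (cases "length l") auto
    qed
    ultimately show ?thesis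
      using permutes_not_in[OF t] by (metis eq_id_iff lessThan_iff le_antisym)
  qed
  then have "shuffles_from 0 (length l) = {id}"
    by (auto simp: shuffles_from_def permutes_id strict_mono_on_def)
  then show ?case by (simp add: map_nth sign_id)
next
  case (Cons \<xi> \<xi>s)
  let ?v = "\<xi>s @ l"
  let ?N = "length ?v"
  define W where "W \<sigma> = map (\<lambda>s. ?v ! inv \<sigma> s) [0..<?N]" for \<sigma>
  have summand: "fscale (of_int (sign (cycle_to p \<circ> shift_perm \<sigma>))) (G (map (\<lambda>s. (\<xi> # ?v) ! inv (cycle_to p \<circ> shift_perm \<sigma>) s) [0..<Suc ?N]))
      = fscale (of_int (sign \<sigma>)) (if even p then G (take p (W \<sigma>) @ \<xi> # drop p (W \<sigma>)) else - G (take p (W \<sigma>) @ \<xi> # drop p (W \<sigma>)))"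
    if "p \<in> {..?N}" "\<sigma> \<in> shuffles_from (length \<xi>s) ?N" for p \<sigma>
  proof -
    have \<sigma>: "\<sigma> permutes {..<?N}" using that by (simp add: shuffles_from_def)
    have p: "p \<le> ?N" using that by simp
    have "permutation (cycle_to p)" "permutation (shift_perm \<sigma>)"
      using cycle_to_permutes[OF p] shift_perm_permutes(1)[OF \<sigma>] permutation_permutes finite_lessThan by blast+
    then have "sign (cycle_to p \<circ> shift_perm \<sigma>) = (-1) ^ p * sign \<sigma>"
      by (simp add: sign_compose sign_cycle_to shift_perm_permutes(2)[OF \<sigma>])
    then show ?thesis unfolding shuffle_word[OF \<sigma> p] by (simp add: W_def)
  qed
  have "(\<Sum>\<tau>\<in>shuffles_from (Suc (length \<xi>s)) (Suc ?N). fscale (of_int (sign \<tau>)) (G (map (\<lambda>s. (\<xi> # ?v) ! inv \<tau> s) [0..<Suc ?N])))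
    = (\<Sum>(p, \<sigma>)\<in>{..?N} \<times> shuffles_from (length \<xi>s) ?N. fscale (of_int (sign (cycle_to p \<circ> shift_perm \<sigma>)))
        (G (map (\<lambda>s. (\<xi> # ?v) ! inv (cycle_to p \<circ> shift_perm \<sigma>) s) [0..<Suc ?N])))"
    by (subst sum.reindex_bij_betw[OF shuffles_from_Suc[of ?N "length \<xi>s"], symmetric]) (simp only: case_prod_unfold)
  also have "\<dots> = (\<Sum>(p, \<sigma>)\<in>{..?N} \<times> shuffles_from (length \<xi>s) ?N. fscale (of_int (sign \<sigma>))
      (if even p then G (take p (W \<sigma>) @ \<xi> # drop p (W \<sigma>)) else - G (take p (W \<sigma>) @ \<xi> # drop p (W \<sigma>))))"
    by (rule sum.cong[OF refl]) (use summand in auto)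
  also have "\<dots> = (\<Sum>\<sigma>\<in>shuffles_from (length \<xi>s) ?N. fscale (of_int (sign \<sigma>)) (ins \<xi> G (W \<sigma>)))"
  proof -
    have "length (W \<sigma>) = ?N" for \<sigma> by (simp add: W_def)
    then show ?thesis
      unfolding sum.cartesian_product[symmetric] ins_sum fs.scale_sum_right by (subst sum.swap) simp
  qed
  also have "\<dots> = multi_ins_all (\<xi> # \<xi>s) G l"
    unfolding W_def Cons.IH by simp
  finally show ?case by simp
qed

theorem int_tensor_multi_ins:
  assumes "a \<noteq> []"
  shows "int_tensor \<xi>s a = fscale ((1 / hbar) ^ length \<xi>s) (multi_ins \<xi>s free_exp a)"
proof -
  obtain x l where a: "a = x # l" using assms by (cases a) auto
  show ?thesis
    unfolding a multi_ins_tail sum_shuffles[symmetric] by (simp add: int_tensor_def Let_def shuffles_from_def)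
qed

section \<open>The interacting expectation on chains\<close>

abbreviation clin :: "(('n::finite, 'r::finite) chain \<Rightarrow> 'm::finite form) \<Rightarrow> bool" where
  "clin \<equiv> module_hom cscale fscale"

lemma clinI: "(\<And>x y. f (x + y) = f x + f y) \<Longrightarrow> (\<And>c x. f (cscale c x) = fscale c (f x)) \<Longrightarrow> clin f"
  by (intro module_hom.intro module_hom_axioms.intro module_fscale module_cscale)

lemma chain_induct [case_names zero tens add]:
  fixes x :: "('n::finite, 'r::finite) chain"
  assumes zero: "P 0" and tens: "\<And>c l. l \<noteq> [] \<Longrightarrow> P (cscale c (tens l))" and add: "\<And>x y. P x \<Longrightarrow> P y \<Longrightarrow> P (x + y)"
  shows "P x"
proof -
  have "P (abs_chain (Poly_Mapping.single (a, m) c))" for a :: "('n, 'r) gl" and m c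
  proof -
    have "Poly_Mapping.single (a, m) c = wscale c (word (a # m))"
      by (rule poly_mapping_eqI) (simp add: word_def lookup_single when_def)
    then have "abs_chain (Poly_Mapping.single (a, m) c) = cscale c (tens (a # m))"
      by (simp add: tens.abs_eq cscale.abs_eq)
    then show ?thesis by (simp add: tens)
  qed
  then have s: "P (abs_chain (Poly_Mapping.single k c))" for k c by (cases k) auto
  have z: "abs_chain 0 = (0 :: ('n, 'r) chain)" by (simp add: zero_chain_def)
  have sum: "P (abs_chain (\<Sum>k\<in>S. Poly_Mapping.single k (f k)))" for S f
    by (induction S rule: infinite_finite_induct) (auto simp: z zero plus_chain.abs_eq[symmetric] intro!: add s)
  have "P (abs_chain w)" for w
    using sum[of "Poly_Mapping.lookup w" "Poly_Mapping.keys w"] by (simp only: pm_sum_single)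
  from this[of "rep_chain x"] show ?thesis unfolding Quotient3_abs_rep[OF Quotient3_chain] .
qed

text \<open>Reduces identities between expectations of chains to pure tensors, where the list
  calculus applies.\<close>

lemma clin_eq:
  assumes "clin f" "clin g" "\<And>l. l \<noteq> [] \<Longrightarrow> f (tens l) = g (tens l)"
  shows "f x = g x"
  by (induction x rule: chain_induct)
     (simp_all add: assms(3) module_hom.zero[OF assms(1)] module_hom.zero[OF assms(2)] module_hom.add[OF assms(1)] module_hom.add[OF assms(2)]
        module_hom.scale[OF assms(1)] module_hom.scale[OF assms(2)])

lemma clin_int: "clin (int_exp \<xi>)" by (rule clinI) (rule int_exp_lin)+
lemmas int_exp_hom = module_hom.zero[OF clin_int] module_hom.add[OF clin_int] module_hom.scale[OF clin_int] module_hom.sum[OF clin_int]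

lemma sgn_mult_fscale: "sgn_mult n (fscale c v) = fscale c (sgn_mult n v)"
  by (simp add: sgn_mult_eq)

lemma clin_comp: "clin (\<lambda>x. int_exp \<xi> (hoch_b x))" "clin (\<lambda>x. int_exp \<xi> (connes_B x))" "clin (\<lambda>x. int_exp \<xi> (chain_act \<eta> x))"
  by (rule clinI; simp add: int_exp_hom hoch_b_lin connes_B_lin chain_act_lin)+

lemma clin_flin: "flin h \<Longrightarrow> clin f \<Longrightarrow> clin (\<lambda>x. h (f x))"
  by (rule clinI) (simp_all add: module_hom.add module_hom.scale)
lemma clin_sgn: "clin f \<Longrightarrow> clin (\<lambda>x. sgn_mult n (f x))"
  by (rule clinI) (simp_all add: module_hom.add module_hom.scale sgn_mult_simps sgn_mult_fscale)
lemma clin_minus: "clin f \<Longrightarrow> clin (\<lambda>x. - f x)"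
  by (rule clinI) (simp_all add: module_hom.add module_hom.scale)
lemma clin_add: "clin f \<Longrightarrow> clin g \<Longrightarrow> clin (\<lambda>x. f x + g x)"
  by (rule clinI) (simp_all add: module_hom.add module_hom.scale fs.scale_right_distrib)
lemma clin_sum: "(\<And>s. s \<in> S \<Longrightarrow> clin (f s)) \<Longrightarrow> clin (\<lambda>x. \<Sum>s\<in>S. f s x)"
  by (induction S rule: infinite_finite_induct) (auto intro!: clin_add intro: clinI)

lemma sgn_mult_power: "fscale ((-1) ^ n) v = sgn_mult n v"
  by (simp add: sgn_mult_eq)

lemma hoch_inner_sum: "hoch_inner F l = (\<Sum>i<length l - 1. sgn_mult i (F (mrg i l)))"
proof (induction l arbitrary: F rule: induct_list012)
  case (3 x y l)
  have "mrg (Suc i) (x # m) = x # mrg i m" for i m by (simp add: mrg_def eval_nat_numeral)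
  then show ?case
    by (simp add: "3.IH"(2)[of "\<lambda>m. F (x # m)"] sum.lessThan_Suc_shift sum_negf mrg_def[of 0] numeral_2_eq_2 del: sum.lessThan_Suc)
qed simp_all

lemma mrg_cyc_ne [simp]: "mrg i l \<noteq> []" "cyc l \<noteq> []" by (simp_all add: mrg_def cyc_def)

abbreviation int_fun :: "('n::{finite,linorder}, 'r::finite) gl list \<Rightarrow> ('n, 'r) gl list \<Rightarrow> 'n form" where
  "int_fun \<xi> \<equiv> multi_ins \<xi> free_exp"

lemma int_exp_tens:
  assumes "l \<noteq> []"
  shows "int_exp \<xi> (tens l) = fscale ((1 / hbar) ^ length \<xi>) (int_fun \<xi> l)"
  unfolding int_exp_lin(3)[OF assms] int_tensor_multi_ins[OF assms] ..

lemma int_exp_hoch_b: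
  assumes l: "l \<noteq> []"
  shows "int_exp \<xi> (hoch_b (tens l)) = fscale ((1 / hbar) ^ length \<xi>) (hoch_dual (int_fun \<xi>) l)"
proof -
  define c where "c = (1 / hbar) ^ length \<xi>"
  have "hoch_b (tens l) = (if length l - 1 = 0 then 0 else cscale ((-1) ^ (length l - 1)) (tens (cyc l))
      + (\<Sum>i<length l - 1. cscale ((-1) ^ i) (tens (mrg i l))))"
    unfolding hoch_b_lin(3)[OF l] by (simp add: Let_def mrg_def cyc_def numeral_2_eq_2)
  then have "int_exp \<xi> (hoch_b (tens l)) = (if length l - 1 = 0 then 0 else sgn_mult (length l - 1) (fscale c (int_fun \<xi> (cyc l)))
      + (\<Sum>i<length l - 1. sgn_mult i (fscale c (int_fun \<xi> (mrg i l)))))"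
    by (simp only: int_exp_hom int_exp_tens mrg_cyc_ne sgn_mult_power c_def if_distrib[of "int_exp \<xi>"] simp_thms)
  also have "\<dots> = fscale c (hoch_dual (int_fun \<xi>) l)"
    unfolding hoch_dual_def hoch_last_def hoch_inner_sum sgn_mult_fscale fs.scale_sum_right[symmetric] fs.scale_right_distrib[symmetric]
    using l by (cases l) (auto simp: add.commute)
  finally show ?thesis unfolding c_def .
qed

lemma int_exp_connes_B:
  assumes l: "l \<noteq> []"
  shows "int_exp \<xi> (connes_B (tens l)) = fscale ((1 / hbar) ^ length \<xi>) (connes_dual (int_fun \<xi>) l)"
proof -
  obtain p where p: "length l = Suc p" using l by (cases l) auto
  have "connes_B (tens l) = (\<Sum>i<Suc p. cscale ((-1) ^ (p * i)) (tens (mat 1 # drop i l @ take i l)))"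
    unfolding connes_B_lin(3)[OF l] Let_def p by (simp only: diff_Suc_1 lessThan_Suc_atMost)
  then have "int_exp \<xi> (connes_B (tens l)) = (\<Sum>i<Suc p. sgn_mult (p * i) (fscale ((1 / hbar) ^ length \<xi>) (int_fun \<xi> (mat 1 # drop i l @ take i l))))"
    by (simp only: int_exp_hom int_exp_tens list.distinct simp_thms sgn_mult_power)
  then show ?thesis unfolding connes_dual_def p diff_Suc_1 sgn_mult_fscale fs.scale_sum_right[symmetric] .
qed

lemma int_exp_chain_act:
  assumes l: "l \<noteq> []"
  shows "int_exp \<xi> (chain_act \<eta> (tens l)) = fscale ((1 / hbar) ^ length \<xi>) (der_sum (bracket \<eta>) (int_fun \<xi>) l)"
proof -
  have ne: "l[i := x] \<noteq> []" for i x using l by simp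
  show ?thesis
    unfolding chain_act_lin(3)[OF l] der_sum_update fs.scale_sum_right int_exp_hom int_exp_tens[OF ne] ..
qed

lemma multilin_free_exp: "multilin free_exp"
  unfolding multilin_def by (intro conjI allI free_exp_lin)

lemma hoch_dual_free_exp:
  assumes "a \<noteq> []"
  shows "hoch_dual free_exp a = fscale hbar (BV (free_exp a))"
proof (cases "length a = 1")
  case True
  then obtain x where "a = [x]" by (cases a) auto
  then show ?thesis by (simp add: hoch_dual_def hoch_last_def free_exp_BV_0)
next
  case False
  then obtain m where m: "length a = Suc (Suc m)" using assms by (cases a; cases "tl a") auto
  then show ?thesis
    unfolding free_exp_hoch[OF m] hoch_dual_def hoch_last_def hoch_inner_sum sgn_mult_power by simp
qed

lemma connes_dual_free_exp:
  assumes "a \<noteq> []"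
  shows "connes_dual free_exp a = de_rham (free_exp a)"
proof -
  obtain p where p: "length a = Suc p" using assms by (cases a) auto
  show ?thesis unfolding free_exp_connes[OF p, symmetric] connes_dual_def p sgn_mult_power by (simp only: diff_Suc_1 lessThan_Suc_atMost)
qed

text \<open>The iterated insertion into \<open>connes_dual free_exp\<close> is evaluated twice: by
  the free identity it is the differential of the expectation, and by anticommutation it is, up to
  sign, the expectation of Connes' operator.\<close>

theorem int_exp_de_rham: "sgn_mult (length \<xi>) (int_exp \<xi> (connes_B x)) = de_rham (int_exp \<xi> x)"
proof (rule clin_eq[of "\<lambda>x. sgn_mult (length \<xi>) (int_exp \<xi> (connes_B x))"])
  show "clin (\<lambda>x. sgn_mult (length \<xi>) (int_exp \<xi> (connes_B x)))" by (rule clin_sgn[OF clin_comp(2)])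
  show "clin (\<lambda>x. de_rham (int_exp \<xi> x))" by (rule clin_flin[OF flin_de_rham clin_int])
  fix l :: "('a, 'b) gl list" assume l: "l \<noteq> []"
  have "multi_ins \<xi> (connes_dual free_exp) l = multi_ins \<xi> (\<lambda>a. de_rham (free_exp a)) l"
    by (rule multi_ins_cong[OF connes_dual_free_exp l])
  also have "\<dots> = de_rham (int_fun \<xi> l)" by (rule multi_ins_hom) (rule de_rham_lin)
  finally have "sgn_mult (length \<xi>) (connes_dual (int_fun \<xi>) l) = de_rham (int_fun \<xi> l)"
    by (simp only: multi_ins_connes)
  then show "sgn_mult (length \<xi>) (int_exp \<xi> (connes_B (tens l))) = de_rham (int_exp \<xi> (tens l))"
    by (simp only: int_exp_connes_B[OF l] int_exp_tens[OF l] sgn_mult_fscale de_rham_lin)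
qed

lemma length_nths_skip2: "i < j \<Longrightarrow> j < length l \<Longrightarrow> length (nths l (- {i, j})) = length l - 2"
proof -
  assume "i < j" "j < length l"
  moreover have "{k. k < length l \<and> k \<in> - {i, j}} = {..<length l} - {i, j}" by auto
  ultimately show ?thesis by (simp add: length_nths)
qed

text \<open>The same double evaluation for \<open>hoch_dual free_exp\<close>; here the
  anticommutators do not vanish and provide the Lie algebra terms.\<close>

theorem int_exp_BV:
  "(\<Sum>i<length \<xi>. sgn_mult i (- int_exp (nths \<xi> (- {i})) (chain_act (\<xi> ! i) x)))
   + (\<Sum>(i, j) | i < j \<and> j < length \<xi>. sgn_mult (i + j) (int_exp (bracket (\<xi> ! i) (\<xi> ! j) # nths \<xi> (- {i, j})) x))
   + sgn_mult (length \<xi>) (int_exp \<xi> (hoch_b x)) = fscale hbar (BV (int_exp \<xi> x))"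
proof (rule clin_eq[of "\<lambda>x. (\<Sum>i<length \<xi>. sgn_mult i (- int_exp (nths \<xi> (- {i})) (chain_act (\<xi> ! i) x)))
   + (\<Sum>(i, j) | i < j \<and> j < length \<xi>. sgn_mult (i + j) (int_exp (bracket (\<xi> ! i) (\<xi> ! j) # nths \<xi> (- {i, j})) x))
   + sgn_mult (length \<xi>) (int_exp \<xi> (hoch_b x))"])
  show "clin (\<lambda>x. (\<Sum>i<length \<xi>. sgn_mult i (- int_exp (nths \<xi> (- {i})) (chain_act (\<xi> ! i) x)))
   + (\<Sum>(i, j) | i < j \<and> j < length \<xi>. sgn_mult (i + j) (int_exp (bracket (\<xi> ! i) (\<xi> ! j) # nths \<xi> (- {i, j})) x))
   + sgn_mult (length \<xi>) (int_exp \<xi> (hoch_b x)))"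
    unfolding case_prod_unfold by (intro clin_sgn clin_comp clin_int clin_add clin_sum clin_minus)
  show "clin (\<lambda>x. fscale hbar (BV (int_exp \<xi> x)))"
    by (rule clinI) (simp_all add: int_exp_hom module_hom.add[OF flin_BV] module_hom.scale[OF flin_BV] fs.scale_right_distrib mult.commute)
  fix l :: "('a, 'b) gl list" assume l: "l \<noteq> []"
  define k where "k = length \<xi>"
  define c where "c = (1 / hbar) ^ k"
  \<comment> \<open>The Lie algebra terms have one argument less, hence one inverse power of
    \<open>hbar\<close> less, than the boundary term; the factor \<open>hbar\<close> in front of
    \<open>hoch_defect\<close> fills the gap.\<close>
  have c1: "(1 / hbar) ^ (k - 1) = c * hbar" if "k > 0"
  proof -
    have "(1 / hbar) * hbar = (1 :: complex fls)" by (simp only: times_divide_eq_left mult_1_left) (rule divide_self, simp)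
    moreover have "c = (1 / hbar) ^ (k - 1) * (1 / hbar)"
      using that power_Suc2[of "1 / hbar" "k - 1"] by (simp only: c_def Suc_diff_1)
    ultimately show ?thesis by (simp only: mult.assoc mult_1_right)
  qed
  have 1: "int_exp (nths \<xi> (- {i})) (chain_act (\<xi> ! i) (tens l)) = fscale c (fscale hbar (der_sum (bracket (\<xi> ! i)) (int_fun (nths \<xi> (- {i}))) l))"
    if "i < k" for i
  proof -
    have "length (nths \<xi> (- {i})) = k - 1" using that by (simp add: nths_skip k_def)
    moreover have "k > 0" using that by simp
    ultimately show ?thesis by (simp only: int_exp_chain_act[OF l] c1 fs.scale_scale)
  qed
  have 2: "int_exp (bracket (\<xi> ! i) (\<xi> ! j) # nths \<xi> (- {i, j})) (tens l) =
      fscale c (fscale hbar (int_fun (bracket (\<xi> ! i) (\<xi> ! j) # nths \<xi> (- {i, j})) l))" if "i < j" "j < k" for i j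
  proof -
    have "length (bracket (\<xi> ! i) (\<xi> ! j) # nths \<xi> (- {i, j})) = k - 1" using that by (simp add: length_nths_skip2 k_def)
    moreover have "k > 0" using that by simp
    ultimately show ?thesis by (simp only: int_exp_tens[OF l] c1 fs.scale_scale)
  qed
  have "multi_ins \<xi> (hoch_dual free_exp) l = multi_ins \<xi> (\<lambda>a. fscale hbar (BV (free_exp a))) l"
    by (rule multi_ins_cong[OF hoch_dual_free_exp l])
  also have "\<dots> = fscale hbar (BV (int_fun \<xi> l))"
    by (rule multi_ins_hom[of "\<lambda>w. fscale hbar (BV w)"]) (simp add: module_hom.diff[OF flin_BV] fs.scale_right_diff_distrib)
  finally have main: "fscale hbar (hoch_defect \<xi> free_exp l) + sgn_mult k (hoch_dual (int_fun \<xi>) l) = fscale hbar (BV (int_fun \<xi> l))"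
    by (simp only: multi_ins_hoch[OF multilin_free_exp] k_def add.commute)
  have "(\<Sum>i<k. sgn_mult i (- int_exp (nths \<xi> (- {i})) (chain_act (\<xi> ! i) (tens l))))
   + (\<Sum>(i, j) | i < j \<and> j < k. sgn_mult (i + j) (int_exp (bracket (\<xi> ! i) (\<xi> ! j) # nths \<xi> (- {i, j})) (tens l)))
   = fscale c (fscale hbar (hoch_defect \<xi> free_exp l))"
  proof -
    have "(\<Sum>i<k. sgn_mult i (- int_exp (nths \<xi> (- {i})) (chain_act (\<xi> ! i) (tens l)))) =
      fscale c (fscale hbar (- (\<Sum>i<k. sgn_mult i (der_sum (bracket (\<xi> ! i)) (int_fun (nths \<xi> (- {i}))) l))))"
      unfolding sum_negf[symmetric] fs.scale_sum_right
      by (intro sum.cong refl) (simp only: lessThan_iff 1 sgn_mult_simps sgn_mult_fscale fs.scale_minus_right)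
    moreover have "(\<Sum>(i, j) | i < j \<and> j < k. sgn_mult (i + j) (int_exp (bracket (\<xi> ! i) (\<xi> ! j) # nths \<xi> (- {i, j})) (tens l))) =
      fscale c (fscale hbar (\<Sum>(i, j) | i < j \<and> j < k. sgn_mult (i + j) (int_fun (bracket (\<xi> ! i) (\<xi> ! j) # nths \<xi> (- {i, j})) l)))"
      unfolding fs.scale_sum_right
      by (intro sum.cong refl) (clarsimp simp only: 2 sgn_mult_fscale mem_Collect_eq prod.case)
    ultimately show ?thesis unfolding hoch_defect_sum k_def by (simp only: fs.scale_right_distrib)
  qed
  moreover have "sgn_mult k (int_exp \<xi> (hoch_b (tens l))) = fscale c (sgn_mult k (hoch_dual (int_fun \<xi>) l))"
    by (simp only: int_exp_hoch_b[OF l] sgn_mult_fscale c_def k_def)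
  moreover have "fscale hbar (BV (int_exp \<xi> (tens l))) = fscale c (fscale hbar (BV (int_fun \<xi> l)))"
    by (simp only: int_exp_tens[OF l] c_def k_def module_hom.scale[OF flin_BV] fs.scale_scale mult.commute)
  ultimately show "(\<Sum>i<length \<xi>. sgn_mult i (- int_exp (nths \<xi> (- {i})) (chain_act (\<xi> ! i) (tens l))))
   + (\<Sum>(i, j) | i < j \<and> j < length \<xi>. sgn_mult (i + j) (int_exp (bracket (\<xi> ! i) (\<xi> ! j) # nths \<xi> (- {i, j})) (tens l)))
   + sgn_mult (length \<xi>) (int_exp \<xi> (hoch_b (tens l))) = fscale hbar (BV (int_exp \<xi> (tens l)))"
    unfolding k_def[symmetric] by (simp only: main[symmetric] fs.scale_right_distrib)
qed

section \<open>Vanishing on \<open>lie_h\<close>, alternation and the degree bound\<close>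

lemma base_zero_ins:
  fixes F :: "'a list \<Rightarrow> 'm::{finite,linorder} form"
  assumes "\<And>m. base_zero (F m)"
  shows "base_zero (ins \<xi> F l)" "base_zero (ins_tail \<xi> F l)"
proof -
  have z: "base_zero (0 :: 'm form)" by (simp add: base_zero_def zero_mps.rep_eq)
  have d: "base_zero (v - w)" if "base_zero v" "base_zero w" for v w :: "'m form"
    using base_zero_sum[of "{True, False}" "\<lambda>b. if b then v else fscale (-1) w"] that base_zero_scale[of w "-1"] by simp
  have i: "base_zero (ins \<xi> F l)" if "\<And>m. base_zero (F m)" for F :: "'a list \<Rightarrow> 'm form" and l
    using that
  proof (induction l arbitrary: F)
    case (Cons x l)
    show ?case unfolding ins.simps by (intro d Cons.IH Cons.prems)
  qed simp
  show "base_zero (ins \<xi> F l)" by (rule i) (rule assms)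
  show "base_zero (ins_tail \<xi> F l)" by (cases l) (auto intro: i assms z)
qed

text \<open>Insertions anticommute, so the argument from \<open>lie_h\<close> may be taken as the
  one inserted directly into \<open>free_exp\<close>; the remaining insertions only form signed
  sums.\<close>

lemma base_zero_int_fun:
  assumes \<eta>: "\<eta> \<in> set \<xi>" "\<eta> \<in> lie_h"
  shows "base_zero (int_fun \<xi> l)"
proof -
  have t: "base_zero (ins_tail \<eta> free_exp a)" for a
  proof (cases a)
    case Nil
    then show ?thesis by (simp add: base_zero_def zero_mps.rep_eq)
  next
    case (Cons x m)
    have "ins_tail \<eta> free_exp a = (\<Sum>r<Suc (length m). fscale ((-1) ^ r) (free_exp (take (Suc r) a @ \<eta> # drop (Suc r) a)))"
      unfolding Cons ins_tail.simps ins_sum lessThan_Suc_atMost sgn_mult_power sgn_mult_eq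
        take_Suc_Cons drop_Suc_Cons append_Cons ..
    with base_zero_insert[OF \<eta>(2), of a "length m"] show ?thesis by (simp add: Cons del: sum.lessThan_Suc)
  qed
  have m: "(\<And>a. base_zero (F a)) \<Longrightarrow> base_zero (multi_ins ys F l)" for F :: "('a, 'b) gl list \<Rightarrow> 'a form" and ys
  proof (induction ys arbitrary: F)
    case (Cons y ys)
    show ?case unfolding multi_ins.simps by (rule Cons.IH[OF base_zero_ins(2)[OF Cons.prems]])
  qed simp
  obtain xs ys where x: "\<xi> = xs @ \<eta> # ys" using split_list[OF \<eta>(1)] by blast
  have "base_zero (int_fun (\<eta> # xs @ ys) l)" using m[OF t] by simp
  then show ?thesis unfolding x multi_ins_front
    using base_zero_scale[of "int_fun (\<eta> # xs @ ys) l" "(-1) ^ length xs"] by (simp only: sgn_mult_power)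
qed

lemma base_zero_int_exp:
  assumes \<eta>: "\<eta> \<in> set \<xi>" "\<eta> \<in> lie_h"
  shows "base_zero (int_exp \<xi> x)"
proof (induction x rule: chain_induct)
  case zero
  then show ?case by (simp add: int_exp_hom base_zero_def zero_mps.rep_eq)
next
  case (tens c l)
  then show ?case
    unfolding int_exp_hom int_exp_tens[OF tens] by (intro base_zero_scale base_zero_int_fun[OF \<eta>])
next
  case (add x y)
  then show ?case using base_zero_sum[of "{True, False}" "\<lambda>b. if b then int_exp \<xi> x else int_exp \<xi> y"] by (simp add: int_exp_hom)
qed

lemma int_exp_multilin:
  "int_exp (xs @ (\<xi> + \<xi>') # ys) z = int_exp (xs @ \<xi> # ys) z + int_exp (xs @ \<xi>' # ys) z"
  "int_exp (xs @ gscale c \<xi> # ys) z = fscale c (int_exp (xs @ \<xi> # ys) z)"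
proof -
  show "int_exp (xs @ (\<xi> + \<xi>') # ys) z = int_exp (xs @ \<xi> # ys) z + int_exp (xs @ \<xi>' # ys) z"
    by (rule clin_eq[of _ "\<lambda>z. int_exp (xs @ \<xi> # ys) z + int_exp (xs @ \<xi>' # ys) z"])
       (simp_all add: clin_int clin_add int_exp_tens multi_ins_multilin[OF multilin_free_exp] fs.scale_right_distrib)
  have "clin (\<lambda>z. fscale c (int_exp (xs @ \<xi> # ys) z))"
    by (rule clinI) (simp_all add: int_exp_hom fs.scale_right_distrib mult.commute)
  then show "int_exp (xs @ gscale c \<xi> # ys) z = fscale c (int_exp (xs @ \<xi> # ys) z)"
    by (rule clin_eq[of _ "\<lambda>z. fscale c (int_exp (xs @ \<xi> # ys) z)", OF clin_int])
       (simp add: int_exp_tens multi_ins_multilin[OF multilin_free_exp] mult.commute)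
qed

lemma int_exp_update: "j < length \<xi> \<Longrightarrow> int_exp (\<xi>[j := \<eta>]) z = sgn_mult j (int_exp (\<eta> # nths \<xi> (- {j})) z)"
proof (rule clin_eq[of _ "\<lambda>z. sgn_mult j (int_exp (\<eta> # nths \<xi> (- {j})) z)"])
  fix l :: "('a, 'b) gl list" assume j: "j < length \<xi>" and l: "l \<noteq> []"
  have "length (\<xi>[j := \<eta>]) = length \<xi>" "length (\<eta> # nths \<xi> (- {j})) = length \<xi>"
    using j by (simp_all add: nths_skip)
  then show "int_exp (\<xi>[j := \<eta>]) (tens l) = sgn_mult j (int_exp (\<eta> # nths \<xi> (- {j})) (tens l))"
    unfolding int_exp_tens[OF l] multi_ins_update[OF j] by (simp only: sgn_mult_fscale)
qed (intro clin_int clin_sgn)+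

text \<open>Anticommutativity alone would show only that twice the value is zero, which is not
  enough in an arbitrary abelian group.\<close>

lemma ins_self: "ins \<xi> (ins \<xi> F) l = 0"
proof (induction l arbitrary: F)
  case (Cons x l)
  show ?case using Cons[of "\<lambda>m. F (x # m)"] by (simp add: ins_lin)
qed simp

text \<open>Both copies are moved to the front, where inserting the same element twice gives
  zero.\<close>

lemma int_exp_alternating:
  assumes "i < j" "j < length \<xi>" "\<xi> ! i = \<xi> ! j"
  shows "int_exp \<xi> z = 0"
proof -
  define a where "a = \<xi> ! i"
  define r where "r = drop (Suc i) \<xi>"
  have 1: "\<xi> = take i \<xi> @ a # r" unfolding a_def r_def by (rule id_take_nth_drop) (use assms in simp)
  have j: "j - Suc i < length r" "r ! (j - Suc i) = a" using assms by (auto simp: r_def a_def)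
  define u v where "u = take (j - Suc i) r" and "v = drop (Suc (j - Suc i)) r"
  have 2: "r = u @ a # v" unfolding u_def v_def j(2)[symmetric] by (rule id_take_nth_drop[OF j(1)])
  have z: "ins_tail a (ins_tail a F) = (\<lambda>l. 0)" for F :: "('a, 'b) gl list \<Rightarrow> 'a form"
  proof
    show "ins_tail a (ins_tail a F) l = 0" for l by (cases l) (simp_all add: ins_self)
  qed
  have "multi_ins \<xi>s (\<lambda>l. 0 :: 'a form) l = 0" for \<xi>s and l :: "('a, 'b) gl list"
    by (induction \<xi>s) (simp_all add: ins_tail_lin[abs_def])
  then have "int_fun (a # a # w) l = 0" for w l by (simp add: z)
  moreover have "int_fun \<xi> l = sgn_mult (length (take i \<xi>)) (sgn_mult (length (a # take i \<xi> @ u)) (int_fun (a # (a # take i \<xi> @ u) @ v) l))" for l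
  proof -
    have "int_fun \<xi> l = sgn_mult (length (take i \<xi>)) (int_fun (a # take i \<xi> @ r) l)"
      by (subst 1) (simp only: multi_ins_front)
    also have "a # take i \<xi> @ r = (a # take i \<xi> @ u) @ a # v" by (simp add: 2)
    finally show ?thesis by (simp only: multi_ins_front)
  qed
  ultimately have "int_fun \<xi> l = 0" for l by (simp add: sgn_mult_simps)
  then show ?thesis
    using clin_eq[of "int_exp \<xi>" "\<lambda>z. 0" z] by (simp add: clin_int int_exp_tens clinI)
qed

lemma multi_ins_0:
  "(\<And>m. length m = length l + length \<xi> \<Longrightarrow> F m = 0) \<Longrightarrow> multi_ins \<xi> F l = 0"
proof (induction \<xi> arbitrary: F)
  case (Cons \<eta> \<xi>)
  have "ins_tail \<eta> F m = 0" if "length m = length l + length \<xi>" for m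
  proof (cases m)
    case m: (Cons x k)
    have "ins \<eta> (\<lambda>a. F (x # a)) k = ins \<eta> (\<lambda>a. 0) k"
      by (rule ins_cong) (use Cons.prems that m in auto)
    then show ?thesis by (simp add: m ins_lin)
  qed simp
  from Cons.IH[OF this] show ?case by simp
qed simp

lemma int_exp_degree:
  fixes \<xi> :: "('n::{finite,linorder}, 'r::finite) gl list"
  assumes "2 * CARD('n) < length \<xi>"
  shows "int_exp \<xi> z = 0"
proof -
  have "int_fun \<xi> l = 0" if "l \<noteq> []" for l
  proof (rule multi_ins_0)
    fix m :: "('n, 'r) gl list" assume m: "length m = length l + length \<xi>"
    then have "length m = Suc (length m - 1)" using that by (cases l) auto
    then show "free_exp m = 0" by (rule free_exp_degree) (use m that assms in \<open>cases l, auto\<close>)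
  qed
  then show ?thesis
    using clin_eq[of "int_exp \<xi>" "\<lambda>z. 0" z] by (simp add: clin_int int_exp_tens clinI)
qed

section \<open>The universal trace\<close>

lemma berezin_single_sum: "berezin_single j (sum f S) = (\<Sum>s\<in>S. berezin_single j (f s))"
  by (induction S rule: infinite_finite_induct) (simp_all add: berezin_single_add)

lemma berezin_single_uminus: "berezin_single j (- w) = - berezin_single j w"
  using berezin_single_add[of j w "- w"] by (simp add: eq_neg_iff_add_eq_0 add.commute)

lemma berezin_single_sgn: "berezin_single j (sgn_mult k w) = (-1) ^ k * berezin_single j w"
  by (induction k) (simp_all add: berezin_single_uminus)

text \<open>A common finite index set makes sums of chains and images under chain maps comparable,
  whose supports may shrink.\<close>

lemma universal_trace_superset:
  assumes "finite S" "Poly_Mapping.keys z \<subseteq> S"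
  shows "universal_trace \<xi> z = (\<Sum>j\<in>S. berezin_single j (int_exp \<xi> (Poly_Mapping.lookup z j)))"
proof -
  have lk: "Poly_Mapping.lookup (Poly_Mapping.map (int_exp \<xi>) z) j = int_exp \<xi> (Poly_Mapping.lookup z j)" for j
    by (simp add: Poly_Mapping.map.rep_eq when_def int_exp_hom)
  have "Poly_Mapping.keys (Poly_Mapping.map (int_exp \<xi>) z) \<subseteq> Poly_Mapping.keys z"
    using lk by (auto simp: in_keys_iff int_exp_hom)
  with assms(2) have k: "Poly_Mapping.keys (Poly_Mapping.map (int_exp \<xi>) z) \<subseteq> S" by (rule subset_trans[rotated])
  have "universal_trace \<xi> z = (\<Sum>j\<in>Poly_Mapping.keys (Poly_Mapping.map (int_exp \<xi>) z).
      berezin_single j (Poly_Mapping.lookup (Poly_Mapping.map (int_exp \<xi>) z) j))"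
    by (simp only: universal_trace_def berezin_def berezin_single_def)
  also have "\<dots> = (\<Sum>j\<in>S. berezin_single j (Poly_Mapping.lookup (Poly_Mapping.map (int_exp \<xi>) z) j))"
    by (rule sum.mono_neutral_left[OF assms(1) k]) (simp add: not_in_keys_iff_lookup_eq_zero)
  finally show ?thesis unfolding lk .
qed

lemmas universal_trace_sum = universal_trace_superset[OF finite_keys subset_refl]

lemma universal_trace_add: "universal_trace \<xi> (x + y) = universal_trace \<xi> x + universal_trace \<xi> y"
proof -
  let ?S = "Poly_Mapping.keys x \<union> Poly_Mapping.keys y"
  have S: "finite ?S" by simp
  have k: "Poly_Mapping.keys (x + y) \<subseteq> ?S" "Poly_Mapping.keys x \<subseteq> ?S" "Poly_Mapping.keys y \<subseteq> ?S"
    by (auto simp: keys_add)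
  show ?thesis
    unfolding universal_trace_superset[OF S k(1)] universal_trace_superset[OF S k(2)] universal_trace_superset[OF S k(3)]
      lookup_add int_exp_hom berezin_single_add sum.distrib ..
qed

lemma universal_trace_single: "universal_trace \<xi> (Poly_Mapping.single j x) = berezin_single j (int_exp \<xi> x)"
proof -
  have "universal_trace \<xi> (Poly_Mapping.single j x) = (\<Sum>i\<in>{j}. berezin_single i (int_exp \<xi> (Poly_Mapping.lookup (Poly_Mapping.single j x) i)))"
    by (rule universal_trace_superset) auto
  then show ?thesis by simp
qed

lemma universal_trace_0: "universal_trace \<xi> 0 = 0"
  using universal_trace_add[of \<xi> 0 0] by simp

lemma universal_trace_of_sum: "universal_trace \<xi> (sum f S) = (\<Sum>s\<in>S. universal_trace \<xi> (f s))"
  by (induction S rule: infinite_finite_induct) (simp_all add: universal_trace_0 universal_trace_add)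

lemma universal_trace_kscale: "universal_trace \<xi> (kscale \<kappa> x) = \<kappa> * universal_trace \<xi> x"
proof -
  have "universal_trace \<xi> (kscale \<kappa> x) = (\<Sum>i\<in>Poly_Mapping.keys \<kappa>. \<Sum>j\<in>Poly_Mapping.keys x.
      Poly_Mapping.single i (Poly_Mapping.lookup \<kappa> i) * berezin_single j (int_exp \<xi> (Poly_Mapping.lookup x j)))"
    unfolding kscale_def universal_trace_of_sum universal_trace_single int_exp_hom berezin_single_scale ..
  also have "\<dots> = (\<Sum>i\<in>Poly_Mapping.keys \<kappa>. Poly_Mapping.single i (Poly_Mapping.lookup \<kappa> i)) * universal_trace \<xi> x"
    unfolding universal_trace_sum sum_product ..
  finally show ?thesis unfolding pm_sum_single .
qed

lemma universal_trace_map: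
  assumes "f 0 = 0"
  shows "universal_trace \<xi> (Poly_Mapping.map f z) = (\<Sum>j\<in>Poly_Mapping.keys z. berezin_single j (int_exp \<xi> (f (Poly_Mapping.lookup z j))))"
proof -
  have lk: "Poly_Mapping.lookup (Poly_Mapping.map f z) j = f (Poly_Mapping.lookup z j)" for j
    by (simp add: Poly_Mapping.map.rep_eq when_def assms)
  have "Poly_Mapping.keys (Poly_Mapping.map f z) \<subseteq> Poly_Mapping.keys z"
    using lk assms by (auto simp: in_keys_iff)
  from universal_trace_superset[OF finite_keys this] show ?thesis unfolding lk .
qed

lemma chain_maps_0: "hoch_b 0 = 0" "connes_B 0 = 0" "chain_act \<eta> 0 = 0"
  using hoch_b_lin(1)[of 0 0] connes_B_lin(1)[of 0 0] chain_act_lin(1)[of \<eta> 0 0] by simp_all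

text \<open>At each power of u, the Lie algebra terms and the Hochschild term give
  \<open>hbar\<close> times \<open>BV\<close>, and Connes' term gives \<open>de_rham\<close> one
  power of u higher; this is the combination in \<open>berezin_closed\<close>.\<close>

theorem universal_trace_closed: "lie_diff universal_trace \<xi> z + cyc_diff universal_trace \<xi> z = 0"
proof -
  define k where "k = length \<xi>"
  define K where "K = Poly_Mapping.keys z"
  define x where "x j = Poly_Mapping.lookup z j" for j
  have act: "(-1) ^ i * hom_act \<eta> (universal_trace \<zeta>) z = (\<Sum>j\<in>K. berezin_single j (sgn_mult i (- int_exp \<zeta> (chain_act \<eta> (x j)))))" for i \<eta> \<zeta>
    unfolding hom_act_def cc_act_def universal_trace_map[of "chain_act \<eta>", OF chain_maps_0(3)] K_def x_def berezin_single_sgn berezin_single_uminus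
    by (simp add: sum_distrib_left sum_negf)
  have br: "(-1) ^ i * universal_trace \<zeta> z = (\<Sum>j\<in>K. berezin_single j (sgn_mult i (int_exp \<zeta> (x j))))" for i \<zeta>
    unfolding universal_trace_sum K_def x_def berezin_single_sgn by (simp add: sum_distrib_left)
  have cyc: "cyc_diff universal_trace \<xi> z = (\<Sum>j\<in>K. berezin_single j (sgn_mult k (int_exp \<xi> (hoch_b (x j)))))
      + (\<Sum>j\<in>K. berezin_single (j + 1) (de_rham (int_exp \<xi> (x j))))"
  proof -
    have "Poly_Mapping.single 1 1 * berezin_single j w = berezin_single (j + 1) w" for j and w :: "'a form"
      using berezin_single_scale[of 1 j 1 w] by (simp add: add.commute)
    then have "(-1) ^ k * (Poly_Mapping.single 1 1 * berezin_single j (int_exp \<xi> (connes_B (x j)))) =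
        berezin_single (j + 1) (de_rham (int_exp \<xi> (x j)))" for j
      by (simp only: berezin_single_sgn[symmetric] int_exp_de_rham k_def)
    then show ?thesis
      unfolding cyc_diff_def cc_diff_def universal_trace_add universal_trace_kscale
        universal_trace_map[of hoch_b, OF chain_maps_0(1)] universal_trace_map[of connes_B, OF chain_maps_0(2)]
        distrib_left sum_distrib_left berezin_single_sgn k_def[symmetric] K_def[symmetric] x_def[symmetric] by simp
  qed
  have lie: "lie_diff universal_trace \<xi> z = (\<Sum>j\<in>K. berezin_single j (
      (\<Sum>i<k. sgn_mult i (- int_exp (nths \<xi> (- {i})) (chain_act (\<xi> ! i) (x j))))
    + (\<Sum>(i, i') | i < i' \<and> i' < k. sgn_mult (i + i') (int_exp (bracket (\<xi> ! i) (\<xi> ! i') # nths \<xi> (- {i, i'})) (x j)))))"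
    unfolding lie_diff_def act br berezin_single_add berezin_single_sum k_def[symmetric] case_prod_unfold sum.distrib
    by (intro arg_cong2[where f = "(+)"] sum.swap)
  have "lie_diff universal_trace \<xi> z + cyc_diff universal_trace \<xi> z =
      (\<Sum>j\<in>K. berezin_single j (fscale hbar (BV (int_exp \<xi> (x j)))) + berezin_single (j + 1) (de_rham (int_exp \<xi> (x j))))"
    unfolding lie cyc add.assoc[symmetric] sum.distrib[symmetric] berezin_single_add[symmetric] k_def int_exp_BV ..
  then show ?thesis by (simp add: berezin_closed)
qed

lemma universal_trace_lie_h:
  assumes "\<eta> \<in> set \<xi>" "\<eta> \<in> lie_h"
  shows "universal_trace \<xi> z = 0"
  unfolding universal_trace_sum by (simp add: berezin_single_base_zero[OF base_zero_int_exp[OF assms]])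

lemma universal_trace_update: "j < length \<xi> \<Longrightarrow> universal_trace (\<xi>[j := \<eta>]) z = (-1) ^ j * universal_trace (\<eta> # nths \<xi> (- {j})) z"
  unfolding universal_trace_sum by (simp add: int_exp_update berezin_single_sgn sum_distrib_left)

text \<open>Equivariance under \<open>\<eta> \<in> lie_h\<close> is Cartan's formula: evaluate the closedness at \<open>\<eta> # \<xi>\<close> and drop the
  terms in which \<open>\<eta>\<close> is still an argument.\<close>

lemma universal_trace_equivariant:
  assumes \<eta>: "\<eta> \<in> lie_h"
  shows "hom_act \<eta> (universal_trace \<xi>) z = (\<Sum>i<length \<xi>. universal_trace (\<xi>[i := bracket \<eta> (\<xi> ! i)]) z)"
proof -
  have v: "universal_trace \<zeta> y = 0" if "\<eta> \<in> set \<zeta>" for \<zeta> y by (rule universal_trace_lie_h[OF that \<eta>])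
  have "lie_diff universal_trace (\<eta> # \<xi>) z = 0"
    using universal_trace_closed[of "\<eta> # \<xi>" z] by (simp add: cyc_diff_def v)
  moreover have "lie_diff universal_trace (\<eta> # \<xi>) z =
      hom_act \<eta> (universal_trace \<xi>) z - (\<Sum>j<length \<xi>. universal_trace (\<xi>[j := bracket \<eta> (\<xi> ! j)]) z)"
  proof -
    have "(\<Sum>i<length (\<eta> # \<xi>). (-1) ^ i * hom_act ((\<eta> # \<xi>) ! i) (universal_trace (nths (\<eta> # \<xi>) (- {i}))) z) = hom_act \<eta> (universal_trace \<xi>) z"
      unfolding list.size add_Suc_right add_0_right sum.lessThan_Suc_shift nths_Cons_skip by (simp add: hom_act_def v)
    moreover have "(\<Sum>(i, j) | i < j \<and> j < length (\<eta> # \<xi>). (-1) ^ (i + j) * universal_trace (bracket ((\<eta> # \<xi>) ! i) ((\<eta> # \<xi>) ! j) # nths (\<eta> # \<xi>) (- {i, j})) z)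
        = - (\<Sum>j<length \<xi>. universal_trace (\<xi>[j := bracket \<eta> (\<xi> ! j)]) z)"
      unfolding list.size add_Suc_right add_0_right sum_pairs_Suc nths_Cons_skip
      by (simp add: v universal_trace_update case_prod_unfold sum_negf)
    ultimately show ?thesis unfolding lie_diff_def by simp
  qed
  ultimately show ?thesis by simp
qed

theorem theorem3p13:
  "(universal_trace :: ('n::{finite,linorder}, 'r::finite) cochain) \<in> rel_complex
   \<and> (\<forall>\<xi> \<in> lists (lie_g :: ('n, 'r) gl set). \<forall>z.
        lie_diff universal_trace \<xi> z + cyc_diff universal_trace \<xi> z = 0)"
proof (intro conjI ballI allI)
  show "lie_diff universal_trace \<xi> z + cyc_diff universal_trace \<xi> z = 0" for \<xi> :: "('n, 'r) gl list" and z
    by (rule universal_trace_closed)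
  have coch: "(universal_trace :: ('n, 'r) cochain) \<in> cochains k" for k
    unfolding cochains_def
  proof (intro CollectI ballI impI conjI allI)
    fix \<xi> :: "('n, 'r) gl list" assume k: "length \<xi> = k"
    show "universal_trace \<xi> \<in> hom_K"
      by (simp add: hom_K_def universal_trace_add universal_trace_kscale)
    fix i assume i: "i < k"
    have upd: "\<xi>[i := x] = take i \<xi> @ x # drop (Suc i) \<xi>" for x
      using i k by (simp add: upd_conv_take_nth_drop)
    show "universal_trace (\<xi>[i := x + y]) z = universal_trace (\<xi>[i := x]) z + universal_trace (\<xi>[i := y]) z" for x y z
      unfolding upd universal_trace_sum int_exp_multilin berezin_single_add sum.distrib ..
    show "universal_trace (\<xi>[i := gscale (fls_const c) x]) z = Poly_Mapping.single 0 (fls_const c) * universal_trace (\<xi>[i := x]) z" for x c z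
      unfolding upd universal_trace_sum int_exp_multilin sum_distrib_left
      by (intro sum.cong refl) (use berezin_single_scale[of 0] in simp)
    fix j z assume j: "j < k" and e: "i \<noteq> j \<and> \<xi> ! i = \<xi> ! j"
    have "int_exp \<xi> x = 0" for x
      using int_exp_alternating[of i j \<xi> x] int_exp_alternating[of j i \<xi> x] e i j k by (metis linorder_neqE_nat)
    then show "universal_trace \<xi> z = 0" by (simp add: universal_trace_sum)
  qed
  show "(universal_trace :: ('n, 'r) cochain) \<in> rel_complex"
    unfolding rel_complex_def
  \<comment> \<open>With more than 2n arguments there are more 1-forms than coordinates.\<close>
  proof (intro CollectI conjI allI exI[of _ "2 * CARD('n)"] ballI impI)
    show "(universal_trace :: ('n, 'r) cochain) \<in> rel_cochains k" for k
      unfolding rel_cochains_def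
    proof (intro CollectI conjI ballI impI allI coch)
      fix \<xi> :: "('n, 'r) gl list" and z assume k: "length \<xi> = k"
      show "universal_trace \<xi> z = 0" if "set \<xi> \<inter> lie_h \<noteq> {}"
        using that universal_trace_lie_h[of _ \<xi> z] by blast
      show "hom_act \<eta> (universal_trace \<xi>) z = (\<Sum>i<k. universal_trace (\<xi>[i := bracket \<eta> (\<xi> ! i)]) z)" if "\<eta> \<in> lie_h" for \<eta>
        using universal_trace_equivariant[OF that, of \<xi> z] k by simp
    qed
    show "universal_trace \<xi> z = 0" if "2 * CARD('n) < length \<xi>" for \<xi> :: "('n, 'r) gl list" and z
      by (simp add: universal_trace_sum int_exp_degree[OF that])
  qed
qed

end
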